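(* Let $X$ and $Y$ be independent (not necessarily identically distributed) irreducible zero mean finite variance random walks on $\mathbb{Z}^2$, both starting from the origin, and either both in discrete time or both in continuous time, such that $Z:=X-Y$ is also irreducible. Let $Q$ be the covariance matrix of $Z$. Let $\kappa>0$ and $\rho>0$ denote the respective jump rates of $X$ and $Y$ if they are continuous time random walks, and set $\kappa+\rho=1$ if they are discrete time random walks. Let $L_t(X,Y)$ denote the local time of $X-Y$ at the origin up to time $t$. Then for almost every realization of $Y$, as $t\to\infty$, $$\mathbb{E}^X_0\left[\left(\frac{2\pi(\kappa+\rho)\sqrt{\det Q}\;L_t(X,Y)}{\log t}\right)^k \,\Big|\, Y\right]\longrightarrow k!\qquad\text{for each } k\in\mathbb{N},$$ and the conditional law given $Y$ of $$\frac{2\pi(\kappa+\rho)\sqrt{\det Q}\;L_t(X,Y)}{\log t}$$ converges weakly to the law of an exponential random variable with mean $1$.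
   Context: A discrete time random walk on $\mathbb{Z}^2$ is a process with i.i.d. increments with one-step increment distribution $p(\cdot)$ on $\mathbb{Z}^2$; a continuous time random walk with jump rate $r>0$ and increment distribution $p(\cdot)$ makes i.i.d. jumps with law $p$ at the times of a rate $r$ Poisson process. Zero mean and finite variance mean $\sum_x p(x)x=0$ and $\sum_x p(x)\|x\|^2<\infty$. Irreducible means that, starting from the origin, every site of $\mathbb{Z}^2$ is visited with positive probability. The covariance matrix of a random walk with one-step increment (jump) distribution $p$ is $Q_{ij}=\sum_{x\in\mathbb{Z}^2}p(x)x_ix_j$, $1\le i,j\le 2$. For $Z=X-Y$, where $X$ and $Y$ have one-step increment distributions $p^X$ and $p^Y$: in discrete time, the one-step increment distribution of $Z$ is the law of the difference of independent variables with laws $p^X$ and $p^Y$; in continuous time, $Z$ is a continuous time random walk with jump rate $\kappa+\rho$ and increment distribution $p(x)=\frac{\kappa p^X(x)+\rho p^Y(-x)}{\kappa+\rho}$, so $Q$ is the covariance matrix of this $p$. Local time: $L_t(X,Y)=\sum_{i=0}^{t}\mathbf{1}_{\{X_i=Y_i\}}$ for $t\in\mathbb{N}$ in discrete time, and $L_t(X,Y)=\int_0^t \mathbf{1}_{\{X_s=Y_s\}}\,ds$ for $t\ge 0$ in continuous time. $\mathbb{E}^X_0[\,\cdot\,|Y]$ denotes expectation with respect to $X$ started from the origin, with the path of $Y$ held fixed. $\mathbb{N}=\{1,2,\dots\}$. *)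

theory Defs
  imports "HOL-Probability.Probability"
begin

section \<open>Increment distributions on the square lattice\<close>

definition real_site :: "int ^ 2 \<Rightarrow> real ^ 2" where
  "real_site x = (\<chi> i. real_of_int (x $ i))"

text \<open>Integrability is part of \<open>zero_mean\<close>, because the integral of a non-integrable
  function is \<open>0\<close> by convention.\<close>

definition zero_mean :: "(int ^ 2) pmf \<Rightarrow> bool" where
  "zero_mean p \<longleftrightarrow> has_bochner_integral (measure_pmf p) real_site 0"

definition finite_variance :: "(int ^ 2) pmf \<Rightarrow> bool" where
  "finite_variance p \<longleftrightarrow> integrable (measure_pmf p) (\<lambda>x. (norm (real_site x))\<^sup>2)"

definition covariance_matrix :: "(int ^ 2) pmf \<Rightarrow> real ^ 2 ^ 2" where
  "covariance_matrix p =
     (\<chi> i j. measure_pmf.expectation p (\<lambda>x. real_of_int (x $ i) * real_of_int (x $ j)))"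

text \<open>The one-step increment distribution of \<open>X - Y\<close> in discrete time, and its jump
  distribution in continuous time, where \<open>\<kappa>\<close> and \<open>\<rho>\<close> are the jump rates of \<open>X\<close> and \<open>Y\<close>.\<close>

definition discrete_difference_pmf :: "(int ^ 2) pmf \<Rightarrow> (int ^ 2) pmf \<Rightarrow> (int ^ 2) pmf" where
  "discrete_difference_pmf pX pY = map_pmf (\<lambda>(x, y). x - y) (pair_pmf pX pY)"

definition continuous_difference_pmf ::
    "real \<Rightarrow> real \<Rightarrow> (int ^ 2) pmf \<Rightarrow> (int ^ 2) pmf \<Rightarrow> (int ^ 2) pmf" where
  "continuous_difference_pmf \<kappa> \<rho> pX pY =
     embed_pmf (\<lambda>x. (\<kappa> * pmf pX x + \<rho> * pmf pY (- x)) / (\<kappa> + \<rho>))"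

lemma pmf_continuous_difference_pmf:
  assumes "\<kappa> > 0" "\<rho> > 0"
  shows "pmf (continuous_difference_pmf \<kappa> \<rho> pX pY) x
           = (\<kappa> * pmf pX x + \<rho> * pmf pY (- x)) / (\<kappa> + \<rho>)"
proof -
  let ?q = "bernoulli_pmf (\<kappa> / (\<kappa> + \<rho>)) \<bind> (\<lambda>b. if b then pX else map_pmf uminus pY)"
  have minus: "pmf (map_pmf uminus pY) z = pmf pY (- z)" for z
    using pmf_map_inj'[of "uminus :: int ^ 2 \<Rightarrow> int ^ 2" pY "- z"] by simp
  have q: "pmf ?q z = (\<kappa> * pmf pX z + \<rho> * pmf pY (- z)) / (\<kappa> + \<rho>)" for z
  proof -
    have "1 - \<kappa> / (\<kappa> + \<rho>) = \<rho> / (\<kappa> + \<rho>)"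
      using assms by (simp add: field_simps)
    then show ?thesis
      using assms by (simp add: pmf_bind minus add_divide_distrib mult.commute)
  qed
  have "continuous_difference_pmf \<kappa> \<rho> pX pY = ?q"
    unfolding continuous_difference_pmf_def q[symmetric] by (rule type_definition.Rep_inverse[OF td_pmf_embed_pmf])
  then show ?thesis
    by (simp only: q)
qed

section \<open>Random walks started from the origin\<close>

definition iid_increments :: "'a measure \<Rightarrow> (int ^ 2) pmf \<Rightarrow> (nat \<Rightarrow> 'a \<Rightarrow> int ^ 2) \<Rightarrow> bool" where
  "iid_increments M p \<xi> \<longleftrightarrow>
     prob_space.indep_vars M (\<lambda>_. count_space UNIV) \<xi> UNIV \<and>
     (\<forall>i. distr M (count_space UNIV) (\<xi> i) = measure_pmf p)"

definition discrete_random_walk ::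
    "'a measure \<Rightarrow> (int ^ 2) pmf \<Rightarrow> (nat \<Rightarrow> 'a \<Rightarrow> int ^ 2) \<Rightarrow> bool" where
  "discrete_random_walk M p X \<longleftrightarrow>
     (\<exists>\<xi>. iid_increments M p \<xi> \<and> (\<forall>n. \<forall>\<omega>\<in>space M. X n \<omega> = (\<Sum>i<n. \<xi> i \<omega>)))"

text \<open>A rate \<open>r\<close> Poisson process is given by its independent exponential waiting times
  \<open>\<tau> 0, \<tau> 1, \<dots>\<close>; the sum \<open>\<tau> 0 + \<dots> + \<tau> n\<close> is the time of the \<open>(n + 1)\<close>-st point.\<close>

definition poisson_waiting_times :: "'a measure \<Rightarrow> real \<Rightarrow> (nat \<Rightarrow> 'a \<Rightarrow> real) \<Rightarrow> bool" where
  "poisson_waiting_times M r \<tau> \<longleftrightarrow>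
     prob_space.indep_vars M (\<lambda>_. borel) \<tau> UNIV \<and>
     (\<forall>i. distributed M lborel (\<tau> i) (exponential_density r))"

definition poisson_count :: "(nat \<Rightarrow> 'a \<Rightarrow> real) \<Rightarrow> real \<Rightarrow> 'a \<Rightarrow> nat" where
  "poisson_count \<tau> t \<omega> = card {n. (\<Sum>i\<le>n. \<tau> i \<omega>) \<le> t}"

definition continuous_random_walk ::
    "'a measure \<Rightarrow> real \<Rightarrow> (int ^ 2) pmf \<Rightarrow> (real \<Rightarrow> 'a \<Rightarrow> int ^ 2) \<Rightarrow> bool" where
  "continuous_random_walk M r p X \<longleftrightarrow>
     (\<exists>\<tau> \<xi>. poisson_waiting_times M r \<tau> \<and> iid_increments M p \<xi> \<and>
        prob_space.indep_set M
          (sets (vimage_algebra (space M) (\<lambda>\<omega> i. \<tau> i \<omega>) (\<Pi>\<^sub>M i\<in>UNIV. borel)))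
          (sets (vimage_algebra (space M) (\<lambda>\<omega> i. \<xi> i \<omega>) (\<Pi>\<^sub>M i\<in>UNIV. count_space UNIV))) \<and>
        (\<forall>t\<ge>0. \<forall>\<omega>\<in>space M. X t \<omega> = (\<Sum>i<poisson_count \<tau> t \<omega>. \<xi> i \<omega>)))"

text \<open>In the following two definitions \<open>T\<close> is the set of times, \<open>UNIV :: nat set\<close> or
  \<open>{0..} :: real set\<close>.\<close>

definition irreducible_walk :: "'a measure \<Rightarrow> 't set \<Rightarrow> ('t \<Rightarrow> 'a \<Rightarrow> int ^ 2) \<Rightarrow> bool" where
  "irreducible_walk M T X \<longleftrightarrow> (\<forall>x. \<P>(\<omega> in M. \<exists>t\<in>T. X t \<omega> = x) > 0)"

definition independent_processes ::
    "'a measure \<Rightarrow> 't set \<Rightarrow> ('t \<Rightarrow> 'a \<Rightarrow> int ^ 2) \<Rightarrow> ('t \<Rightarrow> 'a \<Rightarrow> int ^ 2) \<Rightarrow> bool" where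
  "independent_processes M T X Y \<longleftrightarrow>
     prob_space.indep_var M
       (\<Pi>\<^sub>M t\<in>T. count_space UNIV) (\<lambda>\<omega>. \<lambda>t\<in>T. X t \<omega>)
       (\<Pi>\<^sub>M t\<in>T. count_space UNIV) (\<lambda>\<omega>. \<lambda>t\<in>T. Y t \<omega>)"

section \<open>Local times, as functions of the two paths\<close>

definition discrete_local_time :: "(nat \<Rightarrow> int ^ 2) \<Rightarrow> (nat \<Rightarrow> int ^ 2) \<Rightarrow> nat \<Rightarrow> real" where
  "discrete_local_time x y t = (\<Sum>i=0..t. of_bool (x i = y i))"

definition continuous_local_time :: "(real \<Rightarrow> int ^ 2) \<Rightarrow> (real \<Rightarrow> int ^ 2) \<Rightarrow> real \<Rightarrow> real" where
  "continuous_local_time x y t = (LINT s:{0..t}|lborel. of_bool (x s = y s))"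

section \<open>Expectations and laws given \<open>Y\<close>\<close>

text \<open>\<open>F\<close> is a functional of the two paths. The path of \<open>Y\<close> is held fixed at its realization
  at \<open>\<omega>\<close>, and only the path of \<open>X\<close> is averaged over; for independent \<open>X\<close> and \<open>Y\<close> this is the
  regular version of the conditional expectation (conditional law) given \<open>Y\<close>.\<close>

definition expectation_given ::
    "'a measure \<Rightarrow> ('t \<Rightarrow> 'a \<Rightarrow> 's) \<Rightarrow> ('t \<Rightarrow> 'a \<Rightarrow> 's) \<Rightarrow>
     (('t \<Rightarrow> 's) \<Rightarrow> ('t \<Rightarrow> 's) \<Rightarrow> real) \<Rightarrow> 'a \<Rightarrow> real" where
  "expectation_given M X Y F \<omega> = (\<integral>\<omega>'. F (\<lambda>s. X s \<omega>') (\<lambda>s. Y s \<omega>) \<partial>M)"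

definition law_given ::
    "'a measure \<Rightarrow> ('t \<Rightarrow> 'a \<Rightarrow> 's) \<Rightarrow> ('t \<Rightarrow> 'a \<Rightarrow> 's) \<Rightarrow>
     (('t \<Rightarrow> 's) \<Rightarrow> ('t \<Rightarrow> 's) \<Rightarrow> real) \<Rightarrow> 'a \<Rightarrow> real measure" where
  "law_given M X Y F \<omega> = distr M borel (\<lambda>\<omega>'. F (\<lambda>s. X s \<omega>') (\<lambda>s. Y s \<omega>))"

text \<open>The library's \<open>weak_conv_m\<close>, for an arbitrary filter in place of \<open>sequentially\<close>.\<close>

definition weak_conv_along :: "'t filter \<Rightarrow> ('t \<Rightarrow> real measure) \<Rightarrow> real measure \<Rightarrow> bool" where
  "weak_conv_along F \<mu> \<nu> \<longleftrightarrow>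
     (\<forall>x. isCont (cdf \<nu>) x \<longrightarrow> ((\<lambda>t. cdf (\<mu> t) x) \<longlongrightarrow> cdf \<nu> x) F)"

lemma weak_conv_along_sequentially: "weak_conv_along sequentially \<mu> \<nu> \<longleftrightarrow> weak_conv_m \<mu> \<nu>"
  by (simp add: weak_conv_along_def weak_conv_m_def weak_conv_def)

definition exponential_law :: "real \<Rightarrow> real measure" where
  "exponential_law l = density lborel (exponential_density l)"

end

theory Submission
  imports Defs "HOL-Real_Asymp.Real_Asymp"
begin

text \<open>
  Write \<open>L\<close> for the local time up to \<open>t\<close>, \<open>p\<^sub>s\<close> for the law of \<open>X\<close> at time \<open>s\<close>, and \<open>g s\<close> for the mean of \<open>p\<^sub>s (Y\<^sub>s)\<close> over
  \<open>Y\<close>, which is the probability that \<open>Z = X - Y\<close> is at the origin at time \<open>s\<close>. For a fixed path of \<open>Y\<close>, the mean of \<open>L ^ k\<close>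
  over \<open>X\<close> is essentially \<open>k!\<close> times an integral over collision times \<open>s\<^sub>1 < \<dots> < s\<^sub>k \<le> t\<close>. If instead the \<open>k\<close> waiting times
  between collisions range independently over \<open>[0, t]\<close>, the integral becomes a chain: the first \<open>k + 1\<close> collisions consist of
  one at time \<open>s\<close>, with weight \<open>p\<^sub>s (Y\<^sub>s)\<close>, and of \<open>k\<close> collisions with the path of \<open>Y\<close> restarted at time \<open>s\<close>. The moments lie
  between the chains with waiting times up to \<open>t / k\<close> and up to \<open>t\<close> (\<open>chain_le_moment\<close>, \<open>moment_le_chain\<close>), and a
  logarithm does not notice the factor \<open>k\<close>. So it suffices that the chain of length \<open>k\<close>, divided by \<open>(ln t) ^ k\<close>, converges
  almost surely to \<open>A ^ k\<close>, where \<open>A\<close> is the limit of \<open>1 / ln t\<close> times the integral of \<open>g\<close> up to \<open>t\<close>.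

  Three facts give this convergence. The mean of the first chain is the integral of \<open>g\<close>, and grows like \<open>A * ln t\<close> with
  \<open>A = 1 / (2 * pi * r * sqrt (det Q))\<close>, \<open>r\<close> being the jump rate of \<open>Z\<close> (\<open>discrete_returns_log\<close>,
  \<open>continuous_returns_log\<close>): this is a local central limit theorem for the walk with Poisson jump times, transferred to
  discrete time by generating functions. The variance of the first chain is only of order \<open>ln t\<close>, because the covariances
  of \<open>p\<^sub>s (Y\<^sub>s)\<close> and \<open>p\<^sub>u (Y\<^sub>u)\<close> are small by Fourier analysis (\<open>covariance_le\<close>). Finally, \<open>Y\<^sub>s\<close> is independent of the path
  restarted at time \<open>s\<close>, so that the mean error of the chain of length \<open>k\<close> is at most \<open>k\<close> times the mean error of the
  first chain, times a power of the mean (\<open>chain_L1\<close>). Almost sure convergence follows along a sequence of times by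
  summability, and between these times by monotonicity (\<open>chain_AE_tendsto\<close>).

  The locales \<open>regenerative_walk\<close>, \<open>collision\<close> and \<open>collision_decay\<close> abstract from the two kinds of time what this argument
  uses: regeneration at fixed times and the decay of characteristic functions. The limits \<open>k!\<close>
  are the moments of the exponential law, and they determine it, so that the conditional laws converge weakly
  (\<open>nonneg_moments_imp_weak_conv_along\<close>).
\<close>

section \<open>The method of moments for the exponential law\<close>

lemma exp_minus_Taylor_bound:
  fixes y :: real
  assumes "0 \<le> y"
  shows "\<bar>exp (- y) - (\<Sum>j<J. (- y) ^ j / fact j)\<bar> \<le> y ^ J / fact J"
proof (cases "y = 0 \<or> J = 0")
  case True
  then show ?thesis
    using assms by (cases J) (auto simp: sum.lessThan_Suc_shift simp del: sum.lessThan_Suc)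
next
  case False
  have "\<exists>t. - y < t \<and> t < 0 \<and>
      exp (- y) = (\<Sum>m<J. exp 0 / fact m * (- y) ^ m) + exp t / fact J * (- y) ^ J"
    using False assms
    by (intro Maclaurin_minus) (auto intro!: derivative_eq_intros)
  then obtain t where t: "t < 0"
    "exp (- y) - (\<Sum>j<J. (- y) ^ j / fact j) = exp t / fact J * (- y) ^ J"
    by auto
  have "\<bar>exp t / fact J * (- y) ^ J\<bar> = exp t * (y ^ J / fact J)"
    using assms by (simp add: abs_mult power_abs)
  also have "\<dots> \<le> 1 * (y ^ J / fact J)"
    using t assms by (intro mult_right_mono) auto
  finally show ?thesis
    using t by simp
qed

definition nonneg_with_moments :: "real measure \<Rightarrow> bool" where
  "nonneg_with_moments \<mu> \<longleftrightarrow>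
     real_distribution \<mu> \<and> (AE x in \<mu>. 0 \<le> x) \<and> (\<forall>k::nat. integrable \<mu> (\<lambda>x. x ^ k))"

text \<open>The weight is the \<open>n\<close>-th power of \<open>exp (- x / 4)\<close>, so that the tilted moments with \<open>m = 0\<close> are the means of the
  monomials in \<open>exp (- x / 4)\<close>.\<close>

definition tilted_moment :: "real measure \<Rightarrow> nat \<Rightarrow> nat \<Rightarrow> real" where
  "tilted_moment \<mu> n m = (\<integral>x. x ^ m * exp (- (real n * x / 4)) \<partial>\<mu>)"

lemma integrable_tilted_moment:
  assumes "nonneg_with_moments \<mu>"
  shows "integrable \<mu> (\<lambda>x. x ^ m * exp (- (real n * x / 4)))"
proof -
  interpret real_distribution \<mu>
    using assms by (simp add: nonneg_with_moments_def)
  have "integrable \<mu> (\<lambda>x. x ^ m)" and AE: "AE x in \<mu>. 0 \<le> x"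
    using assms by (auto simp: nonneg_with_moments_def)
  from this(1) show ?thesis
  proof (rule Bochner_Integration.integrable_bound)
    show "AE x in \<mu>. norm (x ^ m * exp (- (real n * x / 4))) \<le> norm (x ^ m)"
      using AE by eventually_elim (auto simp: abs_mult intro!: mult_left_le)
  qed simp
qed

lemma tilted_moment_le:
  assumes "nonneg_with_moments \<mu>"
  shows "tilted_moment \<mu> n m \<le> (\<integral>x. x ^ m \<partial>\<mu>)"
  unfolding tilted_moment_def
proof (rule integral_mono_AE)
  show "integrable \<mu> (\<lambda>x. x ^ m * exp (- (real n * x / 4)))"
    by (rule integrable_tilted_moment[OF assms])
  show "integrable \<mu> (\<lambda>x. x ^ m)" using assms by (simp add: nonneg_with_moments_def)
  have "AE x in \<mu>. 0 \<le> x" using assms by (simp add: nonneg_with_moments_def)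
  then show "AE x in \<mu>. x ^ m * exp (- (real n * x / 4)) \<le> x ^ m"
    by eventually_elim (auto intro!: mult_left_le)
qed

text \<open>The step from one tilt to the next: the tail of the alternating series is controlled by
  its first omitted term, and a quarter is well inside the radius of convergence.\<close>

lemma tilted_moment_Suc_approx:
  assumes "nonneg_with_moments \<mu>"
  shows "\<bar>tilted_moment \<mu> (Suc n) m - (\<Sum>j<J. (- 1 / 4) ^ j / fact j * tilted_moment \<mu> n (m + j))\<bar>
           \<le> (1 / 4) ^ J / fact J * tilted_moment \<mu> n (m + J)"
proof -
  interpret real_distribution \<mu>
    using assms by (simp add: nonneg_with_moments_def)
  note int = integrable_tilted_moment[OF assms]
  let ?w = "\<lambda>x::real. exp (- (real n * x / 4))"
  let ?S = "\<lambda>x. (\<Sum>j<J. (- 1 / 4) ^ j / fact j * (x ^ (m + j) * ?w x))"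
  have split: "x ^ m * exp (- (real (Suc n) * x / 4)) = x ^ m * ?w x * exp (- (x / 4))" for x
    by (simp add: mult_exp_exp field_simps)
  have eq: "(\<Sum>j<J. (- 1 / 4) ^ j / fact j * tilted_moment \<mu> n (m + j))
      = (\<integral>x. ?S x \<partial>\<mu>)"
    unfolding tilted_moment_def
    by (subst Bochner_Integration.integral_sum) (auto intro!: integrable_mult_right int)
  have "\<bar>tilted_moment \<mu> (Suc n) m - (\<Sum>j<J. (- 1 / 4) ^ j / fact j * tilted_moment \<mu> n (m + j))\<bar>
     = \<bar>\<integral>x. x ^ m * exp (- (real (Suc n) * x / 4))
          - ?S x \<partial>\<mu>\<bar>"
    unfolding eq tilted_moment_def[of \<mu> "Suc n" m]
    by (subst Bochner_Integration.integral_diff)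
       (auto intro!: int Bochner_Integration.integrable_sum integrable_mult_right simp del: of_nat_Suc)
  also have "\<dots> \<le> (\<integral>x. \<bar>x ^ m * exp (- (real (Suc n) * x / 4))
          - ?S x\<bar> \<partial>\<mu>)"
    by (rule integral_abs_bound)
  also have "\<dots> \<le> (\<integral>x. (1 / 4) ^ J / fact J * (x ^ (m + J) * ?w x) \<partial>\<mu>)"
  proof (rule integral_mono_AE)
    show "integrable \<mu> (\<lambda>x. \<bar>x ^ m * exp (- (real (Suc n) * x / 4))
          - ?S x\<bar>)"
      by (intro integrable_abs Bochner_Integration.integrable_diff int
          Bochner_Integration.integrable_sum integrable_mult_right)
    show "integrable \<mu> (\<lambda>x. (1 / 4) ^ J / fact J * (x ^ (m + J) * ?w x))"
      by (intro integrable_mult_right int)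
    have "AE x in \<mu>. 0 \<le> x" using assms by (simp add: nonneg_with_moments_def)
    then show "AE x in \<mu>. \<bar>x ^ m * exp (- (real (Suc n) * x / 4))
          - ?S x\<bar>
        \<le> (1 / 4) ^ J / fact J * (x ^ (m + J) * ?w x)"
    proof eventually_elim
      case (elim x)
      have "?S x
          = x ^ m * ?w x * (\<Sum>j<J. (- (x / 4)) ^ j / fact j)"
        unfolding sum_distrib_left
      proof (intro sum.cong refl)
        fix j
        have "(- (x / 4)) ^ j = (- 1 / 4) ^ j * x ^ j"
          by (simp flip: power_mult_distrib)
        then show "(- 1 / 4) ^ j / fact j * (x ^ (m + j) * ?w x)
            = x ^ m * ?w x * ((- (x / 4)) ^ j / fact j)"
          by (simp add: power_add)
      qed
      then have "\<bar>x ^ m * exp (- (real (Suc n) * x / 4))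
          - ?S x\<bar>
        = \<bar>x ^ m * ?w x * (exp (- (x / 4)) - (\<Sum>j<J. (- (x / 4)) ^ j / fact j))\<bar>"
        unfolding split by (simp add: algebra_simps)
      also have "\<dots> = x ^ m * ?w x * \<bar>exp (- (x / 4)) - (\<Sum>j<J. (- (x / 4)) ^ j / fact j)\<bar>"
        using elim by (simp add: abs_mult)
      also have "\<dots> \<le> x ^ m * ?w x * ((x / 4) ^ J / fact J)"
        using elim by (intro mult_left_mono exp_minus_Taylor_bound) auto
      finally show ?case
        by (simp add: power_add power_divide field_simps)
    qed
  qed
  also have "\<dots> = (1 / 4) ^ J / fact J * tilted_moment \<mu> n (m + J)"
    by (simp add: tilted_moment_def)
  finally show ?thesis .
qed

lemma quarter_powers_beat_fact_ratio:
  "(\<lambda>J. (1 / 4) ^ J / fact J * fact (m + J) :: real) \<longlonglongrightarrow> 0"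
proof (rule tendsto_sandwich[where f = "\<lambda>_. 0"])
  have "(1 / 4) ^ J / fact J * fact (m + J) \<le> fact m * 2 ^ m * (1 / 2 :: real) ^ J" for J
  proof -
    have "fact (m + J) = (fact m * fact J * real ((m + J) choose m) :: real)"
      using binomial_fact_lemma[of m "m + J"]
      by (metis add_diff_cancel_left' le_add1 of_nat_fact of_nat_mult)
    moreover have "real ((m + J) choose m) \<le> 2 ^ (m + J)"
      using binomial_le_pow2[of "m + J" m] by (metis of_nat_le_iff of_nat_numeral of_nat_power)
    ultimately have "(1 / 4) ^ J / fact J * fact (m + J) \<le> (1 / 4) ^ J * fact m * (2 ^ (m + J) :: real)"
      by (simp add: field_simps)
    also have "\<dots> = fact m * 2 ^ m * ((1 / 4) ^ J * 2 ^ J)"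
      by (simp add: power_add)
    also have "(1 / 4) ^ J * 2 ^ J = (1 / 2 :: real) ^ J"
      by (simp flip: power_mult_distrib)
    finally show ?thesis .
  qed
  then show "\<forall>\<^sub>F J in sequentially.
      (1 / 4) ^ J / fact J * fact (m + J) \<le> fact m * 2 ^ m * (1 / 2 :: real) ^ J"
    by simp
  show "(\<lambda>J. fact m * 2 ^ m * (1 / 2 :: real) ^ J) \<longlonglongrightarrow> 0"
    by (intro tendsto_mult_right_zero LIMSEQ_realpow_zero) auto
qed auto

text \<open>Moments bounded by \<open>fact k\<close> determine the Laplace transform at \<open>1 / 4\<close>, by expanding the exponential. The tilted
  moments of the limit are again bounded by factorials, so the same step leads from \<open>n / 4\<close> to \<open>(n + 1) / 4\<close> for every \<open>n\<close>.\<close>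

lemma tilted_moments_tendsto:
  fixes \<mu> :: "'t \<Rightarrow> real measure"
  assumes \<mu>: "\<forall>\<^sub>F t in F. nonneg_with_moments (\<mu> t)" and \<nu>: "nonneg_with_moments \<nu>"
    and conv: "\<And>k. ((\<lambda>t. \<integral>x. x ^ k \<partial>\<mu> t) \<longlongrightarrow> (\<integral>x. x ^ k \<partial>\<nu>)) F"
    and bound: "\<And>k. (\<integral>x. x ^ k \<partial>\<nu>) \<le> fact k"
  shows "((\<lambda>t. tilted_moment (\<mu> t) n m) \<longlongrightarrow> tilted_moment \<nu> n m) F"
proof (induction n arbitrary: m)
  case 0
  then show ?case using conv by (simp add: tilted_moment_def)
next
  case (Suc n)
  show ?case
  proof (rule tendstoI)
    fix e :: real assume "e > 0"
    then have "\<forall>\<^sub>F J in sequentially. (1 / 4) ^ J / fact J * fact (m + J) < e / 4"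
      by (intro order_tendstoD(2)[OF quarter_powers_beat_fact_ratio]) simp
    then obtain J where J: "(1 / 4) ^ J / fact J * fact (m + J) < e / 4"
      by (auto simp: eventually_sequentially)
    let ?S = "\<lambda>\<mu>. \<Sum>j<J. (- 1 / 4) ^ j / fact j * tilted_moment \<mu> n (m + j)"
    let ?E = "\<lambda>\<mu>. (1 / 4) ^ J / fact J * tilted_moment \<mu> n (m + J)"
    have E: "?E \<nu> < e / 4"
    proof -
      have "?E \<nu> \<le> (1 / 4) ^ J / fact J * fact (m + J)"
        using tilted_moment_le[OF \<nu>, of n "m + J"] bound[of "m + J"]
        by (intro mult_left_mono) auto
      with J show ?thesis by linarith
    qed
    have "((\<lambda>t. ?E (\<mu> t)) \<longlongrightarrow> ?E \<nu>) F"
      by (intro tendsto_intros Suc)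
    then have "\<forall>\<^sub>F t in F. ?E (\<mu> t) < e / 4"
      using E by (rule order_tendstoD)
    moreover have "((\<lambda>t. ?S (\<mu> t)) \<longlongrightarrow> ?S \<nu>) F"
      by (intro tendsto_intros Suc)
    then have "\<forall>\<^sub>F t in F. dist (?S (\<mu> t)) (?S \<nu>) < e / 4"
      by (rule tendstoD) (use \<open>e > 0\<close> in simp)
    ultimately show "\<forall>\<^sub>F t in F.
        dist (tilted_moment (\<mu> t) (Suc n) m) (tilted_moment \<nu> (Suc n) m) < e"
      using \<mu>
    proof eventually_elim
      case (elim t)
      show ?case
        using tilted_moment_Suc_approx[OF elim(3), of n m J]
          tilted_moment_Suc_approx[OF \<nu>, of n m J] elim E
        unfolding dist_real_def by linarith
    qed
  qed
qed

text \<open>By the theorem of Weierstrass, a continuous function of \<open>exp (- x / 4) \<in> {0..1}\<close> is a uniform limit of polynomials in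
  \<open>exp (- x / 4)\<close>, and the means of these converge as tilted moments.\<close>

lemma continuous_of_exp_tendsto:
  fixes \<mu> :: "'t \<Rightarrow> real measure" and f :: "real \<Rightarrow> real"
  assumes \<mu>: "\<forall>\<^sub>F t in F. nonneg_with_moments (\<mu> t)" and \<nu>: "nonneg_with_moments \<nu>"
    and conv: "\<And>k. ((\<lambda>t. \<integral>x. x ^ k \<partial>\<mu> t) \<longlongrightarrow> (\<integral>x. x ^ k \<partial>\<nu>)) F"
    and bound: "\<And>k. (\<integral>x. x ^ k \<partial>\<nu>) \<le> fact k"
    and f: "continuous_on {0..1} f"
    and h: "h \<in> borel_measurable borel" "\<And>x. 0 \<le> x \<Longrightarrow> h x = f (exp (- x / 4))" "\<And>x. \<bar>h x\<bar> \<le> 1"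
  shows "((\<lambda>t. \<integral>x. h x \<partial>\<mu> t) \<longlongrightarrow> (\<integral>x. h x \<partial>\<nu>)) F"
proof (rule tendstoI)
  fix e :: real assume "e > 0"
  obtain g where g: "real_polynomial_function g" "\<And>x. x \<in> {0..1} \<Longrightarrow> \<bar>f x - g x\<bar> < e / 4"
    using Stone_Weierstrass_real_polynomial_function[of "{0..1::real}" f "e / 4"] f \<open>e > 0\<close> by auto
  obtain a N where a: "g = (\<lambda>x. \<Sum>i\<le>N. a i * x ^ i)"
    using g(1) by (auto simp: real_polynomial_function_iff_sum)
  have g_int: "integrable M (\<lambda>x. g (exp (- x / 4))) \<and>
      (\<integral>x. g (exp (- x / 4)) \<partial>M) = (\<Sum>i\<le>N. a i * tilted_moment M i 0)"
    if "nonneg_with_moments M" for M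
  proof -
    have "g (exp (- x / 4)) = (\<Sum>i\<le>N. a i * (x ^ 0 * exp (- (real i * x / 4))))" for x :: real
      unfolding a by (simp flip: exp_of_nat_mult)
    then show ?thesis
      using integrable_tilted_moment[OF that, of 0]
      by (simp add: tilted_moment_def Bochner_Integration.integral_sum Bochner_Integration.integrable_sum)
  qed
  have close: "\<bar>(\<integral>x. h x \<partial>M) - (\<Sum>i\<le>N. a i * tilted_moment M i 0)\<bar> \<le> e / 4"
    if M: "nonneg_with_moments M" for M
  proof -
    interpret real_distribution M using M by (simp add: nonneg_with_moments_def)
    have int_h: "integrable M h"
      by (rule integrable_const_bound[of _ 1]) (use h in auto)
    have "(\<integral>x. h x \<partial>M) - (\<Sum>i\<le>N. a i * tilted_moment M i 0) = (\<integral>x. h x - g (exp (- x / 4)) \<partial>M)"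
      using g_int[OF M] int_h by simp
    also have "\<bar>\<dots>\<bar> \<le> (\<integral>x. \<bar>h x - g (exp (- x / 4))\<bar> \<partial>M)"
      by (rule integral_abs_bound)
    also have "\<dots> \<le> (\<integral>x. e / 4 \<partial>M)"
    proof (rule integral_mono_AE)
      have "AE x in M. 0 \<le> x" using M by (simp add: nonneg_with_moments_def)
      then show "AE x in M. \<bar>h x - g (exp (- x / 4))\<bar> \<le> e / 4"
      proof eventually_elim
        case (elim x)
        then show ?case using g(2)[of "exp (- x / 4)"] h(2)[of x] by simp
      qed
    qed (use g_int[OF M] int_h in auto)
    finally show ?thesis using prob_space by simp
  qed
  have "((\<lambda>t. \<Sum>i\<le>N. a i * tilted_moment (\<mu> t) i 0) \<longlongrightarrow> (\<Sum>i\<le>N. a i * tilted_moment \<nu> i 0)) F"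
    by (intro tendsto_intros tilted_moments_tendsto[OF \<mu> \<nu> conv bound])
  then have "\<forall>\<^sub>F t in F. dist (\<Sum>i\<le>N. a i * tilted_moment (\<mu> t) i 0) (\<Sum>i\<le>N. a i * tilted_moment \<nu> i 0) < e / 4"
    by (rule tendstoD) (use \<open>e > 0\<close> in simp)
  with \<mu> show "\<forall>\<^sub>F t in F. dist (\<integral>x. h x \<partial>\<mu> t) (\<integral>x. h x \<partial>\<nu>) < e"
  proof eventually_elim
    case (elim t)
    then show ?case
      using close[OF elim(1)] close[OF \<nu>] \<open>e > 0\<close> unfolding dist_real_def by linarith
  qed
qed

lemma continuous_cts_step_of_log:
  assumes "x < y"
  shows "continuous_on {0..1} (\<lambda>u. if u \<le> 0 then 0 else cts_step x y (- 4 * ln u))"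
proof -
  have cts: "continuous_on UNIV (cts_step x y)"
    using assms by (intro uniformly_continuous_imp_continuous cts_step_uniformly_continuous)
  define r where "r = exp (- y / 4)"
  have "r > 0" by (simp add: r_def)
  have "(if u \<le> 0 then 0 else cts_step x y (- 4 * ln u)) = cts_step x y (- 4 * ln (max u r))" for u
  proof (cases "u \<le> r")
    case True
    have "cts_step x y (- 4 * ln (max u r)) = 0"
      using True assms by (simp add: max_def r_def cts_step_def)
    moreover have "cts_step x y (- 4 * ln u) = 0" if "u > 0"
    proof -
      have "ln u \<le> - y / 4"
        using True that by (metis r_def ln_exp ln_le_cancel_iff exp_gt_zero)
      then show ?thesis using assms by (simp add: cts_step_def)
    qed
    ultimately show ?thesis by auto
  qed (use \<open>r > 0\<close> in \<open>auto simp: max_def\<close>)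
  moreover have "continuous_on {0..1} (\<lambda>u. cts_step x y (- 4 * ln (max u r)))"
    by (rule continuous_on_compose2[OF cts])
       (use \<open>r > 0\<close> in \<open>auto intro!: continuous_intros\<close>)
  ultimately show ?thesis by presburger
qed

text \<open>A distribution function at a point of continuity lies between the means of two continuous step functions, and on the
  positive half-line such a step is a continuous function of \<open>exp (- x / 4)\<close>.\<close>

proposition nonneg_moments_imp_weak_conv_along:
  fixes \<mu> :: "'t \<Rightarrow> real measure"
  assumes \<mu>: "\<forall>\<^sub>F t in F. nonneg_with_moments (\<mu> t)" and \<nu>: "nonneg_with_moments \<nu>"
    and conv: "\<And>k. ((\<lambda>t. \<integral>x. x ^ k \<partial>\<mu> t) \<longlongrightarrow> (\<integral>x. x ^ k \<partial>\<nu>)) F"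
    and bound: "\<And>k. (\<integral>x. x ^ k \<partial>\<nu>) \<le> fact k"
  shows "weak_conv_along F \<mu> \<nu>"
  unfolding weak_conv_along_def
proof (intro allI impI)
  fix x assume cont: "isCont (cdf \<nu>) x"
  have step: "((\<lambda>t. \<integral>z. cts_step a b z \<partial>\<mu> t) \<longlongrightarrow> (\<integral>z. cts_step a b z \<partial>\<nu>)) F" if "a < b" for a b
  proof (rule continuous_of_exp_tendsto[OF \<mu> \<nu> conv bound continuous_cts_step_of_log[OF that]])
    show "cts_step a b \<in> borel_measurable borel" by (simp add: cts_step_def[abs_def])
  qed (use that in \<open>auto simp: cts_step_def divide_simps\<close>)
  show "((\<lambda>t. cdf (\<mu> t) x) \<longlongrightarrow> cdf \<nu> x) F"
  proof (rule order_tendstoI)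
    fix l assume "l < cdf \<nu> x"
    then have "\<forall>\<^sub>F y in at x. l < cdf \<nu> y"
      using cont by (auto simp: isCont_def intro: order_tendstoD)
    then have "\<forall>\<^sub>F y in at_left x. l < cdf \<nu> y"
      by (simp add: eventually_at_split)
    then obtain y where y: "y < x" "l < cdf \<nu> y"
      by (metis eventually_at_left_field dense)
    then have "l < (\<integral>z. cts_step y x z \<partial>\<nu>)"
      using real_distribution.cdf_cts_step(1)[of \<nu> y x] \<nu> by (auto simp: nonneg_with_moments_def)
    from order_tendstoD(1)[OF step[OF y(1)] this] \<mu> show "\<forall>\<^sub>F t in F. l < cdf (\<mu> t) x"
    proof eventually_elim
      case (elim t)
      then show ?case
        using real_distribution.cdf_cts_step(2)[of "\<mu> t" y x] y by (auto simp: nonneg_with_moments_def)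
    qed
  next
    fix l assume "cdf \<nu> x < l"
    then have "\<forall>\<^sub>F y in at x. cdf \<nu> y < l"
      using cont by (auto simp: isCont_def intro: order_tendstoD)
    then have "\<forall>\<^sub>F y in at_right x. cdf \<nu> y < l"
      by (simp add: eventually_at_split)
    then obtain y where y: "x < y" "cdf \<nu> y < l"
      by (metis eventually_at_right_field dense)
    then have "(\<integral>z. cts_step x y z \<partial>\<nu>) < l"
      using real_distribution.cdf_cts_step(2)[of \<nu> x y] \<nu> by (auto simp: nonneg_with_moments_def)
    from order_tendstoD(2)[OF step[OF y(1)] this] \<mu> show "\<forall>\<^sub>F t in F. cdf (\<mu> t) x < l"
    proof eventually_elim
      case (elim t)
      then show ?case
        using real_distribution.cdf_cts_step(1)[of "\<mu> t" x y] y by (auto simp: nonneg_with_moments_def)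
    qed
  qed
qed

lemma exponential_law_moments:
  shows "nonneg_with_moments (exponential_law 1)"
    and "(\<integral>x. x ^ k \<partial>exponential_law 1) = fact k"
proof -
  interpret prob_space "exponential_law 1"
    unfolding exponential_law_def by (rule prob_space_exponential_density) simp
  have D: "distributed (exponential_law 1) lborel (\<lambda>x. x) (exponential_density 1)"
    unfolding distributed_def exponential_law_def by (auto simp: distr_id2)
  show "(\<integral>x. x ^ k \<partial>exponential_law 1) = fact k"
    using erlang_ith_moment[OF _ D, of k] by simp
  have "AE x in exponential_law 1. 0 \<le> x"
    unfolding distributed_AE2[OF D, of "\<lambda>x. 0 \<le> x", simplified] by (simp add: erlang_density_def)
  moreover have "integrable (exponential_law 1) (\<lambda>x. x ^ k)" for k
    using erlang_ith_moment_integrable[OF _ D, of k] by simp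
  moreover have "real_distribution (exponential_law 1)"
    by (simp add: real_distribution_def real_distribution_axioms_def prob_space_axioms)
       (simp add: exponential_law_def)
  ultimately show "nonneg_with_moments (exponential_law 1)"
    by (simp add: nonneg_with_moments_def)
qed

section \<open>Fourier analysis on the square lattice\<close>

lemma bounded_Fubini:
  fixes f :: "'x \<Rightarrow> 'y \<Rightarrow> 'b::{banach, second_countable_topology}"
  assumes "finite_measure M1" "finite_measure M2"
    and f: "case_prod f \<in> borel_measurable (M1 \<Otimes>\<^sub>M M2)"
    and bound: "\<And>x y. x \<in> space M1 \<Longrightarrow> y \<in> space M2 \<Longrightarrow> norm (f x y) \<le> B"
  shows "(\<integral>x. (\<integral>y. f x y \<partial>M2) \<partial>M1) = (\<integral>y. (\<integral>x. f x y \<partial>M1) \<partial>M2)"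
    and "integrable M1 (\<lambda>x. \<integral>y. f x y \<partial>M2)" and "integrable M2 (\<lambda>y. \<integral>x. f x y \<partial>M1)"
proof -
  interpret A: finite_measure M1 by fact
  interpret B: finite_measure M2 by fact
  interpret pair_sigma_finite M1 M2 ..
  have int: "integrable (M1 \<Otimes>\<^sub>M M2) (case_prod f)"
  proof (rule finite_measure.integrable_const_bound)
    show "finite_measure (M1 \<Otimes>\<^sub>M M2)"
      by (rule finite_measure_pair_measure) unfold_locales
  qed (use f bound in \<open>auto simp: space_pair_measure intro!: AE_I2[where P = "\<lambda>x. norm (case_prod f x) \<le> B"]\<close>)
  show "(\<integral>x. (\<integral>y. f x y \<partial>M2) \<partial>M1) = (\<integral>y. (\<integral>x. f x y \<partial>M1) \<partial>M2)"
    by (rule Fubini_integral[OF int, symmetric])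
  show "integrable M1 (\<lambda>x. \<integral>y. f x y \<partial>M2)" "integrable M2 (\<lambda>y. \<integral>x. f x y \<partial>M1)"
    using integrable_fst[OF int] integrable_snd[OF int] by auto
qed

definition pairing :: "real \<times> real \<Rightarrow> int ^ 2 \<Rightarrow> real" where
  "pairing \<theta> x = fst \<theta> * real_of_int (x $ 1) + snd \<theta> * real_of_int (x $ 2)"

definition character :: "real \<times> real \<Rightarrow> int ^ 2 \<Rightarrow> complex" where
  "character \<theta> x = cis (pairing \<theta> x)"

definition char_fun :: "(int ^ 2) pmf \<Rightarrow> real \<times> real \<Rightarrow> complex" where
  "char_fun p \<theta> = (\<integral>x. character \<theta> x \<partial>measure_pmf p)"

lemma pairing_add: "pairing \<theta> (x + y) = pairing \<theta> x + pairing \<theta> y"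
  and pairing_minus: "pairing \<theta> (- x) = - pairing \<theta> x"
  and pairing_0: "pairing \<theta> 0 = 0" "pairing 0 x = 0"
  and pairing_scaleR: "pairing (c *\<^sub>R \<theta>) x = c * pairing \<theta> x"
  by (simp_all add: pairing_def algebra_simps)

lemma character_add: "character \<theta> (x + y) = character \<theta> x * character \<theta> y"
  and character_minus: "character \<theta> (- x) = cnj (character \<theta> x)"
  and character_0 [simp]: "character \<theta> 0 = 1" "character 0 x = 1"
  and norm_character [simp]: "norm (character \<theta> x) = 1"
  by (simp_all add: character_def pairing_add pairing_minus pairing_0 cis_mult cis_cnj)

lemma character_diff: "character \<theta> (x - y) = character \<theta> x * cnj (character \<theta> y)"
  using character_add[of \<theta> x "- y"] by (simp add: character_minus)

lemma continuous_on_pairing: "continuous_on UNIV (\<lambda>\<theta>. pairing \<theta> x)"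
  unfolding pairing_def by (intro continuous_intros)

lemma continuous_on_character: "continuous_on UNIV (\<lambda>\<theta>. character \<theta> x)"
  unfolding character_def by (intro continuous_intros continuous_on_pairing)

lemma measurable_character [measurable (raw)]:
  assumes f: "f \<in> M \<rightarrow>\<^sub>M borel" and g: "g \<in> M \<rightarrow>\<^sub>M count_space UNIV"
  shows "(\<lambda>\<omega>. character (f \<omega>) (g \<omega>)) \<in> borel_measurable M"
  by (rule measurable_compose_countable'[OF _ g])
     (auto intro!: measurable_compose[OF f] borel_measurable_continuous_onI continuous_on_character)

lemma integrable_character [simp]: "integrable (measure_pmf p) (character \<theta>)"
  by (rule measure_pmf.integrable_const_bound[of _ 1]) auto

lemma continuous_on_char_fun: "continuous_on UNIV (char_fun p)"
  unfolding continuous_on_sequentially char_fun_def comp_def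
proof (intro ballI allI impI, elim conjE)
  fix \<theta> u assume u: "u \<longlonglongrightarrow> (\<theta> :: real \<times> real)"
  show "(\<lambda>n. \<integral>x. character (u n) x \<partial>measure_pmf p) \<longlonglongrightarrow> (\<integral>x. character \<theta> x \<partial>measure_pmf p)"
  proof (rule integral_dominated_convergence[where w = "\<lambda>_. 1"])
    show "AE x in measure_pmf p. (\<lambda>n. character (u n) x) \<longlonglongrightarrow> character \<theta> x"
      by (intro AE_I2 continuous_on_tendsto_compose[OF continuous_on_character u]) auto
  qed auto
qed

lemma borel_measurable_char_fun [measurable]: "char_fun p \<in> borel_measurable borel"
  by (intro borel_measurable_continuous_onI continuous_on_char_fun)

lemma norm_char_fun_le: "norm (char_fun p \<theta>) \<le> 1"
  unfolding char_fun_def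
  using integral_norm_bound[of "measure_pmf p" "character \<theta>"] by simp

lemma char_fun_0 [simp]: "char_fun p 0 = 1"
  by (simp add: char_fun_def)

lemma Re_char_fun: "Re (char_fun p \<theta>) = (\<integral>x. cos (pairing \<theta> x) \<partial>measure_pmf p)"
  unfolding char_fun_def by (subst integral_Re[symmetric]) (auto simp: character_def)

lemma integrable_cos_pairing [simp]:
  "integrable (measure_pmf p) (\<lambda>x. cos (pairing \<theta> x))"
  by (rule measure_pmf.integrable_const_bound[of _ 1]) auto

subsection \<open>The torus and Fourier inversion\<close>

definition torus :: "(real \<times> real) measure" where
  "torus = density lborel (\<lambda>\<theta>. ennreal (indicator (cbox (-pi, -pi) (pi, pi)) \<theta> / (2 * pi)\<^sup>2))"

lemma sets_torus [simp, measurable_cong]: "sets torus = sets borel"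
  and space_torus [simp]: "space torus = UNIV"
  by (auto simp: torus_def)

lemma cbox_pi_eq: "cbox (-pi, -pi) (pi, pi) = {-pi..pi} \<times> {-pi..pi}"
  by (auto simp: cbox_Pair_eq)

lemma prob_space_torus: "prob_space torus"
proof
  have "emeasure torus (space torus)
      = (\<integral>\<^sup>+\<theta>. ennreal (1 / (2 * pi)\<^sup>2) * indicator (cbox (-pi, -pi) (pi, pi)) \<theta> \<partial>lborel)"
    by (auto simp: torus_def emeasure_density intro!: nn_integral_cong split: split_indicator)
  also have "\<dots> = ennreal (1 / (2 * pi)\<^sup>2) * emeasure lborel (cbox (-pi, -pi) (pi, pi :: real))"
    by (rule nn_integral_cmult_indicator) auto
  also have "emeasure lborel (cbox (-pi, -pi) (pi, pi :: real)) = ennreal ((2 * pi)\<^sup>2)"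
    by (subst emeasure_lborel_cbox_eq) (auto simp: Basis_prod_def power2_eq_square inner_prod_def)
  finally show "emeasure torus (space torus) = 1"
    by (simp flip: ennreal_mult)
qed

interpretation torus: prob_space torus
  by (rule prob_space_torus)

lemma nn_integral_torus:
  assumes "f \<in> borel_measurable borel"
  shows "(\<integral>\<^sup>+\<theta>. f \<theta> \<partial>torus)
    = ennreal (1 / (2 * pi)\<^sup>2) * (\<integral>\<^sup>+\<theta>. indicator (cbox (-pi, -pi) (pi, pi)) \<theta> * f \<theta> \<partial>lborel)"
  unfolding torus_def using assms
  by (subst nn_integral_density, simp, simp, subst nn_integral_cmult[symmetric])
     (auto intro!: nn_integral_cong split: split_indicator)

lemma integral_torus:
  fixes f :: "_ \<Rightarrow> 'b::{banach, second_countable_topology}"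
  assumes "f \<in> borel_measurable borel"
  shows "(\<integral>\<theta>. f \<theta> \<partial>torus)
    = (1 / (2 * pi)\<^sup>2) *\<^sub>R (\<integral>\<theta>. indicator (cbox (-pi, -pi) (pi, pi)) \<theta> *\<^sub>R f \<theta> \<partial>lborel)"
  unfolding torus_def using assms
  by (subst integral_density) (auto simp flip: integral_scaleR_right)

lemma integral_cis_int:
  fixes n :: int
  shows "(\<integral>t. indicator {-pi..pi} t *\<^sub>R cis (t * real_of_int n) \<partial>lborel) = of_real (2 * pi * of_bool (n = 0))"
proof (cases "n = 0")
  case True
  have "(\<integral>t. indicator {-pi..pi} t *\<^sub>R (1::complex) \<partial>lborel) = of_real (2 * pi)"
    by (simp add: scaleR_conv_of_real)
  with True show ?thesis by simp
next
  case False
  let ?F = "\<lambda>t. cis (t * real_of_int n) / (\<i> * of_int n)"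
  have "(\<integral>t. indicator {-pi..pi} t *\<^sub>R cis (t * real_of_int n) \<partial>lborel) = ?F pi - ?F (- pi)"
  proof (rule integral_FTC_Icc)
    fix x :: real
    have "(?F has_vector_derivative (of_int n * (\<i> * cis (x * of_int n))) / (\<i> * of_int n))
            (at x within {-pi..pi})"
      unfolding cis_conv_exp using False
      by (auto intro!: derivative_eq_intros has_vector_derivative_real_field simp: field_simps)
    then show "(?F has_vector_derivative cis (x * of_int n)) (at x within {-pi..pi})"
      using False by simp
  qed (auto intro!: continuous_intros)
  also have "cis (pi * real_of_int n) = cis (- pi * real_of_int n)"
    using sin_zero_iff_int2[of "pi * real_of_int n"] by (auto simp: complex_eq_iff)
  finally show ?thesis using False by simp
qed

lemma integral_character_torus: "(\<integral>\<theta>. character \<theta> x \<partial>torus) = of_bool (x = 0)"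
proof -
  let ?f = "\<lambda>n t. indicator {-pi..pi} t *\<^sub>R cis (t * real_of_int n)"
  have f_int: "integrable lborel (?f n)" for n
    by (rule borel_integrable_compact) (auto intro!: continuous_intros)
  have "(\<integral>\<theta>. indicator (cbox (-pi, -pi) (pi, pi)) \<theta> *\<^sub>R character \<theta> x \<partial>lborel)
      = (\<integral>\<theta>. (case \<theta> of (a, b) \<Rightarrow> ?f (x $ 1) a * ?f (x $ 2) b) \<partial>(lborel \<Otimes>\<^sub>M lborel))"
    unfolding lborel_prod cbox_pi_eq
    by (intro Bochner_Integration.integral_cong)
       (auto simp: character_def pairing_def cis_mult indicator_def)
  also have "\<dots> = (\<integral>a. (\<integral>b. ?f (x $ 1) a * ?f (x $ 2) b \<partial>lborel) \<partial>lborel)"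
  proof (rule lborel_pair.integral_fst[symmetric], rule lborel_pair.Fubini_integrable)
    show "integrable lborel (\<lambda>a. \<integral>b. norm (case (a, b) of (a, b) \<Rightarrow> ?f (x $ 1) a * ?f (x $ 2) b) \<partial>lborel)"
      by (simp only: prod.case norm_mult integral_mult_right_zero)
         (intro integrable_mult_left integrable_norm f_int)
    show "AE a in lborel. integrable lborel (\<lambda>b. case (a, b) of (a, b) \<Rightarrow> ?f (x $ 1) a * ?f (x $ 2) b)"
      by (simp only: prod.case) (intro AE_I2 integrable_mult_right f_int)
    have [measurable]: "?f n \<in> borel_measurable borel" for n
      using f_int[of n] by (simp add: integrable_iff_bounded)
    show "(\<lambda>(a, b). ?f (x $ 1) a * ?f (x $ 2) b) \<in> borel_measurable (lborel \<Otimes>\<^sub>M lborel)"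
      unfolding case_prod_unfold by (intro borel_measurable_times measurable_compose[OF measurable_fst]
          measurable_compose[OF measurable_snd]) simp_all
  qed
  also have "\<dots> = of_real (2 * pi * of_bool (x $ 1 = 0)) * of_real (2 * pi * of_bool (x $ 2 = 0))"
    by (simp only: integral_mult_right_zero integral_mult_left_zero integral_cis_int)
  also have "\<dots> = (2 * pi)\<^sup>2 * of_bool (x = 0)"
    by (auto simp: vec_eq_iff forall_2 power2_eq_square)
  finally show ?thesis
    by (subst integral_torus) (auto intro: borel_measurable_continuous_onI continuous_on_character
        simp: scaleR_conv_of_real)
qed

lemma (in prob_space) Fourier_inversion:
  assumes [measurable]: "V \<in> M \<rightarrow>\<^sub>M count_space UNIV"
  shows "complex_of_real (prob {\<omega> \<in> space M. V \<omega> = x})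
    = (\<integral>\<theta>. cnj (character \<theta> x) * (\<integral>\<omega>. character \<theta> (V \<omega>) \<partial>M) \<partial>torus)"
proof -
  have "(\<integral>\<theta>. cnj (character \<theta> x) * (\<integral>\<omega>. character \<theta> (V \<omega>) \<partial>M) \<partial>torus)
      = (\<integral>\<theta>. (\<integral>\<omega>. character \<theta> (V \<omega> - x) \<partial>M) \<partial>torus)"
    by (simp add: character_diff mult.commute)
  also have "\<dots> = (\<integral>\<omega>. (\<integral>\<theta>. character \<theta> (V \<omega> - x) \<partial>torus) \<partial>M)"
    by (rule bounded_Fubini[where B = 1]) (auto simp: torus.finite_measure_axioms finite_measure_axioms)
  also have "\<dots> = (\<integral>\<omega>. of_real (indicator {\<omega> \<in> space M. V \<omega> = x} \<omega>) \<partial>M)"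
    by (intro Bochner_Integration.integral_cong)
       (auto simp: integral_character_torus split: split_indicator)
  also have "\<dots> = of_real (prob {\<omega> \<in> space M. V \<omega> = x})"
    by (subst integral_complex_of_real) simp
  finally show ?thesis ..
qed

section \<open>Irreducible increment distributions\<close>

text \<open>A walk whose increments have law \<open>p\<close> reaches exactly the finite sums of points of the
  support of \<open>p\<close>.\<close>

definition irreducible_pmf :: "(int ^ 2) pmf \<Rightarrow> bool" where
  "irreducible_pmf p \<longleftrightarrow> (\<forall>x. \<exists>zs. set zs \<subseteq> set_pmf p \<and> sum_list zs = x)"

lemma irreducible_pmf_induct:
  assumes "irreducible_pmf p" "P 0" "\<And>x y. x \<in> set_pmf p \<Longrightarrow> P y \<Longrightarrow> P (x + y)"
  shows "P z"
proof -
  have "P (sum_list zs)" if "set zs \<subseteq> set_pmf p" for zs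
    using that by (induction zs) (use assms in auto)
  moreover obtain zs where "set zs \<subseteq> set_pmf p" "sum_list zs = z"
    using assms(1) unfolding irreducible_pmf_def by blast
  ultimately show ?thesis by blast
qed

definition cross :: "int ^ 2 \<Rightarrow> int ^ 2 \<Rightarrow> int" where
  "cross x y = x $ 1 * y $ 2 - x $ 2 * y $ 1"

lemma cross_add: "cross (x + y) z = cross x z + cross y z"
  and cross_diff: "cross (x - y) z = cross x z - cross y z"
  by (simp_all add: cross_def algebra_simps)

lemma cross_eq_0_imp: "(\<And>x. cross x z = 0) \<Longrightarrow> z = 0"
proof -
  assume a: "\<And>x. cross x z = 0"
  have "cross (axis 1 1) z = z $ 2" "cross (axis 2 1) z = - z $ 1"
    by (simp_all add: cross_def axis_def)
  with a show "z = 0" by (simp add: vec_eq_iff forall_2)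
qed

lemma zero_mean_coordinate:
  assumes "zero_mean p"
  shows "integrable (measure_pmf p) (\<lambda>x. real_of_int (x $ i))"
    and "(\<integral>x. real_of_int (x $ i) \<partial>measure_pmf p) = 0"
proof -
  have "has_bochner_integral (measure_pmf p) (\<lambda>x. real_site x $ i) (0 $ i)"
    using bounded_linear_vec_nth assms unfolding zero_mean_def
    by (rule has_bochner_integral_bounded_linear)
  then have "has_bochner_integral (measure_pmf p) (\<lambda>x. real_of_int (x $ i)) 0"
    by (simp add: real_site_def)
  then show "integrable (measure_pmf p) (\<lambda>x. real_of_int (x $ i))"
    "(\<integral>x. real_of_int (x $ i) \<partial>measure_pmf p) = 0"
    by (auto simp: has_bochner_integral_iff)
qed

lemma irreducible_support_spans:
  assumes "irreducible_pmf p"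
  obtains x y where "x \<in> set_pmf p" "y \<in> set_pmf p" "cross x y \<noteq> 0"
proof (rule ccontr)
  assume no: "\<not> thesis"
  note pair = that
  have all: "cross x y = 0" if "x \<in> set_pmf p" "y \<in> set_pmf p" for x y
    using no pair[OF that] by blast
  have "\<exists>y\<in>set_pmf p. y \<noteq> 0"
  proof (rule ccontr)
    assume "\<not> (\<exists>y\<in>set_pmf p. y \<noteq> 0)"
    then have "z = 0" for z :: "int ^ 2"
      using irreducible_pmf_induct[OF assms, of "\<lambda>z. z = 0" z] by auto
    from this[of "axis 1 1"] show False by (simp add: axis_eq_0_iff)
  qed
  then obtain y where y: "y \<in> set_pmf p" "y \<noteq> 0" by blast
  have "cross x y = 0" for x
    by (rule irreducible_pmf_induct[OF assms])
       (use all y in \<open>auto simp: cross_add, auto simp: cross_def\<close>)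
  then show False using cross_eq_0_imp y by blast
qed

text \<open>Without the zero mean, the support could lie on a line that misses the origin, and then
  the differences of its points would all be parallel.\<close>

lemma irreducible_differences_span:
  assumes irr: "irreducible_pmf p" and mean: "zero_mean p"
  obtains x x' y y' where "x \<in> set_pmf p" "x' \<in> set_pmf p" "y \<in> set_pmf p" "y' \<in> set_pmf p"
    "cross (x - x') (y - y') \<noteq> 0"
proof (rule ccontr)
  assume no: "\<not> thesis"
  note points = that
  have all: "cross (x - x') (y - y') = 0"
    if "x \<in> set_pmf p" "x' \<in> set_pmf p" "y \<in> set_pmf p" "y' \<in> set_pmf p" for x x' y y'
    using no points[OF that] by blast
  obtain u v where uv: "u \<in> set_pmf p" "v \<in> set_pmf p" "cross u v \<noteq> 0"
    using irreducible_support_spans[OF irr] .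
  define d where "d = u - v"
  have "d \<noteq> 0" using uv by (auto simp: d_def cross_def)
  have const: "cross x d = cross u d" if "x \<in> set_pmf p" for x
    using all[OF that uv(1) uv(1) uv(2)] by (simp add: cross_diff d_def)
  have "(\<integral>x. real_of_int (cross x d) \<partial>measure_pmf p) = 0"
    unfolding cross_def using zero_mean_coordinate[OF mean] by simp
  moreover have "(\<integral>x. real_of_int (cross x d) \<partial>measure_pmf p) = (\<integral>x. real_of_int (cross u d) \<partial>measure_pmf p)"
    by (intro integral_cong_AE) (auto simp: AE_measure_pmf_iff const)
  ultimately have zero: "cross u d = 0" by simp
  have "cross x d = 0" for x
    by (rule irreducible_pmf_induct[OF irr])
       (use const zero in \<open>auto simp: cross_add, auto simp: cross_def\<close>)
  then show False using cross_eq_0_imp \<open>d \<noteq> 0\<close> by blast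
qed

section \<open>Decay of characteristic functions\<close>

lemma one_minus_cos_ge:
  assumes "\<bar>v\<bar> \<le> pi"
  shows "v\<^sup>2 / 10 \<le> 1 - cos v"
proof -
  define x where "x = v / 2"
  have x: "\<bar>x\<bar> \<le> pi / 2" and v: "v = 2 * x" using assms by (auto simp: x_def)
  have "x\<^sup>2 \<le> 2\<^sup>2"
    using x pi_less_4 by (intro abs_le_square_iff[THEN iffD1]) auto
  have "x\<^sup>2 \<le> 5 * (sin x)\<^sup>2"
  proof (cases "\<bar>x\<bar> = pi / 2")
    case True
    then have "x = pi / 2 \<or> x = - (pi / 2)" by auto
    then have "(sin x)\<^sup>2 = 1" by (elim disjE; hypsubst; simp)
    then show ?thesis using \<open>x\<^sup>2 \<le> 2\<^sup>2\<close> by simp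
  next
    case False
    then have lt: "\<bar>x\<bar> < pi / 2" using x by simp
    have "cos x > 0" using lt by (intro cos_gt_zero_pi) auto
    have "x\<^sup>2 \<le> (tan x)\<^sup>2" using abs_tan_ge[OF lt] by (simp add: abs_le_square_iff)
    then have "x\<^sup>2 * (cos x)\<^sup>2 \<le> (sin x)\<^sup>2"
      using \<open>cos x > 0\<close> by (simp add: tan_def power_divide field_simps)
    then have "x\<^sup>2 \<le> (1 + x\<^sup>2) * (sin x)\<^sup>2"
      by (simp add: cos_squared_eq algebra_simps)
    also have "\<dots> \<le> 5 * (sin x)\<^sup>2"
      using \<open>x\<^sup>2 \<le> 2\<^sup>2\<close> by (intro mult_right_mono) auto
    finally show ?thesis .
  qed
  moreover have "1 - cos v = 2 * (sin x)\<^sup>2"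
    unfolding v by (simp add: cos_double_sin)
  ultimately show ?thesis by (simp add: v power2_eq_square)
qed

lemma nn_integral_Gaussian:
  fixes a m :: real
  assumes "a > 0"
  shows "(\<integral>\<^sup>+x. ennreal (exp (- (a * (x - m)\<^sup>2))) \<partial>lborel) = ennreal (sqrt (pi / a))"
proof -
  define \<sigma> where "\<sigma> = sqrt (1 / (2 * a))"
  have \<sigma>: "\<sigma> > 0" "\<sigma>\<^sup>2 = 1 / (2 * a)" using assms by (auto simp: \<sigma>_def)
  have eq: "exp (- (a * (x - m)\<^sup>2)) = sqrt (pi / a) * normal_density m \<sigma> x" for x
    using assms unfolding normal_density_def \<sigma>(2) by (simp add: field_simps real_sqrt_divide)
  have "(\<integral>\<^sup>+x. ennreal (normal_density m \<sigma> x) \<partial>lborel) = 1"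
    using \<sigma> by (subst nn_integral_eq_integral) auto
  then show ?thesis
    unfolding eq using assms \<sigma> by (simp add: ennreal_mult nn_integral_cmult)
qed

text \<open>Invertible linear coordinates in the plane turn the integral of a product of functions of two independent linear forms
  into a product of one-dimensional integrals.\<close>

lemma nn_integral_linear_pair:
  fixes F G :: "real \<Rightarrow> ennreal" and a b c d :: real
  assumes [measurable]: "F \<in> borel_measurable borel" "G \<in> borel_measurable borel"
    and det: "a * d - b * c \<noteq> 0"
  shows "(\<integral>\<^sup>+z. F (a * fst z + b * snd z) * G (c * fst z + d * snd z) \<partial>lborel)
    = ennreal (1 / \<bar>a * d - b * c\<bar>) * ((\<integral>\<^sup>+v. F v \<partial>lborel) * (\<integral>\<^sup>+w. G w \<partial>lborel))"
proof -
  have main: "(\<integral>\<^sup>+y. (\<integral>\<^sup>+x. F (a * x + b * y) * G (c * x + d * y) \<partial>lborel) \<partial>lborel)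
    = ennreal (1 / \<bar>a * d - b * c\<bar>) * ((\<integral>\<^sup>+v. F v \<partial>lborel) * (\<integral>\<^sup>+w. G w \<partial>lborel))"
    if a: "a \<noteq> 0" and det: "a * d - b * c \<noteq> 0" for a b c d :: real
  proof -
    define e where "e = (a * d - b * c) / a"
    define k where "k = c / a"
    have e: "e \<noteq> 0" using a det by (simp add: e_def)
    have inner: "(\<integral>\<^sup>+x. F (a * x + b * y) * G (c * x + d * y) \<partial>lborel)
        = ennreal (1 / \<bar>a\<bar>) * (\<integral>\<^sup>+v. F v * G (k * v + e * y) \<partial>lborel)" for y
    proof -
      have arg: "k * (b * y + a * x) + e * y = c * x + d * y" for x
        using a by (simp add: e_def k_def field_simps)
      have "(\<integral>\<^sup>+v. F v * G (k * v + e * y) \<partial>lborel)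
          = \<bar>a\<bar> * (\<integral>\<^sup>+x. F (b * y + a * x) * G (k * (b * y + a * x) + e * y) \<partial>lborel)"
        by (rule nn_integral_real_affine) (use a in simp_all)
      then show ?thesis
        unfolding arg using a
        by (simp add: mult.assoc[symmetric] ennreal_mult[symmetric] add.commute del: ennreal_mult'')
    qed
    have scale: "(\<integral>\<^sup>+w. G w \<partial>lborel) = \<bar>e\<bar> * (\<integral>\<^sup>+y. G (k * v + e * y) \<partial>lborel)" for v
      by (rule nn_integral_real_affine) (use e in simp_all)
    have scale': "(\<integral>\<^sup>+y. G (k * v + e * y) \<partial>lborel) = ennreal (1 / \<bar>e\<bar>) * (\<integral>\<^sup>+w. G w \<partial>lborel)" for v
      unfolding scale[of v] using e by (simp add: mult.assoc[symmetric] ennreal_mult[symmetric])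
    have "(\<integral>\<^sup>+y. (\<integral>\<^sup>+x. F (a * x + b * y) * G (c * x + d * y) \<partial>lborel) \<partial>lborel)
        = ennreal (1 / \<bar>a\<bar>) * (\<integral>\<^sup>+y. (\<integral>\<^sup>+v. F v * G (k * v + e * y) \<partial>lborel) \<partial>lborel)"
      unfolding inner by (rule nn_integral_cmult) measurable
    also have "(\<integral>\<^sup>+y. (\<integral>\<^sup>+v. F v * G (k * v + e * y) \<partial>lborel) \<partial>lborel)
        = (\<integral>\<^sup>+v. (\<integral>\<^sup>+y. F v * G (k * v + e * y) \<partial>lborel) \<partial>lborel)"
      by (rule lborel_pair.Fubini') measurable
    also have "\<dots> = (\<integral>\<^sup>+v. F v * (ennreal (1 / \<bar>e\<bar>) * (\<integral>\<^sup>+w. G w \<partial>lborel)) \<partial>lborel)"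
      by (subst nn_integral_cmult) (auto simp: scale')
    also have "\<dots> = ennreal (1 / \<bar>e\<bar>) * ((\<integral>\<^sup>+v. F v \<partial>lborel) * (\<integral>\<^sup>+w. G w \<partial>lborel))"
      by (subst nn_integral_multc) (auto simp: ac_simps)
    also have "ennreal (1 / \<bar>a\<bar>) * (ennreal (1 / \<bar>e\<bar>) * ((\<integral>\<^sup>+v. F v \<partial>lborel) * (\<integral>\<^sup>+w. G w \<partial>lborel)))
        = ennreal (1 / \<bar>a\<bar> * (1 / \<bar>e\<bar>)) * ((\<integral>\<^sup>+v. F v \<partial>lborel) * (\<integral>\<^sup>+w. G w \<partial>lborel))"
      by (subst ennreal_mult) (auto simp: mult.assoc)
    also have "1 / \<bar>a\<bar> * (1 / \<bar>e\<bar>) = 1 / \<bar>a * d - b * c\<bar>"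
      using a by (simp add: e_def abs_divide)
    finally show ?thesis .
  qed
  let ?H = "\<lambda>z. F (a * fst z + b * snd z) * G (c * fst z + d * snd z)"
  have "(\<integral>\<^sup>+z. ?H z \<partial>(lborel \<Otimes>\<^sub>M lborel)) = (\<integral>\<^sup>+x. (\<integral>\<^sup>+y. ?H (x, y) \<partial>lborel) \<partial>lborel)"
    by (rule lborel.nn_integral_fst[symmetric]) measurable
  then have xy: "(\<integral>\<^sup>+z. ?H z \<partial>lborel) = (\<integral>\<^sup>+x. (\<integral>\<^sup>+y. ?H (x, y) \<partial>lborel) \<partial>lborel)"
    by (simp add: lborel_prod)
  also have "\<dots> = (\<integral>\<^sup>+y. (\<integral>\<^sup>+x. ?H (x, y) \<partial>lborel) \<partial>lborel)"
    by (rule lborel_pair.Fubini'[symmetric]) measurable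
  finally have yx: "(\<integral>\<^sup>+z. ?H z \<partial>lborel) = (\<integral>\<^sup>+y. (\<integral>\<^sup>+x. ?H (x, y) \<partial>lborel) \<partial>lborel)" .
  show ?thesis
  proof (cases "a = 0")
    case False
    then show ?thesis using yx main[OF False det] by simp
  next
    case True
    then have "b \<noteq> 0" using det by auto
    have "b * c - a * d \<noteq> 0" using det by simp
    then show ?thesis
      using xy main[OF \<open>b \<noteq> 0\<close>, of c a d] by (simp add: add.commute abs_minus_commute)
  qed
qed

text \<open>A sum of Gaussian bumps at the multiples of \<open>2 * pi\<close>: it dominates \<open>exp (- u * (1 - cos v))\<close>
  on a long interval and has a total mass of order \<open>1 / sqrt u\<close>.\<close>

definition bumps :: "nat \<Rightarrow> real \<Rightarrow> real \<Rightarrow> real" where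
  "bumps K u v = (\<Sum>m\<in>{- int K..int K}. exp (- (u / 10 * (v - 2 * pi * real_of_int m)\<^sup>2)))"

text \<open>Only the multiple of \<open>2 * pi\<close> nearest to \<open>v\<close> matters: at distance at most \<open>pi\<close> from it, \<open>1 - cos\<close> dominates a tenth of
  the squared distance.\<close>

lemma exp_cos_le_bumps:
  assumes "\<bar>v\<bar> \<le> 2 * pi * real K" "u \<ge> 0"
  shows "exp (- (u * (1 - cos v))) \<le> bumps K u v"
proof -
  define m where "m = round (v / (2 * pi))"
  have m: "\<bar>v / (2 * pi) - real_of_int m\<bar> \<le> 1 / 2"
    using of_int_round_abs_le[of "v / (2 * pi)"] by (simp add: m_def abs_minus_commute)
  have "v - 2 * pi * real_of_int m = 2 * pi * (v / (2 * pi) - real_of_int m)"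
    by (simp add: field_simps)
  then have "\<bar>v - 2 * pi * real_of_int m\<bar> = 2 * pi * \<bar>v / (2 * pi) - real_of_int m\<bar>"
    by (simp add: abs_mult)
  also have "\<dots> \<le> 2 * pi * (1 / 2)"
    using m by (intro mult_left_mono) auto
  finally have "(v - 2 * pi * real_of_int m)\<^sup>2 / 10 \<le> 1 - cos (v - 2 * pi * real_of_int m)"
    by (intro one_minus_cos_ge) simp
  also have "cos (v - 2 * pi * real_of_int m) = cos v"
    using sin_int_2pin[of m] cos_int_2pin[of m] by (simp add: cos_diff)
  finally have "u * ((v - 2 * pi * real_of_int m)\<^sup>2 / 10) \<le> u * (1 - cos v)"
    using \<open>u \<ge> 0\<close> by (rule mult_left_mono)
  then have "exp (- (u * (1 - cos v))) \<le> exp (- (u / 10 * (v - 2 * pi * real_of_int m)\<^sup>2))"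
    by simp
  also have "\<dots> \<le> bumps K u v"
  proof -
    have "\<bar>v / (2 * pi)\<bar> \<le> real K"
      using assms(1) by (simp add: abs_divide field_simps)
    then have "\<bar>real_of_int m\<bar> \<le> real K + 1 / 2" using m by linarith
    then have "m \<in> {- int K..int K}" by auto
    then show ?thesis
      unfolding bumps_def
      by (intro member_le_sum[where f = "\<lambda>m. exp (- (u / 10 * (v - 2 * pi * real_of_int m)\<^sup>2))"]) auto
  qed
  finally show ?thesis .
qed

lemma nn_integral_bumps:
  assumes "u > 0"
  shows "(\<integral>\<^sup>+v. ennreal (bumps K u v) \<partial>lborel) = ennreal (real (2 * K + 1) * sqrt (10 * pi / u))"
proof -
  have "(\<integral>\<^sup>+v. ennreal (bumps K u v) \<partial>lborel)
      = (\<Sum>m\<in>{- int K..int K}. \<integral>\<^sup>+v. ennreal (exp (- (u / 10 * (v - 2 * pi * real_of_int m)\<^sup>2))) \<partial>lborel)"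
    unfolding bumps_def by (subst nn_integral_sum[symmetric]) (auto simp: sum_ennreal)
  also have "\<dots> = (\<Sum>m\<in>{- int K..int K}. ennreal (sqrt (pi / (u / 10))))"
    using assms by (intro sum.cong refl nn_integral_Gaussian) simp
  also have "\<dots> = ennreal (\<Sum>m\<in>{- int K..int K}. sqrt (pi / (u / 10)))"
    using assms by (subst sum_ennreal) auto
  also have "(\<Sum>m\<in>{- int K..int K}. sqrt (pi / (u / 10))) = real (2 * K + 1) * sqrt (10 * pi / u)"
    by (simp add: algebra_simps nat_add_distrib)
  finally show ?thesis .
qed

lemma measure_pair_pmf_countable:
  fixes p :: "'x::countable pmf" and q :: "'y::countable pmf"
  shows "measure_pmf (pair_pmf p q) = measure_pmf p \<Otimes>\<^sub>M measure_pmf q"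
proof (rule measure_eqI)
  have "sets (measure_pmf p \<Otimes>\<^sub>M measure_pmf q) = sets (count_space UNIV \<Otimes>\<^sub>M count_space UNIV)"
    by (intro sets_pair_measure_cong) auto
  also have "\<dots> = UNIV"
    by (subst pair_measure_countable) auto
  finally have sets: "sets (measure_pmf p \<Otimes>\<^sub>M measure_pmf q) = UNIV" .
  then show "sets (measure_pmf (pair_pmf p q)) = sets (measure_pmf p \<Otimes>\<^sub>M measure_pmf q)" by simp
  fix A assume "A \<in> sets (measure_pmf (pair_pmf p q))"
  have "emeasure (measure_pmf (pair_pmf p q)) A = (\<integral>\<^sup>+z. indicator A z \<partial>pair_pmf p q)"
    by simp
  also have "\<dots> = (\<integral>\<^sup>+x. \<integral>\<^sup>+y. indicator A (x, y) \<partial>measure_pmf q \<partial>measure_pmf p)"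
    by (rule nn_integral_pair_pmf')
  also have "\<dots> = emeasure (measure_pmf p \<Otimes>\<^sub>M measure_pmf q) A"
    by (subst measure_pmf.emeasure_pair_measure) (auto simp: sets)
  finally show "emeasure (measure_pmf (pair_pmf p q)) A = emeasure (measure_pmf p \<Otimes>\<^sub>M measure_pmf q) A" .
qed

lemma char_fun_discrete_difference:
  "char_fun (discrete_difference_pmf p q) \<theta> = char_fun p \<theta> * cnj (char_fun q \<theta>)"
proof -
  interpret pair_prob_space "measure_pmf p" "measure_pmf q" ..
  have int: "integrable (measure_pmf (pair_pmf p q)) (\<lambda>(x, y). character \<theta> (x - y))"
    by (rule measure_pmf.integrable_const_bound[of _ 1]) auto
  have "char_fun (discrete_difference_pmf p q) \<theta>
      = (\<integral>z. (case z of (x, y) \<Rightarrow> character \<theta> (x - y)) \<partial>measure_pmf (pair_pmf p q))"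
    by (simp add: char_fun_def discrete_difference_pmf_def case_prod_unfold)
  also have "\<dots> = (\<integral>x. (\<integral>y. character \<theta> (x - y) \<partial>measure_pmf q) \<partial>measure_pmf p)"
    using int unfolding measure_pair_pmf_countable by (rule integral_fst[symmetric])
  also have "\<dots> = char_fun p \<theta> * cnj (char_fun q \<theta>)"
    by (simp add: character_diff char_fun_def)
  finally show ?thesis .
qed

lemma one_minus_Re_char_fun_ge:
  assumes "finite A"
  shows "(\<Sum>x\<in>A. pmf p x * (1 - cos (pairing \<theta> x))) \<le> 1 - Re (char_fun p \<theta>)"
proof -
  have "(\<Sum>x\<in>A. pmf p x * (1 - cos (pairing \<theta> x)))
      = (\<integral>x. indicator A x * (1 - cos (pairing \<theta> x)) \<partial>measure_pmf p)"
    by (subst integral_measure_pmf[OF assms]) (auto simp: indicator_def split: if_splits intro!: sum.cong)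
  also have "\<dots> \<le> (\<integral>x. 1 - cos (pairing \<theta> x) \<partial>measure_pmf p)"
    by (intro integral_mono measure_pmf.integrable_const_bound[of _ 2])
       (auto split: split_indicator simp: abs_le_iff intro: order_trans[OF cos_le_one])
  also have "\<dots> = 1 - Re (char_fun p \<theta>)"
    by (simp add: Re_char_fun)
  finally show ?thesis .
qed

text \<open>The squared modulus of a characteristic function may equal \<open>1\<close> at several points of the
  torus, when the walk is periodic; the bound is nevertheless the one for a single such point, because
  a linear change of variables turns the two independent differences into coordinates.\<close>

proposition torus_integral_decay:
  assumes irr: "irreducible_pmf p" and mean: "zero_mean p"
  shows "\<exists>C>0. \<forall>u>0. (\<integral>\<^sup>+\<theta>. ennreal (exp (- (u * (1 - (norm (char_fun p \<theta>))\<^sup>2)))) \<partial>torus) \<le> ennreal (C / u)"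
proof -
  obtain x x' y y' where supp: "x \<in> set_pmf p" "x' \<in> set_pmf p" "y \<in> set_pmf p" "y' \<in> set_pmf p"
    and cr: "cross (x - x') (y - y') \<noteq> 0"
    using irreducible_differences_span[OF irr mean] .
  define d where "d = x - x'"
  define e where "e = y - y'"
  \<comment> \<open>The squared modulus is the characteristic function of the difference of two independent increments.\<close>
  define D where "D = discrete_difference_pmf p p"
  define q where "q = min (pmf D d) (pmf D e)"
  have "d \<in> set_pmf D" "e \<in> set_pmf D"
    using supp by (auto simp: D_def discrete_difference_pmf_def d_def e_def image_iff)
  then have q: "q > 0" by (simp add: q_def pmf_positive)
  have "cross d e \<noteq> 0" using cr by (simp add: d_def e_def)
  then have "d \<noteq> e" by (auto simp: cross_def)
  have lower: "q * (1 - cos (pairing \<theta> d)) + q * (1 - cos (pairing \<theta> e)) \<le> 1 - (norm (char_fun p \<theta>))\<^sup>2" for \<theta>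
  proof -
    have "q * (1 - cos (pairing \<theta> d)) + q * (1 - cos (pairing \<theta> e))
        \<le> pmf D d * (1 - cos (pairing \<theta> d)) + pmf D e * (1 - cos (pairing \<theta> e))"
      by (intro add_mono mult_right_mono) (auto simp: q_def)
    also have "\<dots> = (\<Sum>z\<in>{d, e}. pmf D z * (1 - cos (pairing \<theta> z)))"
      using \<open>d \<noteq> e\<close> by simp
    also have "\<dots> \<le> 1 - Re (char_fun D \<theta>)"
      by (rule one_minus_Re_char_fun_ge) simp
    also have "char_fun D \<theta> = of_real ((norm (char_fun p \<theta>))\<^sup>2)"
      unfolding D_def char_fun_discrete_difference by (rule complex_norm_square[symmetric])
    finally show ?thesis by simp
  qed
  define K where "K = nat (max (\<bar>d $ 1\<bar> + \<bar>d $ 2\<bar>) (\<bar>e $ 1\<bar> + \<bar>e $ 2\<bar>))"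
  have pair_le: "\<bar>pairing \<theta> z\<bar> \<le> 2 * pi * real K"
    if "\<theta> \<in> cbox (-pi, -pi) (pi, pi)" "z \<in> {d, e}" for \<theta> z
  proof -
    have \<theta>: "\<bar>fst \<theta>\<bar> \<le> pi" "\<bar>snd \<theta>\<bar> \<le> pi"
      using that(1) unfolding cbox_pi_eq by auto
    have "\<bar>pairing \<theta> z\<bar> \<le> \<bar>fst \<theta>\<bar> * \<bar>real_of_int (z $ 1)\<bar> + \<bar>snd \<theta>\<bar> * \<bar>real_of_int (z $ 2)\<bar>"
      unfolding pairing_def by (metis abs_mult abs_triangle_ineq)
    also have "\<dots> \<le> pi * \<bar>real_of_int (z $ 1)\<bar> + pi * \<bar>real_of_int (z $ 2)\<bar>"
      using \<theta> by (intro add_mono mult_right_mono) auto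
    also have "\<dots> = pi * real_of_int (\<bar>z $ 1\<bar> + \<bar>z $ 2\<bar>)"
      by (simp add: algebra_simps)
    also have "\<dots> \<le> pi * real K"
    proof (intro mult_left_mono)
      have "\<bar>z $ 1\<bar> + \<bar>z $ 2\<bar> \<le> int K" using that(2) by (auto simp: K_def)
      then show "real_of_int (\<bar>z $ 1\<bar> + \<bar>z $ 2\<bar>) \<le> real K" by linarith
    qed auto
    finally show ?thesis using pi_gt_zero by (auto intro: order_trans[rotated])
  qed
  have det: "real_of_int (d $ 1) * real_of_int (e $ 2) - real_of_int (d $ 2) * real_of_int (e $ 1) \<noteq> 0"
    using cr unfolding cross_def d_def[symmetric] e_def[symmetric]
    by (metis of_int_diff of_int_eq_0_iff of_int_mult)
  define \<Delta> where "\<Delta> = \<bar>real_of_int (d $ 1) * real_of_int (e $ 2) - real_of_int (d $ 2) * real_of_int (e $ 1)\<bar>"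
  have "\<Delta> > 0" using det by (simp add: \<Delta>_def)
  define C where "C = 1 / (2 * pi)\<^sup>2 * (1 / \<Delta> * ((real (2 * K + 1))\<^sup>2 * (10 * pi / q)))"
  have "C > 0" unfolding C_def using \<open>\<Delta> > 0\<close> q by (intro mult_pos_pos divide_pos_pos) auto
  have [measurable]: "bumps K u \<in> borel_measurable borel" for u
    unfolding bumps_def by measurable
  have "(\<integral>\<^sup>+\<theta>. ennreal (exp (- (u * (1 - (norm (char_fun p \<theta>))\<^sup>2)))) \<partial>torus) \<le> ennreal (C / u)"
    if u: "u > 0" for u
  proof -
    let ?E = "\<lambda>\<theta>. ennreal (exp (- (u * (1 - (norm (char_fun p \<theta>))\<^sup>2))))" and ?b = "real (2 * K + 1) * sqrt (10 * pi / (u * q))"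
    have uq: "u * q > 0" using u q by simp
    have "(\<integral>\<^sup>+\<theta>. ?E \<theta> \<partial>torus)
      = ennreal (1 / (2 * pi)\<^sup>2) * (\<integral>\<^sup>+\<theta>. indicator (cbox (-pi, -pi) (pi, pi)) \<theta>
            * ?E \<theta> \<partial>lborel)"
      by (rule nn_integral_torus) simp
    also have "\<dots> \<le> ennreal (1 / (2 * pi)\<^sup>2) * (\<integral>\<^sup>+\<theta>. ennreal (bumps K (u * q) (d $ 1 * fst \<theta> + d $ 2 * snd \<theta>))
            * ennreal (bumps K (u * q) (e $ 1 * fst \<theta> + e $ 2 * snd \<theta>)) \<partial>lborel)"
    proof (intro mult_left_mono nn_integral_mono)
      fix \<theta> :: "real \<times> real"
      show "indicator (cbox (-pi, -pi) (pi, pi)) \<theta> * ?E \<theta>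
        \<le> ennreal (bumps K (u * q) (d $ 1 * fst \<theta> + d $ 2 * snd \<theta>))
            * ennreal (bumps K (u * q) (e $ 1 * fst \<theta> + e $ 2 * snd \<theta>))"
      proof (cases "\<theta> \<in> cbox (-pi, -pi) (pi, pi)")
        case True
        have "exp (- (u * (1 - (norm (char_fun p \<theta>))\<^sup>2)))
          \<le> exp (- (u * (q * (1 - cos (pairing \<theta> d)) + q * (1 - cos (pairing \<theta> e)))))"
          using lower[of \<theta>] u by simp
        also have "\<dots> = exp (- (u * q * (1 - cos (pairing \<theta> d)))) * exp (- (u * q * (1 - cos (pairing \<theta> e))))"
          by (simp add: mult_exp_exp algebra_simps)
        also have "\<dots> \<le> bumps K (u * q) (pairing \<theta> d) * bumps K (u * q) (pairing \<theta> e)"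
          using uq pair_le[OF True]
          by (intro mult_mono exp_cos_le_bumps) (auto simp: bumps_def intro!: sum_nonneg)
        finally have "?E \<theta>
          \<le> ennreal (bumps K (u * q) (pairing \<theta> d) * bumps K (u * q) (pairing \<theta> e))"
          by (rule ennreal_leI)
        also have "\<dots> = ennreal (bumps K (u * q) (pairing \<theta> d)) * ennreal (bumps K (u * q) (pairing \<theta> e))"
          by (intro ennreal_mult) (auto simp: bumps_def intro!: sum_nonneg)
        finally show ?thesis
          using True by (simp add: pairing_def mult.commute)
      qed simp
    qed simp
    also have "\<dots> = ennreal (1 / (2 * pi)\<^sup>2) * (ennreal (1 / \<Delta>) *
        (ennreal ?b * ennreal ?b))"
      unfolding nn_integral_bumps[OF uq, symmetric] \<Delta>_def
      by (subst nn_integral_linear_pair) (use det in simp_all)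
    also have "\<dots> = ennreal (1 / (2 * pi)\<^sup>2 * (1 / \<Delta> * ((real (2 * K + 1))\<^sup>2 * (10 * pi / (u * q)))))"
    proof -
      have "?b * ?b
          = (real (2 * K + 1))\<^sup>2 * (10 * pi / (u * q))"
        using uq by (simp add: power2_eq_square real_sqrt_mult_self mult_ac flip: real_sqrt_mult)
      then show ?thesis
        using \<open>\<Delta> > 0\<close> uq by (simp add: ennreal_mult'[symmetric])
    qed
    also have "1 / (2 * pi)\<^sup>2 * (1 / \<Delta> * ((real (2 * K + 1))\<^sup>2 * (10 * pi / (u * q)))) = C / u"
      unfolding C_def using u q by (simp add: field_simps)
    finally show ?thesis .
  qed
  with \<open>C > 0\<close> show ?thesis by blast
qed

section \<open>Time measures and logarithmic averages\<close>

text \<open>When \<open>B\<close> is the set of collision times, the integrand is the \<open>k\<close>-th power of the local time that accumulates between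
  a collision at time \<open>s\<close> and time \<open>t\<close>. Hence \<open>k + 1\<close> times this integral is comparable with the power \<open>k + 1\<close> of the
  local time up to \<open>t\<close>.\<close>

abbreviation collision_integral :: "real measure \<Rightarrow> real set \<Rightarrow> real \<Rightarrow> nat \<Rightarrow> real" where
  "collision_integral \<nu> B t k \<equiv>
     (\<integral>s. indicator (B \<inter> {0..t}) s * measure \<nu> {v \<in> {0..t - s}. s + v \<in> B} ^ k \<partial>\<nu>)"

lemma harm_le_one_plus_ln: "1 \<le> N \<Longrightarrow> (harm N :: real) \<le> 1 + ln (real N)"
  using decseqD[OF decseq_harm_diff_ln, of 0 "N - 1"] by (simp add: harm_expand)

text \<open>Counting measure on the natural numbers and Lebesgue measure both give every interval
  \<open>[n, n + 1)\<close> at most the mass \<open>1\<close>; this is all that the estimates of time integrals use.\<close>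

locale time_measure =
  fixes \<nu> :: "real measure"
  assumes sets_\<nu> [measurable_cong]: "sets \<nu> = sets borel"
    and unit_mass: "\<And>n :: nat. emeasure \<nu> {real n..<real n + 1} \<le> 1"
begin

lemma space_\<nu> [simp]: "space \<nu> = UNIV"
  using sets_eq_imp_space_eq[OF sets_\<nu>] by simp

text \<open>Each unit interval contributes at most the value at its left end.\<close>

lemma nn_integral_antimono_le_sum:
  fixes f :: "real \<Rightarrow> ennreal"
  assumes [measurable]: "f \<in> borel_measurable borel"
    and f: "\<And>x y. 0 \<le> x \<Longrightarrow> x \<le> y \<Longrightarrow> f y \<le> f x"
  shows "(\<integral>\<^sup>+s. f s * indicator {0..<real N} s \<partial>\<nu>) \<le> (\<Sum>n<N. f (real n))"
proof -
  have "indicator {0..<real N} s = (\<Sum>n<N. indicator {real n..<real n + 1} s :: ennreal)" for s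
  proof (induction N)
    case (Suc N)
    have "indicator {0..<real (Suc N)} s
        = (indicator {0..<real N} s + indicator {real N..<real N + 1} s :: ennreal)"
      by (auto split: split_indicator)
    with Suc show ?case by simp
  qed simp
  then have "(\<integral>\<^sup>+s. f s * indicator {0..<real N} s \<partial>\<nu>)
      = (\<Sum>n<N. \<integral>\<^sup>+s. f s * indicator {real n..<real n + 1} s \<partial>\<nu>)"
    by (subst nn_integral_sum[symmetric]) (auto simp: sum_distrib_left)
  also have "\<dots> \<le> (\<Sum>n<N. f (real n))"
  proof (rule sum_mono)
    fix n
    have "(\<integral>\<^sup>+s. f s * indicator {real n..<real n + 1} s \<partial>\<nu>)
        \<le> (\<integral>\<^sup>+s. f (real n) * indicator {real n..<real n + 1} s \<partial>\<nu>)"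
      by (intro nn_integral_mono) (auto split: split_indicator intro: f)
    also have "\<dots> = f (real n) * emeasure \<nu> {real n..<real n + 1}"
      by (rule nn_integral_cmult_indicator) simp
    also have "\<dots> \<le> f (real n) * 1"
      by (intro mult_left_mono unit_mass) simp
    finally show "(\<integral>\<^sup>+s. f s * indicator {real n..<real n + 1} s \<partial>\<nu>) \<le> f (real n)"
      by simp
  qed
  finally show ?thesis .
qed

lemma nn_integral_antimono_le_suminf:
  fixes f :: "real \<Rightarrow> ennreal"
  assumes [measurable]: "f \<in> borel_measurable borel"
    and f: "\<And>x y. 0 \<le> x \<Longrightarrow> x \<le> y \<Longrightarrow> f y \<le> f x"
  shows "(\<integral>\<^sup>+s. f s * indicator {0..} s \<partial>\<nu>) \<le> (\<Sum>n. f (real n))"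
proof -
  have "(\<integral>\<^sup>+s. f s * indicator {0..} s \<partial>\<nu>)
      = (\<integral>\<^sup>+s. (SUP N. f s * indicator {0..<real N} s) \<partial>\<nu>)"
  proof (intro nn_integral_cong antisym)
    fix s
    obtain N :: nat where "s < real N" using reals_Archimedean2 by blast
    then show "f s * indicator {0..} s \<le> (SUP N. f s * indicator {0..<real N} s)"
      by (intro SUP_upper2[of N]) (auto split: split_indicator)
  qed (auto intro!: SUP_least mult_left_mono split: split_indicator)
  also have "\<dots> = (SUP N. \<integral>\<^sup>+s. f s * indicator {0..<real N} s \<partial>\<nu>)"
    by (rule nn_integral_monotone_convergence_SUP)
       (auto simp: incseq_def le_fun_def intro!: mult_left_mono split: split_indicator)
  also have "\<dots> \<le> (\<Sum>n. f (real n))"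
    by (intro SUP_least order_trans[OF nn_integral_antimono_le_sum] sum_le_suminf f) auto
  finally show ?thesis .
qed

lemma emeasure_Icc_le:
  assumes "0 \<le> t"
  shows "emeasure \<nu> {0..t} \<le> ennreal (t + 1)"
proof -
  define N where "N = Suc (nat \<lfloor>t\<rfloor>)"
  have "emeasure \<nu> {0..t} \<le> emeasure \<nu> {0..<real N}"
    by (intro emeasure_mono) (use assms in \<open>auto simp: N_def, linarith\<close>)
  also have "\<dots> = (\<integral>\<^sup>+s. 1 * indicator {0..<real N} s \<partial>\<nu>)" by simp
  also have "\<dots> \<le> (\<Sum>n<N. 1)"
    by (rule nn_integral_antimono_le_sum) auto
  also have "\<dots> = ennreal (real N)" by (simp add: ennreal_of_nat_eq_real_of_nat)
  also have "\<dots> \<le> ennreal (t + 1)"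
    by (intro ennreal_leI) (use assms in \<open>simp add: N_def\<close>)
  finally show ?thesis .
qed

lemma emeasure_Icc_finite: "emeasure \<nu> {0..t} < \<infinity>"
proof (cases "0 \<le> t")
  case True
  show ?thesis using le_less_trans[OF emeasure_Icc_le[OF True]] by simp
qed simp

lemma measure_Icc_le: "0 \<le> t \<Longrightarrow> measure \<nu> {0..t} \<le> t + 1"
  using emeasure_Icc_le[of t] by (simp add: measure_def enn2real_leI)

lemma nn_integral_exp_le:
  assumes "t \<ge> 1"
  shows "(\<integral>\<^sup>+s. ennreal (exp (- (s / t))) * indicator {0..} s \<partial>\<nu>) \<le> ennreal (2 * t)"
proof -
  have "(\<integral>\<^sup>+s. ennreal (exp (- (s / t))) * indicator {0..} s \<partial>\<nu>) \<le> (\<Sum>n. ennreal (exp (- (real n / t))))"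
    by (rule nn_integral_antimono_le_suminf) (use assms in \<open>auto intro!: ennreal_leI divide_right_mono\<close>)
  also have "\<dots> = (\<Sum>n. ennreal (exp (- (1 / t)) ^ n))"
    by (simp flip: exp_of_nat_mult)
  also have "\<dots> = ennreal (\<Sum>n. exp (- (1 / t)) ^ n)"
    by (rule suminf_ennreal_eq) (use assms in \<open>auto intro!: summable_sums summable_geometric\<close>)
  also have "(\<Sum>n. exp (- (1 / t)) ^ n) = 1 / (1 - exp (- (1 / t)))"
    using assms by (intro suminf_geometric) simp
  also have "\<dots> \<le> 2 * t"
  proof -
    have "exp (1 / t) \<ge> 1 + 1 / t" by (rule exp_ge_add_one_self)
    then have "exp (- (1 / t)) \<le> 1 / (1 + 1 / t)"
      using assms by (simp add: exp_minus inverse_eq_divide divide_simps mult.commute) 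
    also have "\<dots> = 1 - 1 / (t + 1)" using assms by (simp add: field_simps)
    finally have "1 / (t + 1) \<le> 1 - exp (- (1 / t))" by simp
    then have "1 / (1 - exp (- (1 / t))) \<le> 1 / (1 / (t + 1))"
      using assms by (intro divide_left_mono) (auto intro!: mult_pos_pos)
    with assms show ?thesis by simp
  qed
  finally show ?thesis by (simp add: ennreal_leI)
qed

lemma integrable_exp:
  assumes "t \<ge> 1"
  shows "integrable \<nu> (\<lambda>s. indicator {0..} s * exp (- (s / t)))"
proof (rule integrableI_nonneg)
  have "(\<integral>\<^sup>+s. ennreal (indicator {0..} s * exp (- (s / t))) \<partial>\<nu>)
      = (\<integral>\<^sup>+s. ennreal (exp (- (s / t))) * indicator {0..} s \<partial>\<nu>)"
    by (intro nn_integral_cong) (auto split: split_indicator)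
  also have "\<dots> < \<infinity>" using le_less_trans[OF nn_integral_exp_le[OF assms]] by simp
  finally show "(\<integral>\<^sup>+s. ennreal (indicator {0..} s * exp (- (s / t))) \<partial>\<nu>) < \<infinity>" .
qed (auto split: split_indicator)

lemma integral_exp_le:
  assumes "t \<ge> 1"
  shows "(\<integral>s. indicator {0..} s * exp (- (s / t)) \<partial>\<nu>) \<le> 2 * t"
proof (rule integral_real_bounded)
  show "(\<integral>\<^sup>+s. ennreal (indicator {0..} s * exp (- (s / t))) \<partial>\<nu>) \<le> ennreal (2 * t)"
    using nn_integral_exp_le[OF assms]
    by (rule order_trans[rotated]) (auto intro!: nn_integral_mono split: split_indicator)
qed (use assms in auto)

text \<open>Cutting off at time \<open>t\<close> and damping at scale \<open>t\<close> differ by a bounded amount as soon as the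
  integrand is of order \<open>1 / s\<close>.\<close>

lemma cutoff_vs_damping:
  fixes k :: "real \<Rightarrow> real"
  assumes [measurable]: "k \<in> borel_measurable borel"
    and k: "\<And>s. 0 \<le> s \<Longrightarrow> \<bar>k s\<bar> \<le> C / max 1 s" and t: "t \<ge> 1"
  shows "\<bar>(\<integral>s. indicator {0..t} s * k s \<partial>\<nu>) - (\<integral>s. indicator {0..} s * (exp (- (s / t)) * k s) \<partial>\<nu>)\<bar> \<le> 4 * C"
proof -
  have C: "C \<ge> 0" using k[of 0] by simp
  have k': "\<bar>k s\<bar> \<le> C" if "0 \<le> s" for s
  proof -
    have "C / max 1 s \<le> C / 1" using C by (intro divide_left_mono) auto
    with k[OF that] show ?thesis by simp
  qed
  have int1: "integrable \<nu> (\<lambda>s. indicator {0..t} s :: real)"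
    using emeasure_Icc_finite by (simp add: integrable_real_indicator)
  have int_k: "integrable \<nu> (\<lambda>s. indicator {0..t} s * k s)"
    by (rule Bochner_Integration.integrable_bound[OF integrable_mult_right[OF int1, of C]])
       (use k' C in \<open>auto split: split_indicator\<close>)
  have int_e: "integrable \<nu> (\<lambda>s. indicator {0..} s * (exp (- (s / t)) * k s))"
    by (rule Bochner_Integration.integrable_bound[OF integrable_mult_right[OF integrable_exp[OF t], of C]])
       (use k' C in \<open>auto simp: abs_mult mult_ac intro!: mult_right_mono split: split_indicator\<close>)
  have "\<bar>(\<integral>s. indicator {0..t} s * k s \<partial>\<nu>) - (\<integral>s. indicator {0..} s * (exp (- (s / t)) * k s) \<partial>\<nu>)\<bar>
      = \<bar>\<integral>s. indicator {0..t} s * k s - indicator {0..} s * (exp (- (s / t)) * k s) \<partial>\<nu>\<bar>"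
    using int_k int_e by simp
  also have "\<dots> \<le> (\<integral>s. \<bar>indicator {0..t} s * k s - indicator {0..} s * (exp (- (s / t)) * k s)\<bar> \<partial>\<nu>)"
    by (rule integral_abs_bound)
  also have "\<dots> \<le> (\<integral>s. C / t * indicator {0..t} s + C / t * (indicator {0..} s * exp (- (s / t))) \<partial>\<nu>)"
  proof (rule integral_mono)
    fix s
    consider "s < 0" | "0 \<le> s" "s \<le> t" | "t < s" by linarith
    then show "\<bar>indicator {0..t} s * k s - indicator {0..} s * (exp (- (s / t)) * k s)\<bar>
        \<le> C / t * indicator {0..t} s + C / t * (indicator {0..} s * exp (- (s / t)))"
    proof cases
      case 2
      have "1 - exp (- (s / t)) \<le> s / t" using exp_ge_add_one_self[of "- (s / t)"] by simp
      moreover have "exp (- (s / t)) \<le> 1" using 2 t by simp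
      ultimately have "\<bar>1 - exp (- (s / t))\<bar> * \<bar>k s\<bar> \<le> s / t * (C / max 1 s)"
        using k[OF 2(1)] 2 t by (intro mult_mono) auto
      also have "\<dots> = C / t * (s / max 1 s)" by simp
      also have "\<dots> \<le> C / t * 1"
        using C t 2 by (intro mult_left_mono) (auto simp: divide_simps)
      finally have "\<bar>k s - exp (- (s / t)) * k s\<bar> \<le> C / t"
        by (simp add: algebra_simps flip: abs_mult)
      moreover have "0 \<le> C / t * exp (- (s / t))" using C t by simp
      ultimately show ?thesis using 2 by simp
    next
      case 3
      have "exp (- (s / t)) * \<bar>k s\<bar> \<le> exp (- (s / t)) * (C / max 1 s)"
        using k[of s] 3 t by (intro mult_left_mono) auto
      also have "\<dots> \<le> exp (- (s / t)) * (C / t)"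
        using 3 t C by (intro mult_left_mono divide_left_mono) auto
      finally show ?thesis using 3 t by (simp add: abs_mult mult_ac)
    qed simp
  qed (use int_k int_e int1 integrable_exp[OF t] in auto)
  also have "\<dots> = C / t * measure \<nu> {0..t} + C / t * (\<integral>s. indicator {0..} s * exp (- (s / t)) \<partial>\<nu>)"
    using int1 integrable_exp[OF t] by simp
  also have "\<dots> \<le> C / t * (t + 1) + C / t * (2 * t)"
    using t C by (intro add_mono mult_left_mono measure_Icc_le integral_exp_le) auto
  also have "\<dots> \<le> 4 * C"
  proof -
    have "C * 1 \<le> C * t" using t C by (intro mult_left_mono) auto
    then show ?thesis using t by (simp add: field_simps)
  qed
  finally show ?thesis .
qed

text \<open>Integrals against a time measure are bounded by sums over the natural numbers; this one is the source of all
  logarithms in the bounds of the errors.\<close>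

lemma integral_inverse_le:
  assumes "t \<ge> 1"
  shows "(\<integral>s. indicator {0..t} s * (1 / max 1 s) \<partial>\<nu>) \<le> 2 + ln t"
proof (rule integral_real_bounded)
  define N where "N = nat \<lfloor>t\<rfloor>"
  have N: "N \<ge> 1" "real N \<le> t" "t < real (Suc N)" using assms real_of_int_floor_add_one_gt[of t] by (auto simp: N_def le_nat_iff add.commute)
  have "(\<integral>\<^sup>+s. ennreal (indicator {0..t} s * (1 / max 1 s)) \<partial>\<nu>)
      \<le> (\<integral>\<^sup>+s. ennreal (1 / max 1 s) * indicator {0..<real (Suc N)} s \<partial>\<nu>)"
    by (intro nn_integral_mono) (use N in \<open>auto split: split_indicator\<close>)
  also have "\<dots> \<le> (\<Sum>n<Suc N. ennreal (1 / max 1 (real n)))"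
    by (rule nn_integral_antimono_le_sum) (auto intro!: ennreal_leI divide_left_mono)
  also have "\<dots> = ennreal (\<Sum>n<Suc N. 1 / max 1 (real n))"
    by (rule sum_ennreal) auto
  also have "(\<Sum>n<Suc N. 1 / max 1 (real n)) = 1 + harm N"
    by (simp add: sum.lessThan_Suc_shift harm_def sum.atLeast1_atMost_eq divide_inverse del: sum.lessThan_Suc)
  also have "harm N \<le> 1 + ln (real N)"
    using N(1) by (rule harm_le_one_plus_ln)
  also have "ln (real N) \<le> ln t" using N by simp
  finally show "(\<integral>\<^sup>+s. ennreal (indicator {0..t} s * (1 / max 1 s)) \<partial>\<nu>) \<le> ennreal (2 + ln t)"
    by (simp add: ennreal_leI)
qed (use assms in auto)

lemma integral_inverse_sqrt_le:
  assumes "u \<ge> 0"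
  shows "(\<integral>s. indicator {0..u} s * (1 / sqrt (max 1 s)) \<partial>\<nu>) \<le> 4 * sqrt (max 1 u)"
proof (rule integral_real_bounded)
  define N where "N = nat \<lfloor>u\<rfloor>"
  have N: "real N \<le> u" "u < real (Suc N)"
    using assms real_of_int_floor_add_one_gt[of u] by (auto simp: N_def add.commute)
  have sum: "(\<Sum>n<Suc N. 1 / sqrt (max 1 (real n))) \<le> 2 + 2 * sqrt (real N)" for N
  proof (induction N)
    case (Suc N)
    have "1 / sqrt (max 1 (real (Suc N))) \<le> 2 * (sqrt (real (Suc N)) - sqrt (real N))"
    proof -
      have "(sqrt (real (Suc N)) - sqrt (real N)) * (sqrt (real (Suc N)) + sqrt (real N)) = 1"
        by (simp add: algebra_simps flip: real_sqrt_mult)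
      moreover have "sqrt (real N) \<le> sqrt (real (Suc N))" by simp
      ultimately have "1 \<le> (sqrt (real (Suc N)) - sqrt (real N)) * (2 * sqrt (real (Suc N)))"
        by (smt (verit) mult_left_mono)
      then show ?thesis by (simp add: max_def field_simps)
    qed
    with Suc show ?case by simp
  qed simp
  have "(\<integral>\<^sup>+s. ennreal (indicator {0..u} s * (1 / sqrt (max 1 s))) \<partial>\<nu>)
      \<le> (\<integral>\<^sup>+s. ennreal (1 / sqrt (max 1 s)) * indicator {0..<real (Suc N)} s \<partial>\<nu>)"
    by (intro nn_integral_mono) (use N in \<open>auto split: split_indicator\<close>)
  also have "\<dots> \<le> (\<Sum>n<Suc N. ennreal (1 / sqrt (max 1 (real n))))"
    by (rule nn_integral_antimono_le_sum) (auto intro!: ennreal_leI divide_left_mono)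
  also have "\<dots> = ennreal (\<Sum>n<Suc N. 1 / sqrt (max 1 (real n)))"
    by (rule sum_ennreal) auto
  also have "\<dots> \<le> ennreal (2 + 2 * sqrt (real N))"
    by (intro ennreal_leI sum)
  also have "\<dots> \<le> ennreal (4 * sqrt (max 1 u))"
  proof (intro ennreal_leI)
    have "1 \<le> sqrt (max 1 u)" "sqrt (real N) \<le> sqrt (max 1 u)" using N by auto
    then show "2 + 2 * sqrt (real N) \<le> 4 * sqrt (max 1 u)" by linarith
  qed
  finally show "(\<integral>\<^sup>+s. ennreal (indicator {0..u} s * (1 / sqrt (max 1 s))) \<partial>\<nu>) \<le> ennreal (4 * sqrt (max 1 u))" .
qed auto

end

lemma integral_indicator_inverse:
  fixes S T :: real
  assumes "0 < S" "S \<le> T"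
  shows "(\<integral>s. indicator {S..T} s * (1 / s) \<partial>lborel) = ln T - ln S"
    and "integrable lborel (\<lambda>s. indicator {S..T} s * (1 / s))"
proof -
  have "(\<integral>s. indicator {S..T} s *\<^sub>R (1 / s) \<partial>lborel) = ln T - ln S"
  proof (rule integral_FTC_Icc)
    show "(ln has_vector_derivative 1 / x) (at x within {S..T})" if "S \<le> x" for x
      using that assms
      by (auto intro!: derivative_eq_intros simp: has_real_derivative_iff_has_vector_derivative[symmetric])
  qed (use assms in \<open>auto intro!: continuous_intros\<close>)
  then show "(\<integral>s. indicator {S..T} s * (1 / s) \<partial>lborel) = ln T - ln S" by simp
  have "integrable lborel (\<lambda>s. indicator {S..T} s *\<^sub>R (1 / s))"
    by (rule borel_integrable_compact) (use assms in \<open>auto intro!: continuous_intros\<close>)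
  then show "integrable lborel (\<lambda>s. indicator {S..T} s * (1 / s))" by simp
qed

text \<open>The function is compared with \<open>A / max 1 s\<close>, whose integral up to \<open>T\<close> is \<open>A * (1 + ln T)\<close>: the difference is bounded
  before a fixed time and a small multiple of \<open>1 / s\<close> after it.\<close>

lemma log_Cesaro:
  fixes k :: "real \<Rightarrow> real"
  assumes [measurable]: "k \<in> borel_measurable borel"
    and bound: "\<And>s. 0 \<le> s \<Longrightarrow> \<bar>k s\<bar> \<le> K"
    and lim: "((\<lambda>s. s * k s) \<longlongrightarrow> A) at_top"
  shows "((\<lambda>T. (\<integral>s. indicator {0..T} s * k s \<partial>lborel) / ln T) \<longlongrightarrow> A) at_top"
proof (rule tendstoI)
  fix e :: real assume "e > 0"
  let ?I = "\<lambda>T. (\<integral>s. indicator {0..T} s * k s \<partial>lborel)"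
  have "K \<ge> 0" using bound[of 0] by simp
  have "\<forall>\<^sub>F s in at_top. dist (s * k s) A < e / 2 \<and> 1 \<le> s"
    by (intro eventually_conj tendstoD[OF lim] eventually_ge_at_top) (use \<open>e > 0\<close> in simp)
  then obtain S where S: "\<And>s. S \<le> s \<Longrightarrow> \<bar>s * k s - A\<bar> < e / 2" "1 \<le> S"
    unfolding eventually_at_top_linorder dist_real_def by blast
  define D where "D = (K + \<bar>A\<bar>) * S + \<bar>A\<bar> + e / 2"
  let ?J = "\<lambda>T s. indicator {0..T} s * (1 / max 1 s) :: real"
  have int: "integrable lborel (\<lambda>s. indicator {0..T} s * f s)"
    if "f \<in> borel_measurable borel" "\<And>s. 0 \<le> s \<Longrightarrow> \<bar>f s\<bar> \<le> c" for f :: "real \<Rightarrow> real" and c T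
  proof (rule Bochner_Integration.integrable_bound)
    show "integrable lborel (\<lambda>s. c * indicator {0..T} s)"
      by (intro integrable_mult_right integrable_real_indicator) (auto simp: emeasure_lborel_Icc_eq)
    have "0 \<le> c" using that(2)[of 0] by simp
    then show "AE s in lborel. norm (indicator {0..T} s * f s) \<le> norm (c * indicator {0..T} s)"
      using that(2) by (auto split: split_indicator)
  qed (use that in simp)
  have int_J: "integrable lborel (?J T)" for T by (rule int[of _ 1]) auto
  have int_k: "integrable lborel (\<lambda>s. indicator {0..T} s * k s)" for T by (rule int[OF _ bound]) simp
  have J: "(\<integral>s. ?J T s \<partial>lborel) = 1 + ln T" if "1 \<le> T" for T
  proof -
    note inv = integral_indicator_inverse[of 1 T]
    have "(\<integral>s. ?J T s \<partial>lborel) = (\<integral>s. indicator {0..1} s + indicator {1..T} s * (1 / s) \<partial>lborel)"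
    proof (rule integral_cong_AE)
      have "AE s in lborel. s \<noteq> (1 :: real)" by (rule AE_lborel_singleton)
      then show "AE s in lborel. ?J T s = indicator {0..1} s + indicator {1..T} s * (1 / s)"
        by eventually_elim (use that in \<open>auto split: split_indicator\<close>)
    qed auto
    then show ?thesis using inv that by (simp add: integrable_real_indicator)
  qed
  have main: "\<bar>?I T - A * ln T\<bar> \<le> D + e / 2 * ln T" if T: "S \<le> T" for T
  proof -
    have "?I T - A * (1 + ln T) = (\<integral>s. indicator {0..T} s * k s - A * ?J T s \<partial>lborel)"
    proof -
      have "(\<integral>s. A * ?J T s \<partial>lborel) = A * (1 + ln T)"
        using S(2) T by (subst integral_mult_right_zero, subst J) auto
      then show ?thesis
        by (simp only: Bochner_Integration.integral_diff[OF int_k integrable_mult_right[OF int_J]])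
    qed
    moreover have "\<bar>\<integral>s. indicator {0..T} s * k s - A * ?J T s \<partial>lborel\<bar>
        \<le> (\<integral>s. \<bar>indicator {0..T} s * k s - A * ?J T s\<bar> \<partial>lborel)"
      by (rule integral_abs_bound)
    moreover have "(\<integral>s. \<bar>indicator {0..T} s * k s - A * ?J T s\<bar> \<partial>lborel)
        \<le> (\<integral>s. indicator {0..S} s * (K + \<bar>A\<bar>) + e / 2 * ?J T s \<partial>lborel)"
    proof (rule integral_mono)
      fix s
      have "\<bar>k s - A * (1 / max 1 s)\<bar> \<le> K + \<bar>A\<bar>" if "0 \<le> s"
      proof -
        have "\<bar>A\<bar> / max 1 s \<le> \<bar>A\<bar> / 1" by (intro divide_left_mono) auto
        then have "\<bar>A * (1 / max 1 s)\<bar> \<le> \<bar>A\<bar>" by (simp add: abs_mult)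
        then show ?thesis using bound[OF that] by linarith
      qed
      moreover have "\<bar>k s - A * (1 / max 1 s)\<bar> \<le> e / 2 * (1 / max 1 s)" if "S < s"
      proof -
        have s: "0 < s" "max 1 s = s" using that S(2) by auto
        have "k s - A / s = (s * k s - A) / s" using s by (simp add: diff_divide_distrib)
        moreover have "\<bar>s * k s - A\<bar> / s \<le> e / 2 / s"
          using S(1)[of s] that s by (intro divide_right_mono) auto
        ultimately show ?thesis using s by (simp add: abs_divide)
      qed
      moreover have "0 \<le> e / 2 * (1 / max 1 s)" using \<open>e > 0\<close> by simp
      ultimately show "\<bar>indicator {0..T} s * k s - A * ?J T s\<bar> \<le> indicator {0..S} s * (K + \<bar>A\<bar>) + e / 2 * ?J T s"
        using \<open>K \<ge> 0\<close> by (auto split: split_indicator)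
    qed (use \<open>K \<ge> 0\<close> in \<open>intro integrable_abs Bochner_Integration.integrable_diff Bochner_Integration.integrable_add
        integrable_mult_right int_J int_k int[of _ "K + \<bar>A\<bar>"]; simp\<close>)+
    moreover have "(\<integral>s. indicator {0..S} s * (K + \<bar>A\<bar>) + e / 2 * ?J T s \<partial>lborel) = S * (K + \<bar>A\<bar>) + e / 2 * (1 + ln T)"
    proof -
      have "integrable lborel (\<lambda>s. indicator {0..S} s * (K + \<bar>A\<bar>))"
        by (rule int[of _ "K + \<bar>A\<bar>"]) (use \<open>K \<ge> 0\<close> in simp_all)
      then have "(\<integral>s. indicator {0..S} s * (K + \<bar>A\<bar>) + e / 2 * ?J T s \<partial>lborel)
          = (\<integral>s. indicator {0..S} s * (K + \<bar>A\<bar>) \<partial>lborel) + (\<integral>s. e / 2 * ?J T s \<partial>lborel)"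
        by (rule Bochner_Integration.integral_add) (rule integrable_mult_right[OF int_J])
      also have "(\<integral>s. e / 2 * ?J T s \<partial>lborel) = e / 2 * (1 + ln T)"
        using S(2) T by (subst integral_mult_right_zero, subst J) auto
      finally show ?thesis using S(2) by simp
    qed
    ultimately have le: "\<bar>?I T - A * (1 + ln T)\<bar> \<le> S * (K + \<bar>A\<bar>) + e / 2 * (1 + ln T)"
      by linarith
    have "x - A * ln T = (x - A * (1 + ln T)) + A" for x by (simp add: distrib_left)
    then have tri: "\<bar>x - A * ln T\<bar> \<le> \<bar>x - A * (1 + ln T)\<bar> + \<bar>A\<bar>" for x
      using abs_triangle_ineq[of "x - A * (1 + ln T)" A] by (simp only:)
    have "S * (K + \<bar>A\<bar>) + e / 2 * (1 + ln T) + \<bar>A\<bar> = D + e / 2 * ln T"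
      by (simp add: D_def distrib_left mult.commute)
    with order_trans[OF tri add_right_mono[OF le]] show ?thesis by (simp only:)
  qed
  have "filterlim ln at_top (at_top :: real filter)" by (rule ln_at_top)
  then have "\<forall>\<^sub>F T in at_top. ln T > max 1 (2 * D / e)"
    unfolding filterlim_at_top_dense by (rule spec)
  then show "\<forall>\<^sub>F T in at_top. dist (?I T / ln T) A < e"
    using eventually_ge_at_top[of S]
  proof eventually_elim
    case (elim T)
    have "D < e / 2 * ln T" using elim(1) \<open>e > 0\<close> by (simp add: field_simps)
    then have "\<bar>?I T - A * ln T\<bar> < e * ln T"
      using main[OF elim(2)] by (simp add: field_simps)
    moreover have "?I T / ln T - A = (?I T - A * ln T) / ln T"
      using elim(1) by (simp add: diff_divide_distrib)
    ultimately show ?case using elim(1) by (simp add: dist_real_def abs_divide divide_less_eq)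
  qed
qed

section \<open>The return kernel of a planar walk\<close>

lemma integrable_coordinate_product:
  assumes "finite_variance p"
  shows "integrable (measure_pmf p) (\<lambda>x. real_of_int (x $ i) * real_of_int (x $ j))"
proof (rule Bochner_Integration.integrable_bound)
  show "integrable (measure_pmf p) (\<lambda>x. (norm (real_site x))\<^sup>2)"
    using assms by (simp add: finite_variance_def)
  have "norm (real_of_int (x $ i) * real_of_int (x $ j)) \<le> norm ((norm (real_site x))\<^sup>2)" for x
  proof -
    have "\<bar>real_of_int (x $ i)\<bar> \<le> norm (real_site x)" "\<bar>real_of_int (x $ j)\<bar> \<le> norm (real_site x)"
      using component_le_norm_cart[of "real_site x" i] component_le_norm_cart[of "real_site x" j]
      by (simp_all add: real_site_def)
    then show ?thesis
      by (simp add: abs_mult power2_eq_square mult_mono)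
  qed
  then show "AE x in measure_pmf p. norm (real_of_int (x $ i) * real_of_int (x $ j)) \<le> norm ((norm (real_site x))\<^sup>2)"
    by simp
qed simp

text \<open>The quadratic form of the covariance matrix.\<close>

definition variance_form :: "(int ^ 2) pmf \<Rightarrow> real \<times> real \<Rightarrow> real" where
  "variance_form p \<theta> = (\<integral>x. (pairing \<theta> x)\<^sup>2 \<partial>measure_pmf p)"

lemma pairing_sq: "(pairing \<theta> x)\<^sup>2 = (fst \<theta>)\<^sup>2 * (real_of_int (x $ 1) * real_of_int (x $ 1))
    + (2 * fst \<theta> * snd \<theta>) * (real_of_int (x $ 1) * real_of_int (x $ 2))
    + (snd \<theta>)\<^sup>2 * (real_of_int (x $ 2) * real_of_int (x $ 2))"
  by (simp add: pairing_def power2_eq_square algebra_simps)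

lemma integrable_pairing_sq:
  assumes "finite_variance p"
  shows "integrable (measure_pmf p) (\<lambda>x. (pairing \<theta> x)\<^sup>2)"
  unfolding pairing_sq
  by (intro Bochner_Integration.integrable_add integrable_mult_right integrable_coordinate_product[OF assms])

lemma variance_form_eq:
  assumes "finite_variance p"
  defines "Q \<equiv> covariance_matrix p"
  shows "variance_form p \<theta> = Q $ 1 $ 1 * (fst \<theta>)\<^sup>2 + 2 * Q $ 1 $ 2 * fst \<theta> * snd \<theta> + Q $ 2 $ 2 * (snd \<theta>)\<^sup>2"
  unfolding variance_form_def pairing_sq Q_def covariance_matrix_def
  using integrable_coordinate_product[OF assms(1)]
  by simp

lemma covariance_positive:
  assumes irr: "irreducible_pmf p" and fv: "finite_variance p"
  defines "Q \<equiv> covariance_matrix p"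
  shows "det Q > 0" and "Q $ 1 $ 1 > 0"
    and "det Q = Q $ 1 $ 1 * Q $ 2 $ 2 - (Q $ 1 $ 2)\<^sup>2"
proof -
  have pos: "variance_form p \<theta> > 0" if "\<theta> \<noteq> 0" for \<theta>
  proof (rule ccontr)
    assume "\<not> variance_form p \<theta> > 0"
    moreover have "variance_form p \<theta> \<ge> 0" unfolding variance_form_def by simp
    ultimately have "variance_form p \<theta> = 0" by simp
    then have "AE x in measure_pmf p. (pairing \<theta> x)\<^sup>2 = 0"
      unfolding variance_form_def
      by (subst (asm) integral_nonneg_eq_0_iff_AE) (auto intro: integrable_pairing_sq[OF fv])
    then have supp: "\<And>x. x \<in> set_pmf p \<Longrightarrow> pairing \<theta> x = 0"
      by (simp add: AE_measure_pmf_iff)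
    have "pairing \<theta> x = 0" for x
      by (rule irreducible_pmf_induct[OF irr]) (use supp in \<open>auto simp: pairing_add pairing_0\<close>)
    from this[of "axis 1 1"] this[of "axis 2 1"] that show False
      by (simp add: pairing_def axis_def prod_eq_iff)
  qed
  note form = variance_form_eq[OF fv, folded Q_def]
  have sym: "Q $ 2 $ 1 = Q $ 1 $ 2"
    by (simp add: Q_def covariance_matrix_def mult.commute)
  then show det: "det Q = Q $ 1 $ 1 * Q $ 2 $ 2 - (Q $ 1 $ 2)\<^sup>2"
    by (simp add: det_2 power2_eq_square)
  show Q1: "Q $ 1 $ 1 > 0"
    using pos[of "(1, 0)"] by (simp add: form prod_eq_iff)
  have "0 < variance_form p (- Q $ 1 $ 2, Q $ 1 $ 1)"
    using Q1 by (intro pos) (simp add: prod_eq_iff)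
  also have "\<dots> = Q $ 1 $ 1 * det Q"
    unfolding form det by (simp add: power2_eq_square algebra_simps)
  finally show "det Q > 0" using Q1 by (simp add: zero_less_mult_iff)
qed

text \<open>If the real part is \<open>1\<close>, every point of the support pairs with \<open>\<theta>\<close> to a multiple of \<open>2 * pi\<close>; by irreducibility so does
  every site, in particular the two unit vectors, and then the coordinates of \<open>\<theta>\<close> are multiples of \<open>2 * pi\<close>.\<close>

lemma char_fun_eq_1_imp:
  assumes irr: "irreducible_pmf p" and \<theta>: "\<theta> \<in> cbox (-pi, -pi) (pi, pi)" and one: "Re (char_fun p \<theta>) = 1"
  shows "\<theta> = 0"
proof -
  have "(\<integral>x. 1 - cos (pairing \<theta> x) \<partial>measure_pmf p) = 0"
    using one by (simp add: Re_char_fun)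
  then have "AE x in measure_pmf p. 1 - cos (pairing \<theta> x) = 0"
    by (subst (asm) integral_nonneg_eq_0_iff_AE) auto
  then have supp: "\<And>x. x \<in> set_pmf p \<Longrightarrow> cos (pairing \<theta> x) = 1"
    by (auto simp: AE_measure_pmf_iff)
  have ch: "character \<theta> x = 1" if "x \<in> set_pmf p" for x
  proof -
    have "(sin (pairing \<theta> x))\<^sup>2 = 0" using sin_cos_squared_add[of "pairing \<theta> x"] supp[OF that] by simp
    then show ?thesis using supp[OF that] by (simp add: character_def complex_eq_iff)
  qed
  have "character \<theta> x = 1" for x
    by (rule irreducible_pmf_induct[OF irr]) (use ch in \<open>auto simp: character_add\<close>)
  from this[of "axis 1 1"] this[of "axis 2 1"]
  have "cos (fst \<theta>) = 1" "cos (snd \<theta>) = 1"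
    by (simp_all add: character_def pairing_def axis_def complex_eq_iff)
  moreover have "t = 0" if "cos t = 1" "\<bar>t\<bar> \<le> pi" for t
    using one_minus_cos_ge[OF that(2)] that(1) by simp
  moreover have "\<bar>fst \<theta>\<bar> \<le> pi" "\<bar>snd \<theta>\<bar> \<le> pi"
    using \<theta> unfolding cbox_pi_eq by auto
  ultimately show "\<theta> = 0" by (simp add: prod_eq_iff)
qed

lemma norm_pair_sq: "(norm (\<theta> :: real \<times> real))\<^sup>2 = (fst \<theta>)\<^sup>2 + (snd \<theta>)\<^sup>2"
  by (simp add: norm_prod_def)

text \<open>The two pairings are linearly independent forms in \<open>\<theta>\<close>; the constant comes from solving for \<open>\<theta>\<close> by the rule of Cramer.\<close>

lemma independent_pairings_ge:
  assumes "cross x y \<noteq> 0"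
  shows "\<exists>c>0. \<forall>\<theta>. c * (norm \<theta>)\<^sup>2 \<le> (pairing \<theta> x)\<^sup>2 + (pairing \<theta> y)\<^sup>2"
proof -
  define \<Delta> where "\<Delta> = real_of_int (cross x y)"
  define N where "N = (real_of_int (x $ 1))\<^sup>2 + (real_of_int (x $ 2))\<^sup>2 + (real_of_int (y $ 1))\<^sup>2 + (real_of_int (y $ 2))\<^sup>2"
  have "\<Delta> \<noteq> 0" using assms by (simp add: \<Delta>_def)
  have "N > 0"
    using assms unfolding N_def cross_def
    by (auto simp: add_nonneg_eq_0_iff order.strict_iff_order)
  have ineq: "\<Delta>\<^sup>2 * (norm \<theta>)\<^sup>2 \<le> 2 * N * ((pairing \<theta> x)\<^sup>2 + (pairing \<theta> y)\<^sup>2)" for \<theta>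
  proof -
    let ?v = "pairing \<theta> x" and ?w = "pairing \<theta> y"
    have sq: "(a * b - c * d)\<^sup>2 \<le> 2 * (a\<^sup>2 * b\<^sup>2 + c\<^sup>2 * d\<^sup>2)" for a b c d :: real
      using zero_le_power2[of "a * b + c * d"] by (simp add: power2_eq_square algebra_simps)
    have 1: "\<Delta> * fst \<theta> = ?v * real_of_int (y $ 2) - ?w * real_of_int (x $ 2)"
      and 2: "\<Delta> * snd \<theta> = ?w * real_of_int (x $ 1) - ?v * real_of_int (y $ 1)"
      by (simp_all add: \<Delta>_def cross_def pairing_def algebra_simps)
    have "\<Delta>\<^sup>2 * (norm \<theta>)\<^sup>2 = (\<Delta> * fst \<theta>)\<^sup>2 + (\<Delta> * snd \<theta>)\<^sup>2"
      by (simp add: norm_pair_sq power_mult_distrib algebra_simps)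
    also have "\<dots> \<le> 2 * (?v\<^sup>2 * (real_of_int (y $ 2))\<^sup>2 + ?w\<^sup>2 * (real_of_int (x $ 2))\<^sup>2)
        + 2 * (?w\<^sup>2 * (real_of_int (x $ 1))\<^sup>2 + ?v\<^sup>2 * (real_of_int (y $ 1))\<^sup>2)"
      unfolding 1 2 by (intro add_mono sq)
    also have "\<dots> \<le> 2 * N * (?v\<^sup>2 + ?w\<^sup>2)"
      by (simp add: N_def algebra_simps)
    finally show ?thesis .
  qed
  show ?thesis
  proof (intro exI[of _ "\<Delta>\<^sup>2 / (2 * N)"] conjI allI)
    show "\<Delta>\<^sup>2 / (2 * N) > 0" using \<open>\<Delta> \<noteq> 0\<close> \<open>N > 0\<close> by simp
    show "\<Delta>\<^sup>2 / (2 * N) * (norm \<theta>)\<^sup>2 \<le> (pairing \<theta> x)\<^sup>2 + (pairing \<theta> y)\<^sup>2" for \<theta>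
      using ineq[of \<theta>] \<open>N > 0\<close> by (simp add: field_simps)
  qed
qed

lemma abs_pairing_le: "\<bar>pairing \<theta> x\<bar> \<le> norm \<theta> * (\<bar>real_of_int (x $ 1)\<bar> + \<bar>real_of_int (x $ 2)\<bar>)"
proof -
  have "\<bar>fst \<theta>\<bar> \<le> norm \<theta>" "\<bar>snd \<theta>\<bar> \<le> norm \<theta>"
    using norm_fst_le[of "fst \<theta>" "snd \<theta>"] norm_snd_le[of "snd \<theta>" "fst \<theta>"] by auto
  then have "\<bar>fst \<theta> * real_of_int (x $ 1)\<bar> + \<bar>snd \<theta> * real_of_int (x $ 2)\<bar>
      \<le> norm \<theta> * \<bar>real_of_int (x $ 1)\<bar> + norm \<theta> * \<bar>real_of_int (x $ 2)\<bar>"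
    unfolding abs_mult by (intro add_mono mult_right_mono) auto
  then show ?thesis
    unfolding pairing_def by (simp add: algebra_simps)
qed

text \<open>Near the origin two independent points of the support give the quadratic lower bound; away from it the left side is
  bounded and the right side has a positive minimum by compactness. In the local limit theorem this bound supplies the integrable majorant.\<close>

lemma one_minus_Re_char_fun_quadratic:
  assumes irr: "irreducible_pmf p"
  shows "\<exists>c>0. \<forall>\<theta>\<in>cbox (-pi, -pi) (pi, pi). c * (norm \<theta>)\<^sup>2 \<le> 1 - Re (char_fun p \<theta>)"
proof -
  obtain x y where xy: "x \<in> set_pmf p" "y \<in> set_pmf p" "cross x y \<noteq> 0"
    using irreducible_support_spans[OF irr] .
  have "x \<noteq> y" using xy by (auto simp: cross_def)
  obtain c1 where c1: "c1 > 0" "\<And>\<theta>. c1 * (norm \<theta>)\<^sup>2 \<le> (pairing \<theta> x)\<^sup>2 + (pairing \<theta> y)\<^sup>2"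
    using independent_pairings_ge[OF xy(3)] by blast
  define q where "q = min (pmf p x) (pmf p y)"
  have "q > 0" using xy by (simp add: q_def pmf_positive)
  define B where "B = 1 + \<bar>real_of_int (x $ 1)\<bar> + \<bar>real_of_int (x $ 2)\<bar> + \<bar>real_of_int (y $ 1)\<bar> + \<bar>real_of_int (y $ 2)\<bar>"
  define \<delta> where "\<delta> = pi / B"
  have "B > 0" unfolding B_def by (simp add: add_pos_nonneg)
  then have "\<delta> > 0" by (simp add: \<delta>_def)
  have near: "q * c1 / 10 * (norm \<theta>)\<^sup>2 \<le> 1 - Re (char_fun p \<theta>)" if "norm \<theta> \<le> \<delta>" for \<theta>
  proof -
    have small: "\<bar>pairing \<theta> z\<bar> \<le> pi" if "z \<in> {x, y}" for z
    proof -
      have "\<bar>pairing \<theta> z\<bar> \<le> norm \<theta> * (\<bar>real_of_int (z $ 1)\<bar> + \<bar>real_of_int (z $ 2)\<bar>)"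
        by (rule abs_pairing_le)
      also have "\<dots> \<le> \<delta> * B"
        using \<open>norm \<theta> \<le> \<delta>\<close> \<open>\<delta> > 0\<close> that by (intro mult_mono) (auto simp: B_def)
      finally show ?thesis using \<open>B > 0\<close> by (simp add: \<delta>_def)
    qed
    have "q * c1 / 10 * (norm \<theta>)\<^sup>2 = q / 10 * (c1 * (norm \<theta>)\<^sup>2)" by simp
    also have "\<dots> \<le> q / 10 * ((pairing \<theta> x)\<^sup>2 + (pairing \<theta> y)\<^sup>2)"
      using c1 \<open>q > 0\<close> by (intro mult_left_mono) auto
    also have "\<dots> = q * ((pairing \<theta> x)\<^sup>2 / 10) + q * ((pairing \<theta> y)\<^sup>2 / 10)"
      by (simp add: algebra_simps)
    also have "\<dots> \<le> pmf p x * (1 - cos (pairing \<theta> x)) + pmf p y * (1 - cos (pairing \<theta> y))"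
      using small by (intro add_mono mult_mono one_minus_cos_ge) (auto simp: q_def)
    also have "\<dots> = (\<Sum>z\<in>{x, y}. pmf p z * (1 - cos (pairing \<theta> z)))"
      using \<open>x \<noteq> y\<close> by simp
    also have "\<dots> \<le> 1 - Re (char_fun p \<theta>)"
      by (rule one_minus_Re_char_fun_ge) simp
    finally show ?thesis .
  qed
  define K where "K = cbox (-pi, -pi) (pi, pi) \<inter> {\<theta> :: real \<times> real. \<delta> \<le> norm \<theta>}"
  have "compact K"
    unfolding K_def by (intro compact_Int_closed compact_cbox closed_Collect_le continuous_intros)
  have "\<exists>m>0. \<forall>\<theta>\<in>K. m \<le> 1 - Re (char_fun p \<theta>)"
  proof (cases "K = {}")
    case False
    have "continuous_on K (\<lambda>\<theta>. 1 - Re (char_fun p \<theta>))"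
      by (intro continuous_intros continuous_on_subset[OF continuous_on_char_fun]) auto
    then obtain \<theta>0 where \<theta>0: "\<theta>0 \<in> K" "\<And>\<theta>. \<theta> \<in> K \<Longrightarrow> 1 - Re (char_fun p \<theta>0) \<le> 1 - Re (char_fun p \<theta>)"
      using continuous_attains_inf[OF \<open>compact K\<close> False] by blast
    have "\<theta>0 \<noteq> 0" using \<theta>0(1) \<open>\<delta> > 0\<close> by (auto simp: K_def)
    then have "Re (char_fun p \<theta>0) \<noteq> 1"
      using char_fun_eq_1_imp[OF irr, of \<theta>0] \<theta>0(1) unfolding K_def by blast
    moreover have "Re (char_fun p \<theta>0) \<le> 1"
      using complex_Re_le_cmod[of "char_fun p \<theta>0"] norm_char_fun_le[of p \<theta>0] by linarith
    ultimately show ?thesis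
      using \<theta>0(2) by (intro exI[of _ "1 - Re (char_fun p \<theta>0)"]) auto
  qed (auto intro: exI[of _ 1])
  then obtain m where m: "m > 0" "\<And>\<theta>. \<theta> \<in> K \<Longrightarrow> m \<le> 1 - Re (char_fun p \<theta>)" by blast
  define c where "c = min (q * c1 / 10) (m / (2 * pi\<^sup>2))"
  show ?thesis
  proof (intro exI[of _ c] conjI ballI)
    show "c > 0" using m \<open>q > 0\<close> c1 by (simp add: c_def)
    fix \<theta> assume \<theta>: "\<theta> \<in> cbox (-pi, -pi) (pi, pi :: real)"
    show "c * (norm \<theta>)\<^sup>2 \<le> 1 - Re (char_fun p \<theta>)"
    proof (cases "norm \<theta> \<le> \<delta>")
      case True
      have "c * (norm \<theta>)\<^sup>2 \<le> q * c1 / 10 * (norm \<theta>)\<^sup>2"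
        by (intro mult_right_mono) (auto simp: c_def)
      with near[OF True] show ?thesis by simp
    next
      case False
      have "(fst \<theta>)\<^sup>2 \<le> pi\<^sup>2" "(snd \<theta>)\<^sup>2 \<le> pi\<^sup>2"
        using \<theta> unfolding cbox_pi_eq by (auto intro!: abs_le_square_iff[THEN iffD1])
      then have "(norm \<theta>)\<^sup>2 \<le> 2 * pi\<^sup>2" by (simp add: norm_pair_sq)
      then have "c * (norm \<theta>)\<^sup>2 \<le> m / (2 * pi\<^sup>2) * (2 * pi\<^sup>2)"
        using m by (intro mult_mono) (auto simp: c_def)
      also have "\<dots> = m" by simp
      also have "m \<le> 1 - Re (char_fun p \<theta>)"
        using \<theta> False by (intro m) (simp add: K_def)
      finally show ?thesis .
    qed
  qed
qed

text \<open>Taylor expansion to second order under the integral. The linear term may be added because the mean is zero, and the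
  remainder is dominated by the square of the pairing, which is integrable by the finite variance.\<close>

lemma char_fun_diffusive_scaling:
  assumes mean: "zero_mean p" and fv: "finite_variance p"
  shows "((\<lambda>s. of_real s * (1 - char_fun p ((1 / sqrt s) *\<^sub>R \<theta>)))
            \<longlongrightarrow> complex_of_real (variance_form p \<theta> / 2)) at_top"
proof -
  define F where "F s x = complex_of_real s * (1 + \<i> * of_real (pairing \<theta> x / sqrt s) - cis (pairing \<theta> x / sqrt s))" for s x
  have int_pairing: "integrable (measure_pmf p) (\<lambda>x. pairing \<theta> x)"
    and mean_pairing: "(\<integral>x. pairing \<theta> x \<partial>measure_pmf p) = 0"
    unfolding pairing_def using zero_mean_coordinate[OF mean] by simp_all
  have F_eq: "of_real s * (1 - char_fun p ((1 / sqrt s) *\<^sub>R \<theta>)) = (\<integral>x. F s x \<partial>measure_pmf p)" for s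
  proof -
    have i1: "integrable (measure_pmf p) (\<lambda>x. \<i> * complex_of_real (pairing \<theta> x / sqrt s))"
      by (intro integrable_mult_right integrable_of_real integrable_divide int_pairing)
    have i2: "integrable (measure_pmf p) (\<lambda>x. cis (pairing \<theta> x / sqrt s))"
      by (rule measure_pmf.integrable_const_bound[of _ 1]) auto
    have "(\<integral>x. \<i> * complex_of_real (pairing \<theta> x / sqrt s) \<partial>measure_pmf p) = 0"
      by (simp add: mean_pairing)
    then have "(\<integral>x. F s x \<partial>measure_pmf p) = of_real s * (1 + 0 - (\<integral>x. cis (pairing \<theta> x / sqrt s) \<partial>measure_pmf p))"
      unfolding F_def using i1 i2 by simp
    then show ?thesis
      by (simp add: char_fun_def character_def pairing_scaleR)
  qed
  have "((\<lambda>s. \<integral>x. F s x \<partial>measure_pmf p) \<longlongrightarrow> (\<integral>x. complex_of_real ((pairing \<theta> x)\<^sup>2 / 2) \<partial>measure_pmf p)) at_top"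
  proof (rule integral_dominated_convergence_at_top)
    show "integrable (measure_pmf p) (\<lambda>x. (pairing \<theta> x)\<^sup>2 / 2)"
      by (intro integrable_divide integrable_pairing_sq[OF fv])
    show "\<forall>\<^sub>F s in at_top. AE x in measure_pmf p. norm (F s x) \<le> (pairing \<theta> x)\<^sup>2 / 2"
      using eventually_gt_at_top[of 0]
    proof eventually_elim
      case (elim s)
      have "norm (F s x) \<le> (pairing \<theta> x)\<^sup>2 / 2" for x
      proof -
        let ?y = "pairing \<theta> x / sqrt s"
        have "norm (cis ?y - (1 + \<i> * of_real ?y)) \<le> ?y\<^sup>2 / 2"
          using iexp_approx1[of ?y 1] by (simp add: cis_conv_exp numeral_2_eq_2 mult.commute)
        then have "norm (F s x) \<le> s * (?y\<^sup>2 / 2)"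
          unfolding F_def norm_mult using elim
          by (simp add: norm_minus_commute del: of_real_divide)
        also have "\<dots> = (pairing \<theta> x)\<^sup>2 / 2" using elim by (simp add: power_divide)
        finally show ?thesis .
      qed
      then show ?case by simp
    qed
    show "AE x in measure_pmf p. ((\<lambda>s. F s x) \<longlongrightarrow> complex_of_real ((pairing \<theta> x)\<^sup>2 / 2)) at_top"
    proof (rule AE_I2)
      fix x
      have "((\<lambda>s. F s x - complex_of_real ((pairing \<theta> x)\<^sup>2 / 2)) \<longlongrightarrow> 0) at_top"
      proof (rule Lim_null_comparison)
        show "\<forall>\<^sub>F s in at_top. norm (F s x - complex_of_real ((pairing \<theta> x)\<^sup>2 / 2)) \<le> \<bar>pairing \<theta> x\<bar> ^ 3 / 6 / sqrt s"
          using eventually_gt_at_top[of 0]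
        proof eventually_elim
          case (elim s)
          let ?y = "pairing \<theta> x / sqrt s"
          have "norm (cis ?y - (1 + \<i> * of_real ?y - (of_real ?y)\<^sup>2 / 2)) \<le> \<bar>?y\<bar> ^ 3 / 6"
            using iexp_approx1[of ?y 2]
            by (simp add: cis_conv_exp numeral_2_eq_2 numeral_3_eq_3 mult.commute power_mult_distrib
                fact_numeral algebra_simps)
          moreover have "F s x - complex_of_real ((pairing \<theta> x)\<^sup>2 / 2)
              = - (of_real s * (cis ?y - (1 + \<i> * of_real ?y - (of_real ?y)\<^sup>2 / 2)))"
          proof -
            have "(complex_of_real ?y)\<^sup>2 = of_real ((pairing \<theta> x)\<^sup>2 / s)"
              using elim by (simp add: power_divide flip: of_real_power)
            then show ?thesis using elim by (simp add: F_def algebra_simps)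
          qed
          ultimately have "norm (F s x - complex_of_real ((pairing \<theta> x)\<^sup>2 / 2)) \<le> s * (\<bar>?y\<bar> ^ 3 / 6)"
            using elim by (simp add: norm_mult)
          also have "\<dots> = \<bar>pairing \<theta> x\<bar> ^ 3 / 6 / sqrt s"
          proof -
            have "s = sqrt s * sqrt s" using elim by simp
            then show ?thesis using elim
              by (simp add: power_divide power3_eq_cube field_simps)
          qed
          finally show ?case .
        qed
        show "((\<lambda>s. \<bar>pairing \<theta> x\<bar> ^ 3 / 6 / sqrt s) \<longlongrightarrow> 0) at_top"
          by (intro tendsto_divide_0[OF tendsto_const] filterlim_at_top_imp_at_infinity sqrt_at_top)
      qed
      then show "((\<lambda>s. F s x) \<longlongrightarrow> complex_of_real ((pairing \<theta> x)\<^sup>2 / 2)) at_top"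
        by (simp add: LIM_zero_iff)
    qed
  qed auto
  then show ?thesis
    unfolding F_eq variance_form_def by (simp del: of_real_divide of_real_power)
qed

lemma Gaussian_integrable: 
  assumes "c > 0"
  shows "integrable lborel (\<lambda>\<theta> :: real \<times> real. exp (- (c * (norm \<theta>)\<^sup>2)))"
proof (rule integrableI_nonneg)
  have "(\<integral>\<^sup>+\<theta>. ennreal (exp (- (c * (norm (\<theta> :: real \<times> real))\<^sup>2))) \<partial>lborel)
      = (\<integral>\<^sup>+\<theta>. ennreal (exp (- (c * (1 * fst \<theta> + 0 * snd \<theta> - 0)\<^sup>2))) * ennreal (exp (- (c * (0 * fst \<theta> + 1 * snd \<theta> - 0)\<^sup>2))) \<partial>lborel)"
    by (intro nn_integral_cong) (simp add: norm_pair_sq algebra_simps exp_add[symmetric] flip: ennreal_mult)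
  also have "\<dots> = ennreal (1 / \<bar>1 * 1 - 0 * 0\<bar>) * (ennreal (sqrt (pi / c)) * ennreal (sqrt (pi / c)))"
    unfolding nn_integral_Gaussian[OF assms, of 0, symmetric]
    by (rule nn_integral_linear_pair) auto
  also have "\<dots> < \<infinity>" by (simp add: ennreal_mult_less_top)
  finally show "(\<integral>\<^sup>+\<theta>. ennreal (exp (- (c * (norm (\<theta> :: real \<times> real))\<^sup>2))) \<partial>lborel) < \<infinity>" .
qed auto

lemma integral_exp_variance_form:
  assumes irr: "irreducible_pmf p" and fv: "finite_variance p"
  shows "(\<integral>\<theta>. exp (- (variance_form p \<theta> / 2)) \<partial>lborel) = 2 * pi / sqrt (det (covariance_matrix p))"
proof -
  define Q where "Q = covariance_matrix p"
  note pos = covariance_positive[OF irr fv, folded Q_def]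
  define a where "a = Q $ 1 $ 1"
  define b where "b = Q $ 1 $ 2"
  define e where "e = det Q / a"
  have ae: "a > 0" "e > 0" using pos by (simp_all add: a_def e_def)
  have form: "variance_form p \<theta> / 2 = a / 2 * (1 * fst \<theta> + b / a * snd \<theta> - 0)\<^sup>2 + e / 2 * (0 * fst \<theta> + 1 * snd \<theta> - 0)\<^sup>2" for \<theta>
  proof -
    have Q22: "Q $ 2 $ 2 = e + b\<^sup>2 / a"
      using ae pos(3) by (simp add: e_def a_def b_def field_simps)
    show ?thesis
      using ae unfolding variance_form_eq[OF fv] Q_def[symmetric] a_def[symmetric] b_def[symmetric] Q22
      by (simp add: power2_eq_square field_simps)
  qed
  have "(\<integral>\<^sup>+\<theta>. ennreal (exp (- (variance_form p \<theta> / 2))) \<partial>lborel)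
      = (\<integral>\<^sup>+\<theta>. ennreal (exp (- (a / 2 * (1 * fst \<theta> + b / a * snd \<theta> - 0)\<^sup>2))) * ennreal (exp (- (e / 2 * (0 * fst \<theta> + 1 * snd \<theta> - 0)\<^sup>2))) \<partial>lborel)"
    unfolding form by (intro nn_integral_cong) (simp add: exp_add[symmetric] flip: ennreal_mult)
  also have "\<dots> = ennreal (1 / \<bar>1 * 1 - b / a * 0\<bar>) * (ennreal (sqrt (pi / (a / 2))) * ennreal (sqrt (pi / (e / 2))))"
    using ae unfolding nn_integral_Gaussian[of "a / 2" 0, symmetric, OF half_gt_zero[OF ae(1)]]
      nn_integral_Gaussian[of "e / 2" 0, symmetric, OF half_gt_zero[OF ae(2)]]
    by (intro nn_integral_linear_pair) auto
  also have "\<dots> = ennreal (sqrt (pi / (a / 2)) * sqrt (pi / (e / 2)))"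
    using ae by (simp add: ennreal_mult)
  also have "sqrt (pi / (a / 2)) * sqrt (pi / (e / 2)) = sqrt ((2 * pi)\<^sup>2 / det Q)"
    using ae by (simp add: e_def power2_eq_square flip: real_sqrt_mult)
  also have "\<dots> = 2 * pi / sqrt (det Q)"
    by (simp only: real_sqrt_divide real_sqrt_abs) simp
  finally have "(\<integral>\<^sup>+\<theta>. ennreal (exp (- (variance_form p \<theta> / 2))) \<partial>lborel) = ennreal (2 * pi / sqrt (det Q))" .
  moreover have "(\<lambda>\<theta>. exp (- (variance_form p \<theta> / 2))) \<in> borel_measurable lborel"
    unfolding form measurable_lborel2
    by (intro borel_measurable_continuous_onI continuous_intros)
  ultimately show ?thesis
    unfolding Q_def[symmetric] using pos by (intro integral_eq_nn_integral[THEN trans]) auto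
qed

text \<open>The probability that the walk with jumps of law \<open>p\<close> at the times of a rate \<open>1\<close> Poisson process is at the origin at
  time \<open>s\<close>, by Fourier inversion.\<close>

definition return_kernel :: "(int ^ 2) pmf \<Rightarrow> real \<Rightarrow> real" where
  "return_kernel p s = Re (\<integral>\<theta>. exp (- (of_real s * (1 - char_fun p \<theta>))) \<partial>torus)"

lemma Re_char_fun_le: "Re (char_fun p \<theta>) \<le> 1"
  using complex_Re_le_cmod[of "char_fun p \<theta>"] norm_char_fun_le[of p \<theta>] by linarith

lemma norm_exp_kernel_le: "0 \<le> s \<Longrightarrow> norm (exp (- (of_real s * (1 - char_fun p \<theta>)))) \<le> 1"
  using Re_char_fun_le[of p \<theta>] by (simp add: mult_nonneg_nonneg)

lemma borel_measurable_return_kernel [measurable]: "return_kernel p \<in> borel_measurable borel"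
  unfolding return_kernel_def
  by (intro borel_measurable_Re torus.borel_measurable_lebesgue_integral[THEN measurable_compose[OF _ borel_measurable_Re]]
      measurable_compose[OF torus.borel_measurable_lebesgue_integral]) (simp_all add: case_prod_unfold)

lemma lborel_scale_plane:
  fixes f :: "real \<times> real \<Rightarrow> complex"
  assumes [measurable]: "f \<in> borel_measurable borel" and "s > 0"
  shows "of_real s * (\<integral>\<theta>. f \<theta> \<partial>lborel) = (\<integral>\<theta>. f ((1 / sqrt s) *\<^sub>R \<theta>) \<partial>lborel)"
proof -
  let ?c = "1 / sqrt s"
  have c: "?c \<noteq> 0" using assms by simp
  have "(\<integral>\<theta>. f \<theta> \<partial>lborel) = (\<integral>\<theta>. f \<theta> \<partial>density (distr lborel borel (\<lambda>x. 0 + ?c *\<^sub>R x)) (\<lambda>_. ennreal (\<bar>?c\<bar> ^ DIM(real \<times> real))))"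
    by (rule arg_cong[where f = "\<lambda>M. integral\<^sup>L M f"]) (rule lborel_affine[OF c])
  also have "\<bar>?c\<bar> ^ DIM(real \<times> real) = ?c ^ 2"
    using assms by (simp add: power2_eq_square)
  also have "?c ^ 2 = 1 / s" using assms by (simp add: power_divide)
  also have "(\<integral>\<theta>. f \<theta> \<partial>density (distr lborel borel (\<lambda>x. 0 + ?c *\<^sub>R x)) (\<lambda>_. ennreal (1 / s)))
      = (1 / s) *\<^sub>R (\<integral>\<theta>. f (?c *\<^sub>R \<theta>) \<partial>lborel)"
    using assms by (subst integral_density) (simp_all add: integral_distr)
  finally show ?thesis using assms by (simp add: scaleR_conv_of_real)
qed

text \<open>The local central limit theorem at the origin, for the walk whose jumps occur at the times of a
  rate \<open>1\<close> Poisson process; its characteristic function is close to \<open>1\<close> in modulus only near the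
  origin, even when the discrete walk is periodic.\<close>

proposition return_kernel_asymptotics:
  assumes irr: "irreducible_pmf p" and mean: "zero_mean p" and fv: "finite_variance p"
  shows "((\<lambda>s. s * return_kernel p s) \<longlongrightarrow> 1 / (2 * pi * sqrt (det (covariance_matrix p)))) at_top"
proof -
  define Box where "Box = cbox (-pi, -pi) (pi, pi :: real)"
  define f where "f s \<theta> = indicator Box \<theta> *\<^sub>R exp (- (of_real s * (1 - char_fun p \<theta>)))" for s :: real and \<theta>
  have [measurable]: "Box \<in> sets borel" by (simp add: Box_def)
  have f_meas [measurable]: "f s \<in> borel_measurable borel" for s
    unfolding f_def by measurable
  obtain c where c: "c > 0" "\<And>\<theta>. \<theta> \<in> Box \<Longrightarrow> c * (norm \<theta>)\<^sup>2 \<le> 1 - Re (char_fun p \<theta>)"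
    using one_minus_Re_char_fun_quadratic[OF irr] unfolding Box_def by blast
  let ?sc = "\<lambda>s \<theta>. (1 / sqrt s) *\<^sub>R \<theta> :: real \<times> real"
  have "((\<lambda>s. \<integral>\<theta>. f s (?sc s \<theta>) \<partial>lborel) \<longlongrightarrow> (\<integral>\<theta>. complex_of_real (exp (- (variance_form p \<theta> / 2))) \<partial>lborel)) at_top"
  proof (rule integral_dominated_convergence_at_top)
    show "integrable lborel (\<lambda>\<theta> :: real \<times> real. exp (- (c * (norm \<theta>)\<^sup>2)))"
      using c by (intro Gaussian_integrable)
    show "\<forall>\<^sub>F s in at_top. AE \<theta> in lborel. norm (f s (?sc s \<theta>)) \<le> exp (- (c * (norm \<theta>)\<^sup>2))"
      using eventually_gt_at_top[of 0]
    proof eventually_elim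
      case (elim s)
      have "norm (f s (?sc s \<theta>)) \<le> exp (- (c * (norm \<theta>)\<^sup>2))" for \<theta>
      proof (cases "?sc s \<theta> \<in> Box")
        case True
        have "c * (norm \<theta>)\<^sup>2 = s * (c * (norm (?sc s \<theta>))\<^sup>2)"
          using elim by (simp add: power_mult_distrib power_divide)
        also have "\<dots> \<le> s * (1 - Re (char_fun p (?sc s \<theta>)))"
          using c(2)[OF True] elim by (intro mult_left_mono) auto
        finally show ?thesis using True by (simp add: f_def)
      qed (simp add: f_def)
      then show ?case by simp
    qed
    show "AE \<theta> in lborel. ((\<lambda>s. f s (?sc s \<theta>)) \<longlongrightarrow> complex_of_real (exp (- (variance_form p \<theta> / 2)))) at_top"
    proof (rule AE_I2)
      fix \<theta> :: "real \<times> real"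
      have "((\<lambda>s. ?sc s \<theta>) \<longlongrightarrow> 0 *\<^sub>R \<theta>) at_top"
        by (intro tendsto_scaleR tendsto_const tendsto_divide_0[OF tendsto_const]
            filterlim_at_top_imp_at_infinity sqrt_at_top)
      moreover have "0 *\<^sub>R \<theta> \<in> box (-pi, -pi) (pi, pi)"
        by (simp add: mem_box Basis_prod_def)
      ultimately have "\<forall>\<^sub>F s in at_top. ?sc s \<theta> \<in> box (-pi, -pi) (pi, pi)"
        by (rule topological_tendstoD[OF _ open_box])
      then have "\<forall>\<^sub>F s in at_top. exp (- (of_real s * (1 - char_fun p (?sc s \<theta>)))) = f s (?sc s \<theta>)"
      proof eventually_elim
        case (elim s)
        then have "?sc s \<theta> \<in> Box"
          unfolding Box_def by (rule subsetD[OF box_subset_cbox])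
        then show ?case by (simp add: f_def)
      qed
      moreover have "((\<lambda>s. exp (- (of_real s * (1 - char_fun p (?sc s \<theta>))))) \<longlongrightarrow> exp (- complex_of_real (variance_form p \<theta> / 2))) at_top"
        by (intro tendsto_exp tendsto_minus char_fun_diffusive_scaling mean fv)
      ultimately have "((\<lambda>s. f s (?sc s \<theta>)) \<longlongrightarrow> exp (- complex_of_real (variance_form p \<theta> / 2))) at_top"
        by (rule Lim_transform_eventually[rotated])
      then show "((\<lambda>s. f s (?sc s \<theta>)) \<longlongrightarrow> complex_of_real (exp (- (variance_form p \<theta> / 2)))) at_top"
        by (simp add: exp_of_real[symmetric])
    qed
    have "(\<lambda>\<theta>. variance_form p \<theta>) \<in> borel_measurable borel"
      unfolding variance_form_eq[OF fv]
      by (intro borel_measurable_continuous_onI continuous_intros)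
    then show "(\<lambda>\<theta>. complex_of_real (exp (- (variance_form p \<theta> / 2)))) \<in> borel_measurable lborel" by simp
  qed simp
  then have "((\<lambda>s. Re (\<integral>\<theta>. f s (?sc s \<theta>) \<partial>lborel)) \<longlongrightarrow> Re (of_real (2 * pi / sqrt (det (covariance_matrix p))))) at_top"
    unfolding integral_complex_of_real integral_exp_variance_form[OF irr fv] by (rule tendsto_Re)
  then have "((\<lambda>s. 1 / (2 * pi)\<^sup>2 * Re (\<integral>\<theta>. f s (?sc s \<theta>) \<partial>lborel)) \<longlongrightarrow> 1 / (2 * pi)\<^sup>2 * (2 * pi / sqrt (det (covariance_matrix p)))) at_top"
    by (intro tendsto_mult tendsto_const) simp
  moreover have "\<forall>\<^sub>F s in at_top. 1 / (2 * pi)\<^sup>2 * Re (\<integral>\<theta>. f s (?sc s \<theta>) \<partial>lborel) = s * return_kernel p s"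
    using eventually_gt_at_top[of 0]
  proof eventually_elim
    case (elim s)
    have "s * return_kernel p s = Re (of_real s * ((1 / (2 * pi)\<^sup>2) *\<^sub>R (\<integral>\<theta>. f s \<theta> \<partial>lborel)))"
      unfolding return_kernel_def f_def Box_def by (subst integral_torus) simp_all
    also have "\<dots> = 1 / (2 * pi)\<^sup>2 * Re (of_real s * (\<integral>\<theta>. f s \<theta> \<partial>lborel))"
      by simp
    also have "of_real s * (\<integral>\<theta>. f s \<theta> \<partial>lborel) = (\<integral>\<theta>. f s (?sc s \<theta>) \<partial>lborel)"
      using elim by (intro lborel_scale_plane) auto
    finally show ?case ..
  qed
  ultimately have "((\<lambda>s. s * return_kernel p s) \<longlongrightarrow> 1 / (2 * pi)\<^sup>2 * (2 * pi / sqrt (det (covariance_matrix p)))) at_top"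
    by (rule Lim_transform_eventually)
  then show ?thesis by (simp add: power2_eq_square)
qed

interpretation lborel_time: time_measure lborel
  by unfold_locales auto

lemma return_kernel_le:
  assumes irr: "irreducible_pmf p" and mean: "zero_mean p" and fv: "finite_variance p"
  shows "\<exists>C. \<forall>s\<ge>0. \<bar>return_kernel p s\<bar> \<le> C / max 1 s"
proof -
  define A where "A = 1 / (2 * pi * sqrt (det (covariance_matrix p)))"
  have "\<forall>\<^sub>F s in at_top. dist (s * return_kernel p s) A < 1"
    unfolding A_def by (rule tendstoD[OF return_kernel_asymptotics[OF assms]]) simp
  then obtain S where S: "\<And>s. S \<le> s \<Longrightarrow> \<bar>s * return_kernel p s - A\<bar> < 1"
    unfolding eventually_at_top_linorder dist_real_def by blast
  define C where "C = max (\<bar>A\<bar> + 1) (max 1 S)"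
  have le1: "\<bar>return_kernel p s\<bar> \<le> 1" if "s \<ge> 0" for s
  proof -
    have "\<bar>return_kernel p s\<bar> \<le> norm (\<integral>\<theta>. exp (- (of_real s * (1 - char_fun p \<theta>))) \<partial>torus)"
      unfolding return_kernel_def by (rule abs_Re_le_cmod)
    also have "\<dots> \<le> (\<integral>\<theta>. norm (exp (- (of_real s * (1 - char_fun p \<theta>)))) \<partial>torus)"
      by (rule integral_norm_bound)
    also have "\<dots> \<le> (\<integral>\<theta>. 1 \<partial>torus)"
    proof (rule integral_mono)
      show "integrable torus (\<lambda>\<theta>. norm (exp (- (complex_of_real s * (1 - char_fun p \<theta>)))))"
        by (rule torus.integrable_const_bound[of _ 1]) (use norm_exp_kernel_le[OF that] in auto)
    qed (use norm_exp_kernel_le[OF that] in auto)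
    finally show ?thesis using torus.prob_space by simp
  qed
  have "\<bar>return_kernel p s\<bar> \<le> C / max 1 s" if "s \<ge> 0" for s
  proof (cases "S \<le> s \<and> 1 \<le> s")
    case True
    then have "\<bar>s * return_kernel p s\<bar> \<le> C" using S[of s] by (auto simp: C_def)
    then have "s * \<bar>return_kernel p s\<bar> \<le> C" using that by (simp add: abs_mult)
    then show ?thesis using True by (simp add: max_def field_simps)
  next
    case False
    then have "max 1 s \<le> C" by (auto simp: C_def)
    then have "1 \<le> C / max 1 s" by (simp add: field_simps)
    with le1[OF that] show ?thesis by linarith
  qed
  then show ?thesis by blast
qed

lemma integral_exp_complex:
  fixes z :: complex
  assumes "t \<ge> 1" "Re z \<ge> 1 / t"
  shows "(\<integral>s. indicator {0..} s *\<^sub>R exp (- (of_real s * z)) \<partial>lborel) = 1 / z"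
proof -
  let ?f = "\<lambda>s. indicator {0..} s *\<^sub>R exp (- (of_real s * z))"
  have "Re z > 0" using assms by (intro less_le_trans[OF _ assms(2)]) simp
  then have "z \<noteq> 0" by auto
  have int: "integrable lborel (\<lambda>s. ?f s)"
  proof (rule Bochner_Integration.integrable_bound[OF lborel_time.integrable_exp[OF assms(1)]])
    have "exp (- (s * Re z)) \<le> exp (- (s / t))" if "s \<ge> 0" for s
      using mult_left_mono[OF assms(2) that] by simp
    then show "AE s in lborel. norm (?f s) \<le> norm (indicator {0..} s * exp (- (s / t)))"
      by (auto split: split_indicator)
  qed auto
  have "((\<lambda>T. \<integral>s. indicator {..T} s *\<^sub>R ?f s \<partial>lborel)
      \<longlongrightarrow> (\<integral>s. ?f s \<partial>lborel)) at_top"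
    by (rule tendsto_integral_at_top) (use int in auto)
  moreover have "((\<lambda>T. \<integral>s. indicator {..T} s *\<^sub>R ?f s \<partial>lborel)
      \<longlongrightarrow> (1 - 0) / z) at_top"
  proof (rule Lim_transform_eventually)
    have "((\<lambda>T. exp (- (complex_of_real T * z))) \<longlongrightarrow> 0) at_top"
    proof (rule Lim_null_comparison)
      show "\<forall>\<^sub>F T in at_top. norm (exp (- (complex_of_real T * z))) \<le> exp (- (Re z * T))"
        by (simp add: mult.commute)
      show "((\<lambda>T. exp (- (Re z * T))) \<longlongrightarrow> 0) at_top"
        using \<open>Re z > 0\<close>
        by (intro filterlim_compose[OF exp_at_bot] filterlim_uminus_at_top[THEN iffD1]
            filterlim_tendsto_pos_mult_at_top[OF tendsto_const] filterlim_ident)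
    qed
    then show "((\<lambda>T. (1 - exp (- (complex_of_real T * z))) / z) \<longlongrightarrow> (1 - 0) / z) at_top"
      by (intro tendsto_intros \<open>z \<noteq> 0\<close>)
    show "\<forall>\<^sub>F T in at_top. (1 - exp (- (complex_of_real T * z))) / z
        = (\<integral>s. indicator {..T} s *\<^sub>R ?f s \<partial>lborel)"
      using eventually_ge_at_top[of 0]
    proof eventually_elim
      case (elim T)
      have "(\<integral>s. indicator {..T} s *\<^sub>R ?f s \<partial>lborel)
          = (\<integral>s. indicator {0..T} s *\<^sub>R exp (- (of_real s * z)) \<partial>lborel)"
        by (intro Bochner_Integration.integral_cong) (auto split: split_indicator)
      also have "\<dots> = - exp (- (of_real T * z)) / z - - exp (- (of_real 0 * z)) / z"
      proof (rule integral_FTC_Icc[OF elim])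
        fix x :: real
        have "((\<lambda>s. - exp (- (s * z)) / z) has_field_derivative exp (- (of_real x * z))) (at (of_real x))"
          using \<open>z \<noteq> 0\<close> by (auto intro!: derivative_eq_intros)
        then show "((\<lambda>s. - exp (- (complex_of_real s * z)) / z) has_vector_derivative exp (- (of_real x * z))) (at x within {0..T})"
          by (rule has_vector_derivative_real_field[THEN has_vector_derivative_at_within])
      qed (intro continuous_intros)
      finally show ?case by (simp add: diff_divide_distrib)
    qed
  qed
  ultimately show ?thesis
    using LIMSEQ_unique tendsto_unique[OF trivial_limit_at_top_linorder] by fastforce
qed

text \<open>The damped integral over time and the damped sum over the steps below both lead to the resolvent of the
  characteristic function. This is what makes the two kinds of walk comparable.\<close>

lemma return_kernel_Laplace:
  assumes t: "t \<ge> 1"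
  shows "(\<integral>s. indicator {0..} s * (exp (- (s / t)) * return_kernel p s) \<partial>lborel)
    = Re (\<integral>\<theta>. 1 / (of_real (1 / t) + 1 - char_fun p \<theta>) \<partial>torus)"
proof -
  define D where "D = density lborel (\<lambda>s. ennreal (indicator {0..} s * exp (- (s / t))))"
  have [simp, measurable_cong]: "sets D = sets borel" by (simp add: D_def)
  have D: "finite_measure D"
  proof
    have "emeasure D (space D) = (\<integral>\<^sup>+s. ennreal (indicator {0..} s * exp (- (s / t))) \<partial>lborel)"
      by (simp add: D_def emeasure_density)
    also have "\<dots> < \<infinity>"
      using lborel_time.integrable_exp[OF t] by (simp add: integrable_iff_bounded)
    finally show "emeasure D (space D) \<noteq> \<infinity>" by simp
  qed
  let ?f = "\<lambda>s \<theta>. indicator {0..} s *\<^sub>R exp (- (complex_of_real s * (1 - char_fun p \<theta>)))"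
  have f_meas: "case_prod ?f \<in> borel_measurable (D \<Otimes>\<^sub>M torus)"
    by (simp add: case_prod_unfold)
  have f_le: "norm (?f s \<theta>) \<le> 1" for s \<theta>
    using norm_exp_kernel_le[of s p \<theta>] by (auto split: split_indicator)
  note Fub = bounded_Fubini[OF D torus.finite_measure_axioms f_meas f_le]
  have "(\<integral>s. (\<integral>\<theta>. ?f s \<theta> \<partial>torus) \<partial>D) = (\<integral>\<theta>. (\<integral>s. ?f s \<theta> \<partial>D) \<partial>torus)"
    by (rule Fub(1))
  also have "\<dots> = (\<integral>\<theta>. 1 / (of_real (1 / t) + 1 - char_fun p \<theta>) \<partial>torus)"
  proof (rule Bochner_Integration.integral_cong[OF refl])
    fix \<theta>
    have "(\<integral>s. ?f s \<theta> \<partial>D) = (\<integral>s. indicator {0..} s *\<^sub>R exp (- (of_real s * (of_real (1 / t) + 1 - char_fun p \<theta>))) \<partial>lborel)"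
      unfolding D_def
      by (subst integral_density)
         (auto intro!: Bochner_Integration.integral_cong split: split_indicator
           simp: scaleR_conv_of_real exp_of_real[symmetric] mult_exp_exp algebra_simps)
    also have "\<dots> = 1 / (of_real (1 / t) + 1 - char_fun p \<theta>)"
      by (rule integral_exp_complex[OF t]) (use Re_char_fun_le[of p \<theta>] in simp)
    finally show "(\<integral>s. ?f s \<theta> \<partial>D) = 1 / (of_real (1 / t) + 1 - char_fun p \<theta>)" .
  qed
  finally have "Re (\<integral>s. (\<integral>\<theta>. ?f s \<theta> \<partial>torus) \<partial>D) = Re (\<integral>\<theta>. 1 / (of_real (1 / t) + 1 - char_fun p \<theta>) \<partial>torus)"
    by (rule arg_cong)
  moreover have "Re (\<integral>s. (\<integral>\<theta>. ?f s \<theta> \<partial>torus) \<partial>D) = (\<integral>s. indicator {0..} s * return_kernel p s \<partial>D)"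
    by (subst integral_Re[OF Fub(2), symmetric]) (simp add: return_kernel_def)
  moreover have "(\<integral>s. indicator {0..} s * return_kernel p s \<partial>D)
      = (\<integral>s. indicator {0..} s * (exp (- (s / t)) * return_kernel p s) \<partial>lborel)"
    unfolding D_def
    by (subst integral_density) (auto intro!: Bochner_Integration.integral_cong split: split_indicator)
  ultimately show ?thesis by simp
qed

lemma return_series_Abel:
  fixes x :: real
  assumes "0 \<le> x" "x < 1"
  shows "(\<lambda>n. x ^ n * Re (\<integral>\<theta>. char_fun p \<theta> ^ n \<partial>torus)) sums Re (\<integral>\<theta>. 1 / (1 - of_real x * char_fun p \<theta>) \<partial>torus)"
proof -
  let ?z = "\<lambda>\<theta>. of_real x * char_fun p \<theta>"
  have le: "norm (?z \<theta> ^ n) \<le> x ^ n" for \<theta> n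
    using assms norm_char_fun_le[of p \<theta>]
    by (auto simp: norm_power norm_mult intro!: power_mono mult_left_le)
  have int: "integrable torus (\<lambda>\<theta>. ?z \<theta> ^ n)" for n
    by (rule torus.integrable_const_bound[of _ "x ^ n"]) (use le in auto)
  have "(\<lambda>n. \<integral>\<theta>. ?z \<theta> ^ n \<partial>torus) sums (\<integral>\<theta>. (\<Sum>n. ?z \<theta> ^ n) \<partial>torus)"
  proof (rule sums_integral[OF int])
    show "AE \<theta> in torus. summable (\<lambda>n. norm (?z \<theta> ^ n))"
    proof (rule AE_I2)
      fix \<theta>
      show "summable (\<lambda>n. norm (?z \<theta> ^ n))"
        by (rule summable_comparison_test'[of "\<lambda>n. x ^ n" 0]) (use le assms in \<open>auto intro: summable_geometric\<close>)
    qed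
    show "summable (\<lambda>n. \<integral>\<theta>. norm (?z \<theta> ^ n) \<partial>torus)"
    proof (rule summable_comparison_test'[of "\<lambda>n. x ^ n" 0])
      fix n :: nat
      have "(\<integral>\<theta>. norm (?z \<theta> ^ n) \<partial>torus) \<le> (\<integral>\<theta>. x ^ n \<partial>torus)"
        by (rule integral_mono) (use int le in \<open>auto intro: integrable_norm\<close>)
      then show "norm (\<integral>\<theta>. norm (?z \<theta> ^ n) \<partial>torus) \<le> x ^ n"
        using torus.prob_space by simp
    qed (use assms in \<open>auto intro: summable_geometric\<close>)
  qed
  also have "(\<lambda>n. \<integral>\<theta>. ?z \<theta> ^ n \<partial>torus) = (\<lambda>n. of_real (x ^ n) * (\<integral>\<theta>. char_fun p \<theta> ^ n \<partial>torus))"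
    by (simp add: power_mult_distrib)
  also have "(\<integral>\<theta>. (\<Sum>n. ?z \<theta> ^ n) \<partial>torus) = (\<integral>\<theta>. 1 / (1 - ?z \<theta>) \<partial>torus)"
  proof (rule Bochner_Integration.integral_cong[OF refl])
    fix \<theta>
    have "norm (?z \<theta>) < 1" using le[of \<theta> 1] assms by simp
    then show "(\<Sum>n. ?z \<theta> ^ n) = 1 / (1 - ?z \<theta>)"
      by (rule suminf_geometric)
  qed
  finally have "(\<lambda>n. Re (of_real (x ^ n) * (\<integral>\<theta>. char_fun p \<theta> ^ n \<partial>torus)))
      sums Re (\<integral>\<theta>. 1 / (1 - ?z \<theta>) \<partial>torus)"
    by (rule sums_Re)
  then show ?thesis by simp
qed

section \<open>Logarithmic growth of the expected number of returns\<close>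

definition count_time :: "real measure" where
  "count_time = distr (count_space UNIV) borel (real :: nat \<Rightarrow> real)"

lemma emeasure_count_time:
  assumes "A \<in> sets borel"
  shows "emeasure count_time A = emeasure (count_space UNIV) {n. real n \<in> A}"
  unfolding count_time_def using assms by (subst emeasure_distr) (auto simp: vimage_def)

interpretation count_time: time_measure count_time
proof
  fix n :: nat
  have "{m. real m \<in> {real n..<real n + 1}} = {n}" by auto
  then show "emeasure count_time {real n..<real n + 1} \<le> 1"
    by (subst emeasure_count_time) auto
qed (simp add: count_time_def)

theorem continuous_returns_log:
  assumes irr: "irreducible_pmf p" and mean: "zero_mean p" and fv: "finite_variance p" and r: "r > 0"
  shows "((\<lambda>t. (\<integral>s. indicator {0..t} s * return_kernel p (r * s) \<partial>lborel) / ln t)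
            \<longlongrightarrow> 1 / (2 * pi * r * sqrt (det (covariance_matrix p)))) at_top"
proof -
  define A where "A = 1 / (2 * pi * sqrt (det (covariance_matrix p)))"
  obtain C' where C': "\<And>s. 0 \<le> s \<Longrightarrow> \<bar>return_kernel p s\<bar> \<le> C' / max 1 s"
    using return_kernel_le[OF irr mean fv] by blast
  have "((\<lambda>t. (\<integral>s. indicator {0..t} s * return_kernel p (r * s) \<partial>lborel) / ln t) \<longlongrightarrow> 1 / r * A) at_top"
  proof (rule log_Cesaro)
    fix s :: real assume "0 \<le> s"
    have "C' \<ge> 0" using C'[of 0] by simp
    have "C' / max 1 (r * s) \<le> C' / 1" using \<open>C' \<ge> 0\<close> by (intro divide_left_mono) auto
    then show "\<bar>return_kernel p (r * s)\<bar> \<le> C'" using C'[of "r * s"] \<open>0 \<le> s\<close> r by simp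
  next
    have "filterlim (\<lambda>s. r * s) at_top at_top"
      by (rule filterlim_tendsto_pos_mult_at_top[OF tendsto_const r filterlim_ident])
    from filterlim_compose[OF return_kernel_asymptotics[OF irr mean fv] this]
    have "((\<lambda>s. 1 / r * (r * s * return_kernel p (r * s))) \<longlongrightarrow> 1 / r * A) at_top"
      unfolding A_def by (intro tendsto_mult tendsto_const)
    then show "((\<lambda>s. s * return_kernel p (r * s)) \<longlongrightarrow> 1 / r * A) at_top"
      using r by simp
  qed simp
  then show ?thesis by (simp add: A_def mult_ac)
qed

text \<open>The discrete return probabilities themselves need not obey a local limit theorem, because of periodicity. Their
  generating function at \<open>exp (- 1 / t)\<close>, however, is \<open>exp (1 / t)\<close> times the Laplace transform of the return kernel at
  \<open>exp (1 / t) - 1 = 1 / \<tau> t\<close>, and replacing damping by a cutoff costs a bounded amount on both sides, which is negligible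
  against \<open>ln t\<close>.\<close>

theorem discrete_returns_log:
  fixes g :: "real \<Rightarrow> real"
  assumes irr: "irreducible_pmf p" and mean: "zero_mean p" and fv: "finite_variance p"
    and [measurable]: "g \<in> borel_measurable borel"
    and g: "\<And>n. g (real n) = Re (\<integral>\<theta>. char_fun p \<theta> ^ n \<partial>torus)"
    and g_le: "\<And>s. 0 \<le> s \<Longrightarrow> \<bar>g s\<bar> \<le> C / max 1 s"
  shows "((\<lambda>t. (\<integral>s. indicator {0..t} s * g s \<partial>count_time) / ln t)
            \<longlongrightarrow> 1 / (2 * pi * sqrt (det (covariance_matrix p)))) at_top"
proof -
  define A where "A = 1 / (2 * pi * sqrt (det (covariance_matrix p)))"
  define h where "h t = (\<integral>s. indicator {0..t} s * g s \<partial>count_time)" for t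
  define I where "I t = (\<integral>s. indicator {0..t} s * return_kernel p s \<partial>lborel)" for t
  define \<tau> where "\<tau> t = 1 / (exp (1 / t) - 1)" for t :: real
  obtain C' where C': "\<And>s. 0 \<le> s \<Longrightarrow> \<bar>return_kernel p s\<bar> \<le> C' / max 1 s"
    using return_kernel_le[OF irr mean fv] by blast
  have I_lim: "((\<lambda>T. I T / ln T) \<longlongrightarrow> A) at_top"
    using continuous_returns_log[OF irr mean fv, of 1] by (simp add: I_def A_def)
  have Laplace: "(\<integral>s. indicator {0..} s * (exp (- (s / t)) * g s) \<partial>count_time)
      = Re (\<integral>\<theta>. 1 / (1 - of_real (exp (- (1 / t))) * char_fun p \<theta>) \<partial>torus)" if "t \<ge> 1" for t
  proof -
    let ?x = "exp (- (1 / t))"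
    have x: "0 \<le> ?x" "?x < 1" using that by auto
    have pow: "exp (- (real n / t)) = ?x ^ n" for n :: nat
      by (simp flip: exp_of_nat_mult)
    have C: "C \<ge> 0" using g_le[of 0] by simp
    have sum_int: "integrable (count_space UNIV) (\<lambda>n. ?x ^ n * g (real n))"
      unfolding integrable_count_space_nat_iff
    proof (rule summable_comparison_test'[of "\<lambda>n. C * ?x ^ n" 0])
      fix n :: nat
      have "C / max 1 (real n) \<le> C / 1" using C by (intro divide_left_mono) auto
      then have "\<bar>g (real n)\<bar> \<le> C" using g_le[of "real n"] by simp
      then show "norm (norm (?x ^ n * g (real n))) \<le> C * ?x ^ n"
        by (simp add: abs_mult mult.commute mult_left_mono)
    qed (use x in \<open>auto intro!: summable_mult summable_geometric\<close>)
    have "(\<integral>s. indicator {0..} s * (exp (- (s / t)) * g s) \<partial>count_time)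
        = (\<integral>n. ?x ^ n * g (real n) \<partial>count_space UNIV)"
      unfolding count_time_def by (subst integral_distr) (auto simp: pow)
    also have "\<dots> = (\<Sum>n. ?x ^ n * g (real n))"
      by (rule integral_count_space_nat[OF sum_int])
    also have "\<dots> = Re (\<integral>\<theta>. 1 / (1 - of_real ?x * char_fun p \<theta>) \<partial>torus)"
      unfolding g by (rule sums_unique[symmetric, OF return_series_Abel[OF x]])
    finally show ?thesis .
  qed
  have ev_\<tau>: "\<forall>\<^sub>F t in at_top. \<tau> t \<ge> 1" "\<forall>\<^sub>F t in at_top. exp (1 / t) \<le> (2 :: real)"
    unfolding \<tau>_def by real_asymp+
  have close: "\<forall>\<^sub>F t in at_top. \<bar>h t - exp (1 / t) * I (\<tau> t)\<bar> \<le> 4 * C + 8 * C'"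
    using ev_\<tau> eventually_ge_at_top[of 1]
  proof eventually_elim
    case (elim t)
    define L where "L = (\<integral>s. indicator {0..} s * (exp (- (s / \<tau> t)) * return_kernel p s) \<partial>lborel)"
    have "exp (1 / t) > 1" using elim by simp
    have "(\<integral>s. indicator {0..} s * (exp (- (s / t)) * g s) \<partial>count_time) = exp (1 / t) * L"
    proof -
      have "1 / (1 - of_real (exp (- (1 / t))) * w) = of_real (exp (1 / t)) * (1 / (of_real (1 / \<tau> t) + 1 - w))" for w :: complex
      proof -
        have "of_real (exp (1 / t)) * (1 - of_real (exp (- (1 / t))) * w) = of_real (1 / \<tau> t) + 1 - w"
          by (simp add: \<tau>_def right_diff_distrib mult.assoc[symmetric] flip: of_real_mult exp_add)
        then have "of_real (exp (1 / t)) * (1 / (of_real (1 / \<tau> t) + 1 - w))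
            = of_real (exp (1 / t)) / (of_real (exp (1 / t)) * (1 - of_real (exp (- (1 / t))) * w))"
          by simp
        also have "\<dots> = 1 / (1 - of_real (exp (- (1 / t))) * w)"
          by (rule nonzero_divide_mult_cancel_left) simp
        finally show ?thesis by simp
      qed
      then have "(\<integral>\<theta>. 1 / (1 - of_real (exp (- (1 / t))) * char_fun p \<theta>) \<partial>torus)
          = of_real (exp (1 / t)) * (\<integral>\<theta>. 1 / (of_real (1 / \<tau> t) + 1 - char_fun p \<theta>) \<partial>torus)"
        by (simp only: integral_mult_right_zero)
      then show ?thesis
        unfolding Laplace[OF elim(3)] L_def return_kernel_Laplace[OF elim(1)] by simp
    qed
    then have "\<bar>h t - exp (1 / t) * L\<bar> \<le> 4 * C"
      using count_time.cutoff_vs_damping[of g C t] g_le elim by (simp add: h_def)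
    moreover have "\<bar>exp (1 / t) * (I (\<tau> t) - L)\<bar> \<le> 2 * (4 * C')"
      unfolding abs_mult
      using lborel_time.cutoff_vs_damping[of "return_kernel p" C' "\<tau> t"] C' elim
      by (intro mult_mono) (simp_all add: I_def L_def)
    ultimately show ?case by (simp add: right_diff_distrib)
  qed
  have "((\<lambda>t. h t / ln t - exp (1 / t) * (ln (\<tau> t) / ln t) * (I (\<tau> t) / ln (\<tau> t))) \<longlongrightarrow> 0) at_top"
  proof (rule Lim_null_comparison)
    have "\<forall>\<^sub>F t in at_top. ln (\<tau> t) > 0" "\<forall>\<^sub>F t in at_top. ln (t :: real) > 0"
      unfolding \<tau>_def by real_asymp+
    with close show "\<forall>\<^sub>F t in at_top. norm (h t / ln t - exp (1 / t) * (ln (\<tau> t) / ln t) * (I (\<tau> t) / ln (\<tau> t)))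
        \<le> (4 * C + 8 * C') / ln t"
    proof eventually_elim
      case (elim t)
      have "h t / ln t - exp (1 / t) * (ln (\<tau> t) / ln t) * (I (\<tau> t) / ln (\<tau> t))
          = (h t - exp (1 / t) * I (\<tau> t)) / ln t"
        using elim by (simp add: diff_divide_distrib)
      then show ?case using elim by (simp add: abs_divide divide_right_mono)
    qed
    show "((\<lambda>t :: real. (4 * C + 8 * C') / ln t) \<longlongrightarrow> 0) at_top" by real_asymp
  qed
  moreover have "((\<lambda>t. exp (1 / t) * (ln (\<tau> t) / ln t) * (I (\<tau> t) / ln (\<tau> t))) \<longlongrightarrow> 1 * A) at_top"
  proof (intro tendsto_mult)
    show "((\<lambda>t. exp (1 / t) * (ln (\<tau> t) / ln t)) \<longlongrightarrow> 1) at_top"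
      unfolding \<tau>_def by real_asymp
    have "filterlim \<tau> at_top at_top" unfolding \<tau>_def by real_asymp
    then show "((\<lambda>t. I (\<tau> t) / ln (\<tau> t)) \<longlongrightarrow> A) at_top"
      by (rule filterlim_compose[OF I_lim])
  qed
  ultimately have "((\<lambda>t. h t / ln t) \<longlongrightarrow> 0 + 1 * A) at_top"
    by (rule tendsto_add[THEN tendsto_cong[THEN iffD1, rotated]]) simp
  then show ?thesis by (simp add: h_def A_def)
qed

lemma borel_measurable_cnj [measurable (raw)]:
  fixes F :: "'x \<Rightarrow> complex"
  assumes "F \<in> borel_measurable M"
  shows "(\<lambda>z. cnj (F z)) \<in> borel_measurable M"
  using borel_measurable_continuous_on[of cnj, OF _ assms] by (simp add: continuous_on_cnj continuous_on_id)

section \<open>Regenerative walks and quenched collision moments\<close>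

text \<open>A walk is given by its position \<open>\<Phi> s \<omega>\<close> at time \<open>s\<close>, as a function of a noise \<open>\<omega>\<close>, and by the noise
  \<open>R s \<omega>\<close> that drives it from time \<open>s\<close> on. The set \<open>T\<close> consists of the times at which the walk
  regenerates, and \<open>W\<close> is an almost sure set of noises that is invariant under \<open>R\<close>.\<close>

locale regenerative_walk = prob_space S for S :: "'s measure" +
  fixes \<Phi> :: "real \<Rightarrow> 's \<Rightarrow> int ^ 2" and R :: "real \<Rightarrow> 's \<Rightarrow> 's" and T :: "real set" and W :: "'s set"
  assumes T_nonneg: "s \<in> T \<Longrightarrow> 0 \<le> s"
    and T_diff: "s \<in> T \<Longrightarrow> u \<in> T \<Longrightarrow> s \<le> u \<Longrightarrow> u - s \<in> T"
    and measurable_position_pair: "(\<lambda>z. \<Phi> (fst z) (snd z)) \<in> borel \<Otimes>\<^sub>M S \<rightarrow>\<^sub>M count_space UNIV"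
    and measurable_restart_pair: "(\<lambda>z. R (fst z) (snd z)) \<in> borel \<Otimes>\<^sub>M S \<rightarrow>\<^sub>M S"
    and AE_W: "AE \<omega> in S. \<omega> \<in> W"
    and restart_W: "s \<in> T \<Longrightarrow> \<omega> \<in> W \<Longrightarrow> \<omega> \<in> space S \<Longrightarrow> R s \<omega> \<in> W"
    and position_add: "s \<in> T \<Longrightarrow> u \<in> T \<Longrightarrow> \<omega> \<in> W \<Longrightarrow> \<omega> \<in> space S \<Longrightarrow> \<Phi> (s + u) \<omega> = \<Phi> s \<omega> + \<Phi> u (R s \<omega>)"
    and regeneration: "s \<in> T \<Longrightarrow> distr S (count_space UNIV \<Otimes>\<^sub>M S) (\<lambda>\<omega>. (\<Phi> s \<omega>, R s \<omega>))
      = distr S (count_space UNIV) (\<Phi> s) \<Otimes>\<^sub>M S"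
begin

lemma measurable_position [measurable (raw)]:
  assumes "f \<in> M \<rightarrow>\<^sub>M borel" "g \<in> M \<rightarrow>\<^sub>M S"
  shows "(\<lambda>x. \<Phi> (f x) (g x)) \<in> M \<rightarrow>\<^sub>M count_space UNIV"
  using measurable_compose[OF measurable_Pair[OF assms] measurable_position_pair] by simp

lemma measurable_restart [measurable (raw)]:
  assumes "f \<in> M \<rightarrow>\<^sub>M borel" "g \<in> M \<rightarrow>\<^sub>M S"
  shows "(\<lambda>x. R (f x) (g x)) \<in> M \<rightarrow>\<^sub>M S"
  using measurable_compose[OF measurable_Pair[OF assms] measurable_restart_pair] by simp

lemma measurable_position' [measurable]: "\<Phi> s \<in> S \<rightarrow>\<^sub>M count_space UNIV"
  and measurable_restart' [measurable]: "R s \<in> S \<rightarrow>\<^sub>M S"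
  using measurable_position[of "\<lambda>_. s" S "\<lambda>x. x"] measurable_restart[of "\<lambda>_. s" S "\<lambda>x. x"] by auto

lemma restart_space: "\<omega> \<in> space S \<Longrightarrow> R s \<omega> \<in> space S"
  by (rule measurable_space[OF measurable_restart'])

lemma regeneration_integral:
  fixes F :: "int ^ 2 \<Rightarrow> 's \<Rightarrow> 'b::{banach, second_countable_topology}"
  assumes s: "s \<in> T" and F: "case_prod F \<in> borel_measurable (count_space UNIV \<Otimes>\<^sub>M S)"
    and bound: "\<And>x \<omega>. \<omega> \<in> space S \<Longrightarrow> norm (F x \<omega>) \<le> B"
  shows "(\<integral>\<omega>. F (\<Phi> s \<omega>) (R s \<omega>) \<partial>S) = (\<integral>\<omega>. (\<integral>\<omega>'. F (\<Phi> s \<omega>) \<omega>' \<partial>S) \<partial>S)"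
proof -
  let ?D = "distr S (count_space UNIV) (\<Phi> s)"
  interpret D: prob_space ?D by (rule prob_space_distr) simp
  interpret P: pair_prob_space ?D S ..
  have [measurable]: "case_prod F \<in> borel_measurable (?D \<Otimes>\<^sub>M S)"
    using F by (simp cong: measurable_cong_sets sets_pair_measure_cong)
  have int: "integrable (?D \<Otimes>\<^sub>M S) (case_prod F)"
    by (rule P.integrable_const_bound[where B = B]) (use bound in \<open>auto simp: space_pair_measure intro!: AE_I2\<close>)
  have inner: "(\<lambda>x. \<integral>\<omega>'. F x \<omega>' \<partial>S) \<in> borel_measurable (count_space UNIV)" by simp
  have "(\<integral>\<omega>. F (\<Phi> s \<omega>) (R s \<omega>) \<partial>S)
      = (\<integral>z. case_prod F z \<partial>distr S (count_space UNIV \<Otimes>\<^sub>M S) (\<lambda>\<omega>. (\<Phi> s \<omega>, R s \<omega>)))"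
    using F by (subst integral_distr) auto
  also have "\<dots> = (\<integral>z. case_prod F z \<partial>(?D \<Otimes>\<^sub>M S))"
    by (simp only: regeneration[OF s])
  also have "\<dots> = (\<integral>x. (\<integral>\<omega>'. F x \<omega>' \<partial>S) \<partial>?D)"
    by (rule P.integral_fst[symmetric]) (rule int)
  also have "\<dots> = (\<integral>\<omega>. (\<integral>\<omega>'. F (\<Phi> s \<omega>) \<omega>' \<partial>S) \<partial>S)"
    by (subst integral_distr) (auto simp: inner)
  finally show ?thesis .
qed

definition occupation :: "real \<Rightarrow> int ^ 2 \<Rightarrow> real" where
  "occupation s x = prob {\<omega> \<in> space S. \<Phi> s \<omega> = x}"

lemma occupation_eq: "occupation s x = (\<integral>\<omega>. of_bool (\<Phi> s \<omega> = x) \<partial>S)"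
proof -
  have "(\<integral>\<omega>. of_bool (\<Phi> s \<omega> = x) \<partial>S) = (\<integral>\<omega>. indicator {\<omega> \<in> space S. \<Phi> s \<omega> = x} \<omega> \<partial>S)"
    by (intro Bochner_Integration.integral_cong) auto
  also have "\<dots> = prob {\<omega> \<in> space S. \<Phi> s \<omega> = x}"
    by (subst Bochner_Integration.integral_indicator) (auto simp: Int_def conj_commute)
  finally show ?thesis by (simp add: occupation_def)
qed

lemma occupation_nonneg [simp]: "0 \<le> occupation s x"
  and occupation_le_1: "occupation s x \<le> 1"
  by (simp_all add: occupation_def)

lemma measurable_occupation [measurable (raw)]:
  assumes f [measurable]: "f \<in> M \<rightarrow>\<^sub>M borel" and g: "g \<in> M \<rightarrow>\<^sub>M count_space UNIV"
  shows "(\<lambda>z. occupation (f z) (g z)) \<in> borel_measurable M"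
proof (rule measurable_compose_countable'[OF _ g])
  show "(\<lambda>z. occupation (f z) x) \<in> borel_measurable M" for x
    unfolding occupation_eq by measurable
qed simp

definition step_char :: "real \<Rightarrow> real \<times> real \<Rightarrow> complex" where
  "step_char s \<theta> = (\<integral>\<omega>. character \<theta> (\<Phi> s \<omega>) \<partial>S)"

lemma measurable_step_char [measurable (raw)]:
  assumes [measurable]: "f \<in> M \<rightarrow>\<^sub>M borel" "g \<in> M \<rightarrow>\<^sub>M borel"
  shows "(\<lambda>z. step_char (f z) (g z)) \<in> borel_measurable M"
  unfolding step_char_def by measurable

lemma integrable_step [simp]: "integrable S (\<lambda>\<omega>. character \<theta> (\<Phi> s \<omega>))"
  by (rule integrable_const_bound[of _ 1]) auto

lemma norm_step_char_le: "norm (step_char s \<theta>) \<le> 1"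
  unfolding step_char_def
  using integral_norm_bound[of S "\<lambda>\<omega>. character \<theta> (\<Phi> s \<omega>)"] prob_space by simp

lemma step_char_add:
  assumes "s \<in> T" "u \<in> T"
  shows "step_char (s + u) \<theta> = step_char s \<theta> * step_char u \<theta>"
proof -
  have "step_char (s + u) \<theta> = (\<integral>\<omega>. character \<theta> (\<Phi> s \<omega>) * character \<theta> (\<Phi> u (R s \<omega>)) \<partial>S)"
    unfolding step_char_def
  proof (rule integral_cong_AE)
    show "AE \<omega> in S. character \<theta> (\<Phi> (s + u) \<omega>) = character \<theta> (\<Phi> s \<omega>) * character \<theta> (\<Phi> u (R s \<omega>))"
      using AE_W AE_space
      by eventually_elim (simp add: position_add[OF assms] character_add)
  qed measurable
  also have "\<dots> = (\<integral>\<omega>. (\<integral>\<omega>'. character \<theta> (\<Phi> s \<omega>) * character \<theta> (\<Phi> u \<omega>') \<partial>S) \<partial>S)"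
    by (rule regeneration_integral[OF assms(1), where B = 1]) (auto simp: norm_mult case_prod_unfold)
  also have "\<dots> = step_char s \<theta> * step_char u \<theta>"
    by (simp add: step_char_def)
  finally show ?thesis .
qed

lemma occupation_Fourier:
  "complex_of_real (occupation s x) = (\<integral>\<theta>. cnj (character \<theta> x) * step_char s \<theta> \<partial>torus)"
  unfolding occupation_def step_char_def by (rule Fourier_inversion) simp

text \<open>The spread of \<open>character \<theta> (\<Phi> s)\<close> around its mean is governed by the modulus of the mean.\<close>

lemma step_char_spread:
  "(\<integral>\<omega>. norm (character \<theta> (\<Phi> s \<omega>) - step_char s \<theta>) \<partial>S) \<le> sqrt (1 - (norm (step_char s \<theta>))\<^sup>2)"
proof (rule real_le_rsqrt)
  let ?V = "\<lambda>\<omega>. norm (character \<theta> (\<Phi> s \<omega>) - step_char s \<theta>)"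
  have le2: "?V \<omega> \<le> 2" for \<omega>
    using norm_triangle_ineq4[of "character \<theta> (\<Phi> s \<omega>)" "step_char s \<theta>"] norm_step_char_le[of s \<theta>] by simp
  have int: "integrable S ?V" "integrable S (\<lambda>\<omega>. (?V \<omega>)\<^sup>2)"
    using le2 power_mono[OF le2, of _ 2]
    by (auto intro!: integrable_const_bound[of _ 2] integrable_const_bound[of _ "2\<^sup>2"])
  have "(expectation ?V)\<^sup>2 \<le> expectation (\<lambda>\<omega>. (?V \<omega>)\<^sup>2)"
    using variance_positive[of ?V] variance_eq[OF int] by linarith
  also have "\<dots> = 1 - (norm (step_char s \<theta>))\<^sup>2"
  proof -
    let ?m = "step_char s \<theta>" and ?Z = "\<lambda>\<omega>. character \<theta> (\<Phi> s \<omega>)"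
    have V: "complex_of_real ((?V \<omega>)\<^sup>2) = 1 - ?Z \<omega> * cnj ?m - cnj (?Z \<omega>) * ?m + ?m * cnj ?m" for \<omega>
    proof -
      have "?Z \<omega> * cnj (?Z \<omega>) = 1"
        using complex_norm_square[of "?Z \<omega>"] by simp
      then show ?thesis
        unfolding complex_norm_square by (simp add: algebra_simps)
    qed
    have "complex_of_real (expectation (\<lambda>\<omega>. (?V \<omega>)\<^sup>2)) = (\<integral>\<omega>. complex_of_real ((?V \<omega>)\<^sup>2) \<partial>S)"
      by (simp only: integral_complex_of_real)
    also have "\<dots> = (\<integral>\<omega>. 1 - ?Z \<omega> * cnj ?m - cnj (?Z \<omega>) * ?m + ?m * cnj ?m \<partial>S)"
      by (simp only: V)
    also have "\<dots> = 1 - ?m * cnj ?m - cnj ?m * ?m + ?m * cnj ?m"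
      using prob_space by (simp add: step_char_def)
    also have "\<dots> = of_real (1 - (norm ?m)\<^sup>2)"
      by (simp only: of_real_diff of_real_1 complex_norm_square) (simp add: mult.commute)
    finally show ?thesis by (simp only: of_real_eq_iff)
  qed
  finally show "(expectation ?V)\<^sup>2 \<le> 1 - (norm (step_char s \<theta>))\<^sup>2" .
qed

end

locale collision = X: regenerative_walk S \<Phi> R T W + Y: regenerative_walk S' \<Phi>' R' T W'
  for S :: "'s measure" and \<Phi> R T W and S' :: "'r measure" and \<Phi>' R' W'
begin

text \<open>The mean of \<open>1 / k!\<close> times the \<open>k\<close>-th power of the local time, except that all \<open>k\<close> waiting times
  between successive collisions range independently over the time measure \<open>\<kappa>\<close>, instead of having a
  bounded sum. This makes the recursion exact.\<close>

primrec chain :: "real measure \<Rightarrow> nat \<Rightarrow> 'r \<Rightarrow> real" where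
  "chain \<kappa> 0 y = 1"
| "chain \<kappa> (Suc k) y = (\<integral>s. X.occupation s (\<Phi>' s y) * chain \<kappa> k (R' s y) \<partial>\<kappa>)"

definition green :: "real \<Rightarrow> real" where
  "green s = (\<integral>y. X.occupation s (\<Phi>' s y) \<partial>S')"

definition mean_chain :: "real measure \<Rightarrow> real" where
  "mean_chain \<kappa> = (\<integral>s. green s \<partial>\<kappa>)"

lemma measurable_green [measurable]: "green \<in> borel_measurable borel"
  unfolding green_def by measurable

lemma green_nonneg: "0 \<le> green s"
  unfolding green_def by (intro Bochner_Integration.integral_nonneg) simp

lemma green_le_1: "green s \<le> 1"
proof -
  have "green s \<le> (\<integral>y. 1 \<partial>S')"
    unfolding green_def
    by (intro integral_mono Y.integrable_const_bound[of _ 1]) (auto simp: X.occupation_le_1)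
  then show ?thesis by (simp add: Y.prob_space)
qed

lemma measurable_chain:
  assumes "finite_measure \<kappa>" and [measurable_cong]: "sets \<kappa> = sets borel"
  shows "chain \<kappa> k \<in> borel_measurable S'"
proof (induction k)
  case (Suc k)
  interpret finite_measure \<kappa> by fact
  note [measurable] = Suc
  show ?case unfolding chain.simps by measurable
qed simp

lemma chain_bounds:
  assumes \<kappa>: "finite_measure \<kappa>" and [measurable_cong]: "sets \<kappa> = sets borel" and "y \<in> space S'"
  shows "0 \<le> chain \<kappa> k y \<and> chain \<kappa> k y \<le> measure \<kappa> UNIV ^ k"
  using assms(3)
proof (induction k arbitrary: y)
  case (Suc k)
  interpret finite_measure \<kappa> by fact
  note [measurable] = measurable_chain[OF \<kappa> assms(2)]
  have sp: "space \<kappa> = UNIV" using sets_eq_imp_space_eq[OF assms(2)] by simp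
  have R': "R' s y \<in> space S'" for s by (rule Y.restart_space[OF Suc.prems])
  have "X.occupation s (\<Phi>' s y) * chain \<kappa> k (R' s y) \<le> measure \<kappa> UNIV ^ k" for s
    using Suc.IH[OF R'[of s]] X.occupation_le_1[of s "\<Phi>' s y"] X.occupation_nonneg[of s "\<Phi>' s y"]
    by (meson mult_left_le_one_le order_trans)
  moreover have nn: "0 \<le> X.occupation s (\<Phi>' s y) * chain \<kappa> k (R' s y)" for s
    using Suc.IH[OF R'[of s]] by simp
  ultimately have "(\<integral>s. X.occupation s (\<Phi>' s y) * chain \<kappa> k (R' s y) \<partial>\<kappa>) \<le> (\<integral>s. measure \<kappa> UNIV ^ k \<partial>\<kappa>)"
    using Suc.prems
    by (intro integral_mono integrable_const_bound[of _ "measure \<kappa> UNIV ^ k"]) auto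
  moreover have "0 \<le> (\<integral>s. X.occupation s (\<Phi>' s y) * chain \<kappa> k (R' s y) \<partial>\<kappa>)"
    using nn by (intro Bochner_Integration.integral_nonneg) auto
  ultimately show ?case by (simp add: sp mult.commute)
qed simp

lemma mean_chain_nonneg: "0 \<le> mean_chain \<kappa>"
  unfolding mean_chain_def by (intro Bochner_Integration.integral_nonneg green_nonneg)

text \<open>The step from \<open>k\<close> to \<open>k + 1\<close> collisions: the position of \<open>Y\<close> at time \<open>s\<close> is independent of the
  environment that the walk sees after time \<open>s\<close>, hence the error is passed on without loss.\<close>

lemma chain_L1_step:
  assumes \<kappa>: "finite_measure \<kappa>" and [measurable_cong]: "sets \<kappa> = sets borel" and T: "AE s in \<kappa>. s \<in> T"
  defines "G \<equiv> mean_chain \<kappa>"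
  shows "(\<integral>y. \<bar>chain \<kappa> (Suc k) y - G ^ Suc k\<bar> \<partial>S')
    \<le> G * (\<integral>y. \<bar>chain \<kappa> k y - G ^ k\<bar> \<partial>S') + G ^ k * (\<integral>y. \<bar>chain \<kappa> 1 y - G\<bar> \<partial>S')"
proof -
  interpret K: finite_measure \<kappa> by fact
  have sp: "space \<kappa> = UNIV" using sets_eq_imp_space_eq[OF assms(2)] by simp
  note [measurable] = measurable_chain[OF \<kappa> assms(2)]
  define m where "m = measure \<kappa> UNIV"
  have m: "m \<ge> 0" by (simp add: m_def)
  have G0: "G \<ge> 0" unfolding G_def by (rule mean_chain_nonneg)
  have bd: "\<bar>chain \<kappa> k y\<bar> \<le> m ^ k" if "y \<in> space S'" for k y
    using chain_bounds[OF \<kappa> assms(2) that, of k] by (simp add: m_def)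
  define d where "d k y = \<bar>chain \<kappa> k y - G ^ k\<bar>" for k y
  have [measurable]: "d k \<in> borel_measurable S'" for k unfolding d_def by measurable
  have d_le: "\<bar>d k y\<bar> \<le> m ^ k + G ^ k" if "y \<in> space S'" for k y
    using bd[OF that, of k] G0 unfolding d_def by (smt (verit) zero_le_power)
  have d_int: "integrable S' (d k)" for k
    by (rule Y.integrable_const_bound[of _ "m ^ k + G ^ k"]) (use d_le in auto)
  let ?q = "\<lambda>s y. X.occupation s (\<Phi>' s y)"
  have q: "0 \<le> ?q s y" "?q s y \<le> 1" for s y by (auto simp: X.occupation_le_1)
  have qd_le: "norm (?q s y * d k (R' s y)) \<le> m ^ k + G ^ k" if "y \<in> space S'" for s y
  proof -
    have "norm (?q s y * d k (R' s y)) \<le> 1 * (m ^ k + G ^ k)"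
      unfolding real_norm_def abs_mult
      using q d_le[OF Y.restart_space[OF that]] by (intro mult_mono) auto
    then show ?thesis by simp
  qed
  have pointwise: "d (Suc k) y \<le> (\<integral>s. ?q s y * d k (R' s y) \<partial>\<kappa>) + G ^ k * d 1 y" if y: "y \<in> space S'" for y
  proof -
    have R': "R' s y \<in> space S'" for s by (rule Y.restart_space[OF y])
    have int1: "integrable \<kappa> (\<lambda>s. ?q s y * chain \<kappa> k (R' s y))"
    proof (rule K.integrable_const_bound[of _ "1 * m ^ k"])
      show "AE s in \<kappa>. norm (?q s y * chain \<kappa> k (R' s y)) \<le> 1 * m ^ k"
        unfolding real_norm_def abs_mult using q bd[OF R'] by (intro AE_I2 mult_mono) auto
    qed (use y in measurable)
    have int2: "integrable \<kappa> (\<lambda>s. ?q s y)"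
      by (rule K.integrable_const_bound[of _ 1]) (use q y in auto)
    have int3: "integrable \<kappa> (\<lambda>s. ?q s y * d k (R' s y))"
      by (rule K.integrable_const_bound[of _ "m ^ k + G ^ k"]) (use qd_le[OF y] y in auto)
    have "chain \<kappa> (Suc k) y - G ^ Suc k
        = (\<integral>s. ?q s y * chain \<kappa> k (R' s y) \<partial>\<kappa>) - (\<integral>s. ?q s y * G ^ k \<partial>\<kappa>) + G ^ k * (chain \<kappa> 1 y - G)"
      by (simp add: algebra_simps)
    also have "(\<integral>s. ?q s y * chain \<kappa> k (R' s y) \<partial>\<kappa>) - (\<integral>s. ?q s y * G ^ k \<partial>\<kappa>)
        = (\<integral>s. ?q s y * (chain \<kappa> k (R' s y) - G ^ k) \<partial>\<kappa>)"
      using int1 integrable_mult_left[OF int2, of "G ^ k"]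
      by (subst Bochner_Integration.integral_diff[symmetric]) (auto simp: right_diff_distrib)
    finally have eq: "chain \<kappa> (Suc k) y - G ^ Suc k
        = (\<integral>s. ?q s y * (chain \<kappa> k (R' s y) - G ^ k) \<partial>\<kappa>) + G ^ k * (chain \<kappa> 1 y - G)" .
    have "d (Suc k) y \<le> \<bar>\<integral>s. ?q s y * (chain \<kappa> k (R' s y) - G ^ k) \<partial>\<kappa>\<bar> + \<bar>G ^ k * (chain \<kappa> 1 y - G)\<bar>"
      unfolding d_def eq by (rule abs_triangle_ineq)
    also have "\<bar>\<integral>s. ?q s y * (chain \<kappa> k (R' s y) - G ^ k) \<partial>\<kappa>\<bar>
        \<le> (\<integral>s. \<bar>?q s y * (chain \<kappa> k (R' s y) - G ^ k)\<bar> \<partial>\<kappa>)"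
      by (rule integral_abs_bound)
    also have "(\<integral>s. \<bar>?q s y * (chain \<kappa> k (R' s y) - G ^ k)\<bar> \<partial>\<kappa>) = (\<integral>s. ?q s y * d k (R' s y) \<partial>\<kappa>)"
      by (simp add: d_def abs_mult)
    also have "\<bar>G ^ k * (chain \<kappa> 1 y - G)\<bar> = G ^ k * d 1 y"
      using G0 by (simp add: d_def abs_mult)
    finally show ?thesis by simp
  qed
  have qd_meas: "(\<lambda>(s, y). ?q s y * d k (R' s y)) \<in> borel_measurable (\<kappa> \<Otimes>\<^sub>M S')"
    by measurable
  have Fub: "(\<integral>s. (\<integral>y. ?q s y * d k (R' s y) \<partial>S') \<partial>\<kappa>) = (\<integral>y. (\<integral>s. ?q s y * d k (R' s y) \<partial>\<kappa>) \<partial>S')"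
    "integrable S' (\<lambda>y. \<integral>s. ?q s y * d k (R' s y) \<partial>\<kappa>)"
    using bounded_Fubini[OF \<kappa> Y.finite_measure_axioms qd_meas qd_le] by auto
  have regen: "(\<integral>y. ?q s y * d k (R' s y) \<partial>S') = green s * (\<integral>y. d k y \<partial>S')" if "s \<in> T" for s
  proof -
    have "norm (X.occupation s x * d k y) \<le> m ^ k + G ^ k" if "y \<in> space S'" for x y
    proof -
      have "norm (X.occupation s x * d k y) \<le> 1 * (m ^ k + G ^ k)"
        unfolding real_norm_def abs_mult
        using d_le[OF that] by (intro mult_mono) (auto simp: X.occupation_le_1)
      then show ?thesis by simp
    qed
    from Y.regeneration_integral[OF \<open>s \<in> T\<close>, of "\<lambda>x y. X.occupation s x * d k y", OF _ this]
    have "(\<integral>y. ?q s y * d k (R' s y) \<partial>S') = (\<integral>y. (\<integral>y'. ?q s y * d k y' \<partial>S') \<partial>S')"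
      by (simp add: case_prod_unfold)
    then show ?thesis by (simp add: green_def)
  qed
  have "(\<integral>y. d (Suc k) y \<partial>S') \<le> (\<integral>y. (\<integral>s. ?q s y * d k (R' s y) \<partial>\<kappa>) + G ^ k * d 1 y \<partial>S')"
    using pointwise d_int Fub(2) by (intro integral_mono) auto
  also have "\<dots> = (\<integral>s. (\<integral>y. ?q s y * d k (R' s y) \<partial>S') \<partial>\<kappa>) + G ^ k * (\<integral>y. d 1 y \<partial>S')"
    using Fub d_int by simp
  also have "(\<integral>s. (\<integral>y. ?q s y * d k (R' s y) \<partial>S') \<partial>\<kappa>) = (\<integral>s. green s * (\<integral>y. d k y \<partial>S') \<partial>\<kappa>)"
    by (rule integral_cong_AE) (use T regen in \<open>auto elim: eventually_mono\<close>)
  also have "\<dots> = G * (\<integral>y. d k y \<partial>S')"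
    by (simp add: G_def mean_chain_def)
  finally show ?thesis by (simp add: d_def)
qed

lemma chain_L1:
  assumes \<kappa>: "finite_measure \<kappa>" and sets: "sets \<kappa> = sets borel" and T: "AE s in \<kappa>. s \<in> T"
  defines "G \<equiv> mean_chain \<kappa>"
  shows "(\<integral>y. \<bar>chain \<kappa> (Suc k) y - G ^ Suc k\<bar> \<partial>S') \<le> real (Suc k) * G ^ k * (\<integral>y. \<bar>chain \<kappa> 1 y - G\<bar> \<partial>S')"
proof (induction k)
  case (Suc k)
  let ?e = "\<integral>y. \<bar>chain \<kappa> 1 y - G\<bar> \<partial>S'"
  have "G \<ge> 0" unfolding G_def by (rule mean_chain_nonneg)
  have "(\<integral>y. \<bar>chain \<kappa> (Suc (Suc k)) y - G ^ Suc (Suc k)\<bar> \<partial>S')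
      \<le> G * (\<integral>y. \<bar>chain \<kappa> (Suc k) y - G ^ Suc k\<bar> \<partial>S') + G ^ Suc k * ?e"
    unfolding G_def by (rule chain_L1_step[OF \<kappa> sets T])
  also have "\<dots> \<le> G * (real (Suc k) * G ^ k * ?e) + G ^ Suc k * ?e"
    using Suc \<open>G \<ge> 0\<close> by (intro add_right_mono mult_left_mono)
  also have "\<dots> = real (Suc (Suc k)) * G ^ Suc k * ?e"
    by (simp add: algebra_simps)
  finally show ?case .
qed simp

end

text \<open>The rates \<open>h\<close> and \<open>h'\<close> measure how far the characteristic functions of the steps of the two walks are from modulus
  \<open>1\<close>; they are the exponential rates of decay in time.\<close>

locale collision_decay = collision S \<Phi> R T W S' \<Phi>' R' W'
  for S :: "'s measure" and \<Phi> R T W and S' :: "'r measure" and \<Phi>' R' W' +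
  fixes h h' :: "real \<times> real \<Rightarrow> real" and C :: real
  assumes measurable_rates [measurable]: "h \<in> borel_measurable borel" "h' \<in> borel_measurable borel"
    and rate_nonneg: "0 \<le> h' \<theta>"
    and X_step_le: "s \<in> T \<Longrightarrow> norm (X.step_char s \<theta>) \<le> exp (- (s * h \<theta>))"
    and Y_step_le: "s \<in> T \<Longrightarrow> norm (Y.step_char s \<theta>) \<le> exp (- (s * h' \<theta>))"
    and Y_spread_le: "s \<in> T \<Longrightarrow> 1 - (norm (Y.step_char s \<theta>))\<^sup>2 \<le> 2 * s * h' \<theta>"
    and X_decay: "u > 0 \<Longrightarrow> (\<integral>\<^sup>+\<theta>. ennreal (exp (- (u * h \<theta>))) \<partial>torus) \<le> ennreal (C / u)"
    and C_ge_1: "1 \<le> C"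
begin

lemma integral_X_decay:
  assumes "u > 0"
  shows "(\<integral>\<theta>. exp (- (u * h \<theta>)) \<partial>torus) \<le> C / u" and "integrable torus (\<lambda>\<theta>. exp (- (u * h \<theta>)))"
proof -
  show "(\<integral>\<theta>. exp (- (u * h \<theta>)) \<partial>torus) \<le> C / u"
    using C_ge_1 assms by (intro integral_real_bounded X_decay) auto
  show "integrable torus (\<lambda>\<theta>. exp (- (u * h \<theta>)))"
    using le_less_trans[OF X_decay[OF assms]] by (intro integrableI_nonneg) auto
qed

lemma integrable_norm_step: "integrable torus (\<lambda>\<theta>. norm (X.step_char u \<theta>))"
  by (rule torus.integrable_const_bound[of _ 1]) (auto simp: X.norm_step_char_le)

lemma integral_norm_step_le:
  assumes "u \<in> T"
  shows "(\<integral>\<theta>. norm (X.step_char u \<theta>) \<partial>torus) \<le> C / max 1 u"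
proof (cases "u \<le> 1")
  case True
  have "(\<integral>\<theta>. norm (X.step_char u \<theta>) \<partial>torus) \<le> (\<integral>\<theta>. 1 \<partial>torus)"
    by (intro integral_mono integrable_norm_step) (auto simp: X.norm_step_char_le)
  also have "\<dots> \<le> C / max 1 u" using True C_ge_1 torus.prob_space by simp
  finally show ?thesis .
next
  case False
  then have "u > 0" by simp
  have "(\<integral>\<theta>. norm (X.step_char u \<theta>) \<partial>torus) \<le> (\<integral>\<theta>. exp (- (u * h \<theta>)) \<partial>torus)"
    by (intro integral_mono integrable_norm_step integral_X_decay \<open>u > 0\<close> X_step_le assms)
  also have "\<dots> \<le> C / max 1 u" using integral_X_decay(1)[OF \<open>u > 0\<close>] False by simp
  finally show ?thesis .
qed

lemma occupation_le:
  assumes "u \<in> T"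
  shows "X.occupation u x \<le> C / max 1 u"
proof -
  have "X.occupation u x = norm (complex_of_real (X.occupation u x))" by simp
  also have "\<dots> \<le> (\<integral>\<theta>. norm (cnj (character \<theta> x) * X.step_char u \<theta>) \<partial>torus)"
    unfolding X.occupation_Fourier by (rule integral_norm_bound)
  also have "\<dots> = (\<integral>\<theta>. norm (X.step_char u \<theta>) \<partial>torus)" by (simp add: norm_mult)
  also have "\<dots> \<le> C / max 1 u" by (rule integral_norm_step_le[OF assms])
  finally show ?thesis .
qed

lemma integrable_occupation: "integrable S' (\<lambda>y. X.occupation s (\<Phi>' s y))"
  by (rule Y.integrable_const_bound[of _ 1]) (auto simp: X.occupation_le_1)

lemma green_le:
  assumes "u \<in> T"
  shows "green u \<le> C / max 1 u"
proof -
  have "green u \<le> (\<integral>y. C / max 1 u \<partial>S')"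
    unfolding green_def by (intro integral_mono integrable_occupation) (auto simp: occupation_le assms)
  then show ?thesis by (simp add: Y.prob_space)
qed

text \<open>The centred occupation probability: at \<open>x = \<Phi>' s y\<close> its mean over \<open>y\<close> is zero.\<close>

definition excess :: "real \<Rightarrow> int ^ 2 \<Rightarrow> real" where
  "excess s x = X.occupation s x - green s"

lemma measurable_excess [measurable (raw)]:
  assumes "f \<in> M \<rightarrow>\<^sub>M borel" "g \<in> M \<rightarrow>\<^sub>M count_space UNIV"
  shows "(\<lambda>z. excess (f z) (g z)) \<in> borel_measurable M"
  unfolding excess_def using assms by measurable

lemma abs_excess_le: "s \<in> T \<Longrightarrow> \<bar>excess s x\<bar> \<le> C / max 1 s"
  unfolding excess_def
  using occupation_le[of s x] green_le[of s] green_nonneg[of s] X.occupation_nonneg[of s x] by linarith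

lemma abs_excess_le_1: "\<bar>excess s x\<bar> \<le> 1"
  unfolding excess_def
  using X.occupation_le_1[of s x] green_le_1[of s] green_nonneg[of s] X.occupation_nonneg[of s x] by linarith

definition fluctuation :: "real \<Rightarrow> real \<times> real \<Rightarrow> 'r \<Rightarrow> complex" where
  "fluctuation u \<theta> y = cnj (character \<theta> (\<Phi>' u y)) - cnj (Y.step_char u \<theta>)"

lemma measurable_fluctuation [measurable (raw)]:
  assumes [measurable]: "f \<in> M \<rightarrow>\<^sub>M borel" "g \<in> M \<rightarrow>\<^sub>M borel" "k \<in> M \<rightarrow>\<^sub>M S'"
  shows "(\<lambda>z. fluctuation (f z) (g z) (k z)) \<in> borel_measurable M"
  unfolding fluctuation_def by measurable

lemma norm_fluctuation: "norm (fluctuation u \<theta> y) = norm (character \<theta> (\<Phi>' u y) - Y.step_char u \<theta>)"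
  unfolding fluctuation_def by (metis complex_cnj_diff complex_mod_cnj)

lemma norm_fluctuation_le: "norm (fluctuation u \<theta> y) \<le> 2"
  unfolding norm_fluctuation
  using norm_triangle_ineq4[of "character \<theta> (\<Phi>' u y)" "Y.step_char u \<theta>"] Y.norm_step_char_le[of u \<theta>] by simp

abbreviation spread :: "real \<Rightarrow> real \<times> real \<Rightarrow> real" where
  "spread s \<theta> \<equiv> sqrt (1 - (norm (Y.step_char s \<theta>))\<^sup>2)"

abbreviation covariance_weight :: "real \<Rightarrow> real \<Rightarrow> real \<times> real \<Rightarrow> real" where
  "covariance_weight s u \<theta> \<equiv> norm (X.step_char u \<theta>) * (norm (Y.step_char (u - s) \<theta>) * spread s \<theta>)"

lemma integral_norm_fluctuation_le:
  "(\<integral>y. norm (fluctuation u \<theta> y) \<partial>S') \<le> spread u \<theta>"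
  unfolding norm_fluctuation by (rule Y.step_char_spread)

lemma green_Fourier:
  "complex_of_real (green u) = (\<integral>\<theta>. cnj (Y.step_char u \<theta>) * X.step_char u \<theta> \<partial>torus)"
proof -
  let ?f = "\<lambda>y \<theta>. cnj (character \<theta> (\<Phi>' u y)) * X.step_char u \<theta>"
  have f_le: "norm (?f y \<theta>) \<le> 1" for y \<theta>
    by (simp add: norm_mult X.norm_step_char_le)
  have "complex_of_real (green u) = (\<integral>y. complex_of_real (X.occupation u (\<Phi>' u y)) \<partial>S')"
    by (simp add: green_def)
  also have "\<dots> = (\<integral>y. (\<integral>\<theta>. ?f y \<theta> \<partial>torus) \<partial>S')"
    by (simp only: X.occupation_Fourier)
  also have "\<dots> = (\<integral>\<theta>. (\<integral>y. ?f y \<theta> \<partial>S') \<partial>torus)"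
    by (rule bounded_Fubini(1)[OF Y.finite_measure_axioms torus.finite_measure_axioms _ f_le])
       (simp add: case_prod_unfold)
  also have "\<dots> = (\<integral>\<theta>. cnj (Y.step_char u \<theta>) * X.step_char u \<theta> \<partial>torus)"
    by (simp add: Y.step_char_def)
  finally show ?thesis .
qed

text \<open>Both terms of the excess have Fourier representations with the same factor for \<open>X\<close>; only the factor of \<open>Y\<close> is centred.\<close>

lemma excess_Fourier:
  "complex_of_real (excess u (\<Phi>' u y)) = (\<integral>\<theta>. X.step_char u \<theta> * fluctuation u \<theta> y \<partial>torus)"
proof -
  let ?f = "\<lambda>\<theta>. cnj (character \<theta> (\<Phi>' u y)) * X.step_char u \<theta>"
  have int1: "integrable torus ?f"
    by (rule torus.integrable_const_bound[of _ 1]) (auto simp: norm_mult X.norm_step_char_le)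
  have "norm (cnj (Y.step_char u \<theta>) * X.step_char u \<theta>) \<le> 1 * 1" for \<theta>
    unfolding norm_mult by (intro mult_mono) (auto simp: X.norm_step_char_le Y.norm_step_char_le)
  then have int2: "integrable torus (\<lambda>\<theta>. cnj (Y.step_char u \<theta>) * X.step_char u \<theta>)"
    by (intro torus.integrable_const_bound[of _ "1 * 1"] AE_I2) auto
  have "complex_of_real (excess u (\<Phi>' u y))
      = (\<integral>\<theta>. ?f \<theta> \<partial>torus) - (\<integral>\<theta>. cnj (Y.step_char u \<theta>) * X.step_char u \<theta> \<partial>torus)"
    by (simp only: excess_def of_real_diff X.occupation_Fourier green_Fourier)
  also have "\<dots> = (\<integral>\<theta>. ?f \<theta> - cnj (Y.step_char u \<theta>) * X.step_char u \<theta> \<partial>torus)"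
    by (rule Bochner_Integration.integral_diff[symmetric, OF int1 int2])
  also have "\<dots> = (\<integral>\<theta>. X.step_char u \<theta> * fluctuation u \<theta> y \<partial>torus)"
    by (intro Bochner_Integration.integral_cong) (auto simp: fluctuation_def algebra_simps)
  finally show ?thesis .
qed

text \<open>The Markov property at time \<open>s\<close> takes the factor belonging to \<open>[s, u]\<close> out of the mean.\<close>

lemma excess_fluctuation_factor:
  assumes s: "s \<in> T" and u: "u \<in> T" and su: "s \<le> u"
  shows "(\<integral>y. complex_of_real (excess s (\<Phi>' s y)) * fluctuation u \<theta> y \<partial>S')
    = cnj (Y.step_char (u - s) \<theta>) * (\<integral>y. complex_of_real (excess s (\<Phi>' s y)) * fluctuation s \<theta> y \<partial>S')"
proof -
  let ?e = "\<lambda>y. complex_of_real (excess s (\<Phi>' s y))"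
  have us: "u - s \<in> T" using X.T_diff[OF s u su] .
  have step: "Y.step_char u \<theta> = Y.step_char s \<theta> * Y.step_char (u - s) \<theta>"
    using Y.step_char_add[OF s us, of \<theta>] by simp
  define F where "F x y = complex_of_real (excess s x) * (cnj (character \<theta> x) * cnj (character \<theta> (\<Phi>' (u - s) y)) - cnj (Y.step_char u \<theta>))" for x y
  have F_le: "norm (F x y) \<le> 1 * 2" for x y
    unfolding F_def norm_mult
  proof (intro mult_mono)
    have "norm (cnj (character \<theta> x) * cnj (character \<theta> (\<Phi>' (u - s) y)) - cnj (Y.step_char u \<theta>))
      \<le> norm (cnj (character \<theta> x) * cnj (character \<theta> (\<Phi>' (u - s) y))) + norm (cnj (Y.step_char u \<theta>))"
      by (rule norm_triangle_ineq4)
    then show "norm (cnj (character \<theta> x) * cnj (character \<theta> (\<Phi>' (u - s) y)) - cnj (Y.step_char u \<theta>)) \<le> 2"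
      using Y.norm_step_char_le[of u \<theta>] by (simp add: norm_mult)
  qed (auto simp: abs_excess_le_1)
  have "(\<integral>y. (?e y) * fluctuation u \<theta> y \<partial>S') = (\<integral>y. F (\<Phi>' s y) (R' s y) \<partial>S')"
  proof (rule integral_cong_AE)
    show "AE y in S'. (?e y) * fluctuation u \<theta> y = F (\<Phi>' s y) (R' s y)"
      using Y.AE_W AE_space
    proof eventually_elim
      case (elim y)
      have "\<Phi>' u y = \<Phi>' s y + \<Phi>' (u - s) (R' s y)"
        using Y.position_add[OF s us elim] by simp
      then show ?case by (simp add: F_def fluctuation_def character_add)
    qed
    show "(\<lambda>y. F (\<Phi>' s y) (R' s y)) \<in> borel_measurable S'" unfolding F_def by measurable
  qed measurable
  also have "\<dots> = (\<integral>y. (\<integral>y'. F (\<Phi>' s y) y' \<partial>S') \<partial>S')"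
    by (rule Y.regeneration_integral[OF s _ F_le]) (simp add: F_def case_prod_unfold)
  also have "\<dots> = (\<integral>y. cnj (Y.step_char (u - s) \<theta>) * ((?e y) * fluctuation s \<theta> y) \<partial>S')"
  proof (rule Bochner_Integration.integral_cong[OF refl])
    fix y
    have int: "integrable S' (\<lambda>y'. cnj (character \<theta> x) * cnj (character \<theta> (\<Phi>' (u - s) y')))" for x
      by (rule Y.integrable_const_bound[of _ 1]) (auto simp: norm_mult)
    have "(\<integral>y'. F (\<Phi>' s y) y' \<partial>S') = (?e y)
        * (cnj (character \<theta> (\<Phi>' s y)) * cnj (Y.step_char (u - s) \<theta>) - cnj (Y.step_char u \<theta>))"
      unfolding F_def using int[of "\<Phi>' s y"] Y.prob_space by (simp add: Y.step_char_def)
    then show "(\<integral>y'. F (\<Phi>' s y) y' \<partial>S') = cnj (Y.step_char (u - s) \<theta>) * ((?e y) * fluctuation s \<theta> y)"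
      by (simp add: step fluctuation_def algebra_simps)
  qed
  finally show ?thesis by simp
qed

definition covariance :: "real \<Rightarrow> real \<Rightarrow> real" where
  "covariance s u = (\<integral>y. excess s (\<Phi>' s y) * excess u (\<Phi>' u y) \<partial>S')"

lemma covariance_commute: "covariance s u = covariance u s"
  by (simp add: covariance_def mult.commute)

text \<open>The Fourier representation is used for the later time \<open>u\<close> only. At the earlier time \<open>s\<close> the supremum bound of the
  excess is kept, and the spread of the character of \<open>Y\<close> at time \<open>s\<close> remains as a factor.\<close>

lemma covariance_Fourier_bound:
  assumes s: "s \<in> T" and u: "u \<in> T" and su: "s \<le> u"
  shows "\<bar>covariance s u\<bar> \<le> C / max 1 s * (\<integral>\<theta>. covariance_weight s u \<theta> \<partial>torus)"
proof -
  let ?e = "\<lambda>y. complex_of_real (excess s (\<Phi>' s y))"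
  let ?f = "\<lambda>y \<theta>. ?e y * (X.step_char u \<theta> * fluctuation u \<theta> y)"
  let ?g = "\<lambda>\<theta>. X.step_char u \<theta> * (cnj (Y.step_char (u - s) \<theta>) * (\<integral>y. ?e y * fluctuation s \<theta> y \<partial>S'))"
  have f_le: "norm (?f y \<theta>) \<le> 1 * (1 * 2)" for y \<theta>
    unfolding norm_mult by (intro mult_mono) (auto simp: abs_excess_le_1 X.norm_step_char_le norm_fluctuation_le)
  have "complex_of_real (covariance s u) = (\<integral>y. complex_of_real (excess s (\<Phi>' s y) * excess u (\<Phi>' u y)) \<partial>S')"
    by (simp only: covariance_def integral_complex_of_real)
  also have "\<dots> = (\<integral>y. (\<integral>\<theta>. ?f y \<theta> \<partial>torus) \<partial>S')"
    by (simp only: of_real_mult excess_Fourier[of u] integral_mult_right_zero)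
  also have "\<dots> = (\<integral>\<theta>. (\<integral>y. ?f y \<theta> \<partial>S') \<partial>torus)"
    by (rule bounded_Fubini(1)[OF Y.finite_measure_axioms torus.finite_measure_axioms _ f_le])
       (simp add: case_prod_unfold)
  also have "\<dots> = (\<integral>\<theta>. ?g \<theta> \<partial>torus)"
  proof (rule Bochner_Integration.integral_cong[OF refl])
    fix \<theta>
    have "(\<integral>y. ?f y \<theta> \<partial>S') = (\<integral>y. X.step_char u \<theta> * (?e y * fluctuation u \<theta> y) \<partial>S')"
      by (simp add: mult_ac)
    then show "(\<integral>y. ?f y \<theta> \<partial>S') = ?g \<theta>"
      by (simp only: integral_mult_right_zero excess_fluctuation_factor[OF s u su])
  qed
  finally have eq: "complex_of_real (covariance s u)
      = (\<integral>\<theta>. ?g \<theta> \<partial>torus)" .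
  have inner: "norm (\<integral>y. ?e y * fluctuation s \<theta> y \<partial>S') \<le> C / max 1 s * spread s \<theta>" for \<theta>
  proof -
    have int: "integrable S' (\<lambda>y. norm (fluctuation s \<theta> y))"
      by (rule Y.integrable_const_bound[of _ 2]) (auto simp: norm_fluctuation_le)
    have "norm (\<integral>y. ?e y * fluctuation s \<theta> y \<partial>S') \<le> (\<integral>y. norm (?e y * fluctuation s \<theta> y) \<partial>S')"
      by (rule integral_norm_bound)
    also have "\<dots> \<le> (\<integral>y. C / max 1 s * norm (fluctuation s \<theta> y) \<partial>S')"
    proof (rule integral_mono)
      have "norm (?e y * fluctuation s \<theta> y) \<le> 1 * 2" for y
        unfolding norm_mult by (intro mult_mono) (auto simp: abs_excess_le_1 norm_fluctuation_le)
      then show "integrable S' (\<lambda>y. norm (?e y * fluctuation s \<theta> y))"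
        by (intro Y.integrable_const_bound[of _ "1 * 2"] AE_I2) auto
      show "norm (?e y * fluctuation s \<theta> y) \<le> C / max 1 s * norm (fluctuation s \<theta> y)" for y
        unfolding norm_mult using abs_excess_le[OF s] by (intro mult_right_mono) auto
    qed (use int in simp)
    also have "\<dots> = C / max 1 s * (\<integral>y. norm (fluctuation s \<theta> y) \<partial>S')" by (rule integral_mult_right_zero)
    also have "\<dots> \<le> C / max 1 s * spread s \<theta>"
      using C_ge_1 by (intro mult_left_mono integral_norm_fluctuation_le) auto
    finally show ?thesis .
  qed
  have sq: "0 \<le> spread s \<theta> \<and> spread s \<theta> \<le> 1" for \<theta>
    using Y.norm_step_char_le[of s \<theta>] by (auto simp: power_le_one)
  have "\<bar>covariance s u\<bar> = norm (complex_of_real (covariance s u))" by simp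
  also have "\<dots> \<le> (\<integral>\<theta>. norm (?g \<theta>) \<partial>torus)"
    unfolding eq by (rule integral_norm_bound)
  also have "\<dots> \<le> (\<integral>\<theta>. C / max 1 s * (covariance_weight s u \<theta>) \<partial>torus)"
  proof (rule integral_mono)
    have le: "norm (?g \<theta>)
      \<le> C / max 1 s * (covariance_weight s u \<theta>)" for \<theta>
    proof -
      have "norm (?g \<theta>)
         \<le> norm (X.step_char u \<theta>) * (norm (Y.step_char (u - s) \<theta>) * (C / max 1 s * spread s \<theta>))"
        unfolding norm_mult complex_mod_cnj by (intro mult_left_mono inner) auto
      then show ?thesis by (simp add: mult_ac)
    qed
    then show "norm (?g \<theta>)
      \<le> C / max 1 s * (covariance_weight s u \<theta>)" for \<theta> .
    have prod1: "covariance_weight s u \<theta> \<le> 1 * (1 * 1)" for \<theta>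
      using sq[of \<theta>] by (intro mult_mono) (auto simp: X.norm_step_char_le Y.norm_step_char_le)
    have prod0: "0 \<le> covariance_weight s u \<theta>" for \<theta>
      using sq[of \<theta>] by simp
    show int: "integrable torus (\<lambda>\<theta>. C / max 1 s * (covariance_weight s u \<theta>))"
      by (intro integrable_mult_right torus.integrable_const_bound[of _ 1] AE_I2)
         (use prod0 prod1 in \<open>auto simp: abs_of_nonneg\<close>)
    show "integrable torus (\<lambda>\<theta>. norm (?g \<theta>))"
    proof (rule Bochner_Integration.integrable_bound[OF int])
      show "AE \<theta> in torus. norm (norm (?g \<theta>))
        \<le> norm (C / max 1 s * (covariance_weight s u \<theta>))"
        by (rule AE_I2) (simp only: real_norm_def abs_norm_cancel, rule order_trans[OF le], simp only: abs_ge_self)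
    qed measurable
  qed
  also have "\<dots> = C / max 1 s * (\<integral>\<theta>. covariance_weight s u \<theta> \<partial>torus)"
    by (rule integral_mult_right_zero)
  finally show ?thesis .
qed

abbreviation covariance_bound :: "real \<Rightarrow> real \<Rightarrow> real" where
  "covariance_bound s u \<equiv> 4 * C\<^sup>2 * (1 / sqrt (max 1 s) * (1 / (max 1 u * sqrt (max 1 u))))"

text \<open>For \<open>u \<le> 2 * max 1 s\<close> the decay of the occupation probabilities alone suffices. For larger \<open>u\<close>, the spread at time \<open>s\<close> is of
  order \<open>sqrt (s * h')\<close>, while the factor of the time between \<open>s\<close> and \<open>u\<close> decays like \<open>exp (- (u / 2 * h'))\<close>; their product
  is of order \<open>sqrt (s / u)\<close>, and this gain makes the covariances summable up to a logarithm.\<close>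

lemma covariance_le:
  assumes s: "s \<in> T" and u: "u \<in> T" and su: "s \<le> u"
  shows "\<bar>covariance s u\<bar> \<le> covariance_bound s u"
proof -
  define a where "a = max 1 s"
  define b where "b = max 1 u"
  have ab: "a \<ge> 1" "b \<ge> 1" "a \<le> b" "s \<le> a" using su by (auto simp: a_def b_def)
  have C: "C > 0" using C_ge_1 by simp
  have sq: "0 \<le> spread s \<theta> \<and> spread s \<theta> \<le> 1" for \<theta>
    using Y.norm_step_char_le[of s \<theta>] by (auto simp: power_le_one)
  let ?J = "\<integral>\<theta>. covariance_weight s u \<theta> \<partial>torus"
  have le1: "norm (Y.step_char (u - s) \<theta>) * spread s \<theta> \<le> 1" for \<theta>
    using sq[of \<theta>] Y.norm_step_char_le[of "u - s" \<theta>] by (intro mult_le_one) auto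
  have prod_le: "covariance_weight s u \<theta> \<le> norm (X.step_char u \<theta>)" for \<theta>
    using le1[of \<theta>] by (intro mult_left_le) auto
  have int: "integrable torus (\<lambda>\<theta>. covariance_weight s u \<theta>)"
    by (rule Bochner_Integration.integrable_bound[OF integrable_norm_step[of u]])
       (use prod_le sq in \<open>auto simp: abs_mult\<close>)
  have J: "?J \<le> 4 * C * (sqrt a / (b * sqrt b))"
  proof (cases "u \<le> 2 * a")
    case True
    have "?J \<le> (\<integral>\<theta>. norm (X.step_char u \<theta>) \<partial>torus)"
      by (intro integral_mono int integrable_norm_step prod_le)
    also have "\<dots> \<le> C / b" unfolding b_def by (rule integral_norm_step_le[OF u])
    also have "\<dots> \<le> 4 * C * (sqrt a / (b * sqrt b))"
    proof -
      have "sqrt b \<le> sqrt (4 * a)" using True ab by (intro real_sqrt_le_mono) (auto simp: b_def)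
      also have "sqrt (4 * a) = 2 * sqrt a" by (simp add: real_sqrt_mult)
      finally have "sqrt b \<le> 4 * sqrt a" using ab by (smt (verit) real_sqrt_ge_one)
      then have "C * sqrt b \<le> C * (4 * sqrt a)" using C by (intro mult_left_mono) auto
      then show ?thesis using ab by (simp add: field_simps)
    qed
    finally show ?thesis .
  next
    case False
    then have u2: "u > 2" "b = u" "s \<le> u / 2" using ab by (auto simp: b_def)
    have us: "u - s \<in> T" using X.T_diff[OF s u su] .
    have "?J \<le> (\<integral>\<theta>. sqrt (2 * a / u) * exp (- (u * h \<theta>)) \<partial>torus)"
    proof (intro integral_mono int integrable_mult_right integral_X_decay)
      fix \<theta>
      define x where "x = u * h' \<theta>"
      have "x \<ge> 0" using u2 rate_nonneg by (simp add: x_def)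
      have "norm (Y.step_char (u - s) \<theta>) \<le> exp (- ((u - s) * h' \<theta>))" by (rule Y_step_le[OF us])
      also have "\<dots> \<le> exp (- (u / 2 * h' \<theta>))"
        using mult_right_mono[of "u / 2" "u - s" "h' \<theta>"] u2 rate_nonneg[of \<theta>] by simp
      finally have 1: "norm (Y.step_char (u - s) \<theta>) \<le> exp (- (x / 2))" by (simp add: x_def)
      have "1 - (norm (Y.step_char s \<theta>))\<^sup>2 \<le> 2 * s * h' \<theta>" by (rule Y_spread_le[OF s])
      also have "\<dots> \<le> 2 * a * h' \<theta>" using ab rate_nonneg by (intro mult_right_mono) auto
      also have "\<dots> = 2 * a / u * x" using u2 by (simp add: x_def)
      finally have "spread s \<theta> \<le> sqrt (2 * a / u) * sqrt x"
        using real_sqrt_le_mono by (simp add: real_sqrt_mult[symmetric])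
      with 1 have "norm (Y.step_char (u - s) \<theta>) * spread s \<theta>
          \<le> exp (- (x / 2)) * (sqrt (2 * a / u) * sqrt x)"
        using sq[of \<theta>] by (intro mult_mono) auto
      also have "\<dots> = sqrt (2 * a / u) * (sqrt x * exp (- (x / 2)))" by simp
      also have "\<dots> \<le> sqrt (2 * a / u) * 1"
      proof (rule mult_left_mono)
        have "sqrt x \<le> sqrt (exp x)" using exp_ge_add_one_self[of x] by (intro real_sqrt_le_mono) linarith
        also have "sqrt (exp x) = exp (x / 2)" by (rule real_sqrt_unique) (simp_all add: power2_eq_square mult_exp_exp)
        finally show "sqrt x * exp (- (x / 2)) \<le> 1" by (simp add: exp_minus field_simps)
      qed (use ab u2 in auto)
      finally have "norm (Y.step_char (u - s) \<theta>) * spread s \<theta> \<le> sqrt (2 * a / u)" by simp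
      with X_step_le[OF u, of \<theta>]
      have "covariance_weight s u \<theta>
          \<le> exp (- (u * h \<theta>)) * sqrt (2 * a / u)"
        using sq[of \<theta>] by (intro mult_mono) auto
      then show "covariance_weight s u \<theta>
          \<le> sqrt (2 * a / u) * exp (- (u * h \<theta>))" by (simp add: mult.commute)
    qed (use u2 in auto)
    also have "\<dots> = sqrt (2 * a / u) * (\<integral>\<theta>. exp (- (u * h \<theta>)) \<partial>torus)" by simp
    also have "\<dots> \<le> sqrt (2 * a / u) * (C / u)"
      using u2 ab by (intro mult_left_mono integral_X_decay) auto
    also have "\<dots> \<le> 4 * sqrt (a / u) * (C / u)"
    proof (rule mult_right_mono)
      have "sqrt (2 * a / u) \<le> sqrt (16 * (a / u))" using ab u2 by (intro real_sqrt_le_mono) (simp add: field_simps)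
      also have "\<dots> = 4 * sqrt (a / u)" by (simp only: real_sqrt_mult) simp
      finally show "sqrt (2 * a / u) \<le> 4 * sqrt (a / u)" .
    qed (use C u2 in auto)
    also have "\<dots> = 4 * C * (sqrt a / (b * sqrt b))"
      using u2 by (simp add: real_sqrt_divide mult_ac)
    finally show ?thesis .
  qed
  have "\<bar>covariance s u\<bar> \<le> C / a * ?J"
    unfolding a_def by (rule covariance_Fourier_bound[OF s u su])
  also have "\<dots> \<le> C / a * (4 * C * (sqrt a / (b * sqrt b)))"
    using C ab by (intro mult_left_mono J) auto
  also have "\<dots> = 4 * C\<^sup>2 * (1 / sqrt a * (1 / (b * sqrt b)))"
  proof -
    have "a = sqrt a * sqrt a" using ab by simp
    then have "sqrt a / a = 1 / sqrt a" using ab by (metis real_div_sqrt divide_divide_eq_left divide_self_if mult.commute not_one_le_zero real_sqrt_eq_zero_cancel_iff)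
    moreover have "C / a * (4 * C * (sqrt a / (b * sqrt b))) = 4 * C\<^sup>2 * (sqrt a / a * (1 / (b * sqrt b)))"
      by (simp add: power2_eq_square mult_ac)
    ultimately show ?thesis by simp
  qed
  finally show ?thesis by (simp add: a_def b_def)
qed

end

section \<open>Almost sure convergence of the chains\<close>

lemma (in finite_measure) AE_tendsto_0_if_summable:
  fixes f :: "nat \<Rightarrow> 'a \<Rightarrow> real"
  assumes int: "\<And>n. integrable M (f n)" and nonneg: "\<And>n x. 0 \<le> f n x"
    and le: "\<forall>\<^sub>F n in sequentially. (\<integral>x. f n x \<partial>M) \<le> c n" and c: "summable c"
  shows "AE x in M. (\<lambda>n. f n x) \<longlonglongrightarrow> 0"
proof -
  obtain N where N: "\<And>n. N \<le> n \<Longrightarrow> (\<integral>x. f n x \<partial>M) \<le> c n"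
    using le by (auto simp: eventually_sequentially)
  have [measurable]: "f n \<in> borel_measurable M" for n using int by auto
  have c0: "0 \<le> c (n + N)" for n
    using order_trans[OF Bochner_Integration.integral_nonneg N[of "n + N"]] nonneg by simp
  have "(\<integral>\<^sup>+x. (\<Sum>n. ennreal (f (n + N) x)) \<partial>M) = (\<Sum>n. \<integral>\<^sup>+x. ennreal (f (n + N) x) \<partial>M)"
    by (rule nn_integral_suminf) simp
  also have "\<dots> = (\<Sum>n. ennreal (\<integral>x. f (n + N) x \<partial>M))"
    by (intro suminf_cong nn_integral_eq_integral int) (simp add: nonneg)
  also have "\<dots> \<le> (\<Sum>n. ennreal (c (n + N)))"
    by (intro suminf_le ennreal_leI N) auto
  also have "\<dots> = ennreal (\<Sum>n. c (n + N))"
    using c c0 by (intro suminf_ennreal2) (auto simp: summable_iff_shift)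
  also have "\<dots> < \<infinity>" by simp
  finally have "AE x in M. (\<Sum>n. ennreal (f (n + N) x)) \<noteq> \<infinity>"
    by (intro nn_integral_PInf_AE) auto
  then show ?thesis
  proof eventually_elim
    case (elim x)
    then have "summable (\<lambda>n. f (n + N) x)"
      using nonneg by (intro summable_suminf_not_top) auto
    then have "(\<lambda>n. f (n + N) x) \<longlonglongrightarrow> 0" by (rule summable_LIMSEQ_zero)
    then show ?case by (rule LIMSEQ_offset)
  qed
qed

text \<open>For a monotone function, convergence relative to a power of the logarithm need only be checked along
  a sequence of times whose logarithms have consecutive ratios tending to \<open>1\<close>.\<close>

lemma log_power_interpolation:
  fixes f :: "real \<Rightarrow> real"
  assumes mono: "\<And>s t. 1 \<le> s \<Longrightarrow> s \<le> t \<Longrightarrow> f s \<le> f t" and nonneg: "\<And>s. 0 \<le> f s"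
    and lim: "(\<lambda>n. f (exp (real n ^ 3)) / (real n ^ 3) ^ k) \<longlonglongrightarrow> L"
  shows "((\<lambda>t. f t / ln t ^ k) \<longlongrightarrow> L) at_top"
proof -
  \<comment> \<open>The index of the last time \<open>exp (n ^ 3)\<close> that is not after \<open>t\<close>.\<close>
  define m where "m t = nat \<lfloor>ln t powr (1 / 3)\<rfloor>" for t :: real
  define q where "q n = f (exp (real n ^ 3)) / (real n ^ 3) ^ k" for n
  have m_lim: "filterlim m at_top at_top"
  proof -
    have "filterlim (\<lambda>t :: real. ln t powr (1 / 3)) at_top at_top" by real_asymp
    then show ?thesis unfolding m_def
      by (intro filterlim_compose[OF filterlim_nat_sequentially] filterlim_compose[OF filterlim_floor_sequentially])
  qed
  have bounds: "\<forall>\<^sub>F t in at_top. 1 \<le> m t \<and> real (m t) ^ 3 \<le> ln t \<and> ln t \<le> real (Suc (m t)) ^ 3"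
  proof -
    have "\<forall>\<^sub>F t in at_top. 1 \<le> m t" using m_lim by (simp add: filterlim_at_top)
    moreover have "\<forall>\<^sub>F t :: real in at_top. ln t > 0" by real_asymp
    ultimately show ?thesis
    proof eventually_elim
      case (elim t)
      let ?x = "ln t powr (1 / 3)"
      have x3: "?x ^ 3 = ln t"
        using elim by (simp add: powr_power)
      have "real (m t) \<le> ?x" "?x \<le> real (Suc (m t))"
        unfolding m_def by (simp_all add: of_nat_nat) linarith
      then have "real (m t) ^ 3 \<le> ?x ^ 3" "?x ^ 3 \<le> real (Suc (m t)) ^ 3"
        by (auto intro!: power_mono)
      then show ?case using x3 elim by simp
    qed
  qed
  have ratio: "(\<lambda>n. (real n ^ 3 / real (Suc n) ^ 3) ^ k) \<longlonglongrightarrow> 1"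
  proof -
    have "(\<lambda>n. real n ^ 3 / real (Suc n) ^ 3) \<longlonglongrightarrow> 1" by real_asymp
    from tendsto_power[OF this, of k] show ?thesis by simp
  qed
  have q_Suc: "(\<lambda>n. q (Suc n)) \<longlonglongrightarrow> L"
    using lim unfolding q_def by (rule LIMSEQ_Suc)
  show ?thesis
  proof (rule tendsto_sandwich)
    show "\<forall>\<^sub>F t in at_top. q (m t) * (real (m t) ^ 3 / real (Suc (m t)) ^ 3) ^ k \<le> f t / ln t ^ k"
      using bounds eventually_ge_at_top[of 1]
    proof eventually_elim
      case (elim t)
      have pos: "real (m t) ^ 3 > 0" "ln t > 0" using elim one_le_power[of "real (m t)" 3] by linarith+
      have "q (m t) * (real (m t) ^ 3 / real (Suc (m t)) ^ 3) ^ k = f (exp (real (m t) ^ 3)) / (real (Suc (m t)) ^ 3) ^ k"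
        using pos by (simp add: q_def power_divide)
      also have "\<dots> \<le> f t / ln t ^ k"
      proof (rule frac_le)
        have "exp (real (m t) ^ 3) \<le> exp (ln t)" using elim(1) by (simp only: exp_le_cancel_iff)
        also have "exp (ln t) = t" using elim by simp
        finally have "exp (real (m t) ^ 3) \<le> t" .
        then show "f (exp (real (m t) ^ 3)) \<le> f t" by (intro mono) auto
        show "ln t ^ k \<le> (real (Suc (m t)) ^ 3) ^ k" using elim pos by (intro power_mono) auto
      qed (use nonneg pos in auto)
      finally show ?case .
    qed
    show "\<forall>\<^sub>F t in at_top. f t / ln t ^ k \<le> q (Suc (m t)) / (real (m t) ^ 3 / real (Suc (m t)) ^ 3) ^ k"
      using bounds eventually_ge_at_top[of 1]
    proof eventually_elim
      case (elim t)
      have pos: "real (m t) ^ 3 > 0" "ln t > 0" using elim one_le_power[of "real (m t)" 3] by linarith+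
      have "f t / ln t ^ k \<le> f (exp (real (Suc (m t)) ^ 3)) / (real (m t) ^ 3) ^ k"
      proof (rule frac_le)
        have "t = exp (ln t)" using elim by simp
        also have "\<dots> \<le> exp (real (Suc (m t)) ^ 3)" using elim(1) by (simp only: exp_le_cancel_iff)
        finally have "t \<le> exp (real (Suc (m t)) ^ 3)" .
        then show "f t \<le> f (exp (real (Suc (m t)) ^ 3))" using elim by (intro mono) auto
        show "(real (m t) ^ 3) ^ k \<le> ln t ^ k" using elim pos by (intro power_mono) auto
      qed (use nonneg pos in auto)
      also have "\<dots> = q (Suc (m t)) / (real (m t) ^ 3 / real (Suc (m t)) ^ 3) ^ k"
        by (simp add: q_def power_divide)
      finally show ?case .
    qed
    have "(\<lambda>n. q n * (real n ^ 3 / real (Suc n) ^ 3) ^ k) \<longlonglongrightarrow> L * 1"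
      using lim ratio unfolding q_def by (intro tendsto_mult)
    from filterlim_compose[OF this m_lim]
    show "((\<lambda>t. q (m t) * (real (m t) ^ 3 / real (Suc (m t)) ^ 3) ^ k) \<longlongrightarrow> L) at_top" by simp
    have "(\<lambda>n. q (Suc n) / (real n ^ 3 / real (Suc n) ^ 3) ^ k) \<longlonglongrightarrow> L / 1"
      using q_Suc ratio by (intro tendsto_divide) auto
    from filterlim_compose[OF this m_lim]
    show "((\<lambda>t. q (Suc (m t)) / (real (m t) ^ 3 / real (Suc (m t)) ^ 3) ^ k) \<longlongrightarrow> L) at_top" by simp
  qed
qed

locale collision_time = collision_decay S \<Phi> R T W S' \<Phi>' R' W' h h' C + time_measure \<nu>
  for S :: "'s measure" and \<Phi> R T W and S' :: "'r measure" and \<Phi>' R' W' h h' C \<nu> +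
  assumes AE_T: "AE s in \<nu>. 0 \<le> s \<longrightarrow> s \<in> T"
begin

definition upto :: "real \<Rightarrow> real measure" where
  "upto t = density \<nu> (\<lambda>s. ennreal (indicator {0..t} s))"

lemma sets_upto [simp, measurable_cong]: "sets (upto t) = sets borel"
  by (simp add: upto_def sets_\<nu>)

lemma space_upto [simp]: "space (upto t) = UNIV"
  by (simp add: upto_def)

lemma finite_measure_upto: "finite_measure (upto t)"
proof
  have "emeasure (upto t) (space (upto t)) = emeasure \<nu> {0..t}"
    by (simp add: upto_def emeasure_density sets_\<nu> ennreal_indicator)
  then show "emeasure (upto t) (space (upto t)) \<noteq> \<infinity>"
    using emeasure_Icc_finite[of t] by simp
qed

lemma AE_upto: "AE s in upto t. s \<in> T \<and> 0 \<le> s \<and> s \<le> t"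
  unfolding upto_def
  by (subst AE_density) (use AE_T in \<open>auto simp: sets_\<nu> split: split_indicator elim: eventually_mono\<close>)

lemma integral_upto:
  fixes f :: "real \<Rightarrow> real"
  assumes "f \<in> borel_measurable borel"
  shows "(\<integral>s. f s \<partial>upto t) = (\<integral>s. indicator {0..t} s * f s \<partial>\<nu>)"
  unfolding upto_def using assms
  by (subst integral_density) (auto simp: sets_\<nu> measurable_cong_sets[OF sets_\<nu> refl])

text \<open>Summing \<open>1 / sqrt s\<close> over \<open>s \<le> u\<close> gives a multiple of \<open>sqrt u\<close>, so that only \<open>1 / u\<close> is left to be summed over \<open>u \<le> t\<close>.\<close>

lemma covariance_sum_le:
  assumes t: "t \<ge> 1"
  shows "(\<integral>s. (\<integral>u. covariance s u \<partial>upto t) \<partial>upto t) \<le> 32 * C\<^sup>2 * (2 + ln t)"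
proof -
  interpret K: finite_measure "upto t" by (rule finite_measure_upto)
  define B where "B s u = indicator {0..u} s * covariance_bound s u" for s u :: real
  have [measurable]: "(\<lambda>z. B (fst z) (snd z)) \<in> borel_measurable (borel \<Otimes>\<^sub>M borel)"
  proof -
    have "B (fst z) (snd z) = (if 0 \<le> fst z \<and> fst z \<le> snd z then 4 * C\<^sup>2 * (1 / sqrt (max 1 (fst z)) * (1 / (max 1 (snd z) * sqrt (max 1 (snd z))))) else 0)" for z
      by (simp add: B_def)
    then show ?thesis by simp
  qed
  have B_meas [measurable]: "(\<lambda>z. B (f z) (g z)) \<in> borel_measurable M"
    if [measurable]: "f \<in> borel_measurable M" "g \<in> borel_measurable M" for f g and M :: "'z measure"
    using measurable_compose[OF measurable_Pair[OF that] \<open>(\<lambda>z. B (fst z) (snd z)) \<in> _\<close>] by simp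
  have B0: "0 \<le> B s u" for s u unfolding B_def by simp
  have B1: "norm (B s u) \<le> 4 * C\<^sup>2" for s u
  proof -
    have "1 / sqrt (max 1 s) * (1 / (max 1 u * sqrt (max 1 u))) \<le> 1 * 1"
    proof (rule mult_mono)
      show "1 / (max 1 u * sqrt (max 1 u)) \<le> 1"
        using mult_mono[of 1 "max 1 u" 1 "sqrt (max 1 u)"] by (simp add: divide_le_eq_1)
    qed auto
    then have "covariance_bound s u \<le> 4 * C\<^sup>2 * 1"
      by (intro mult_left_mono) auto
    then show ?thesis using B0[of s u] by (auto simp: B_def split: split_indicator)
  qed
  have cov_le: "covariance s u \<le> B s u + B u s" if "s \<in> T" "u \<in> T" for s u
  proof (cases "s \<le> u")
    case True
    have "B s u = covariance_bound s u"
      using True X.T_nonneg[OF that(1)] by (simp add: B_def)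
    then show ?thesis
      using covariance_le[OF that True] B0[of u s] by linarith
  next
    case False
    then have "u \<le> s" by simp
    then have "B u s = covariance_bound u s"
      using X.T_nonneg[OF that(2)] by (simp add: B_def)
    then show ?thesis
      using covariance_le[OF that(2,1) \<open>u \<le> s\<close>] B0[of s u] covariance_commute[of s u] by linarith
  qed
  have cov_meas [measurable]: "(\<lambda>(s, u). covariance s u) \<in> borel_measurable (upto t \<Otimes>\<^sub>M upto t)"
    unfolding covariance_def by measurable
  have cov_bd: "norm (covariance s u) \<le> 1" for s u
  proof -
    have le: "\<bar>excess s x * excess u x'\<bar> \<le> 1" for x x'
      using mult_mono[OF abs_excess_le_1[of s x] abs_excess_le_1[of u x']] by (simp add: abs_mult)
    have "norm (covariance s u) \<le> (\<integral>y. \<bar>excess s (\<Phi>' s y) * excess u (\<Phi>' u y)\<bar> \<partial>S')"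
      unfolding covariance_def real_norm_def by (rule integral_abs_bound)
    also have "\<dots> \<le> (\<integral>y. 1 \<partial>S')"
      by (intro integral_mono Y.integrable_const_bound[of _ 1]) (use le in auto)
    finally show ?thesis by (simp add: Y.prob_space)
  qed
  note covF = bounded_Fubini[OF finite_measure_upto finite_measure_upto cov_meas cov_bd]
  have B_pair: "(\<lambda>(s, u). B s u) \<in> borel_measurable (upto t \<Otimes>\<^sub>M upto t)" "(\<lambda>(s, u). B u s) \<in> borel_measurable (upto t \<Otimes>\<^sub>M upto t)"
    by measurable
  note BF = bounded_Fubini[OF finite_measure_upto finite_measure_upto B_pair(1) B1]
    and BF' = bounded_Fubini[OF finite_measure_upto finite_measure_upto B_pair(2) B1]
  have int_B: "integrable (upto t) (\<lambda>s. B s u)" "integrable (upto t) (\<lambda>u. B s u)" for s u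
    by (rule K.integrable_const_bound[of _ "4 * C\<^sup>2"], use B1 in auto)+
  have "(\<integral>s. (\<integral>u. covariance s u \<partial>upto t) \<partial>upto t) \<le> (\<integral>s. (\<integral>u. B s u \<partial>upto t) + (\<integral>u. B u s \<partial>upto t) \<partial>upto t)"
  proof (rule integral_mono_AE)
    show "AE s in upto t. (\<integral>u. covariance s u \<partial>upto t) \<le> (\<integral>u. B s u \<partial>upto t) + (\<integral>u. B u s \<partial>upto t)"
      using AE_upto
    proof eventually_elim
      case (elim s)
      have "(\<integral>u. covariance s u \<partial>upto t) \<le> (\<integral>u. B s u + B u s \<partial>upto t)"
      proof (rule integral_mono_AE)
        show "AE u in upto t. covariance s u \<le> B s u + B u s"
          using AE_upto by eventually_elim (use elim cov_le in auto)
        show "integrable (upto t) (\<lambda>u. covariance s u)"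
          by (rule K.integrable_const_bound[of _ 1]) (use cov_bd in auto)
      qed (use int_B in auto)
      then show ?case using int_B by simp
    qed
  qed (use covF BF BF' in auto)
  also have "\<dots> = 2 * (\<integral>u. (\<integral>s. B s u \<partial>upto t) \<partial>upto t)"
    using BF BF' by simp
  also have "\<dots> \<le> 2 * (\<integral>u. 16 * C\<^sup>2 * (1 / max 1 u) \<partial>upto t)"
  proof (intro mult_left_mono integral_mono_AE)
    show "AE u in upto t. (\<integral>s. B s u \<partial>upto t) \<le> 16 * C\<^sup>2 * (1 / max 1 u)"
      using AE_upto
    proof eventually_elim
      case (elim u)
      define r where "r = max 1 u"
      have "r \<ge> 1" by (simp add: r_def)
      have "(\<integral>s. B s u \<partial>upto t) = (\<integral>s. indicator {0..t} s * B s u \<partial>\<nu>)"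
        by (rule integral_upto) simp
      also have "\<dots> = (\<integral>s. 4 * C\<^sup>2 * (1 / (r * sqrt r)) * (indicator {0..u} s * (1 / sqrt (max 1 s))) \<partial>\<nu>)"
        by (intro Bochner_Integration.integral_cong) (use elim in \<open>auto simp: B_def r_def split: split_indicator\<close>)
      also have "\<dots> = 4 * C\<^sup>2 * (1 / (r * sqrt r)) * (\<integral>s. indicator {0..u} s * (1 / sqrt (max 1 s)) \<partial>\<nu>)"
        by (rule integral_mult_right_zero)
      also have "\<dots> \<le> 4 * C\<^sup>2 * (1 / (r * sqrt r)) * (4 * sqrt r)"
        unfolding r_def using elim by (intro mult_left_mono integral_inverse_sqrt_le) auto
      also have "\<dots> = 16 * C\<^sup>2 * (1 / r)" using \<open>r \<ge> 1\<close> by simp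
      finally show ?case by (simp add: r_def)
    qed
    show "integrable (upto t) (\<lambda>u. 16 * C\<^sup>2 * (1 / max 1 u))"
      by (intro integrable_mult_right K.integrable_const_bound[of _ 1] AE_I2) auto
  qed (use BF in auto)
  also have "(\<integral>u. 16 * C\<^sup>2 * (1 / max 1 u) \<partial>upto t) = 16 * C\<^sup>2 * (\<integral>u. indicator {0..t} u * (1 / max 1 u) \<partial>\<nu>)"
    by (subst integral_mult_right_zero, subst integral_upto) auto
  also have "2 * (16 * C\<^sup>2 * (\<integral>u. indicator {0..t} u * (1 / max 1 u) \<partial>\<nu>)) \<le> 2 * (16 * C\<^sup>2 * (2 + ln t))"
    by (intro mult_left_mono integral_inverse_le t) auto
  finally show ?thesis by simp
qed

text \<open>The square of the mean error is at most the variance, which is the double integral of the covariances. It is of order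
  \<open>ln t\<close>, whereas the squared mean of the first chain is of order \<open>(ln t)\<^sup>2\<close>.\<close>

lemma chain_1_L1:
  assumes t: "t \<ge> 1"
  shows "(\<integral>y. \<bar>chain (upto t) 1 y - mean_chain (upto t)\<bar> \<partial>S') \<le> sqrt (32 * C\<^sup>2 * (2 + ln t))"
proof (rule real_le_rsqrt)
  interpret K: finite_measure "upto t" by (rule finite_measure_upto)
  let ?e = "\<lambda>s y. excess s (\<Phi>' s y)"
  define V where "V y = (\<integral>s. ?e s y \<partial>upto t)" for y
  have [measurable]: "V \<in> borel_measurable S'" unfolding V_def by measurable
  define m where "m = measure (upto t) UNIV"
  have e_int: "integrable (upto t) (\<lambda>s. ?e s y)" if "y \<in> space S'" for y
    by (rule K.integrable_const_bound[of _ 1]) (use abs_excess_le_1 that in auto)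
  have V_le: "\<bar>V y\<bar> \<le> m" if "y \<in> space S'" for y
  proof -
    have "\<bar>V y\<bar> \<le> (\<integral>s. \<bar>?e s y\<bar> \<partial>upto t)" unfolding V_def by (rule integral_abs_bound)
    also have "\<dots> \<le> (\<integral>s. 1 \<partial>upto t)"
      using e_int[OF that] by (intro integral_mono integrable_abs) (auto simp: abs_excess_le_1)
    finally show ?thesis by (simp add: m_def)
  qed
  have V: "chain (upto t) 1 y - mean_chain (upto t) = V y" if "y \<in> space S'" for y
  proof -
    have "integrable (upto t) (\<lambda>s. X.occupation s (\<Phi>' s y))"
      by (rule K.integrable_const_bound[of _ 1]) (use that in \<open>auto simp: X.occupation_le_1\<close>)
    moreover have "integrable (upto t) green"
      by (rule K.integrable_const_bound[of _ 1]) (auto simp: green_nonneg green_le_1)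
    ultimately show ?thesis by (simp add: V_def excess_def mean_chain_def)
  qed
  have int: "integrable S' (\<lambda>y. \<bar>V y\<bar>)" "integrable S' (\<lambda>y. (V y)\<^sup>2)"
  proof -
    have "(V y)\<^sup>2 \<le> m\<^sup>2" if "y \<in> space S'" for y
      using power_mono[OF V_le[OF that], of 2] by simp
    then show "integrable S' (\<lambda>y. (V y)\<^sup>2)"
      by (intro Y.integrable_const_bound[of _ "m\<^sup>2"] AE_I2) auto
    show "integrable S' (\<lambda>y. \<bar>V y\<bar>)"
      by (intro Y.integrable_const_bound[of _ m] AE_I2) (use V_le in auto)
  qed
  have "(\<integral>y. \<bar>chain (upto t) 1 y - mean_chain (upto t)\<bar> \<partial>S') = (\<integral>y. \<bar>V y\<bar> \<partial>S')"
    by (intro Bochner_Integration.integral_cong) (use V in auto)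
  then have "(\<integral>y. \<bar>chain (upto t) 1 y - mean_chain (upto t)\<bar> \<partial>S')\<^sup>2 = (\<integral>y. \<bar>V y\<bar> \<partial>S')\<^sup>2" by simp
  also have "\<dots> \<le> (\<integral>y. \<bar>V y\<bar>\<^sup>2 \<partial>S')"
    using Y.variance_positive[of "\<lambda>y. \<bar>V y\<bar>"] Y.variance_eq[of "\<lambda>y. \<bar>V y\<bar>"] int by simp
  also have "\<dots> = (\<integral>y. (\<integral>s. ?e s y * V y \<partial>upto t) \<partial>S')"
    by (simp add: V_def power2_eq_square)
  also have "\<dots> = (\<integral>s. (\<integral>y. ?e s y * V y \<partial>S') \<partial>upto t)"
  proof (rule bounded_Fubini(1)[OF Y.finite_measure_axioms finite_measure_upto])
    fix y s assume "y \<in> space S'"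
    then have "\<bar>?e s y\<bar> * \<bar>V y\<bar> \<le> 1 * m" using V_le by (intro mult_mono) (auto simp: abs_excess_le_1)
    then show "norm (?e s y * V y) \<le> m" by (simp add: abs_mult)
  qed (simp add: case_prod_unfold)
  also have "\<dots> = (\<integral>s. (\<integral>u. covariance s u \<partial>upto t) \<partial>upto t)"
  proof (rule Bochner_Integration.integral_cong[OF refl])
    fix s
    have le: "norm (?e s y * ?e u y) \<le> 1" for u y
      using mult_mono[OF abs_excess_le_1[of s "\<Phi>' s y"] abs_excess_le_1[of u "\<Phi>' u y"]] by (simp add: abs_mult)
    have "(\<integral>y. ?e s y * V y \<partial>S') = (\<integral>y. (\<integral>u. ?e s y * ?e u y \<partial>upto t) \<partial>S')"
      by (simp add: V_def)
    also have "\<dots> = (\<integral>u. (\<integral>y. ?e s y * ?e u y \<partial>S') \<partial>upto t)"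
      by (rule bounded_Fubini(1)[OF Y.finite_measure_axioms finite_measure_upto _ le]) (simp add: case_prod_unfold)
    finally show "(\<integral>y. ?e s y * V y \<partial>S') = (\<integral>u. covariance s u \<partial>upto t)" by (simp add: covariance_def)
  qed
  also have "\<dots> \<le> 32 * C\<^sup>2 * (2 + ln t)" by (rule covariance_sum_le[OF t])
  finally show "(\<integral>y. \<bar>chain (upto t) 1 y - mean_chain (upto t)\<bar> \<partial>S')\<^sup>2 \<le> 32 * C\<^sup>2 * (2 + ln t)" .
qed

lemma chain_mono:
  assumes "s \<le> t" "y \<in> space S'"
  shows "chain (upto s) k y \<le> chain (upto t) k y"
  using assms(2)
proof (induction k arbitrary: y)
  case (Suc k)
  interpret K: finite_measure "upto t" by (rule finite_measure_upto)
  let ?c = "\<lambda>r u. X.occupation u (\<Phi>' u y) * chain (upto r) k (R' u y)"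
  note [measurable] = measurable_chain[OF finite_measure_upto sets_upto]
  have R': "R' u y \<in> space S'" for u by (rule Y.restart_space[OF Suc.prems])
  note bd = chain_bounds[OF finite_measure_upto sets_upto R']
  define m where "m = max (measure (upto s) UNIV ^ k) (measure (upto t) UNIV ^ k)"
  have int: "integrable (upto t) (\<lambda>u. indicator {0..r} u * ?c r u)" if "r \<in> {s, t}" for r
  proof (rule K.integrable_const_bound[of _ m])
    have "norm (indicator {0..r} u * ?c r u) \<le> 1 * (1 * m)" for u
      unfolding norm_mult
      using bd[of r k u] that by (intro mult_mono) (auto simp: X.occupation_le_1 m_def split: split_indicator)
    then show "AE u in upto t. norm (indicator {0..r} u * ?c r u) \<le> m" by simp
  qed (use Suc.prems in measurable)
  have meas: "(\<lambda>u. ?c r u) \<in> borel_measurable borel" for r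
    using Suc.prems by measurable
  have "chain (upto s) (Suc k) y = (\<integral>u. indicator {0..s} u * ?c s u \<partial>\<nu>)"
    unfolding chain.simps by (rule integral_upto[OF meas])
  also have "\<dots> = (\<integral>u. indicator {0..t} u * (indicator {0..s} u * ?c s u) \<partial>\<nu>)"
    by (intro Bochner_Integration.integral_cong) (use assms(1) in \<open>auto split: split_indicator\<close>)
  also have "\<dots> = (\<integral>u. indicator {0..s} u * ?c s u \<partial>upto t)"
    by (rule integral_upto[symmetric]) (use meas in simp)
  also have "\<dots> \<le> (\<integral>u. indicator {0..t} u * ?c t u \<partial>upto t)"
  proof (rule integral_mono)
    fix u
    have "?c s u \<le> ?c t u"
      by (intro mult_left_mono Suc.IH R') simp
    moreover have "0 \<le> ?c t u" using bd[of t k u] by simp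
    ultimately show "indicator {0..s} u * ?c s u
        \<le> indicator {0..t} u * ?c t u"
      using assms(1) by (auto split: split_indicator)
  qed (use int in auto)
  also have "\<dots> = chain (upto t) (Suc k) y"
    unfolding chain.simps
  proof (rule integral_cong_AE)
    show "AE u in upto t. indicator {0..t} u * ?c t u
        = ?c t u"
      using AE_upto by eventually_elim simp
  qed (use meas in simp_all)
  finally show ?case .
qed simp

text \<open>Along the times with logarithm \<open>n ^ 3\<close> the relative mean errors are of order \<open>n powr (- 3 / 2)\<close>, hence summable, and the
  errors tend to zero almost surely. Monotonicity fills the gaps between these times.\<close>

proposition chain_AE_tendsto:
  assumes G: "((\<lambda>t. mean_chain (upto t) / ln t) \<longlongrightarrow> A) at_top"
  shows "AE y in S'. \<forall>k. ((\<lambda>t. chain (upto t) k y / ln t ^ k) \<longlongrightarrow> A ^ k) at_top"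
  unfolding AE_all_countable
proof
  fix k
  show "AE y in S'. ((\<lambda>t. chain (upto t) k y / ln t ^ k) \<longlongrightarrow> A ^ k) at_top"
  proof (cases k)
    case (Suc j)
    define \<tau> where "\<tau> n = exp (real n ^ 3)" for n
    have \<tau>: "\<tau> n \<ge> 1" "ln (\<tau> n) = real n ^ 3" for n by (auto simp: \<tau>_def)
    have \<tau>_lim: "filterlim \<tau> at_top sequentially" unfolding \<tau>_def by real_asymp
    define G' where "G' n = mean_chain (upto (\<tau> n))" for n
    have G'0: "G' n \<ge> 0" for n unfolding G'_def by (rule mean_chain_nonneg)
    have G'_lim: "(\<lambda>n. G' n / real n ^ 3) \<longlonglongrightarrow> A"
      using filterlim_compose[OF G \<tau>_lim] by (simp add: G'_def \<tau>)
    define f where "f n y = \<bar>chain (upto (\<tau> n)) k y - G' n ^ k\<bar> / (real n ^ 3) ^ k" for n y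
    define c where "c n = real k * (\<bar>A\<bar> + 1) ^ j * (12 * C * real n powr (- 3 / 2))" for n
    have "AE y in S'. (\<lambda>n. f n y) \<longlonglongrightarrow> 0"
    proof (rule Y.AE_tendsto_0_if_summable)
      fix n
      note [measurable] = measurable_chain[OF finite_measure_upto sets_upto]
      show "integrable S' (f n)"
      proof -
        have "norm (chain (upto (\<tau> n)) k y) \<le> measure (upto (\<tau> n)) UNIV ^ k" if "y \<in> space S'" for y
          using chain_bounds[OF finite_measure_upto sets_upto that, of "\<tau> n" k] by simp
        then have "integrable S' (chain (upto (\<tau> n)) k)"
          by (intro Y.integrable_const_bound[of _ "measure (upto (\<tau> n)) UNIV ^ k"] AE_I2) auto
        then show ?thesis unfolding f_def by simp
      qed
      show "0 \<le> f n y" for y unfolding f_def by simp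
    next
      show "summable c"
        unfolding c_def by (intro summable_mult) (simp add: summable_real_powr_iff)
      have "\<forall>\<^sub>F n in sequentially. G' n / real n ^ 3 < \<bar>A\<bar> + 1"
        by (rule order_tendstoD[OF G'_lim]) simp
      then show "\<forall>\<^sub>F n in sequentially. (\<integral>y. f n y \<partial>S') \<le> c n"
        using eventually_ge_at_top[of 1]
      proof eventually_elim
        case (elim n)
        have n: "real n > 0" using elim by simp
        have r: "real n powr (3 / 2) * real n powr (3 / 2) = real n ^ 3"
          using n by (simp add: powr_add[symmetric] powr_numeral)
        \<comment> \<open>Rounding the constants up makes the right-hand side a square.\<close>
        have "1 \<le> real n ^ 3" using elim by simp
        then have "32 * C\<^sup>2 * (2 + ln (\<tau> n)) \<le> 36 * C\<^sup>2 * (4 * real n ^ 3)"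
          unfolding \<tau>(2) by (intro mult_mono) auto
        also have "\<dots> = (12 * C * real n powr (3 / 2))\<^sup>2"
          by (simp add: power_mult_distrib power2_eq_square r[symmetric])
        finally have "sqrt (32 * C\<^sup>2 * (2 + ln (\<tau> n))) \<le> 12 * C * real n powr (3 / 2)"
          using C_ge_1 by (intro real_le_lsqrt) auto
        with chain_1_L1[OF \<tau>(1)[of n]]
        have e1: "(\<integral>y. \<bar>chain (upto (\<tau> n)) 1 y - G' n\<bar> \<partial>S') \<le> 12 * C * real n powr (3 / 2)"
          unfolding G'_def by linarith
        have AE_T': "AE s in upto (\<tau> n). s \<in> T" using AE_upto by (auto elim: eventually_mono)
        have "(\<integral>y. f n y \<partial>S') = (\<integral>y. \<bar>chain (upto (\<tau> n)) (Suc j) y - G' n ^ Suc j\<bar> \<partial>S') / (real n ^ 3) ^ k"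
          unfolding f_def Suc by simp
        also have "\<dots> \<le> (real k * G' n ^ j * (12 * C * real n powr (3 / 2))) / (real n ^ 3) ^ k"
        proof (rule divide_right_mono)
          have "(\<integral>y. \<bar>chain (upto (\<tau> n)) (Suc j) y - G' n ^ Suc j\<bar> \<partial>S')
              \<le> real (Suc j) * G' n ^ j * (\<integral>y. \<bar>chain (upto (\<tau> n)) 1 y - G' n\<bar> \<partial>S')"
            unfolding G'_def by (rule chain_L1[OF finite_measure_upto sets_upto AE_T'])
          also have "\<dots> \<le> real (Suc j) * G' n ^ j * (12 * C * real n powr (3 / 2))"
            using G'0[of n] by (intro mult_left_mono e1) auto
          finally show "(\<integral>y. \<bar>chain (upto (\<tau> n)) (Suc j) y - G' n ^ Suc j\<bar> \<partial>S')
              \<le> real k * G' n ^ j * (12 * C * real n powr (3 / 2))" by (simp add: Suc)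
        qed simp
        also have "\<dots> = real k * (G' n / real n ^ 3) ^ j * (12 * C * (real n powr (3 / 2) / real n ^ 3))"
          by (simp add: Suc power_divide)
        also have "real n powr (3 / 2) / real n ^ 3 = real n powr (- 3 / 2)"
          using n by (simp add: powr_minus_divide r[symmetric])
        also have "real k * (G' n / real n ^ 3) ^ j * (12 * C * real n powr (- 3 / 2)) \<le> c n"
          unfolding c_def using elim G'0[of n] C_ge_1
          by (intro mult_right_mono mult_left_mono power_mono) auto
        finally show ?case .
      qed
    qed
    with AE_space show ?thesis
    proof eventually_elim
      case (elim y)
      have lim1: "(\<lambda>n. (chain (upto (\<tau> n)) k y - G' n ^ k) / (real n ^ 3) ^ k) \<longlonglongrightarrow> 0"
        using elim(2) by (rule tendsto_rabs_zero_cancel[OF Lim_transform_eventually]) (simp add: f_def abs_divide)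
      have lim2: "(\<lambda>n. (G' n / real n ^ 3) ^ k) \<longlonglongrightarrow> A ^ k"
        by (intro tendsto_power G'_lim)
      have "(\<lambda>n. chain (upto (\<tau> n)) k y / (real n ^ 3) ^ k) \<longlonglongrightarrow> A ^ k"
        using tendsto_add[OF lim1 lim2] by (simp add: diff_divide_distrib power_divide)
      then show ?case
        unfolding \<tau>_def
      proof (rule log_power_interpolation[rotated 2])
        show "0 \<le> chain (upto s) k y" for s
          using chain_bounds[OF finite_measure_upto sets_upto elim(1)] by blast
      qed (rule chain_mono[OF _ elim(1)])
    qed
  qed simp
qed

section \<open>Quenched moments of the collision local time\<close>

definition local_time :: "real \<Rightarrow> 's \<Rightarrow> 'r \<Rightarrow> real" where
  "local_time t x y = (\<integral>s. of_bool (\<Phi> s x = \<Phi>' s y) \<partial>upto t)"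

lemma measurable_local_time [measurable (raw)]:
  assumes [measurable]: "f \<in> M \<rightarrow>\<^sub>M S" "g \<in> M \<rightarrow>\<^sub>M S'"
  shows "(\<lambda>z. local_time t (f z) (g z)) \<in> borel_measurable M"
proof -
  interpret K: finite_measure "upto t" by (rule finite_measure_upto)
  show ?thesis unfolding local_time_def by measurable
qed

lemma collision_set_measurable:
  assumes "x \<in> space S" "y \<in> space S'"
  shows "{s. \<Phi> s x = \<Phi>' s y} \<in> sets borel"
proof -
  have [measurable]: "(\<lambda>s. \<Phi> s x) \<in> borel \<rightarrow>\<^sub>M count_space UNIV" "(\<lambda>s. \<Phi>' s y) \<in> borel \<rightarrow>\<^sub>M count_space UNIV"
    using assms by measurable
  have "{s \<in> space borel. \<Phi> s x = \<Phi>' s y} \<in> sets borel" by measurable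
  then show ?thesis by simp
qed

lemma local_time_eq_measure:
  assumes "x \<in> space S" "y \<in> space S'"
  shows "local_time t x y = measure \<nu> ({s. \<Phi> s x = \<Phi>' s y} \<inter> {0..t})"
proof -
  note [measurable] = collision_set_measurable[OF assms]
  have "local_time t x y = (\<integral>s. indicator {s. \<Phi> s x = \<Phi>' s y} s \<partial>upto t)"
    unfolding local_time_def by (intro Bochner_Integration.integral_cong) auto
  also have "\<dots> = (\<integral>s. indicator {0..t} s * indicator {s. \<Phi> s x = \<Phi>' s y} s \<partial>\<nu>)"
    by (rule integral_upto) measurable
  also have "\<dots> = (\<integral>s. indicator ({s. \<Phi> s x = \<Phi>' s y} \<inter> {0..t}) s \<partial>\<nu>)"
    by (intro Bochner_Integration.integral_cong) (auto split: split_indicator)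
  also have "\<dots> = measure \<nu> ({s. \<Phi> s x = \<Phi>' s y} \<inter> {0..t})" by simp
  finally show ?thesis .
qed

lemma local_time_bounds:
  shows "0 \<le> local_time t x y" and "x \<in> space S \<Longrightarrow> y \<in> space S' \<Longrightarrow> local_time t x y \<le> measure \<nu> {0..t}"
proof -
  show "0 \<le> local_time t x y"
    unfolding local_time_def by (intro Bochner_Integration.integral_nonneg) simp
  assume "x \<in> space S" "y \<in> space S'"
  note * = collision_set_measurable[OF this] local_time_eq_measure[OF this]
  show "local_time t x y \<le> measure \<nu> {0..t}"
    unfolding *(2) using emeasure_Icc_finite[of t] *(1)
    by (intro measure_mono_fmeasurable) (auto simp: fmeasurable_def sets_\<nu>)
qed

lemma measurable_collision_measure:
  assumes "y \<in> space S'"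
  shows "(\<lambda>x. measure \<nu> ({s. \<Phi> s x = \<Phi>' s y} \<inter> {0..t})) \<in> borel_measurable S"
proof -
  have "(\<lambda>x. local_time t x y) \<in> borel_measurable S" using assms by measurable
  then show ?thesis by (rule measurable_cong[THEN iffD1, rotated]) (simp add: local_time_eq_measure assms)
qed

lemma measure_collision_le:
  assumes "x \<in> space S" "y \<in> space S'"
  shows "measure \<nu> ({s. \<Phi> s x = \<Phi>' s y} \<inter> {0..t}) \<le> measure \<nu> {0..t}"
  using local_time_bounds(2)[OF assms] by (simp add: local_time_eq_measure assms)

lemma local_time_mono:
  assumes "r \<le> t" "x \<in> space S" "y \<in> space S'"
  shows "local_time r x y \<le> local_time t x y"
proof -
  note * = collision_set_measurable[OF assms(2,3)]
  have "emeasure \<nu> ({s. \<Phi> s x = \<Phi>' s y} \<inter> {0..t}) \<le> emeasure \<nu> {0..t}"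
    by (intro emeasure_mono) (auto simp: sets_\<nu>)
  then have "emeasure \<nu> ({s. \<Phi> s x = \<Phi>' s y} \<inter> {0..t}) < \<infinity>"
    using emeasure_Icc_finite[of t] by (rule le_less_trans)
  then show ?thesis
    unfolding local_time_eq_measure[OF assms(2,3)] using assms(1) *
    by (intro measure_mono_fmeasurable) (auto simp: fmeasurable_def sets_\<nu>)
qed

text \<open>After a collision at time \<open>s\<close>, both walks start afresh from a common site.\<close>

lemma measure_after_collision:
  assumes s: "s \<in> T" and x: "x \<in> W" "x \<in> space S" and y: "y \<in> W'" "y \<in> space S'"
    and meet: "\<Phi> s x = \<Phi>' s y"
  shows "measure \<nu> {v \<in> {0..t}. \<Phi> (s + v) x = \<Phi>' (s + v) y} = local_time t (R s x) (R' s y)"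
proof -
  have sp: "R s x \<in> space S" "R' s y \<in> space S'"
    using X.restart_space[OF x(2)] Y.restart_space[OF y(2)] .
  have [measurable]: "(\<lambda>v. \<Phi> (s + v) x) \<in> borel \<rightarrow>\<^sub>M count_space UNIV" "(\<lambda>v. \<Phi>' (s + v) y) \<in> borel \<rightarrow>\<^sub>M count_space UNIV"
    using x y by measurable
  have "{v \<in> space borel. v \<in> {0..t} \<and> \<Phi> (s + v) x = \<Phi>' (s + v) y} \<in> sets borel" by measurable
  then have meas: "{v \<in> {0..t}. \<Phi> (s + v) x = \<Phi>' (s + v) y} \<in> sets \<nu>" by (simp add: sets_\<nu>)
  show ?thesis
    unfolding local_time_eq_measure[OF sp]
  proof (rule measure_eq_AE)
    show "AE v in \<nu>. v \<in> {v \<in> {0..t}. \<Phi> (s + v) x = \<Phi>' (s + v) y} \<longleftrightarrow> v \<in> {v. \<Phi> v (R s x) = \<Phi>' v (R' s y)} \<inter> {0..t}"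
      using AE_T
    proof eventually_elim
      case (elim v)
      show ?case
      proof (cases "0 \<le> v")
        case True
        then have "v \<in> T" using elim by simp
        then show ?thesis
          using X.position_add[OF s _ x] Y.position_add[OF s _ y] meet by auto
      qed auto
    qed
    show "{v. \<Phi> v (R s x) = \<Phi>' v (R' s y)} \<inter> {0..t} \<in> sets \<nu>"
      using collision_set_measurable[OF sp] by (simp add: sets_\<nu>)
  qed (rule meas)
qed

definition later_collisions :: "real set \<Rightarrow> real \<Rightarrow> real \<Rightarrow> real" where
  "later_collisions B t s = (\<integral>v. of_bool (v \<le> t - s \<and> s + v \<in> B) \<partial>upto t)"

lemma measurable_later_collisions [measurable]:
  assumes [measurable]: "B \<in> sets borel"
  shows "later_collisions B t \<in> borel_measurable borel"
proof -
  interpret K: finite_measure "upto t" by (rule finite_measure_upto)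
  show ?thesis unfolding later_collisions_def by measurable
qed

lemma later_collisions_nonneg [simp]: "0 \<le> later_collisions B t s"
  unfolding later_collisions_def by (intro Bochner_Integration.integral_nonneg) simp

lemma later_collisions_eq:
  assumes [measurable]: "B \<in> sets borel" and "0 \<le> s"
  shows "later_collisions B t s = measure \<nu> {v \<in> {0..t - s}. s + v \<in> B}"
proof -
  have "{v \<in> space borel. v \<in> {0..t - s} \<and> s + v \<in> B} \<in> sets borel" by measurable
  then have meas: "{v \<in> {0..t - s}. s + v \<in> B} \<in> sets \<nu>" by (simp add: sets_\<nu>)
  have "later_collisions B t s = (\<integral>v. indicator {0..t} v * of_bool (v \<le> t - s \<and> s + v \<in> B) \<partial>\<nu>)"
    unfolding later_collisions_def by (rule integral_upto) measurable
  also have "\<dots> = (\<integral>v. indicator {v \<in> {0..t - s}. s + v \<in> B} v \<partial>\<nu>)"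
    by (intro Bochner_Integration.integral_cong) (use assms(2) in \<open>auto split: split_indicator\<close>)
  also have "\<dots> = measure \<nu> {v \<in> {0..t - s}. s + v \<in> B}" by simp
  finally show ?thesis .
qed

lemma integral_later_collisions:
  assumes [measurable]: "B \<in> sets borel"
  shows "collision_integral \<nu> B t k
    = (\<integral>s. indicator B s * later_collisions B t s ^ k \<partial>upto t)"
proof -
  have "(\<integral>s. indicator B s * later_collisions B t s ^ k \<partial>upto t)
      = (\<integral>s. indicator {0..t} s * (indicator B s * later_collisions B t s ^ k) \<partial>\<nu>)"
    by (rule integral_upto) simp
  also have "\<dots> = collision_integral \<nu> B t k"
    by (intro Bochner_Integration.integral_cong) (auto simp: later_collisions_eq split: split_indicator)
  finally show ?thesis ..
qed

definition moment :: "nat \<Rightarrow> real \<Rightarrow> 'r \<Rightarrow> real" where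
  "moment k t y = (\<integral>x. local_time t x y ^ k \<partial>S)"

lemma measurable_moment [measurable (raw)]:
  assumes [measurable]: "g \<in> M \<rightarrow>\<^sub>M S'"
  shows "(\<lambda>z. moment k t (g z)) \<in> borel_measurable M"
  unfolding moment_def by measurable

lemma local_time_power_le:
  "x \<in> space S \<Longrightarrow> y \<in> space S' \<Longrightarrow> \<bar>local_time t x y ^ k\<bar> \<le> measure \<nu> {0..t} ^ k"
  using local_time_bounds(1)[of t x y] local_time_bounds(2)[of x y t] by (simp add: power_abs power_mono)

lemma integrable_local_time_power:
  "y \<in> space S' \<Longrightarrow> integrable S (\<lambda>x. local_time t x y ^ k)"
  by (rule X.integrable_const_bound[of _ "measure \<nu> {0..t} ^ k"]) (auto intro!: AE_I2 local_time_power_le simp: power_abs[symmetric])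

lemma moment_bounds: "y \<in> space S' \<Longrightarrow> 0 \<le> moment k t y \<and> moment k t y \<le> measure \<nu> {0..t} ^ k"
proof -
  assume y: "y \<in> space S'"
  have "0 \<le> moment k t y"
    unfolding moment_def by (intro Bochner_Integration.integral_nonneg) (simp add: local_time_bounds)
  moreover have "moment k t y \<le> (\<integral>x. measure \<nu> {0..t} ^ k \<partial>S)"
    unfolding moment_def
    by (intro integral_mono integrable_local_time_power y) (use local_time_power_le[OF _ y] in \<open>auto dest: abs_le_D1\<close>)
  ultimately show ?thesis by (simp add: X.prob_space)
qed

text \<open>Averaging over the walk \<open>X\<close>, at the first of several collisions.\<close>

lemma integral_first_collision:
  fixes k :: nat and t :: real
  assumes y: "y \<in> space S'"
  defines "c \<equiv> \<lambda>x s. of_bool (\<Phi> s x = \<Phi>' s y) * local_time t (R s x) (R' s y) ^ k"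
  shows "(\<integral>x. (\<integral>s. c x s \<partial>upto r) \<partial>S)
      = (\<integral>s. X.occupation s (\<Phi>' s y) * moment k t (R' s y) \<partial>upto r)"
    and "integrable S (\<lambda>x. \<integral>s. c x s \<partial>upto r)"
    and "x \<in> space S \<Longrightarrow> integrable (upto r) (c x)"
proof -
  interpret K: finite_measure "upto r" by (rule finite_measure_upto)
  define m where "m = measure \<nu> {0..t} ^ k"
  have R': "R' s y \<in> space S'" for s by (rule Y.restart_space[OF y])
  have le: "norm (of_bool b * local_time t x' (R' s y) ^ k) \<le> m" if "x' \<in> space S" for x' s b
    using local_time_power_le[OF that R'[of s], of t k] by (auto simp: m_def abs_mult intro: order_trans[OF _ zero_le_power])
  have le': "norm (c x s) \<le> m" if "x \<in> space S" for x s
    unfolding c_def by (rule le[OF X.restart_space[OF that]])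
  have meas: "(\<lambda>(x, s). c x s) \<in> borel_measurable (S \<Otimes>\<^sub>M upto r)"
    using y unfolding c_def by (simp add: case_prod_unfold)
  note F = bounded_Fubini[OF X.finite_measure_axioms finite_measure_upto meas le']
  show "integrable S (\<lambda>x. \<integral>s. c x s \<partial>upto r)"
    by (rule F(2))
  show "integrable (upto r) (c x)" if x: "x \<in> space S"
    by (rule K.integrable_const_bound[of _ m]) (use x y le'[OF x] in \<open>auto simp: c_def\<close>)
  have "(\<integral>x. (\<integral>s. c x s \<partial>upto r) \<partial>S)
      = (\<integral>s. (\<integral>x. c x s \<partial>S) \<partial>upto r)"
    by (rule F(1))
  also have "\<dots> = (\<integral>s. X.occupation s (\<Phi>' s y) * moment k t (R' s y) \<partial>upto r)"
  proof (rule integral_cong_AE)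
    show "AE s in upto r. (\<integral>x. c x s \<partial>S)
        = X.occupation s (\<Phi>' s y) * moment k t (R' s y)"
      using AE_upto
    proof eventually_elim
      case (elim s)
      then have "s \<in> T" by simp
      from X.regeneration_integral[OF this, of "\<lambda>z x'. of_bool (z = \<Phi>' s y) * local_time t x' (R' s y) ^ k", OF _ le]
      have "(\<integral>x. c x s \<partial>S)
          = (\<integral>x. (\<integral>x'. of_bool (\<Phi> s x = \<Phi>' s y) * local_time t x' (R' s y) ^ k \<partial>S) \<partial>S)"
        unfolding c_def using R' by (simp add: case_prod_unfold)
      then show ?case by (simp add: moment_def X.occupation_eq)
    qed
  qed (unfold c_def, use y in measurable)
  finally show "(\<integral>x. (\<integral>s. c x s \<partial>upto r) \<partial>S)
      = (\<integral>s. X.occupation s (\<Phi>' s y) * moment k t (R' s y) \<partial>upto r)" .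
qed

lemma integrable_occupation_product:
  assumes y: "y \<in> space S'" and f [measurable]: "f \<in> borel_measurable S'"
    and le: "\<And>y. y \<in> space S' \<Longrightarrow> 0 \<le> f y \<and> f y \<le> b"
  shows "integrable (upto r) (\<lambda>s. X.occupation s (\<Phi>' s y) * f (R' s y))"
proof -
  interpret K: finite_measure "upto r" by (rule finite_measure_upto)
  have "norm (X.occupation s (\<Phi>' s y) * f (R' s y)) \<le> 1 * b" for s
    unfolding norm_mult using le[OF Y.restart_space[OF y, of s]]
    by (intro mult_mono) (auto simp: X.occupation_le_1)
  then show ?thesis
    by (intro K.integrable_const_bound[of _ b] AE_I2) (use y in auto)
qed

text \<open>After the first of \<open>k + 1\<close> collisions at most \<open>t\<close> is left for the others; giving them the whole time \<open>t\<close> makes the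
  waiting times independent of each other.\<close>

lemma moment_le_chain:
  assumes power: "\<And>B t k. B \<in> sets borel \<Longrightarrow> 0 \<le> t \<Longrightarrow> measure \<nu> (B \<inter> {0..t}) ^ Suc k
      \<le> real (Suc k) * collision_integral \<nu> B t k"
    and t: "0 \<le> t" and y: "y \<in> W'" "y \<in> space S'"
  shows "moment k t y \<le> fact k * chain (upto t) k y"
  using y
proof (induction k arbitrary: y)
  case 0
  then show ?case by (simp add: moment_def X.prob_space)
next
  case (Suc k)
  note y = Suc.prems
  let ?m = "\<lambda>s. X.occupation s (\<Phi>' s y) * moment k t (R' s y)"
  let ?h = "\<lambda>s. X.occupation s (\<Phi>' s y) * chain (upto t) k (R' s y)"
  let ?c = "\<lambda>x s. of_bool (\<Phi> s x = \<Phi>' s y) * local_time t (R s x) (R' s y) ^ k :: real"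
  have pointwise: "local_time t x y ^ Suc k \<le> real (Suc k) * (\<integral>s. ?c x s \<partial>upto t)"
    if x: "x \<in> W" "x \<in> space S" for x
  proof -
    define B where "B = {s. \<Phi> s x = \<Phi>' s y}"
    have [measurable]: "B \<in> sets borel" unfolding B_def using x y by (intro collision_set_measurable)
    have int_c: "integrable (upto t) (?c x)" by (rule integral_first_collision(3)[OF y(2) x(2)])
    have "local_time t x y ^ Suc k \<le> real (Suc k) * collision_integral \<nu> B t k"
      using power[of B t k] t unfolding local_time_eq_measure[OF x(2) y(2)] B_def[symmetric] by simp
    also have "collision_integral \<nu> B t k
        = (\<integral>s. indicator B s * later_collisions B t s ^ k \<partial>upto t)"
      by (rule integral_later_collisions) measurable
    also have "\<dots> \<le> (\<integral>s. ?c x s \<partial>upto t)"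
    proof (rule integral_mono_AE')
      show "AE s in upto t. indicator B s * later_collisions B t s ^ k \<le> ?c x s"
        using AE_upto
      proof eventually_elim
        case (elim s)
        show ?case
        proof (cases "s \<in> B")
          case True
          then have meet: "\<Phi> s x = \<Phi>' s y" by (simp add: B_def)
          have "later_collisions B t s = local_time (t - s) (R s x) (R' s y)"
            using measure_after_collision[OF _ x y meet, of "t - s"] elim later_collisions_eq[of B s t]
            by (simp add: B_def[symmetric]) (simp add: B_def)
          also have "\<dots> \<le> local_time t (R s x) (R' s y)"
            using elim x y by (intro local_time_mono X.restart_space Y.restart_space) auto
          finally show ?thesis using True meet by (simp add: power_mono)
        qed (simp add: local_time_bounds)
      qed
      show "AE s in upto t. 0 \<le> ?c x s" by (simp add: local_time_bounds)
    qed (rule int_c)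
    finally show ?thesis by simp
  qed
  have "moment (Suc k) t y \<le> (\<integral>x. real (Suc k) * (\<integral>s. ?c x s \<partial>upto t) \<partial>S)"
    unfolding moment_def
  proof (rule integral_mono_AE)
    show "AE x in S. local_time t x y ^ Suc k \<le> real (Suc k) * (\<integral>s. ?c x s \<partial>upto t)"
      using X.AE_W AE_space by eventually_elim (rule pointwise)
  qed (intro integrable_local_time_power integrable_mult_right integral_first_collision(2) y)+
  also have "\<dots> = real (Suc k) * (\<integral>s. ?m s \<partial>upto t)"
    by (simp only: integral_mult_right_zero integral_first_collision(1)[OF y(2)])
  also have "\<dots> \<le> real (Suc k) * (\<integral>s. fact k * ?h s \<partial>upto t)"
  proof (intro mult_left_mono integral_mono_AE)
    show "AE s in upto t. ?m s \<le> fact k * ?h s"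
      using AE_upto
    proof eventually_elim
      case (elim s)
      have "moment k t (R' s y) \<le> fact k * chain (upto t) k (R' s y)"
        using elim y by (intro Suc.IH Y.restart_W Y.restart_space) auto
      then have "?m s \<le> X.occupation s (\<Phi>' s y) * (fact k * chain (upto t) k (R' s y))"
        by (rule mult_left_mono) simp
      then show ?case by (simp add: mult_ac)
    qed
    show "integrable (upto t) ?m"
      by (rule integrable_occupation_product[OF y(2) _ moment_bounds]) auto
    show "integrable (upto t) (\<lambda>s. fact k * ?h s)"
      by (intro integrable_mult_right integrable_occupation_product[OF y(2) measurable_chain chain_bounds] finite_measure_upto sets_upto)
  qed simp
  also have "\<dots> = fact (Suc k) * chain (upto t) (Suc k) y" by simp
  finally show ?case .
qed

text \<open>Waiting times of at most \<open>r\<close> each bring \<open>k\<close> collisions within time \<open>k * r\<close>.\<close>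

lemma chain_le_moment:
  assumes power: "\<And>B t k. B \<in> sets borel \<Longrightarrow> 0 \<le> t \<Longrightarrow>
      real (Suc k) * collision_integral \<nu> B t k
        \<le> measure \<nu> (B \<inter> {0..t}) ^ Suc k"
    and r: "0 \<le> r" and y: "y \<in> W'" "y \<in> space S'"
  shows "fact k * chain (upto r) k y \<le> moment k (real k * r) y"
  using y
proof (induction k arbitrary: y)
  case 0
  then show ?case by (simp add: moment_def X.prob_space)
next
  case (Suc k)
  note y = Suc.prems
  let ?m = "\<lambda>s. X.occupation s (\<Phi>' s y) * moment k (real k * r) (R' s y)"
  let ?h = "\<lambda>s. X.occupation s (\<Phi>' s y) * chain (upto r) k (R' s y)"
  define t where "t = real (Suc k) * r"
  have t: "0 \<le> t" "r \<le> t" "t - r = real k * r" using r by (auto simp: t_def algebra_simps)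
  let ?c = "\<lambda>x s. of_bool (\<Phi> s x = \<Phi>' s y) * local_time (real k * r) (R s x) (R' s y) ^ k :: real"
  have pointwise: "real (Suc k) * (\<integral>s. ?c x s \<partial>upto r) \<le> local_time t x y ^ Suc k"
    if x: "x \<in> W" "x \<in> space S" for x
  proof -
    define B where "B = {s. \<Phi> s x = \<Phi>' s y}"
    have [measurable]: "B \<in> sets borel" unfolding B_def using x y by (intro collision_set_measurable)
    interpret K: finite_measure "upto t" by (rule finite_measure_upto)
    have "(\<integral>s. ?c x s \<partial>upto r) = (\<integral>s. indicator {0..r} s * ?c x s \<partial>\<nu>)"
      by (rule integral_upto) (use x y in measurable)
    also have "\<dots> = (\<integral>s. indicator {0..t} s * (indicator {0..r} s * ?c x s) \<partial>\<nu>)"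
      by (intro Bochner_Integration.integral_cong) (use t in \<open>auto split: split_indicator\<close>)
    also have "\<dots> = (\<integral>s. indicator {0..r} s * ?c x s \<partial>upto t)"
      by (rule integral_upto[symmetric]) (use x y in measurable)
    also have "\<dots> \<le> (\<integral>s. indicator B s * later_collisions B t s ^ k \<partial>upto t)"
    proof (rule integral_mono_AE')
      show "AE s in upto t. indicator {0..r} s * ?c x s \<le> indicator B s * later_collisions B t s ^ k"
        using AE_upto
      proof eventually_elim
        case (elim s)
        show ?case
        proof (cases "s \<in> B \<and> s \<le> r")
          case True
          then have meet: "\<Phi> s x = \<Phi>' s y" by (simp add: B_def)
          have "local_time (real k * r) (R s x) (R' s y) \<le> local_time (t - s) (R s x) (R' s y)"
            using True t x y by (intro local_time_mono X.restart_space Y.restart_space) auto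
          also have "\<dots> = later_collisions B t s"
            using measure_after_collision[OF _ x y meet, of "t - s"] elim later_collisions_eq[of B s t]
            by (simp add: B_def[symmetric]) (simp add: B_def)
          finally show ?thesis using True meet elim by (simp add: power_mono local_time_bounds)
        qed (auto simp: B_def split: split_indicator)
      qed
      have "0 \<le> later_collisions B t s \<and> later_collisions B t s ^ k \<le> measure \<nu> {0..t} ^ k" if "0 \<le> s" for s
        using that emeasure_Icc_finite[of t] unfolding later_collisions_eq[OF \<open>B \<in> sets borel\<close> that]
        by (intro conjI power_mono measure_mono_fmeasurable) (auto simp: fmeasurable_def sets_\<nu>)
      then have "AE s in upto t. norm (indicator B s * later_collisions B t s ^ k) \<le> measure \<nu> {0..t} ^ k"
        by (intro eventually_mono[OF AE_upto]) (auto simp: indicator_def)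
      then show "integrable (upto t) (\<lambda>s. indicator B s * later_collisions B t s ^ k)"
        by (rule K.integrable_const_bound) simp
      show "AE s in upto t. 0 \<le> indicator B s * later_collisions B t s ^ k"
        using AE_upto by eventually_elim (simp add: later_collisions_eq)
    qed
    also have "\<dots> = collision_integral \<nu> B t k"
      by (rule integral_later_collisions[symmetric]) measurable
    finally have "real (Suc k) * (\<integral>s. ?c x s \<partial>upto r)
        \<le> real (Suc k) * collision_integral \<nu> B t k"
      by (intro mult_left_mono) auto
    also have "\<dots> \<le> local_time t x y ^ Suc k"
      using power[of B t k] t unfolding local_time_eq_measure[OF x(2) y(2)] B_def[symmetric] by simp
    finally show ?thesis .
  qed
  have "fact (Suc k) * chain (upto r) (Suc k) y
      = real (Suc k) * (\<integral>s. fact k * ?h s \<partial>upto r)" by simp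
  also have "\<dots> \<le> real (Suc k) * (\<integral>s. ?m s \<partial>upto r)"
  proof (intro mult_left_mono integral_mono_AE)
    show "AE s in upto r. fact k * ?h s \<le> ?m s"
      using AE_upto
    proof eventually_elim
      case (elim s)
      have "fact k * chain (upto r) k (R' s y) \<le> moment k (real k * r) (R' s y)"
        using elim y by (intro Suc.IH Y.restart_W Y.restart_space) auto
      then have "X.occupation s (\<Phi>' s y) * (fact k * chain (upto r) k (R' s y)) \<le> ?m s"
        by (rule mult_left_mono) simp
      then show ?case by (simp add: mult_ac)
    qed
    show "integrable (upto r) ?m"
      by (rule integrable_occupation_product[OF y(2) _ moment_bounds]) auto
    show "integrable (upto r) (\<lambda>s. fact k * ?h s)"
      by (intro integrable_mult_right integrable_occupation_product[OF y(2) measurable_chain chain_bounds] finite_measure_upto sets_upto)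
  qed simp
  also have "\<dots> = (\<integral>x. real (Suc k) * (\<integral>s. ?c x s \<partial>upto r) \<partial>S)"
    by (simp only: integral_mult_right_zero integral_first_collision(1)[OF y(2)])
  also have "\<dots> \<le> moment (Suc k) t y"
    unfolding moment_def
  proof (rule integral_mono_AE)
    show "AE x in S. real (Suc k) * (\<integral>s. ?c x s \<partial>upto r) \<le> local_time t x y ^ Suc k"
      using X.AE_W AE_space by eventually_elim (rule pointwise)
  qed (intro integrable_local_time_power integrable_mult_right integral_first_collision(2) y)+
  finally show ?case by (simp only: t_def)
qed

end

text \<open>The moments lie between the chains with waiting times up to \<open>t / k\<close> and up to \<open>t\<close>, and \<open>ln (t / k)\<close> and \<open>ln t\<close> have the
  same growth. The lower bound uses a second time measure \<open>\<nu>0 \<le> \<nu>\<close>, because for counting measure the two inequalities for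
  powers differ in whether a collision may be counted again.\<close>

theorem quenched_moments_tendsto:
  fixes \<nu> \<nu>0 :: "real measure"
  assumes \<nu>: "collision_time S \<Phi> R T W S' \<Phi>' R' W' h h' C \<nu>"
    and \<nu>0: "collision_time S \<Phi> R T W S' \<Phi>' R' W' h h' C \<nu>0"
    and le: "\<And>B. B \<in> sets borel \<Longrightarrow> emeasure \<nu>0 B \<le> emeasure \<nu> B"
    and upper: "\<And>B t k. B \<in> sets borel \<Longrightarrow> 0 \<le> t \<Longrightarrow> measure \<nu> (B \<inter> {0..t}) ^ Suc k
      \<le> real (Suc k) * collision_integral \<nu> B t k"
    and lower: "\<And>B t k. B \<in> sets borel \<Longrightarrow> 0 \<le> t \<Longrightarrow>
      real (Suc k) * collision_integral \<nu>0 B t k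
        \<le> measure \<nu>0 (B \<inter> {0..t}) ^ Suc k"
    and G: "((\<lambda>t. (\<integral>s. indicator {0..t} s * collision.green S \<Phi> S' \<Phi>' s \<partial>\<nu>) / ln t) \<longlongrightarrow> A) at_top"
    and G0: "((\<lambda>t. (\<integral>s. indicator {0..t} s * collision.green S \<Phi> S' \<Phi>' s \<partial>\<nu>0) / ln t) \<longlongrightarrow> A) at_top"
  shows "AE y in S'. \<forall>k. ((\<lambda>t. (\<integral>x. measure \<nu> ({s. \<Phi> s x = \<Phi>' s y} \<inter> {0..t}) ^ k \<partial>S) / ln t ^ k)
      \<longlongrightarrow> fact k * A ^ k) at_top"
proof -
  interpret N: collision_time S \<Phi> R T W S' \<Phi>' R' W' h h' C \<nu> by fact
  interpret N0: collision_time S \<Phi> R T W S' \<Phi>' R' W' h h' C \<nu>0 by fact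
  have "AE y in S'. \<forall>k. ((\<lambda>t. N.chain (N.upto t) k y / ln t ^ k) \<longlongrightarrow> A ^ k) at_top"
    using G by (intro N.chain_AE_tendsto) (simp add: N.mean_chain_def N.integral_upto)
  moreover have "AE y in S'. \<forall>k. ((\<lambda>t. N.chain (N0.upto t) k y / ln t ^ k) \<longlongrightarrow> A ^ k) at_top"
    using G0 by (intro N0.chain_AE_tendsto) (simp add: N.mean_chain_def N0.integral_upto)
  ultimately show ?thesis
    using N.Y.AE_W AE_space
  proof eventually_elim
    case (elim y)
    show ?case
    proof
      fix k
      let ?L = "\<lambda>t. N.chain (N0.upto (t / real k)) k y / ln (t / real k) ^ k * (ln (t / real k) / ln t) ^ k"
      have eq: "(\<integral>x. measure \<nu> ({s. \<Phi> s x = \<Phi>' s y} \<inter> {0..t}) ^ k \<partial>S) = N.moment k t y" for t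
        unfolding N.moment_def
        by (intro Bochner_Integration.integral_cong) (auto simp: N.local_time_eq_measure elim)
      show "((\<lambda>t. (\<integral>x. measure \<nu> ({s. \<Phi> s x = \<Phi>' s y} \<inter> {0..t}) ^ k \<partial>S) / ln t ^ k) \<longlongrightarrow> fact k * A ^ k) at_top"
        unfolding eq
      proof (cases "k = 0")
        case True
        then show "((\<lambda>t. N.moment k t y / ln t ^ k) \<longlongrightarrow> fact k * A ^ k) at_top"
          by (simp add: N.moment_def N.X.prob_space)
      next
        case False
        then have k: "real k \<ge> 1" by simp
        show "((\<lambda>t. N.moment k t y / ln t ^ k) \<longlongrightarrow> fact k * A ^ k) at_top"
        proof (rule tendsto_sandwich[where f = "\<lambda>t. fact k * ?L t"])
          show "\<forall>\<^sub>F t in at_top. N.moment k t y / ln t ^ k \<le> fact k * (N.chain (N.upto t) k y / ln t ^ k)"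
            using eventually_gt_at_top[of 1]
          proof eventually_elim
            case (elim t)
            have "N.moment k t y \<le> fact k * N.chain (N.upto t) k y"
              using elim by (intro N.moment_le_chain[OF upper]) (auto simp: \<open>y \<in> W'\<close> \<open>y \<in> space S'\<close>)
            then show ?case using elim by (simp add: divide_right_mono)
          qed
          show "((\<lambda>t. fact k * (N.chain (N.upto t) k y / ln t ^ k)) \<longlongrightarrow> fact k * A ^ k) at_top"
            by (intro tendsto_mult tendsto_const) (use elim in blast)
          have lim: "((\<lambda>t. N.chain (N0.upto t) k y / ln t ^ k) \<longlongrightarrow> A ^ k) at_top" using elim by blast
          have "filterlim (\<lambda>t. t / real k) at_top at_top" using k by real_asymp
          from filterlim_compose[OF lim this]
          have "((\<lambda>t. N.chain (N0.upto (t / real k)) k y / ln (t / real k) ^ k) \<longlongrightarrow> A ^ k) at_top" .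
          moreover have "((\<lambda>t. (ln (t / real k) / ln t) ^ k) \<longlongrightarrow> 1 ^ k) at_top"
          proof (rule tendsto_power)
            show "((\<lambda>t. ln (t / real k) / ln t) \<longlongrightarrow> 1) at_top" using k by real_asymp
          qed
          ultimately have "((\<lambda>t. ?L t) \<longlongrightarrow> A ^ k * 1 ^ k) at_top"
            by (rule tendsto_mult)
          then have "((\<lambda>t. ?L t) \<longlongrightarrow> A ^ k) at_top"
            by (simp only: power_one mult_1_right)
          then show "((\<lambda>t. fact k * ?L t) \<longlongrightarrow> fact k * A ^ k) at_top"
            by (intro tendsto_mult tendsto_const)
          show "\<forall>\<^sub>F t in at_top. fact k * ?L t \<le> N.moment k t y / ln t ^ k"
            using eventually_gt_at_top[of "max 1 (real k)"]
          proof eventually_elim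
            case (elim t)
            then have "t / real k > 1" using k by (simp add: field_simps)
            then have ln0: "ln (t / real k) > 0" by simp
            have "fact k * N.chain (N0.upto (t / real k)) k y \<le> N0.moment k (real k * (t / real k)) y"
              using \<open>t / real k > 1\<close> by (intro N0.chain_le_moment[OF lower]) (auto simp: \<open>y \<in> W'\<close> \<open>y \<in> space S'\<close>)
            also have "real k * (t / real k) = t" using k by simp
            also have "N0.moment k t y \<le> N.moment k t y"
              unfolding N.moment_def N0.moment_def
            proof (intro integral_mono N.integrable_local_time_power N0.integrable_local_time_power \<open>y \<in> space S'\<close> power_mono)
              fix x assume x: "x \<in> space S"
              note eqs = N.local_time_eq_measure[OF x \<open>y \<in> space S'\<close>] N0.local_time_eq_measure[OF x \<open>y \<in> space S'\<close>]
              have B: "{s. \<Phi> s x = \<Phi>' s y} \<inter> {0..t} \<in> sets borel"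
                using N.collision_set_measurable[OF x \<open>y \<in> space S'\<close>] by simp
              have "emeasure \<nu> ({s. \<Phi> s x = \<Phi>' s y} \<inter> {0..t}) \<le> emeasure \<nu> {0..t}"
                by (intro emeasure_mono) (auto simp: N.sets_\<nu>)
              then have "emeasure \<nu> ({s. \<Phi> s x = \<Phi>' s y} \<inter> {0..t}) < \<infinity>"
                using N.emeasure_Icc_finite[of t] by (rule le_less_trans)
              then show "N0.local_time t x y \<le> N.local_time t x y"
                unfolding eqs measure_def using le[OF B] by (intro enn2real_mono) (auto simp: less_top)
              show "0 \<le> N0.local_time t x y" by (rule N0.local_time_bounds)
            qed
            finally have "fact k * N.chain (N0.upto (t / real k)) k y / ln t ^ k \<le> N.moment k t y / ln t ^ k"
              using elim by (intro divide_right_mono) auto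
            then show ?case using ln0 elim by (simp add: power_divide)
          qed
        qed
      qed
    qed
  qed
qed

section \<open>Powers of a measure as iterated integrals\<close>

lemma Suc_power_le: "(y + 1) ^ Suc k \<le> y ^ Suc k + real (Suc k) * (y + 1) ^ k" if "0 \<le> y" for y :: real
proof (induction k)
  case (Suc k)
  have "(y + 1) ^ Suc (Suc k) \<le> (y + 1) * (y ^ Suc k + real (Suc k) * (y + 1) ^ k)"
    using Suc that by (simp add: mult_left_mono)
  also have "\<dots> = y ^ Suc (Suc k) + (y ^ Suc k + real (Suc k) * (y + 1) ^ Suc k)"
    by (simp add: algebra_simps)
  also have "y ^ Suc k \<le> (y + 1) ^ Suc k" using that by (intro power_mono) auto
  finally show ?case by (simp add: algebra_simps)
qed simp

lemma Suc_power_ge: "y ^ Suc k + real (Suc k) * y ^ k \<le> (y + 1) ^ Suc k" if "0 \<le> y" for y :: real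
proof (induction k)
  case (Suc k)
  have "y ^ Suc (Suc k) + real (Suc (Suc k)) * y ^ Suc k \<le> (y + 1) * (y ^ Suc k + real (Suc k) * y ^ k)"
    using that by (simp add: algebra_simps)
  also have "\<dots> \<le> (y + 1) * (y + 1) ^ Suc k" using Suc that by (intro mult_left_mono) auto
  finally show ?case by simp
qed simp

text \<open>Listing \<open>A\<close> in decreasing order, the increments of the power \<open>k + 1\<close> of the counting function lie between
  \<open>k + 1\<close> times the \<open>k\<close>-th powers of its values before and after the jump.\<close>

lemma card_power_le_sum:
  fixes A :: "nat set"
  assumes "finite A"
  shows "real (card A) ^ Suc k \<le> real (Suc k) * (\<Sum>n\<in>A. real (card {m \<in> A. n \<le> m}) ^ k)"
    and "real (Suc k) * (\<Sum>n\<in>A. real (card {m \<in> A. n < m}) ^ k) \<le> real (card A) ^ Suc k"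
proof -
  have "real (card A) ^ Suc k \<le> real (Suc k) * (\<Sum>n\<in>A. real (card {m \<in> A. n \<le> m}) ^ k) \<and>
      real (Suc k) * (\<Sum>n\<in>A. real (card {m \<in> A. n < m}) ^ k) \<le> real (card A) ^ Suc k"
    using assms
  proof (induction "card A" arbitrary: A)
    case (Suc N)
    define a where "a = Min A"
    define A' where "A' = A - {a}"
    have "A \<noteq> {}" using Suc.hyps(2) by auto
    then have a: "a \<in> A" "\<And>m. m \<in> A \<Longrightarrow> a \<le> m" using Suc.prems by (auto simp: a_def)
    have A': "finite A'" "card A' = N" "A = insert a A'" "a \<notin> A'"
      using Suc a by (auto simp: A'_def)
    have ge: "{m \<in> A. n \<le> m} = {m \<in> A'. n \<le> m}" "{m \<in> A. n < m} = {m \<in> A'. n < m}" if "n \<in> A'" for n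
    proof -
      have "n \<in> A" "n \<noteq> a" using that by (auto simp: A'_def)
      then have "a < n" using a(2)[of n] by simp
      then show "{m \<in> A. n \<le> m} = {m \<in> A'. n \<le> m}" "{m \<in> A. n < m} = {m \<in> A'. n < m}"
        by (auto simp: A'_def)
    qed
    have at_a: "{m \<in> A. a \<le> m} = A" "{m \<in> A. a < m} = A'"
      using a by (auto simp: A'_def order.strict_iff_order)
    have card: "real (card A) = real N + 1" using Suc.hyps(2) by simp
    note IH = Suc.hyps(1)[OF A'(2)[symmetric] A'(1), unfolded A'(2)]
    have s1: "(\<Sum>n\<in>A. real (card {m \<in> A. n \<le> m}) ^ k) = real (card A) ^ k + (\<Sum>n\<in>A'. real (card {m \<in> A'. n \<le> m}) ^ k)"
      using sum.insert[OF A'(1,4), of "\<lambda>n. real (card {m \<in> A. n \<le> m}) ^ k"] ge at_a by (simp flip: A'(3))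
    have s2: "(\<Sum>n\<in>A. real (card {m \<in> A. n < m}) ^ k) = real N ^ k + (\<Sum>n\<in>A'. real (card {m \<in> A'. n < m}) ^ k)"
      using sum.insert[OF A'(1,4), of "\<lambda>n. real (card {m \<in> A. n < m}) ^ k"] ge at_a A'(2) by (simp flip: A'(3))
    show ?case
      unfolding s1 s2 card
      using IH Suc_power_le[of "real N" k] Suc_power_ge[of "real N" k]
      by (simp only: distrib_left) linarith
  qed simp
  then show "real (card A) ^ Suc k \<le> real (Suc k) * (\<Sum>n\<in>A. real (card {m \<in> A. n \<le> m}) ^ k)"
    and "real (Suc k) * (\<Sum>n\<in>A. real (card {m \<in> A. n < m}) ^ k) \<le> real (card A) ^ Suc k" by auto
qed

lemma borel_measurable_measure_greaterThan:
  fixes \<mu> :: "real measure"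
  assumes "finite_measure \<mu>" and [measurable_cong]: "sets \<mu> = sets borel"
  shows "(\<lambda>s. measure \<mu> {s<..}) \<in> borel_measurable borel"
proof -
  interpret finite_measure \<mu> by fact
  have "space \<mu> = UNIV" using sets_eq_imp_space_eq[OF assms(2)] by simp
  then have "measure \<mu> {s<..} = (\<integral>u. of_bool (s < u) \<partial>\<mu>)" for s
    by (subst Bochner_Integration.integral_cong[where g = "indicator {s<..}"]) auto
  then show ?thesis by simp
qed

text \<open>Of \<open>k + 1\<close> independent points, each is equally likely to be the smallest. In the induction, the factor \<open>F a\<close> is split at
  the point \<open>s\<close>; the mass below \<open>s\<close> gives, after an exchange of the integrals, the previous power.\<close>

lemma atomless_power_eq_integral:
  fixes \<mu> :: "real measure"
  assumes fin: "finite_measure \<mu>" and [measurable_cong]: "sets \<mu> = sets borel"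
    and atomless: "\<And>s. emeasure \<mu> {s} = 0"
  defines "F \<equiv> \<lambda>s. measure \<mu> {s<..}"
  shows "real (Suc k) * (\<integral>s. indicator {a<..} s * F s ^ k \<partial>\<mu>) = F a ^ Suc k"
proof (induction k arbitrary: a)
  case 0
  interpret finite_measure \<mu> by fact
  show ?case by (simp add: F_def)
next
  case (Suc k)
  interpret finite_measure \<mu> by fact
  have F_eq: "F s = (\<integral>u. indicator {s<..} u \<partial>\<mu>)" for s by (simp add: F_def)
  have [measurable]: "F \<in> borel_measurable borel"
    unfolding F_def by (rule borel_measurable_measure_greaterThan[OF fin assms(2)])
  define m where "m = measure \<mu> UNIV"
  have sp: "space \<mu> = UNIV" using sets_eq_imp_space_eq[OF assms(2)] by simp
  have F: "0 \<le> F s" "F s \<le> m" for s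
    unfolding F_def m_def by (auto intro!: finite_measure_mono simp: assms(2))
  have Fk: "0 \<le> F s ^ k" "F s ^ k \<le> m ^ k" for s using F by (auto intro!: power_mono)
  let ?I = "indicator {a<..} :: real \<Rightarrow> real"
  let ?g = "\<lambda>s. (\<integral>u. ?I u * (indicator {u<..} s * F s ^ k) \<partial>\<mu>)"
  have int_bd: "integrable \<mu> f" if "f \<in> borel_measurable borel" "\<And>s. \<bar>f s\<bar> \<le> m ^ k" for f :: "real \<Rightarrow> real"
    by (rule integrable_const_bound[of _ "m ^ k"]) (use that in auto)
  have split: "?I s * F s ^ k * F a = ?I s * F s ^ Suc k + ?g s" for s
  proof (cases "a < s")
    case True
    have "F a = (\<integral>u. indicator {s<..} u + indicator {a<..<s} u \<partial>\<mu>)"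
      unfolding F_eq
    proof (rule integral_cong_AE)
      have "AE u in \<mu>. u \<noteq> s" using atomless[of s] by (intro AE_I[of _ _ "{s}"]) (auto simp: assms(2))
      then show "AE u in \<mu>. indicator {a<..} u = (indicator {s<..} u + indicator {a<..<s} u :: real)"
        by eventually_elim (use True in \<open>auto split: split_indicator\<close>)
    qed auto
    also have "\<dots> = F s + (\<integral>u. indicator {a<..<s} u \<partial>\<mu>)"
      unfolding F_eq by (rule Bochner_Integration.integral_add) (auto simp: integrable_real_indicator assms(2) emeasure_eq_measure)
    finally have "?I s * F s ^ k * F a = F s ^ Suc k + (\<integral>u. indicator {a<..<s} u \<partial>\<mu>) * F s ^ k"
      using True by (simp add: algebra_simps)
    also have "(\<integral>u. indicator {a<..<s} u \<partial>\<mu>) * F s ^ k = (\<integral>u. indicator {a<..<s} u * F s ^ k \<partial>\<mu>)" by simp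
    also have "\<dots> = ?g s"
      by (intro Bochner_Integration.integral_cong) (auto split: split_indicator)
    finally show ?thesis using True by simp
  next
    case False
    have "?g s = (\<integral>u. 0 \<partial>\<mu>)"
      by (intro Bochner_Integration.integral_cong) (use False in \<open>auto split: split_indicator\<close>)
    with False show ?thesis by simp
  qed
  have ind: "(\<lambda>z. indicator {snd z<..} (fst z) :: real) \<in> borel_measurable (\<mu> \<Otimes>\<^sub>M \<mu>)"
  proof -
    have "(\<lambda>z. indicator {snd z<..} (fst z) :: real) = (\<lambda>z. of_bool (snd z < fst z))" by (auto simp: fun_eq_iff)
    also have "\<dots> \<in> borel_measurable (\<mu> \<Otimes>\<^sub>M \<mu>)" by measurable
    finally show ?thesis .
  qed
  have pair_meas: "(\<lambda>(s, u). ?I u * (indicator {u<..} s * F s ^ k)) \<in> borel_measurable (\<mu> \<Otimes>\<^sub>M \<mu>)"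
    unfolding case_prod_unfold using ind by measurable
  have pair_bd: "norm (?I u * (indicator {u<..} s * F s ^ k)) \<le> m ^ k" for s u
    using Fk[of s] by (auto split: split_indicator intro: order_trans)
  note Fub = bounded_Fubini[OF fin fin pair_meas pair_bd]
  have int1: "integrable \<mu> (\<lambda>s. ?I s * F s ^ Suc k)"
  proof (rule integrable_const_bound[of _ "m ^ Suc k"])
    show "AE s in \<mu>. norm (?I s * F s ^ Suc k) \<le> m ^ Suc k"
      using F power_mono[OF F(2) F(1), of _ "Suc k"]
      by (auto split: split_indicator simp del: power_Suc intro: order_trans[OF _ power_mono[OF F(2) F(1)]])
  qed measurable
  have "F a ^ Suc (Suc k) = F a * F a ^ Suc k" by simp
  also have "F a ^ Suc k = real (Suc k) * (\<integral>s. ?I s * F s ^ k \<partial>\<mu>)" by (rule Suc.IH[symmetric])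
  also have "F a * (real (Suc k) * (\<integral>s. ?I s * F s ^ k \<partial>\<mu>)) = real (Suc k) * (\<integral>s. ?I s * F s ^ k * F a \<partial>\<mu>)" by simp
  also have "(\<integral>s. ?I s * F s ^ k * F a \<partial>\<mu>)
      = (\<integral>s. ?I s * F s ^ Suc k \<partial>\<mu>) + (\<integral>s. ?g s \<partial>\<mu>)"
    unfolding split by (rule Bochner_Integration.integral_add[OF int1 Fub(2)])
  also have "(\<integral>s. ?g s \<partial>\<mu>)
      = (\<integral>u. ?I u * (\<integral>s. indicator {u<..} s * F s ^ k \<partial>\<mu>) \<partial>\<mu>)"
    unfolding Fub(1) by simp
  also have "\<dots> = (\<integral>u. ?I u * (F u ^ Suc k / real (Suc k)) \<partial>\<mu>)"
  proof -
    have "(\<integral>s. indicator {u<..} s * F s ^ k \<partial>\<mu>) = F u ^ Suc k / real (Suc k)" for u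
      using Suc.IH[of u] by (metis nonzero_mult_div_cancel_left of_nat_neq_0)
    then show ?thesis by (simp only:)
  qed
  also have "\<dots> = (\<integral>u. ?I u * F u ^ Suc k \<partial>\<mu>) / real (Suc k)" by simp
  finally have "F a ^ Suc (Suc k) = real (Suc k) * ((\<integral>s. ?I s * F s ^ Suc k \<partial>\<mu>) + (\<integral>u. ?I u * F u ^ Suc k \<partial>\<mu>) / real (Suc k))" .
  also have "\<dots> = (real (Suc k) + 1) * (\<integral>s. ?I s * F s ^ Suc k \<partial>\<mu>)"
  proof -
    have "c * (J + J / c) = (c + 1) * J" if "c \<noteq> 0" for c J :: real
      using that by (simp add: field_simps)
    then show ?thesis by (simp only: of_nat_neq_0 not_False_eq_True)
  qed
  finally show ?case by (simp only: of_nat_Suc[of "Suc k"] add.commute)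
qed

text \<open>The restriction of Lebesgue measure to \<open>B \<inter> {0..t}\<close> has no atoms, so that the preceding
  identity applies to it.\<close>

lemma lborel_collision_power:
  fixes B :: "real set" and t :: real
  assumes [measurable]: "B \<in> sets borel" and "0 \<le> t"
  shows "real (Suc k) * collision_integral lborel B t k
    = measure lborel (B \<inter> {0..t}) ^ Suc k"
proof -
  have "B \<inter> {0..t} \<in> sets borel" by (intro sets.Int assms(1)) simp
  then have ind: "(indicator (B \<inter> {0..t}) :: real \<Rightarrow> real) \<in> borel_measurable borel"
    by (rule borel_measurable_indicator)
  define \<mu> where "\<mu> = density lborel (\<lambda>s. ennreal (indicator (B \<inter> {0..t}) s))"
  have sets: "sets \<mu> = sets borel" by (simp add: \<mu>_def)
  have em: "emeasure \<mu> E = emeasure lborel (E \<inter> (B \<inter> {0..t}))" if [measurable]: "E \<in> sets borel" for E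
  proof -
    have "emeasure \<mu> E = (\<integral>\<^sup>+s. indicator (E \<inter> (B \<inter> {0..t})) s \<partial>lborel)"
      unfolding \<mu>_def
      by (subst emeasure_density, use ind in simp, use that in simp, intro nn_integral_cong)
         (auto split: split_indicator)
    then show ?thesis by simp
  qed
  have fin: "emeasure lborel (E \<inter> {0..t}) < \<infinity>" for E :: "real set"
  proof -
    have "emeasure lborel (E \<inter> {0..t}) \<le> emeasure lborel {0..t}" by (rule emeasure_mono) auto
    then show ?thesis using \<open>0 \<le> t\<close> by (simp add: le_less_trans)
  qed
  have fin_\<mu>: "finite_measure \<mu>"
  proof
    show "emeasure \<mu> (space \<mu>) \<noteq> \<infinity>" using em[of UNIV] fin[of B] by (simp add: \<mu>_def)
  qed
  have null: "emeasure lborel {s :: real} = 0" for s by simp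
  have atomless: "emeasure \<mu> {s} = 0" for s
  proof -
    have "emeasure \<mu> {s} \<le> emeasure lborel {s}" unfolding em[OF borel_singleton[OF sets.empty_sets]] by (rule emeasure_mono) auto
    then show ?thesis by simp
  qed
  have shift: "measure lborel {v \<in> {0..t - s}. s + v \<in> B} = measure \<mu> {s<..}" if "s \<in> {0..t}" for s
  proof -
    have 1: "{v \<in> {0..t - s}. s + v \<in> B} = (\<lambda>v. s + v) -` (B \<inter> {s..t})" by auto
    have "emeasure lborel (B \<inter> {s..t}) = emeasure (distr lborel borel ((+) s)) (B \<inter> {s..t})"
      by (simp only: lborel_distr_plus)
    also have "\<dots> = emeasure lborel {v \<in> {0..t - s}. s + v \<in> B}"
      unfolding 1 by (subst emeasure_distr) auto
    finally have "measure lborel {v \<in> {0..t - s}. s + v \<in> B} = measure lborel (B \<inter> {s..t})"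
      by (simp add: measure_def)
    also have "\<dots> = measure lborel ({s<..} \<inter> (B \<inter> {0..t}))"
    proof (rule measure_eq_AE)
      have "AE v in lborel. v \<noteq> s" by (rule AE_lborel_singleton)
      then show "AE v in lborel. v \<in> B \<inter> {s..t} \<longleftrightarrow> v \<in> {s<..} \<inter> (B \<inter> {0..t})"
        by eventually_elim (use that in auto)
    qed auto
    also have "\<dots> = measure \<mu> {s<..}" by (simp add: measure_def em)
    finally show ?thesis .
  qed
  \<comment> \<open>A point to the left of the whole interval \<open>{0..t}\<close>.\<close>
  define a where "a = (- 1 :: real)"
  have all: "emeasure lborel (B \<inter> {0..t}) = emeasure \<mu> {a<..}"
    by (subst em) (auto simp: a_def intro!: arg_cong[where f = "emeasure lborel"])
  note F_meas = borel_measurable_measure_greaterThan[OF fin_\<mu> sets]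
  have "collision_integral lborel B t k
      = (\<integral>s. indicator (B \<inter> {0..t}) s *\<^sub>R (indicator {a<..} s * measure \<mu> {s<..} ^ k) \<partial>lborel)"
  proof (intro Bochner_Integration.integral_cong refl)
    fix s
    show "indicator (B \<inter> {0..t}) s * measure lborel {v \<in> {0..t - s}. s + v \<in> B} ^ k
        = indicator (B \<inter> {0..t}) s *\<^sub>R (indicator {a<..} s * measure \<mu> {s<..} ^ k)"
    proof (cases "s \<in> B \<inter> {0..t}")
      case True
      then have s: "s \<in> {0..t}" by simp
      show ?thesis unfolding shift[OF s] using True by (simp add: a_def)
    qed simp
  qed
  also have "\<dots> = (\<integral>s. indicator {a<..} s * measure \<mu> {s<..} ^ k \<partial>\<mu>)"
    unfolding \<mu>_def by (subst integral_density) (use F_meas ind in \<open>simp_all add: \<mu>_def\<close>)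
  finally have "real (Suc k) * collision_integral lborel B t k
      = measure \<mu> {a<..} ^ Suc k"
    using atomless_power_eq_integral[OF fin_\<mu> sets atomless, of k a] by simp
  then show ?thesis by (simp add: measure_def all)
qed

text \<open>Counting measure on \<open>{n. N \<le> n}\<close>; the cases \<open>N = 0\<close> and \<open>N = 1\<close> differ in whether a collision
  counts as its own successor.\<close>

definition count_from :: "nat \<Rightarrow> real measure" where
  "count_from N = distr (count_space UNIV) borel (\<lambda>n. real (n + N))"

lemma sets_count_from [simp, measurable_cong]: "sets (count_from N) = sets borel"
  and space_count_from [simp]: "space (count_from N) = UNIV"
  by (auto simp: count_from_def)

lemma count_from_0: "count_from 0 = count_time"
  by (simp add: count_from_def count_time_def)

lemma bij_betw_shift_nat: "bij_betw (\<lambda>n. n + N) {n. real (n + N) \<in> B} {n. N \<le> n \<and> real n \<in> B}"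
  by (rule bij_betw_byWitness[where f' = "\<lambda>n. n - N"]) auto

lemma emeasure_count_from:
  assumes "B \<in> sets borel"
  shows "emeasure (count_from N) B = emeasure (count_space UNIV) {n. N \<le> n \<and> real n \<in> B}"
proof -
  have "emeasure (count_from N) B = emeasure (count_space UNIV) {n. real (n + N) \<in> B}"
    unfolding count_from_def using assms by (subst emeasure_distr) (auto simp: vimage_def)
  also have "\<dots> = emeasure (count_space UNIV) {n. N \<le> n \<and> real n \<in> B}"
    using bij_betw_finite[OF bij_betw_shift_nat[of N B]] bij_betw_same_card[OF bij_betw_shift_nat[of N B]]
    by (simp add: emeasure_count_space)
  finally show ?thesis .
qed

lemma measure_count_from:
  assumes "B \<in> sets borel"
  shows "measure (count_from N) B = real (card {n. N \<le> n \<and> real n \<in> B})"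
  unfolding measure_def emeasure_count_from[OF assms]
  by (simp add: emeasure_count_space)

lemma finite_nats_le: "finite {n. N \<le> n \<and> real n \<in> B \<inter> {0..t}}"
  by (rule finite_subset[of _ "{..nat \<lfloor>t\<rfloor>}"]) (auto simp: le_nat_floor)

lemma integral_count_from:
  fixes f :: "real \<Rightarrow> real"
  assumes [measurable]: "f \<in> borel_measurable borel" "B \<in> sets borel"
  shows "(\<integral>s. indicator (B \<inter> {0..t}) s * f s \<partial>count_from N) = (\<Sum>n | N \<le> n \<and> real n \<in> B \<inter> {0..t}. f (real n))"
proof -
  let ?A = "{n. real (n + N) \<in> B \<inter> {0..t}}"
  have fin: "finite ?A"
    using bij_betw_finite[OF bij_betw_shift_nat] finite_nats_le by blast
  have "(\<integral>s. indicator (B \<inter> {0..t}) s * f s \<partial>count_from N)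
      = (\<integral>n. indicator (B \<inter> {0..t}) (real (n + N)) * f (real (n + N)) \<partial>count_space UNIV)"
    unfolding count_from_def by (rule integral_distr) auto
  also have "\<dots> = (\<Sum>n | indicator (B \<inter> {0..t}) (real (n + N)) * f (real (n + N)) \<noteq> 0. indicator (B \<inter> {0..t}) (real (n + N)) * f (real (n + N)))"
  proof (subst lebesgue_integral_count_space_finite_support)
    show "finite {n \<in> UNIV. indicator (B \<inter> {0..t}) (real (n + N)) * f (real (n + N)) \<noteq> 0}"
      by (rule finite_subset[OF _ fin]) (auto simp: indicator_def split: if_splits)
  qed simp
  also have "\<dots> = (\<Sum>n\<in>?A. f (real (n + N)))"
    by (rule sum.mono_neutral_cong_left[OF fin]) (auto simp: indicator_def split: if_splits)
  also have "\<dots> = (\<Sum>n | N \<le> n \<and> real n \<in> B \<inter> {0..t}. f (real n))"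
    using sum.reindex_bij_betw[OF bij_betw_shift_nat, of "\<lambda>n. f (real n)" N "B \<inter> {0..t}"] by simp
  finally show ?thesis .
qed

lemma measurable_of_later_count:
  assumes [measurable]: "B \<in> sets borel"
  shows "(\<lambda>s. real (card {m :: nat. N \<le> m \<and> real m \<le> t - s \<and> s + real m \<in> B})) \<in> borel_measurable borel"
proof -
  have "(\<lambda>s. card {m :: nat. N \<le> m \<and> real m \<le> t - s \<and> s + real m \<in> B}) \<in> borel \<rightarrow>\<^sub>M count_space UNIV"
    by (rule measurable_card) simp
  then show ?thesis by simp
qed

lemma count_from_collision_sum:
  assumes [measurable]: "B \<in> sets borel"
  shows "collision_integral (count_from N) B t k
    = (\<Sum>n | N \<le> n \<and> real n \<in> B \<inter> {0..t}.
        real (card {m. N \<le> m \<and> real m \<in> B \<inter> {0..t} \<and> n + N \<le> m}) ^ k)"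
proof -
  have meas: "{v \<in> {0..t - s}. s + v \<in> B} \<in> sets borel" for s
  proof -
    have "{v \<in> space borel. v \<in> {0..t - s} \<and> s + v \<in> B} \<in> sets borel" by measurable
    then show ?thesis by simp
  qed
  have eq: "measure (count_from N) {v \<in> {0..t - s}. s + v \<in> B}
      = real (card {m :: nat. N \<le> m \<and> real m \<le> t - s \<and> s + real m \<in> B})" for s
    unfolding measure_count_from[OF meas] by simp
  have bij: "bij_betw (\<lambda>m. n + m) {m :: nat. N \<le> m \<and> real m \<le> t - real n \<and> real n + real m \<in> B}
      {m. N \<le> m \<and> real m \<in> B \<inter> {0..t} \<and> n + N \<le> m}" for n
    by (rule bij_betw_byWitness[where f' = "\<lambda>m. m - n"]) auto
  show ?thesis
    unfolding eq
    by (subst integral_count_from) (use measurable_of_later_count bij_betw_same_card[OF bij] in auto)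
qed

lemma count_from_0_collision_power:
  assumes "B \<in> sets borel"
  shows "measure (count_from 0) (B \<inter> {0..t}) ^ Suc k
    \<le> real (Suc k) * collision_integral (count_from 0) B t k"
proof -
  let ?A = "{n. real n \<in> B \<inter> {0..t}}"
  have "finite ?A" using finite_nats_le[of 0 B t] by simp
  from card_power_le_sum(1)[OF this, of k] show ?thesis
    using assms unfolding count_from_collision_sum[OF assms] by (subst measure_count_from) (auto simp: conj_assoc)
qed

lemma count_from_1_collision_power:
  assumes "B \<in> sets borel"
  shows "real (Suc k) * collision_integral (count_from 1) B t k
    \<le> measure (count_from 1) (B \<inter> {0..t}) ^ Suc k"
proof -
  let ?A = "{n. 1 \<le> n \<and> real n \<in> B \<inter> {0..t}}"
  have "finite ?A" by (rule finite_nats_le)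
  from card_power_le_sum(2)[OF this, of k] show ?thesis
    using assms unfolding count_from_collision_sum[OF assms]
    by (subst measure_count_from) (auto simp: conj_assoc Suc_le_eq)
qed

section \<open>Discrete time\<close>

lemma measurable_add_site [measurable (raw)]:
  fixes f g :: "'x \<Rightarrow> int ^ 2"
  assumes [measurable]: "f \<in> M \<rightarrow>\<^sub>M count_space UNIV" "g \<in> M \<rightarrow>\<^sub>M count_space UNIV"
  shows "(\<lambda>x. f x + g x) \<in> M \<rightarrow>\<^sub>M count_space UNIV"
  by (rule measurable_compose_countable'[OF _ assms(2)]) (auto intro!: measurable_compose[OF assms(1)])

lemma measurable_sum_site [measurable (raw)]:
  fixes f :: "nat \<Rightarrow> 'x \<Rightarrow> int ^ 2"
  assumes "\<And>i. f i \<in> M \<rightarrow>\<^sub>M count_space UNIV"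
  shows "(\<lambda>x. \<Sum>i<n. f i x) \<in> M \<rightarrow>\<^sub>M count_space UNIV"
  by (induction n) (auto intro!: measurable_add_site assms)

context
  fixes p :: "(int ^ 2) pmf"
begin

interpretation seq: sequence_space "measure_pmf p"
  by unfold_locales

definition steps :: "(nat \<Rightarrow> int ^ 2) measure" where
  "steps = (\<Pi>\<^sub>M i\<in>UNIV. measure_pmf p)"

text \<open>Times are real numbers here, rounded down to whole steps, so that walks in discrete and in continuous time are instances
  of the same locale; only the time measure sees the difference.\<close>

definition walk_position :: "real \<Rightarrow> (nat \<Rightarrow> int ^ 2) \<Rightarrow> int ^ 2" where
  "walk_position s \<omega> = (\<Sum>i<nat \<lfloor>s\<rfloor>. \<omega> i)"

definition walk_restart :: "real \<Rightarrow> (nat \<Rightarrow> int ^ 2) \<Rightarrow> nat \<Rightarrow> int ^ 2" where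
  "walk_restart s \<omega> = (\<lambda>i. \<omega> (i + nat \<lfloor>s\<rfloor>))"

lemma space_steps [simp]: "space steps = UNIV"
  by (auto simp: steps_def space_PiM)

lemma measurable_step [measurable]: "(\<lambda>\<omega>. \<omega> i) \<in> steps \<rightarrow>\<^sub>M count_space UNIV"
proof -
  have "(\<lambda>\<omega>. \<omega> i) \<in> steps \<rightarrow>\<^sub>M measure_pmf p"
    unfolding steps_def by (rule measurable_component_singleton) simp
  then show ?thesis by (simp cong: measurable_cong_sets)
qed

lemma measurable_into_steps:
  assumes "\<And>i. (\<lambda>x. f x i) \<in> M \<rightarrow>\<^sub>M count_space UNIV"
  shows "f \<in> M \<rightarrow>\<^sub>M steps"
  unfolding steps_def
proof (rule measurable_PiM_single')
  show "(\<lambda>x. f x i) \<in> M \<rightarrow>\<^sub>M measure_pmf p" for i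
    using assms[of i] by (simp cong: measurable_cong_sets)
qed (auto simp: space_PiM)

lemma prob_space_steps: "prob_space steps"
  unfolding steps_def by (rule prob_space_PiM) (rule measure_pmf.prob_space_axioms)

lemma distr_step: "distr steps (count_space UNIV) (\<lambda>\<omega>. \<omega> i) = measure_pmf p"
proof -
  have "distr steps (count_space UNIV) (\<lambda>\<omega>. \<omega> i) = distr steps (measure_pmf p) (\<lambda>\<omega>. \<omega> i)"
    by (intro distr_cong) auto
  also have "\<dots> = measure_pmf p"
    unfolding steps_def by (rule seq.PiM_component) simp
  finally show ?thesis .
qed

lemma discrete_regenerative: "regenerative_walk steps walk_position walk_restart (range real) UNIV"
proof -
  interpret prob_space steps by (rule prob_space_steps)
  have floor: "nat \<lfloor>real n\<rfloor> = n" for n by simp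
  have floor_meas [measurable]: "(\<lambda>z. nat \<lfloor>fst z :: real\<rfloor>) \<in> borel \<Otimes>\<^sub>M steps \<rightarrow>\<^sub>M count_space UNIV"
    by measurable
  show ?thesis
  proof
    show "(\<lambda>z. walk_position (fst z) (snd z)) \<in> borel \<Otimes>\<^sub>M steps \<rightarrow>\<^sub>M count_space UNIV"
      unfolding walk_position_def
      by (rule measurable_compose_countable'[OF _ floor_meas, where f = "\<lambda>n z. \<Sum>i<n. snd z i"]) simp_all
    show "(\<lambda>z. walk_restart (fst z) (snd z)) \<in> borel \<Otimes>\<^sub>M steps \<rightarrow>\<^sub>M steps"
    proof (rule measurable_into_steps)
      fix i
      show "(\<lambda>z. walk_restart (fst z) (snd z) i) \<in> borel \<Otimes>\<^sub>M steps \<rightarrow>\<^sub>M count_space UNIV"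
        unfolding walk_restart_def
        by (rule measurable_compose_countable'[OF _ floor_meas, where f = "\<lambda>n z. snd z (i + n)"]) simp_all
    qed
    fix s assume "s \<in> range real"
    then obtain n where s: "s = real n" by auto
    let ?P = "steps \<Otimes>\<^sub>M steps"
    have comb: "distr ?P steps (\<lambda>(\<omega>, \<omega>'). comb_seq n \<omega> \<omega>') = steps"
      unfolding steps_def by (rule seq.PiM_comb_seq)
    have comb_meas: "(\<lambda>(\<omega>, \<omega>'). comb_seq n \<omega> \<omega>') \<in> ?P \<rightarrow>\<^sub>M steps"
      unfolding steps_def by (rule measurable_comb_seq)
    have pos_meas [measurable]: "walk_position s \<in> steps \<rightarrow>\<^sub>M count_space UNIV"
      unfolding walk_position_def by measurable
    have re_meas [measurable]: "walk_restart s \<in> steps \<rightarrow>\<^sub>M steps"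
      by (rule measurable_into_steps) (simp add: walk_restart_def)
    have "distr steps (count_space UNIV \<Otimes>\<^sub>M steps) (\<lambda>\<omega>. (walk_position s \<omega>, walk_restart s \<omega>))
       = distr (distr ?P steps (\<lambda>(\<omega>, \<omega>'). comb_seq n \<omega> \<omega>')) (count_space UNIV \<Otimes>\<^sub>M steps)
          (\<lambda>\<omega>. (walk_position s \<omega>, walk_restart s \<omega>))"
      by (simp only: comb)
    also have "\<dots> = distr ?P (count_space UNIV \<Otimes>\<^sub>M steps) (\<lambda>(\<omega>, \<omega>'). (walk_position s \<omega>, \<omega>'))"
    proof (subst distr_distr[OF _ comb_meas])
      have "walk_position s (comb_seq n \<omega> \<omega>') = walk_position s \<omega>" for \<omega> \<omega>'
        by (auto simp: walk_position_def s comb_seq_less intro!: sum.cong)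
      moreover have "walk_restart s (comb_seq n \<omega> \<omega>') = \<omega>'" for \<omega> \<omega>'
        by (auto simp: walk_restart_def s comb_seq_add)
      ultimately show "distr ?P (count_space UNIV \<Otimes>\<^sub>M steps) ((\<lambda>\<omega>. (walk_position s \<omega>, walk_restart s \<omega>)) \<circ> (\<lambda>(\<omega>, \<omega>'). comb_seq n \<omega> \<omega>'))
          = distr ?P (count_space UNIV \<Otimes>\<^sub>M steps) (\<lambda>(\<omega>, \<omega>'). (walk_position s \<omega>, \<omega>'))"
        by (intro distr_cong) auto
    qed measurable
    also have "\<dots> = distr steps (count_space UNIV) (walk_position s) \<Otimes>\<^sub>M distr steps steps (\<lambda>\<omega>. \<omega>)"
      by (rule pair_measure_distr[symmetric]) (auto simp: distr_id2 prob_space_imp_sigma_finite prob_space_axioms)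
    finally show "distr steps (count_space UNIV \<Otimes>\<^sub>M steps) (\<lambda>\<omega>. (walk_position s \<omega>, walk_restart s \<omega>))
       = distr steps (count_space UNIV) (walk_position s) \<Otimes>\<^sub>M steps"
      by (simp add: distr_id2)
  next
    fix s u and \<omega> :: "nat \<Rightarrow> int ^ 2" assume "s \<in> range real" "u \<in> range real"
    then obtain n m where s: "s = real n" "u = real m" by auto
    have f: "nat \<lfloor>s + u\<rfloor> = n + m" unfolding s by (metis floor of_nat_add)
    have "(\<Sum>i<n + m. \<omega> i) = (\<Sum>i<n. \<omega> i) + (\<Sum>i<m. \<omega> (i + n))" 
      by (induction m) (auto simp: add.commute add.left_commute)
    then show "walk_position (s + u) \<omega> = walk_position s \<omega> + walk_position u (walk_restart s \<omega>)"
      unfolding walk_position_def walk_restart_def f by (simp add: s)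
  next
    fix s u :: real assume "s \<in> range real" "u \<in> range real"
    then obtain n m where s: "s = real n" "u = real m" by auto
    show "s \<le> u \<Longrightarrow> u - s \<in> range real" unfolding s by (metis of_nat_diff of_nat_le_iff rangeI)
  qed auto
qed

lemma discrete_step_char: "regenerative_walk.step_char steps walk_position (real n) \<theta> = char_fun p \<theta> ^ n"
proof -
  interpret regenerative_walk steps walk_position walk_restart "range real" UNIV
    by (rule discrete_regenerative)
  have one: "step_char 1 \<theta> = char_fun p \<theta>"
  proof -
    have "step_char 1 \<theta> = (\<integral>\<omega>. character \<theta> (\<omega> 0) \<partial>steps)"
      unfolding step_char_def by (simp add: walk_position_def)
    also have "\<dots> = (\<integral>x. character \<theta> x \<partial>distr steps (count_space UNIV) (\<lambda>\<omega>. \<omega> 0))"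
      by (rule integral_distr[symmetric]) auto
    finally show ?thesis by (simp add: distr_step char_fun_def)
  qed
  show ?thesis
  proof (induction n)
    case 0
    show ?case unfolding step_char_def using prob_space by (simp add: walk_position_def)
  next
    case (Suc n)
    have "step_char (real n + 1) \<theta> = step_char (real n) \<theta> * step_char 1 \<theta>"
      by (rule step_char_add) (auto intro: range_eqI[of _ _ 1])
    then show ?case using Suc one by (simp add: add.commute mult.commute)
  qed
qed

end

lemma Bernoulli_power_bound:
  fixes x :: real
  assumes "0 \<le> x"
  shows "1 - x ^ n \<le> real n * (1 - x)"
  using Bernoulli_inequality[of "x - 1" n] assms by (simp add: algebra_simps)

text \<open>The rate is half of \<open>1 - r\<^sup>2\<close> for the modulus \<open>r\<close> of the characteristic function, because \<open>r\<^sup>2 \<le> exp (r\<^sup>2 - 1)\<close>; the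
  bound of the spread is the inequality of Bernoulli.\<close>

lemma discrete_collision_decay:
  assumes irr: "irreducible_pmf pX" and mean: "zero_mean pX"
  shows "\<exists>C. collision_decay (steps pX) walk_position walk_restart (range real) UNIV
    (steps pY) walk_position walk_restart UNIV
    (\<lambda>\<theta>. (1 - (norm (char_fun pX \<theta>))\<^sup>2) / 2) (\<lambda>\<theta>. (1 - (norm (char_fun pY \<theta>))\<^sup>2) / 2) C"
proof -
  obtain C where C: "C > 0" "\<And>u. u > 0 \<Longrightarrow>
      (\<integral>\<^sup>+\<theta>. ennreal (exp (- (u * (1 - (norm (char_fun pX \<theta>))\<^sup>2)))) \<partial>torus) \<le> ennreal (C / u)"
    using torus_integral_decay[OF irr mean] by blast
  interpret X: regenerative_walk "steps pX" walk_position walk_restart "range real" UNIV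
    by (rule discrete_regenerative)
  interpret Y: regenerative_walk "steps pY" walk_position walk_restart "range real" UNIV
    by (rule discrete_regenerative)
  have step: "norm (char_fun p \<theta> ^ n) \<le> exp (- (real n * ((1 - (norm (char_fun p \<theta>))\<^sup>2) / 2)))" for p \<theta> n
  proof -
    let ?r = "norm (char_fun p \<theta>)"
    have "?r\<^sup>2 \<le> exp (?r\<^sup>2 - 1)" using exp_ge_add_one_self[of "?r\<^sup>2 - 1"] by simp
    also have "\<dots> = (exp ((?r\<^sup>2 - 1) / 2))\<^sup>2" by (simp add: power2_eq_square mult_exp_exp)
    finally have "?r \<le> exp ((?r\<^sup>2 - 1) / 2)" by (rule power2_le_imp_le) simp
    then have "?r ^ n \<le> exp ((?r\<^sup>2 - 1) / 2) ^ n" by (intro power_mono) auto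
    also have "\<dots> = exp (- (real n * ((1 - ?r\<^sup>2) / 2)))"
      by (simp add: exp_of_nat_mult[symmetric] algebra_simps diff_divide_distrib)
    finally show ?thesis by (simp add: norm_power)
  qed
  show ?thesis
  proof (intro exI[of _ "max 1 (2 * C)"], unfold_locales)
    show "(\<integral>\<^sup>+\<theta>. ennreal (exp (- (u * ((1 - (norm (char_fun pX \<theta>))\<^sup>2) / 2)))) \<partial>torus) \<le> ennreal (max 1 (2 * C) / u)"
      if "u > 0" for u
    proof -
      have "(\<integral>\<^sup>+\<theta>. ennreal (exp (- (u / 2 * (1 - (norm (char_fun pX \<theta>))\<^sup>2)))) \<partial>torus) \<le> ennreal (C / (u / 2))"
        using that by (intro C) simp
      also have "\<dots> \<le> ennreal (max 1 (2 * C) / u)"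
        using that by (intro ennreal_leI) (simp add: divide_right_mono mult.commute)
      finally show ?thesis by simp
    qed
    fix \<theta>
    show "0 \<le> (1 - (norm (char_fun pY \<theta>))\<^sup>2) / 2"
      using norm_char_fun_le[of pY \<theta>] by (simp add: power_le_one)
    fix s assume "s \<in> range real"
    then obtain n where s: "s = real n" by auto
    show "norm (X.step_char s \<theta>) \<le> exp (- (s * ((1 - (norm (char_fun pX \<theta>))\<^sup>2) / 2)))"
      "norm (Y.step_char s \<theta>) \<le> exp (- (s * ((1 - (norm (char_fun pY \<theta>))\<^sup>2) / 2)))"
      unfolding s discrete_step_char by (rule step)+
    show "1 - (norm (Y.step_char s \<theta>))\<^sup>2 \<le> 2 * s * ((1 - (norm (char_fun pY \<theta>))\<^sup>2) / 2)"
      unfolding s discrete_step_char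
      using Bernoulli_power_bound[of "(norm (char_fun pY \<theta>))\<^sup>2" n]
      by (simp add: norm_power power_mult[symmetric] mult.commute)
  qed auto
qed

lemma time_measure_count_from: "time_measure (count_from N)"
proof
  fix n :: nat
  have "{m. N \<le> m \<and> real m \<in> {real n..<real n + 1}} \<subseteq> {n}" by auto
  then have "emeasure (count_space UNIV) {m. N \<le> m \<and> real m \<in> {real n..<real n + 1}} \<le> emeasure (count_space UNIV) {n}"
    by (intro emeasure_mono) auto
  then show "emeasure (count_from N) {real n..<real n + 1} \<le> 1"
    by (subst emeasure_count_from) auto
qed simp

lemma AE_count_from: "AE s in count_from N. s \<in> range real"
proof -
  have "range real \<in> sets borel" by (rule sets.countable) auto
  then show ?thesis
    unfolding count_from_def by (subst AE_distr_iff) (auto intro!: AE_I2 rangeI simp flip: of_nat_add)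
qed

abbreviation "discrete_collision pX pY C \<nu> \<equiv>
  collision_time (steps pX) walk_position walk_restart (range real) UNIV
    (steps pY) walk_position walk_restart UNIV
    (\<lambda>\<theta>. (1 - (norm (char_fun pX \<theta>))\<^sup>2) / 2) (\<lambda>\<theta>. (1 - (norm (char_fun pY \<theta>))\<^sup>2) / 2) C \<nu>"

lemma discrete_collision_time:
  assumes "irreducible_pmf pX" "zero_mean pX"
  shows "\<exists>C. \<forall>N. discrete_collision pX pY C (count_from N)"
proof -
  have "AE s in count_from N. 0 \<le> s \<longrightarrow> s \<in> range real" for N
    using AE_count_from[of N] by eventually_elim simp
  then show ?thesis
    using discrete_collision_decay[OF assms, of pY] time_measure_count_from
    unfolding collision_time_def collision_time_axioms_def by blast
qed

subsection \<open>The difference of two discrete walks\<close>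

lemma integrable_pair_pmf_fst:
  "integrable (measure_pmf p) f \<Longrightarrow> integrable (measure_pmf (pair_pmf p q)) (\<lambda>z. f (fst z))"
  for f :: "_ \<Rightarrow> 'b::{banach, second_countable_topology}"
  by (subst (asm) map_fst_pair_pmf[of p q, symmetric]) (simp add: map_pmf_rep_eq integrable_distr_eq)

lemma integrable_pair_pmf_snd:
  "integrable (measure_pmf q) f \<Longrightarrow> integrable (measure_pmf (pair_pmf p q)) (\<lambda>z. f (snd z))"
  for f :: "_ \<Rightarrow> 'b::{banach, second_countable_topology}"
  by (subst (asm) map_snd_pair_pmf[of p q, symmetric]) (simp add: map_pmf_rep_eq integrable_distr_eq)

lemma real_site_diff: "real_site (x - y) = real_site x - real_site y"
  by (simp add: real_site_def vec_eq_iff)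

lemma zero_mean_discrete_difference:
  assumes "zero_mean p" "zero_mean q"
  shows "zero_mean (discrete_difference_pmf p q)"
proof -
  have p: "integrable (measure_pmf p) real_site" "(\<integral>x. real_site x \<partial>measure_pmf p) = 0"
    and q: "integrable (measure_pmf q) real_site" "(\<integral>x. real_site x \<partial>measure_pmf q) = 0"
    using assms by (auto simp: zero_mean_def has_bochner_integral_iff)
  note i = integrable_pair_pmf_fst[OF p(1), of q] integrable_pair_pmf_snd[OF q(1), of p]
  have "(\<integral>z. real_site (fst z) \<partial>measure_pmf (pair_pmf p q)) = (\<integral>x. real_site x \<partial>map_pmf fst (pair_pmf p q))"
    "(\<integral>z. real_site (snd z) \<partial>measure_pmf (pair_pmf p q)) = (\<integral>x. real_site x \<partial>map_pmf snd (pair_pmf p q))"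
    by simp_all
  then have "has_bochner_integral (measure_pmf (pair_pmf p q)) (\<lambda>z. real_site (fst z - snd z)) (0 - 0)"
    unfolding real_site_diff map_fst_pair_pmf map_snd_pair_pmf
    by (intro has_bochner_integral_diff) (auto simp: has_bochner_integral_iff i p q)
  then show ?thesis
    unfolding zero_mean_def discrete_difference_pmf_def
    by (simp add: has_bochner_integral_iff map_pmf_rep_eq integrable_distr_eq integral_distr case_prod_unfold)
qed

lemma finite_variance_discrete_difference:
  assumes "finite_variance p" "finite_variance q"
  shows "finite_variance (discrete_difference_pmf p q)"
proof -
  have p: "integrable (measure_pmf (pair_pmf p q)) (\<lambda>z. (norm (real_site (fst z)))\<^sup>2)"
    and q: "integrable (measure_pmf (pair_pmf p q)) (\<lambda>z. (norm (real_site (snd z)))\<^sup>2)"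
    using assms unfolding finite_variance_def by (auto intro: integrable_pair_pmf_fst integrable_pair_pmf_snd)
  have "integrable (measure_pmf (pair_pmf p q)) (\<lambda>z. (norm (real_site (fst z - snd z)))\<^sup>2)"
  proof (rule Bochner_Integration.integrable_bound)
    show "integrable (measure_pmf (pair_pmf p q)) (\<lambda>z. 2 * (norm (real_site (fst z)))\<^sup>2 + 2 * (norm (real_site (snd z)))\<^sup>2)"
      using p q by simp
    have "(norm (a - b))\<^sup>2 \<le> 2 * (norm a)\<^sup>2 + 2 * (norm b)\<^sup>2" for a b :: "real ^ 2"
    proof -
      have "(norm (a - b))\<^sup>2 \<le> (norm a + norm b)\<^sup>2" by (intro power_mono norm_triangle_ineq4) simp
      also have "\<dots> \<le> 2 * (norm a)\<^sup>2 + 2 * (norm b)\<^sup>2"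
        using zero_le_power2[of "norm a - norm b"] by (simp add: power2_eq_square algebra_simps)
      finally show ?thesis .
    qed
    then show "AE z in measure_pmf (pair_pmf p q). norm ((norm (real_site (fst z - snd z)))\<^sup>2)
        \<le> norm (2 * (norm (real_site (fst z)))\<^sup>2 + 2 * (norm (real_site (snd z)))\<^sup>2)"
      by (simp add: real_site_diff)
  qed simp
  then show ?thesis
    unfolding finite_variance_def discrete_difference_pmf_def
    by (simp add: map_pmf_rep_eq integrable_distr_eq case_prod_unfold)
qed

theorem discrete_quenched_moments:
  fixes pX pY :: "(int ^ 2) pmf"
  assumes pX: "irreducible_pmf pX" "zero_mean pX" "finite_variance pX"
    and pY: "zero_mean pY" "finite_variance pY"
    and irr: "irreducible_pmf (discrete_difference_pmf pX pY)"
  defines "A \<equiv> 1 / (2 * pi * sqrt (det (covariance_matrix (discrete_difference_pmf pX pY))))"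
  shows "AE y in steps pY. \<forall>k. ((\<lambda>t. (\<integral>x. measure count_time ({s. walk_position s x = walk_position s y} \<inter> {0..t}) ^ k
      \<partial>steps pX) / ln t ^ k) \<longlongrightarrow> fact k * A ^ k) at_top"
proof -
  define pZ where "pZ = discrete_difference_pmf pX pY"
  have Z: "irreducible_pmf pZ" "zero_mean pZ" "finite_variance pZ"
    using irr zero_mean_discrete_difference finite_variance_discrete_difference pX pY by (auto simp: pZ_def)
  obtain C where time: "\<And>N. discrete_collision pX pY C (count_from N)"
    using discrete_collision_time[OF pX(1,2)] by blast
  interpret collision_time "steps pX" walk_position walk_restart "range real" UNIV
    "steps pY" walk_position walk_restart UNIV
    "\<lambda>\<theta>. (1 - (norm (char_fun pX \<theta>))\<^sup>2) / 2" "\<lambda>\<theta>. (1 - (norm (char_fun pY \<theta>))\<^sup>2) / 2" C "count_from 0"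
    by (rule time)
  have green_n: "green (real n) = Re (\<integral>\<theta>. char_fun pZ \<theta> ^ n \<partial>torus)" for n
  proof -
    have "complex_of_real (green (real n)) = (\<integral>\<theta>. char_fun pZ \<theta> ^ n \<partial>torus)"
      unfolding green_Fourier discrete_step_char pZ_def char_fun_discrete_difference
      by (simp add: power_mult_distrib mult.commute)
    from arg_cong[OF this, of Re] show ?thesis by simp
  qed
  have green_le': "\<bar>green s\<bar> \<le> 2 * C / max 1 s" if "0 \<le> s" for s
  proof -
    define n where "n = nat \<lfloor>s\<rfloor>"
    have "green s = green (real n)"
      by (simp add: green_def X.occupation_def walk_position_def n_def)
    also have "\<dots> \<le> C / max 1 (real n)" by (rule green_le) simp
    also have "\<dots> \<le> 2 * C / max 1 s"
    proof -
      have "s < real n + 1" using that real_of_int_floor_add_one_gt[of s] by (simp add: n_def)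
      then have "max 1 s \<le> 2 * max 1 (real n)" by (auto simp: max_def)
      then have "C * max 1 s \<le> C * (2 * max 1 (real n))" using C_ge_1 by (intro mult_left_mono) auto
      then show ?thesis by (simp add: field_simps)
    qed
    finally show ?thesis using green_nonneg[of s] by simp
  qed
  let ?G = "\<lambda>N t. (\<integral>s. indicator {0..t} s * green s \<partial>count_from N)"
  have G: "((\<lambda>t. ?G 0 t / ln t) \<longlongrightarrow> A) at_top"
    unfolding count_from_0 A_def pZ_def[symmetric]
    by (rule discrete_returns_log[OF Z measurable_green green_n green_le'])
  have split: "?G 1 t = ?G 0 t - green 0" if "0 \<le> t" for t
  proof -
    have "{n. 0 \<le> n \<and> real n \<in> UNIV \<inter> {0..t}} = insert 0 {n. 1 \<le> n \<and> real n \<in> UNIV \<inter> {0..t}}"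
      using that by (auto simp: Suc_le_eq)
    then show ?thesis
      using integral_count_from[where f = green and B = UNIV and t = t and N = 0]
        integral_count_from[where f = green and B = UNIV and t = t and N = 1]
        finite_nats_le[where N = 1 and B = UNIV and t = t] by simp
  qed
  have G1: "((\<lambda>t. ?G 1 t / ln t) \<longlongrightarrow> A) at_top"
  proof -
    have "((\<lambda>t :: real. c / ln t) \<longlongrightarrow> 0) at_top" for c :: real by real_asymp
    from tendsto_diff[OF G this[of "green 0"]]
    have "((\<lambda>t. ?G 0 t / ln t - green 0 / ln t) \<longlongrightarrow> A) at_top" by simp
    then show ?thesis
    proof (rule Lim_transform_eventually)
      show "\<forall>\<^sub>F t in at_top. ?G 0 t / ln t - green 0 / ln t
          = ?G 1 t / ln t"
        using eventually_ge_at_top[of 0] by eventually_elim (simp only: split diff_divide_distrib)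
    qed
  qed
  have le: "emeasure (count_from 1) B \<le> emeasure (count_from 0) B" if "B \<in> sets borel" for B
    unfolding emeasure_count_from[OF that] by (rule emeasure_mono) auto
  show ?thesis
    unfolding count_from_0[symmetric]
    by (rule quenched_moments_tendsto[OF time time le count_from_0_collision_power count_from_1_collision_power G G1])
qed

section \<open>Continuous time\<close>

definition arrival :: "(nat \<Rightarrow> real) \<Rightarrow> nat \<Rightarrow> real" where
  "arrival \<tau> n = (\<Sum>i\<le>n. \<tau> i)"

definition jumps :: "real \<Rightarrow> (nat \<Rightarrow> real) \<Rightarrow> nat" where
  "jumps s \<tau> = card {n. arrival \<tau> n \<le> s}"

definition jump_position :: "real \<Rightarrow> (nat \<Rightarrow> real) \<times> (nat \<Rightarrow> int ^ 2) \<Rightarrow> int ^ 2" where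
  "jump_position s \<omega> = (\<Sum>i<jumps s (fst \<omega>). snd \<omega> i)"

text \<open>After time \<open>s\<close>, the first waiting time is the remainder of the one that is running at time \<open>s\<close>.\<close>

definition jump_restart ::
    "real \<Rightarrow> (nat \<Rightarrow> real) \<times> (nat \<Rightarrow> int ^ 2) \<Rightarrow> (nat \<Rightarrow> real) \<times> (nat \<Rightarrow> int ^ 2)" where
  "jump_restart s \<omega> = (let N = jumps s (fst \<omega>) in
     (\<lambda>i. if i = 0 then arrival (fst \<omega>) N - s else fst \<omega> (N + i), \<lambda>i. snd \<omega> (N + i)))"

text \<open>The arrival times increase strictly and without bound, so that the number of jumps before any time is finite and the
  default value \<open>card A = 0\<close> of an infinite set is never used.\<close>

definition nonexplosive :: "(nat \<Rightarrow> real) \<Rightarrow> bool" where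
  "nonexplosive \<tau> \<longleftrightarrow> (\<forall>i. 0 < \<tau> i) \<and> (\<forall>m :: nat. \<exists>n. real m < arrival \<tau> n)"

lemma arrival_0 [simp]: "arrival \<tau> 0 = \<tau> 0"
  and arrival_Suc: "arrival \<tau> (Suc n) = arrival \<tau> n + \<tau> (Suc n)"
  by (simp_all add: arrival_def)

lemma arrival_mono:
  assumes "nonexplosive \<tau>" "m \<le> n"
  shows "arrival \<tau> m \<le> arrival \<tau> n"
proof (rule lift_Suc_mono_le[OF _ assms(2)])
  show "arrival \<tau> n \<le> arrival \<tau> (Suc n)" for n
    using assms(1) by (simp add: arrival_Suc nonexplosive_def less_imp_le)
qed

lemma arrival_le_iff:
  assumes "nonexplosive \<tau>"
  shows "arrival \<tau> n \<le> s \<longleftrightarrow> n < jumps s \<tau>"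
proof -
  let ?A = "{n. arrival \<tau> n \<le> s}"
  obtain m :: nat where "s \<le> real m" using real_arch_simple by blast
  moreover obtain k where k: "real m < arrival \<tau> k" using assms by (auto simp: nonexplosive_def)
  ultimately have k: "s < arrival \<tau> k" by simp
  define K where "K = (LEAST k. s < arrival \<tau> k)"
  have K: "s < arrival \<tau> K" unfolding K_def using k by (rule LeastI)
  have "?A = {..<K}"
  proof (intro set_eqI iffI)
    fix n assume "n \<in> ?A"
    show "n \<in> {..<K}"
    proof (rule ccontr)
      assume "n \<notin> {..<K}"
      then have "arrival \<tau> K \<le> arrival \<tau> n" by (intro arrival_mono assms) auto
      with K \<open>n \<in> ?A\<close> show False by simp
    qed
  next
    fix n assume "n \<in> {..<K}"
    then have "\<not> s < arrival \<tau> n" unfolding K_def using not_less_Least by blast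
    then show "n \<in> ?A" by simp
  qed
  then have "?A = {..<jumps s \<tau>}" by (simp add: jumps_def)
  then show ?thesis by blast
qed

lemma jumps_eqI:
  assumes "nonexplosive \<tau>" "\<And>n. arrival \<tau> n \<le> s \<longleftrightarrow> n < N"
  shows "jumps s \<tau> = N"
proof -
  have "n < jumps s \<tau> \<longleftrightarrow> n < N" for n
    using assms arrival_le_iff[OF assms(1), of n s] by simp
  from this[of N] this[of "jumps s \<tau>"] show ?thesis by auto
qed

lemma arrival_restart:
  "arrival (fst (jump_restart s (\<tau>, \<xi>))) n = arrival \<tau> (jumps s \<tau> + n) - s"
proof (induction n)
  case 0
  show ?case by (simp add: jump_restart_def Let_def)
next
  case (Suc n)
  then show ?case by (simp add: arrival_Suc jump_restart_def Let_def)
qed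

lemma nonexplosive_restart:
  assumes "nonexplosive \<tau>"
  shows "nonexplosive (fst (jump_restart s (\<tau>, \<xi>)))"
  unfolding nonexplosive_def
proof (intro conjI allI)
  fix i
  have "s < arrival \<tau> (jumps s \<tau>)" using arrival_le_iff[OF assms, of "jumps s \<tau>" s] by simp
  then show "0 < fst (jump_restart s (\<tau>, \<xi>)) i"
    using assms by (auto simp: jump_restart_def Let_def nonexplosive_def)
next
  fix m :: nat
  obtain m' :: nat where m': "real m + s \<le> real m'" using real_arch_simple by blast
  obtain n where "real m' < arrival \<tau> n" using assms by (auto simp: nonexplosive_def)
  also have "\<dots> \<le> arrival \<tau> (jumps s \<tau> + n)" by (intro arrival_mono assms) simp
  finally show "\<exists>n. real m < arrival (fst (jump_restart s (\<tau>, \<xi>))) n"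
    using m' by (intro exI[of _ n]) (simp add: arrival_restart)
qed

lemma jumps_add:
  assumes "nonexplosive \<tau>" "0 \<le> u"
  shows "jumps (s + u) \<tau> = jumps s \<tau> + jumps u (fst (jump_restart s (\<tau>, \<xi>)))"
proof -
  let ?\<tau>' = "fst (jump_restart s (\<tau>, \<xi>))"
  have le: "jumps s \<tau> \<le> jumps (s + u) \<tau>"
  proof (rule ccontr)
    assume "\<not> ?thesis"
    then have "arrival \<tau> (jumps (s + u) \<tau>) \<le> s" by (simp add: arrival_le_iff[OF assms(1)])
    then have "arrival \<tau> (jumps (s + u) \<tau>) \<le> s + u" using assms(2) by simp
    then show False by (simp add: arrival_le_iff[OF assms(1)])
  qed
  have "jumps u ?\<tau>' = jumps (s + u) \<tau> - jumps s \<tau>"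
  proof (rule jumps_eqI[OF nonexplosive_restart[OF assms(1)]])
    fix n
    have "arrival ?\<tau>' n \<le> u \<longleftrightarrow> arrival \<tau> (jumps s \<tau> + n) \<le> s + u"
      by (auto simp: arrival_restart)
    also have "\<dots> \<longleftrightarrow> n < jumps (s + u) \<tau> - jumps s \<tau>"
      by (auto simp: arrival_le_iff[OF assms(1)])
    finally show "arrival ?\<tau>' n \<le> u \<longleftrightarrow> n < jumps (s + u) \<tau> - jumps s \<tau>" .
  qed
  with le show ?thesis by simp
qed

lemma jump_position_add:
  assumes "nonexplosive (fst \<omega>)" "0 \<le> u"
  shows "jump_position (s + u) \<omega> = jump_position s \<omega> + jump_position u (jump_restart s \<omega>)"
proof -
  obtain \<tau> \<xi> where \<omega>: "\<omega> = (\<tau>, \<xi>)" by (cases \<omega>)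
  have sum: "(\<Sum>i<n + m. \<xi> i) = (\<Sum>i<n. \<xi> i) + (\<Sum>i<m. \<xi> (n + i))" for n m
    by (induction m) (auto simp: add.assoc)
  show ?thesis
    using jumps_add[of \<tau> u s \<xi>] assms unfolding \<omega> jump_position_def
    by (simp add: sum) (simp add: jump_restart_def Let_def)
qed

text \<open>Regeneration is proved by removing the first waiting time and the first step from the noise, which leaves a noise with the
  same law.\<close>

lemma arrival_case_nat: "arrival (case_nat a \<tau>) 0 = a" "arrival (case_nat a \<tau>) (Suc n) = a + arrival \<tau> n"
proof -
  show "arrival (case_nat a \<tau>) (Suc n) = a + arrival \<tau> n"
    by (induction n) (simp_all add: arrival_Suc)
qed simp

lemma nonexplosive_case_nat:
  assumes "nonexplosive \<tau>" "0 < a"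
  shows "nonexplosive (case_nat a \<tau>)"
  unfolding nonexplosive_def
proof (intro conjI allI)
  show "0 < case_nat a \<tau> i" for i using assms by (auto simp: nonexplosive_def split: nat.split)
  fix m :: nat
  obtain n where "real m < arrival \<tau> n" using assms by (auto simp: nonexplosive_def)
  then show "\<exists>n. real m < arrival (case_nat a \<tau>) n"
    using assms(2) by (intro exI[of _ "Suc n"]) (simp add: arrival_case_nat)
qed

lemma jumps_case_nat:
  assumes "nonexplosive \<tau>" "0 < a"
  shows "s < a \<Longrightarrow> jumps s (case_nat a \<tau>) = 0"
    and "a \<le> s \<Longrightarrow> jumps s (case_nat a \<tau>) = Suc (jumps (s - a) \<tau>)"
proof -
  note ne = nonexplosive_case_nat[OF assms]
  show "jumps s (case_nat a \<tau>) = 0" if "s < a"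
  proof (rule jumps_eqI[OF ne])
    have "arrival (case_nat a \<tau>) 0 \<le> arrival (case_nat a \<tau>) n" for n by (rule arrival_mono[OF ne]) simp
    then show "arrival (case_nat a \<tau>) n \<le> s \<longleftrightarrow> n < 0" for n
      using that by (simp add: arrival_case_nat not_le less_le_trans)
  qed
  show "jumps s (case_nat a \<tau>) = Suc (jumps (s - a) \<tau>)" if "a \<le> s"
  proof (rule jumps_eqI[OF ne])
    fix n
    show "arrival (case_nat a \<tau>) n \<le> s \<longleftrightarrow> n < Suc (jumps (s - a) \<tau>)"
    proof (cases n)
      case (Suc k)
      have "arrival (case_nat a \<tau>) n \<le> s \<longleftrightarrow> arrival \<tau> k \<le> s - a" by (auto simp: Suc arrival_case_nat)
      then show ?thesis by (simp add: arrival_le_iff[OF assms(1)] Suc)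
    qed (use that in \<open>simp add: arrival_case_nat\<close>)
  qed
qed

lemma jump_case_nat_before:
  assumes "nonexplosive \<tau>" "0 < a" "s < a"
  shows "jump_position s (case_nat a \<tau>, \<xi>) = 0"
    and "jump_restart s (case_nat a \<tau>, \<xi>) = (case_nat (a - s) \<tau>, \<xi>)"
  using jumps_case_nat(1)[OF assms]
  by (auto simp: jump_position_def jump_restart_def Let_def fun_eq_iff split: nat.split)

lemma jump_case_nat_after:
  assumes "nonexplosive \<tau>" "0 < a" "a \<le> s"
  shows "jump_position s (case_nat a \<tau>, case_nat y \<xi>) = y + jump_position (s - a) (\<tau>, \<xi>)"
    and "jump_restart s (case_nat a \<tau>, case_nat y \<xi>) = jump_restart (s - a) (\<tau>, \<xi>)"
  using jumps_case_nat(2)[OF assms]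
  by (auto simp: jump_position_def jump_restart_def Let_def fun_eq_iff sum.lessThan_Suc_shift arrival_case_nat
      simp del: sum.lessThan_Suc)

abbreviation prepend ::
    "real \<Rightarrow> int ^ 2 \<Rightarrow> (nat \<Rightarrow> real) \<times> (nat \<Rightarrow> int ^ 2) \<Rightarrow> (nat \<Rightarrow> real) \<times> (nat \<Rightarrow> int ^ 2)" where
  "prepend a y \<omega> \<equiv> (case_nat a (fst \<omega>), case_nat y (snd \<omega>))"

context
  fixes p :: "(int ^ 2) pmf" and r :: real
  assumes r: "r > 0"
begin

definition wait_law :: "real measure" where
  "wait_law = density lborel (exponential_density r)"

lemma sets_wait_law [simp, measurable_cong]: "sets wait_law = sets borel"
  and space_wait_law [simp]: "space wait_law = UNIV"
  by (auto simp: wait_law_def)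

lemma prob_space_wait_law: "prob_space wait_law"
  unfolding wait_law_def by (rule prob_space_exponential_density[OF r])

interpretation wait: sequence_space wait_law
  using prob_space_wait_law by (simp add: sequence_space_def product_prob_space_def product_prob_space_axioms_def
      product_sigma_finite_def prob_space_imp_sigma_finite)

interpretation step: sequence_space "measure_pmf p"
  by unfold_locales

definition waits :: "(nat \<Rightarrow> real) measure" where
  "waits = (\<Pi>\<^sub>M i\<in>UNIV. wait_law)"

definition noise :: "((nat \<Rightarrow> real) \<times> (nat \<Rightarrow> int ^ 2)) measure" where
  "noise = waits \<Otimes>\<^sub>M steps p"

lemma space_waits [simp]: "space waits = UNIV"
  by (auto simp: waits_def space_PiM)

lemma space_noise [simp]: "space noise = UNIV"
  by (simp add: noise_def space_pair_measure)

lemma prob_space_waits: "prob_space waits"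
  unfolding waits_def by (rule prob_space_PiM) (rule prob_space_wait_law)

interpretation W: prob_space waits by (rule prob_space_waits)
interpretation X: prob_space "steps p" by (rule prob_space_steps)
interpretation WX: pair_prob_space waits "steps p" ..
interpretation wl: prob_space wait_law by (rule prob_space_wait_law)

lemma prob_space_noise: "prob_space noise"
  unfolding noise_def by (rule WX.prob_space_axioms)

lemma measurable_wait [measurable]: "(\<lambda>\<tau>. \<tau> i) \<in> waits \<rightarrow>\<^sub>M borel"
proof -
  have "(\<lambda>\<tau>. \<tau> i) \<in> waits \<rightarrow>\<^sub>M wait_law" unfolding waits_def by (rule measurable_component_singleton) simp
  then show ?thesis by (simp cong: measurable_cong_sets)
qed

lemma measurable_into_waits:
  assumes "\<And>i. (\<lambda>x. f x i) \<in> borel_measurable M"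
  shows "f \<in> M \<rightarrow>\<^sub>M waits"
  unfolding waits_def
proof (rule measurable_PiM_single')
  show "(\<lambda>x. f x i) \<in> M \<rightarrow>\<^sub>M wait_law" for i using assms[of i] by (simp cong: measurable_cong_sets)
qed (auto simp: space_PiM)

lemma measurable_fst_noise [measurable]: "fst \<in> noise \<rightarrow>\<^sub>M waits"
  and measurable_snd_noise [measurable]: "snd \<in> noise \<rightarrow>\<^sub>M steps p"
  by (simp_all add: noise_def)

lemma measurable_wait_noise [measurable]: "(\<lambda>\<omega>. fst \<omega> i) \<in> borel_measurable noise"
  and measurable_step_noise [measurable]: "(\<lambda>\<omega>. snd \<omega> i) \<in> noise \<rightarrow>\<^sub>M count_space UNIV"
  using measurable_compose[OF measurable_fst_noise measurable_wait] measurable_compose[OF measurable_snd_noise measurable_step] by auto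

lemma measurable_Pair_noise:
  assumes "f \<in> M \<rightarrow>\<^sub>M waits" "g \<in> M \<rightarrow>\<^sub>M steps p"
  shows "(\<lambda>x. (f x, g x)) \<in> M \<rightarrow>\<^sub>M noise"
  unfolding noise_def using assms by (rule measurable_Pair)

lemma measurable_arrival [measurable]: "(\<lambda>\<tau>. arrival \<tau> n) \<in> borel_measurable waits"
  unfolding arrival_def by measurable

lemma measurable_arrival_noise [measurable]: "(\<lambda>\<omega>. arrival (fst \<omega>) n) \<in> borel_measurable noise"
  by (rule measurable_compose[OF measurable_fst_noise measurable_arrival])

lemma measurable_jumps_pair [measurable]: "(\<lambda>z. jumps (fst z) (snd z)) \<in> borel \<Otimes>\<^sub>M waits \<rightarrow>\<^sub>M count_space UNIV"
  unfolding jumps_def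
proof (rule measurable_card)
  fix n
  have "{x \<in> space (borel \<Otimes>\<^sub>M waits). arrival (snd x) n \<le> fst x} \<in> sets (borel \<Otimes>\<^sub>M waits)" by measurable
  then show "{x \<in> space (borel \<Otimes>\<^sub>M waits). n \<in> {n. arrival (snd x) n \<le> fst x}} \<in> sets (borel \<Otimes>\<^sub>M waits)" by simp
qed

lemma measurable_jumps [measurable (raw)]:
  assumes "f \<in> M \<rightarrow>\<^sub>M borel" "g \<in> M \<rightarrow>\<^sub>M waits"
  shows "(\<lambda>x. jumps (f x) (g x)) \<in> M \<rightarrow>\<^sub>M count_space UNIV"
  using measurable_compose[OF measurable_Pair[OF assms] measurable_jumps_pair] by simp

lemma measurable_jump_position [measurable (raw)]:
  assumes f: "f \<in> M \<rightarrow>\<^sub>M borel" and g: "g \<in> M \<rightarrow>\<^sub>M noise"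
  shows "(\<lambda>x. jump_position (f x) (g x)) \<in> M \<rightarrow>\<^sub>M count_space UNIV"
  unfolding jump_position_def
proof (rule measurable_compose_countable'[where f = "\<lambda>n x. \<Sum>i<n. snd (g x) i"])
  show "(\<lambda>x. jumps (f x) (fst (g x))) \<in> M \<rightarrow>\<^sub>M count_space UNIV"
    by (intro measurable_jumps f measurable_compose[OF g]) simp
  show "(\<lambda>x. \<Sum>i<n. snd (g x) i) \<in> M \<rightarrow>\<^sub>M count_space UNIV" for n
    by (intro measurable_sum_site measurable_compose[OF g]) simp
qed simp

lemma measurable_jump_restart [measurable (raw)]:
  assumes f [measurable]: "f \<in> M \<rightarrow>\<^sub>M borel" and g: "g \<in> M \<rightarrow>\<^sub>M noise"
  shows "(\<lambda>x. jump_restart (f x) (g x)) \<in> M \<rightarrow>\<^sub>M noise"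
  unfolding jump_restart_def Let_def
proof (intro measurable_Pair_noise measurable_into_waits measurable_into_steps)
  have N: "(\<lambda>x. jumps (f x) (fst (g x))) \<in> M \<rightarrow>\<^sub>M count_space UNIV"
    by (intro measurable_jumps f measurable_compose[OF g]) simp
  have [measurable]: "(\<lambda>x. arrival (fst (g x)) n) \<in> borel_measurable M" "(\<lambda>x. fst (g x) n) \<in> borel_measurable M" for n
    by (intro measurable_compose[OF g], simp)+
  fix i
  show "(\<lambda>x. if i = 0 then arrival (fst (g x)) (jumps (f x) (fst (g x))) - f x else fst (g x) (jumps (f x) (fst (g x)) + i)) \<in> borel_measurable M"
    by (rule measurable_compose_countable'[OF _ N, where f = "\<lambda>n x. if i = 0 then arrival (fst (g x)) n - f x else fst (g x) (n + i)"])
       simp_all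
  show "(\<lambda>x. snd (g x) (jumps (f x) (fst (g x)) + i)) \<in> M \<rightarrow>\<^sub>M count_space UNIV"
    by (rule measurable_compose_countable'[OF _ N, where f = "\<lambda>n x. snd (g x) (n + i)"])
       (intro measurable_compose[OF g], simp_all)
qed

lemma measurable_case_nat_waits [measurable (raw)]:
  assumes [measurable]: "f \<in> M \<rightarrow>\<^sub>M borel" "g \<in> M \<rightarrow>\<^sub>M waits"
  shows "(\<lambda>x. case_nat (f x) (g x)) \<in> M \<rightarrow>\<^sub>M waits"
proof (rule measurable_into_waits)
  show "(\<lambda>x. case i of 0 \<Rightarrow> f x | Suc n \<Rightarrow> g x n) \<in> borel_measurable M" for i
    by (cases i) (auto intro!: measurable_compose[OF assms(2)])
qed

lemma measurable_case_nat_steps [measurable (raw)]: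
  assumes [measurable]: "f \<in> M \<rightarrow>\<^sub>M count_space UNIV" "g \<in> M \<rightarrow>\<^sub>M steps p"
  shows "(\<lambda>x. case_nat (f x) (g x)) \<in> M \<rightarrow>\<^sub>M steps p"
proof (rule measurable_into_steps)
  show "(\<lambda>x. case i of 0 \<Rightarrow> f x | Suc n \<Rightarrow> g x n) \<in> M \<rightarrow>\<^sub>M count_space UNIV" for i
    by (cases i) (auto intro!: measurable_compose[OF assms(2)])
qed

lemma nn_integral_waits_iter:
  assumes [measurable]: "F \<in> borel_measurable waits"
  shows "(\<integral>\<^sup>+\<tau>. F \<tau> \<partial>waits) = (\<integral>\<^sup>+a. (\<integral>\<^sup>+\<tau>. F (case_nat a \<tau>) \<partial>waits) \<partial>wait_law)"
proof -
  have iter: "distr (wait_law \<Otimes>\<^sub>M waits) waits (\<lambda>(s, \<omega>). case_nat s \<omega>) = waits"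
    unfolding waits_def by (rule wait.PiM_iter)
  have "(\<integral>\<^sup>+\<tau>. F \<tau> \<partial>waits) = (\<integral>\<^sup>+\<tau>. F \<tau> \<partial>distr (wait_law \<Otimes>\<^sub>M waits) waits (\<lambda>(s, \<omega>). case_nat s \<omega>))"
    by (simp only: iter)
  also have "\<dots> = (\<integral>\<^sup>+z. F (case z of (s, \<omega>) \<Rightarrow> case_nat s \<omega>) \<partial>(wait_law \<Otimes>\<^sub>M waits))"
    by (rule nn_integral_distr) (simp_all add: case_prod_unfold)
  also have "\<dots> = (\<integral>\<^sup>+a. (\<integral>\<^sup>+\<tau>. F (case_nat a \<tau>) \<partial>waits) \<partial>wait_law)"
    by (subst W.nn_integral_fst[symmetric]) (simp_all add: case_prod_unfold)
  finally show ?thesis .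
qed

lemma nn_integral_steps_iter:
  assumes [measurable]: "F \<in> borel_measurable (steps p)"
  shows "(\<integral>\<^sup>+\<xi>. F \<xi> \<partial>steps p) = (\<integral>\<^sup>+y. (\<integral>\<^sup>+\<xi>. F (case_nat y \<xi>) \<partial>steps p) \<partial>measure_pmf p)"
proof -
  have iter: "distr (measure_pmf p \<Otimes>\<^sub>M steps p) (steps p) (\<lambda>(s, \<omega>). case_nat s \<omega>) = steps p"
    unfolding steps_def by (rule step.PiM_iter)
  have [measurable_cong]: "sets (measure_pmf p) = sets (count_space UNIV)" by simp
  have "(\<integral>\<^sup>+\<xi>. F \<xi> \<partial>steps p)
      = (\<integral>\<^sup>+\<xi>. F \<xi> \<partial>distr (measure_pmf p \<Otimes>\<^sub>M steps p) (steps p) (\<lambda>(s, \<omega>). case_nat s \<omega>))"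
    by (simp only: iter)
  also have "\<dots> = (\<integral>\<^sup>+z. F (case z of (s, \<omega>) \<Rightarrow> case_nat s \<omega>) \<partial>(measure_pmf p \<Otimes>\<^sub>M steps p))"
    by (rule nn_integral_distr) (simp_all add: case_prod_unfold)
  also have "\<dots> = (\<integral>\<^sup>+y. (\<integral>\<^sup>+\<xi>. F (case_nat y \<xi>) \<partial>steps p) \<partial>measure_pmf p)"
    by (subst X.nn_integral_fst[symmetric]) (simp_all add: case_prod_unfold)
  finally show ?thesis .
qed

lemma nn_integral_noise:
  assumes "F \<in> borel_measurable noise"
  shows "(\<integral>\<^sup>+\<omega>. F \<omega> \<partial>noise) = (\<integral>\<^sup>+\<tau>. (\<integral>\<^sup>+\<xi>. F (\<tau>, \<xi>) \<partial>steps p) \<partial>waits)"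
  using assms unfolding noise_def by (rule X.nn_integral_fst[symmetric])

lemma nn_integral_noise_iter:
  assumes F [measurable]: "F \<in> borel_measurable noise"
  shows "(\<integral>\<^sup>+\<omega>. F \<omega> \<partial>noise)
    = (\<integral>\<^sup>+a. (\<integral>\<^sup>+y. (\<integral>\<^sup>+\<omega>. F (prepend a y \<omega>) \<partial>noise) \<partial>measure_pmf p) \<partial>wait_law)"
proof -
  have [measurable_cong]: "sets (measure_pmf p) = sets (count_space UNIV)" by simp
  have F_pair [measurable]: "(\<lambda>x. F (f x, g x)) \<in> borel_measurable M"
    if "f \<in> M \<rightarrow>\<^sub>M waits" "g \<in> M \<rightarrow>\<^sub>M steps p" for f g and M :: "'z measure"
    by (rule measurable_compose[OF measurable_Pair_noise[OF that] F])
  have "(\<integral>\<^sup>+\<omega>. F \<omega> \<partial>noise) = (\<integral>\<^sup>+\<tau>. (\<integral>\<^sup>+\<xi>. F (\<tau>, \<xi>) \<partial>steps p) \<partial>waits)"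
    by (rule nn_integral_noise[OF F])
  also have "\<dots> = (\<integral>\<^sup>+a. (\<integral>\<^sup>+\<tau>. (\<integral>\<^sup>+\<xi>. F (case_nat a \<tau>, \<xi>) \<partial>steps p) \<partial>waits) \<partial>wait_law)"
    by (rule nn_integral_waits_iter) measurable
  also have "\<dots> = (\<integral>\<^sup>+a. (\<integral>\<^sup>+\<tau>. (\<integral>\<^sup>+y. (\<integral>\<^sup>+\<xi>. F (case_nat a \<tau>, case_nat y \<xi>) \<partial>steps p) \<partial>measure_pmf p) \<partial>waits) \<partial>wait_law)"
    by (intro nn_integral_cong nn_integral_steps_iter) measurable
  also have "\<dots> = (\<integral>\<^sup>+a. (\<integral>\<^sup>+y. (\<integral>\<^sup>+\<tau>. (\<integral>\<^sup>+\<xi>. F (case_nat a \<tau>, case_nat y \<xi>) \<partial>steps p) \<partial>waits) \<partial>measure_pmf p) \<partial>wait_law)"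
  proof (rule nn_integral_cong)
    fix a
    interpret P: pair_sigma_finite waits "measure_pmf p" ..
    show "(\<integral>\<^sup>+\<tau>. (\<integral>\<^sup>+y. (\<integral>\<^sup>+\<xi>. F (case_nat a \<tau>, case_nat y \<xi>) \<partial>steps p) \<partial>measure_pmf p) \<partial>waits)
        = (\<integral>\<^sup>+y. (\<integral>\<^sup>+\<tau>. (\<integral>\<^sup>+\<xi>. F (case_nat a \<tau>, case_nat y \<xi>) \<partial>steps p) \<partial>waits) \<partial>measure_pmf p)"
      by (rule P.Fubini'[symmetric]) (simp add: case_prod_unfold)
  qed
  also have "\<dots> = (\<integral>\<^sup>+a. (\<integral>\<^sup>+y. (\<integral>\<^sup>+\<omega>. F (prepend a y \<omega>) \<partial>noise) \<partial>measure_pmf p) \<partial>wait_law)"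
    by (intro nn_integral_cong) (subst nn_integral_noise, simp_all)
  finally show ?thesis .
qed

subsection \<open>No explosion\<close>

lemma nn_integral_wait_law:
  assumes [measurable]: "f \<in> borel_measurable borel"
  shows "(\<integral>\<^sup>+a. f a \<partial>wait_law) = (\<integral>\<^sup>+a. ennreal (r * exp (- (r * a))) * indicator {0..} a * f a \<partial>lborel)"
  unfolding wait_law_def
  by (subst nn_integral_density) (auto intro!: nn_integral_cong simp: exponential_density_def mult.commute split: split_indicator)

lemma AE_wait_pos: "AE a in wait_law. 0 < a"
proof -
  have "AE a in lborel. a \<noteq> (0 :: real)" by (rule AE_lborel_singleton)
  then show ?thesis
    unfolding wait_law_def by (subst AE_density) (auto simp: exponential_density_def elim!: eventually_mono)
qed

lemma wait_Laplace: "(\<integral>\<^sup>+a. ennreal (exp (- a)) \<partial>wait_law) = ennreal (r / (r + 1))"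
proof -
  have "(\<integral>\<^sup>+a. ennreal (exp (- a)) \<partial>wait_law)
      = (\<integral>\<^sup>+a. ennreal (r / (r + 1)) * ennreal (exponential_density (r + 1) a) \<partial>lborel)"
  proof (subst nn_integral_wait_law, simp, intro nn_integral_cong)
    fix a :: real
    show "ennreal (r * exp (- (r * a))) * indicator {0..} a * ennreal (exp (- a)) = ennreal (r / (r + 1)) * ennreal (exponential_density (r + 1) a)"
    proof (cases "a < 0")
      case False
      have "r * exp (- (r * a)) * exp (- a) = r * exp (- (a * (r + 1)))" by (simp add: mult_exp_exp mult.assoc algebra_simps)
      also have "\<dots> = r / (r + 1) * ((r + 1) * exp (- (a * (r + 1))))" using r by simp
      finally have "r * exp (- (r * a)) * exp (- a) = r / (r + 1) * exponential_density (r + 1) a"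
        using False by (simp add: exponential_density_def mult.commute)
      then show ?thesis
        using False r by (simp add: ennreal_mult[symmetric] exponential_density_nonneg)
    qed (simp add: exponential_density_def)
  qed
  also have "\<dots> = ennreal (r / (r + 1)) * (\<integral>\<^sup>+a. ennreal (exponential_density (r + 1) a) \<partial>lborel)"
    by (rule nn_integral_cmult) simp
  also have "(\<integral>\<^sup>+a. ennreal (exponential_density (r + 1) a) \<partial>lborel) = 1"
    using prob_space.emeasure_space_1[OF prob_space_exponential_density[of "r + 1"]] r by (simp add: emeasure_density)
  finally show ?thesis by simp
qed

lemma arrival_Laplace: "(\<integral>\<^sup>+\<tau>. ennreal (exp (- arrival \<tau> n)) \<partial>waits) = ennreal ((r / (r + 1)) ^ Suc n)"
proof (induction n)
  case 0
  have "(\<integral>\<^sup>+\<tau>. ennreal (exp (- arrival \<tau> 0)) \<partial>waits) = (\<integral>\<^sup>+a. ennreal (exp (- a)) \<partial>wait_law)"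
    by (subst nn_integral_waits_iter) (use W.emeasure_space_1 in simp_all)
  then show ?case by (simp add: wait_Laplace)
next
  case (Suc n)
  have "(\<integral>\<^sup>+\<tau>. ennreal (exp (- arrival \<tau> (Suc n))) \<partial>waits)
      = (\<integral>\<^sup>+a. ennreal (exp (- a)) * (\<integral>\<^sup>+\<tau>. ennreal (exp (- arrival \<tau> n)) \<partial>waits) \<partial>wait_law)"
  proof (subst nn_integral_waits_iter)
    have "(\<integral>\<^sup>+\<tau>. ennreal (exp (- arrival (case_nat a \<tau>) (Suc n))) \<partial>waits)
        = (\<integral>\<^sup>+\<tau>. ennreal (exp (- a)) * ennreal (exp (- arrival \<tau> n)) \<partial>waits)" for a
      by (intro nn_integral_cong) (simp add: arrival_case_nat ennreal_mult[symmetric] mult_exp_exp)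
    also have "\<dots> a = ennreal (exp (- a)) * (\<integral>\<^sup>+\<tau>. ennreal (exp (- arrival \<tau> n)) \<partial>waits)" for a
      by (rule nn_integral_cmult) simp
    finally show "(\<integral>\<^sup>+a. (\<integral>\<^sup>+\<tau>. ennreal (exp (- arrival (case_nat a \<tau>) (Suc n))) \<partial>waits) \<partial>wait_law)
        = (\<integral>\<^sup>+a. ennreal (exp (- a)) * (\<integral>\<^sup>+\<tau>. ennreal (exp (- arrival \<tau> n)) \<partial>waits) \<partial>wait_law)"
      by simp
  qed simp
  also have "\<dots> = (\<integral>\<^sup>+a. ennreal (exp (- a)) \<partial>wait_law) * ennreal ((r / (r + 1)) ^ Suc n)"
  proof -
    have "(\<lambda>a :: real. ennreal (exp (- a))) \<in> borel_measurable borel" by simp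
    then have "(\<lambda>a. ennreal (exp (- a))) \<in> borel_measurable wait_law" by (simp cong: measurable_cong_sets)
    then show ?thesis unfolding Suc.IH by (rule nn_integral_multc)
  qed
  also have "\<dots> = ennreal ((r / (r + 1)) ^ Suc (Suc n))"
    using r unfolding wait_Laplace by (subst ennreal_mult[symmetric]) simp_all
  finally show ?case .
qed

text \<open>By the inequality of Markov for \<open>exp (- arrival \<tau> n)\<close>, whose mean decays geometrically in \<open>n\<close>.\<close>

lemma AE_nonexplosive: "AE \<tau> in waits. nonexplosive \<tau>"
proof -
  have pos: "AE \<tau> in waits. \<forall>i. 0 < \<tau> i"
    unfolding AE_all_countable waits_def
    by (intro allI wait.AE_component AE_wait_pos) simp
  have unbounded: "AE \<tau> in waits. \<exists>n. real m < arrival \<tau> n" for m :: nat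
  proof -
    define q where "q = r / (r + 1)"
    have q: "0 \<le> q" "q < 1" using r by (auto simp: q_def)
    define B where "B = {\<tau> \<in> space waits. \<forall>n. arrival \<tau> n \<le> real m}"
    have [measurable]: "B \<in> sets waits" unfolding B_def by measurable
    have le: "emeasure waits B \<le> ennreal (exp (real m) * q ^ Suc n)" for n
    proof -
      have "emeasure waits B = (\<integral>\<^sup>+\<tau>. indicator B \<tau> \<partial>waits)" by simp
      also have "\<dots> \<le> (\<integral>\<^sup>+\<tau>. ennreal (exp (real m)) * ennreal (exp (- arrival \<tau> n)) \<partial>waits)"
      proof (intro nn_integral_mono)
        fix \<tau>
        have "1 \<le> exp (real m) * exp (- arrival \<tau> n)" if "\<tau> \<in> B"
        proof -
          have "arrival \<tau> n \<le> real m" using that by (simp add: B_def)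
          then show ?thesis by (simp add: mult_exp_exp)
        qed
        then have "ennreal 1 \<le> ennreal (exp (real m) * exp (- arrival \<tau> n))" if "\<tau> \<in> B"
          using that by (intro ennreal_leI)
        then show "indicator B \<tau> \<le> ennreal (exp (real m)) * ennreal (exp (- arrival \<tau> n))"
          by (auto simp: ennreal_mult[symmetric] split: split_indicator)
      qed
      also have "\<dots> = ennreal (exp (real m)) * (\<integral>\<^sup>+\<tau>. ennreal (exp (- arrival \<tau> n)) \<partial>waits)"
        by (rule nn_integral_cmult) simp
      also have "\<dots> = ennreal (exp (real m)) * ennreal (q ^ Suc n)"
        by (simp only: arrival_Laplace q_def)
      finally show ?thesis using q by (simp add: ennreal_mult)
    qed
    have "(\<lambda>n. exp (real m) * q ^ Suc n) \<longlonglongrightarrow> exp (real m) * 0"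
      using q by (intro tendsto_mult tendsto_const LIMSEQ_Suc LIMSEQ_realpow_zero)
    then have "(\<lambda>n. ennreal (exp (real m) * q ^ Suc n)) \<longlonglongrightarrow> ennreal 0"
      by (intro tendsto_ennrealI) simp
    then have "emeasure waits B \<le> ennreal 0"
      by (rule LIMSEQ_le_const) (use le in auto)
    then have "B \<in> null_sets waits" by (simp add: null_setsI)
    then have "AE \<tau> in waits. \<tau> \<notin> B" by (rule AE_not_in)
    then show ?thesis by eventually_elim (auto simp: B_def not_le)
  qed
  have "AE \<tau> in waits. \<forall>m :: nat. \<exists>n. real m < arrival \<tau> n"
    unfolding AE_all_countable using unbounded by blast
  with pos show ?thesis by eventually_elim (simp add: nonexplosive_def)
qed

lemma AE_noise: "AE \<omega> in noise. nonexplosive (fst \<omega>)"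
proof -
  have "distr noise waits fst = waits" unfolding noise_def by (rule X.distr_pair_fst)
  then have "AE \<tau> in distr noise waits fst. nonexplosive \<tau>" by (simp only: AE_nonexplosive)
  then show ?thesis by (rule AE_distrD[OF measurable_fst_noise])
qed

subsection \<open>Regeneration at fixed times\<close>

text \<open>The contribution of the event of exactly \<open>n\<close> jumps up to time \<open>s\<close> to the mean of \<open>H\<close>, evaluated at the position and the
  restarted noise. Conditioning on the first waiting time and the first step reduces \<open>n + 1\<close> jumps to \<open>n\<close> jumps in the
  remaining time; with \<open>n = 0\<close> the exponential law enters.\<close>

definition jump_integral where
  "jump_integral n s H = (\<integral>\<^sup>+\<omega>. indicator {n} (jumps s (fst \<omega>)) * H (jump_position s \<omega>) (jump_restart s \<omega>) \<partial>noise)"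

lemma measurable_H:
  assumes H: "case_prod H \<in> borel_measurable (count_space UNIV \<Otimes>\<^sub>M noise)"
    and f: "f \<in> M \<rightarrow>\<^sub>M count_space UNIV" and g: "g \<in> M \<rightarrow>\<^sub>M noise"
  shows "(\<lambda>x. H (f x) (g x)) \<in> borel_measurable M"
  using measurable_compose[OF measurable_Pair[OF f g] H] by simp

lemma measurable_jump_indicator [measurable (raw)]:
  assumes "f \<in> M \<rightarrow>\<^sub>M borel" "g \<in> M \<rightarrow>\<^sub>M noise"
  shows "(\<lambda>x. indicator {n} (jumps (f x) (fst (g x))) :: ennreal) \<in> borel_measurable M"
proof -
  have "(\<lambda>x. jumps (f x) (fst (g x))) \<in> M \<rightarrow>\<^sub>M count_space UNIV"
    by (intro measurable_jumps assms measurable_compose[OF assms(2)]) simp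
  from measurable_compose[OF this, of "\<lambda>k. indicator {n} k :: ennreal" borel] show ?thesis by simp
qed

text \<open>The lack of memory of the exponential law: the substitution \<open>a = s + b\<close> splits off the factor \<open>exp (- (r * s))\<close> from the
  density and leaves the same law for the remaining waiting time \<open>b\<close>.\<close>

lemma jump_integral_0:
  assumes H: "case_prod H \<in> borel_measurable (count_space UNIV \<Otimes>\<^sub>M noise)" and s: "0 \<le> s"
  shows "jump_integral 0 s H = ennreal (exp (- (r * s))) * (\<integral>\<^sup>+\<omega>. H 0 \<omega> \<partial>noise)"
proof -
  let ?J = "\<lambda>a y \<omega>. indicator {0} (jumps s (fst (prepend a y \<omega>))) * H (jump_position s (prepend a y \<omega>)) (jump_restart s (prepend a y \<omega>))"
  note mH [measurable] = measurable_H[OF H]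
  have [measurable_cong]: "sets (measure_pmf p) = sets (count_space UNIV)" by simp
  interpret N: prob_space noise by (rule prob_space_noise)
  have Pair_meas [measurable]: "(\<lambda>x. prepend (f x) (g x) (h x)) \<in> M \<rightarrow>\<^sub>M noise"
    if "f \<in> M \<rightarrow>\<^sub>M borel" "g \<in> M \<rightarrow>\<^sub>M count_space UNIV" "h \<in> M \<rightarrow>\<^sub>M noise" for f g h and M :: "'z measure"
    by (intro measurable_Pair_noise measurable_case_nat_waits measurable_case_nat_steps that measurable_compose[OF that(3)]) simp_all
  define K where "K b = (\<integral>\<^sup>+y. (\<integral>\<^sup>+\<omega>. H 0 (case_nat b (fst \<omega>), case_nat y (snd \<omega>)) \<partial>noise) \<partial>measure_pmf p)" for b
  have K_meas [measurable]: "K \<in> borel_measurable borel" unfolding K_def by measurable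
  have "jump_integral 0 s H = (\<integral>\<^sup>+a. (\<integral>\<^sup>+y. (\<integral>\<^sup>+\<omega>. ?J a y \<omega> \<partial>noise) \<partial>measure_pmf p) \<partial>wait_law)"
    unfolding jump_integral_def by (rule nn_integral_noise_iter) measurable
  also have "\<dots> = (\<integral>\<^sup>+a. indicator {s<..} a * K (a - s) \<partial>wait_law)"
  proof (rule nn_integral_cong_AE)
    show "AE a in wait_law. (\<integral>\<^sup>+y. (\<integral>\<^sup>+\<omega>. ?J a y \<omega> \<partial>noise) \<partial>measure_pmf p)
      = indicator {s<..} a * K (a - s)"
      using AE_wait_pos
    proof eventually_elim
      case (elim a)
      show ?case
      proof (cases "s < a")
        case True
        have "(\<integral>\<^sup>+\<omega>. ?J a y \<omega> \<partial>noise)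
          = (\<integral>\<^sup>+\<omega>. H 0 (case_nat (a - s) (fst \<omega>), case_nat y (snd \<omega>)) \<partial>noise)" for y
          by (intro nn_integral_cong_AE eventually_mono[OF AE_noise])
             (use True elim in \<open>simp add: jump_case_nat_before jumps_case_nat\<close>)
        then show ?thesis using True by (simp add: K_def)
      next
        case False
        have "(\<integral>\<^sup>+\<omega>. ?J a y \<omega> \<partial>noise)
          = (\<integral>\<^sup>+\<omega>. 0 \<partial>noise)" for y
          by (intro nn_integral_cong_AE eventually_mono[OF AE_noise])
             (use False elim in \<open>simp add: jumps_case_nat\<close>)
        then show ?thesis using False by simp
      qed
    qed
  qed
  also have "\<dots> = (\<integral>\<^sup>+a. ennreal (r * exp (- (r * a))) * indicator {0..} a * (indicator {s<..} a * K (a - s)) \<partial>lborel)"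
    by (rule nn_integral_wait_law) simp
  also have "\<dots> = ennreal \<bar>1\<bar> * (\<integral>\<^sup>+b. ennreal (r * exp (- (r * (s + 1 * b)))) * indicator {0..} (s + 1 * b) * (indicator {s<..} (s + 1 * b) * K (s + 1 * b - s)) \<partial>lborel)"
    by (rule nn_integral_real_affine) simp_all
  also have "\<dots> = (\<integral>\<^sup>+b. ennreal (exp (- (r * s))) * (ennreal (r * exp (- (r * b))) * indicator {0..} b * K b) \<partial>lborel)"
  proof -
    have "AE b in lborel. b \<noteq> (0 :: real)" by (rule AE_lborel_singleton)
    then have "AE b in lborel. ennreal (r * exp (- (r * (s + 1 * b)))) * indicator {0..} (s + 1 * b) * (indicator {s<..} (s + 1 * b) * K (s + 1 * b - s))
      = ennreal (exp (- (r * s))) * (ennreal (r * exp (- (r * b))) * indicator {0..} b * K b)"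
    proof eventually_elim
      case (elim b)
      have "ennreal (r * exp (- (r * (s + 1 * b)))) = ennreal (exp (- (r * s))) * ennreal (r * exp (- (r * b)))"
        using r by (subst ennreal_mult[symmetric]) (auto simp: mult_exp_exp algebra_simps)
      then show ?case using elim s by (auto simp: mult.assoc split: split_indicator)
    qed
    then show ?thesis by (simp add: nn_integral_cong_AE)
  qed
  also have "\<dots> = ennreal (exp (- (r * s))) * (\<integral>\<^sup>+b. ennreal (r * exp (- (r * b))) * indicator {0..} b * K b \<partial>lborel)"
    by (rule nn_integral_cmult) simp
  also have "(\<integral>\<^sup>+b. ennreal (r * exp (- (r * b))) * indicator {0..} b * K b \<partial>lborel) = (\<integral>\<^sup>+b. K b \<partial>wait_law)"
    by (rule nn_integral_wait_law[symmetric]) simp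
  also have "\<dots> = (\<integral>\<^sup>+\<omega>. H 0 \<omega> \<partial>noise)"
    unfolding K_def by (rule nn_integral_noise_iter[symmetric]) measurable
  finally show ?thesis .
qed

lemma jump_integral_Suc:
  assumes H: "case_prod H \<in> borel_measurable (count_space UNIV \<Otimes>\<^sub>M noise)" and s: "0 \<le> s"
  shows "jump_integral (Suc n) s H
    = (\<integral>\<^sup>+a. indicator {..s} a * (\<integral>\<^sup>+y. jump_integral n (s - a) (\<lambda>x. H (y + x)) \<partial>measure_pmf p) \<partial>wait_law)"
proof -
  let ?J = "\<lambda>a y \<omega>. indicator {Suc n} (jumps s (fst (prepend a y \<omega>))) * H (jump_position s (prepend a y \<omega>)) (jump_restart s (prepend a y \<omega>))"
  note mH [measurable] = measurable_H[OF H]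
  have "jump_integral (Suc n) s H = (\<integral>\<^sup>+a. (\<integral>\<^sup>+y. (\<integral>\<^sup>+\<omega>. ?J a y \<omega> \<partial>noise) \<partial>measure_pmf p) \<partial>wait_law)"
    unfolding jump_integral_def by (rule nn_integral_noise_iter) measurable
  also have "\<dots> = (\<integral>\<^sup>+a. indicator {..s} a * (\<integral>\<^sup>+y. jump_integral n (s - a) (\<lambda>x. H (y + x)) \<partial>measure_pmf p) \<partial>wait_law)"
  proof (intro nn_integral_cong_AE eventually_mono[OF AE_wait_pos])
    fix a :: real assume a: "0 < a"
    show "(\<integral>\<^sup>+y. (\<integral>\<^sup>+\<omega>. ?J a y \<omega> \<partial>noise) \<partial>measure_pmf p)
      = indicator {..s} a * (\<integral>\<^sup>+y. jump_integral n (s - a) (\<lambda>x. H (y + x)) \<partial>measure_pmf p)"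
    proof (cases "a \<le> s")
      case True
      have "(\<integral>\<^sup>+\<omega>. ?J a y \<omega> \<partial>noise)
        = jump_integral n (s - a) (\<lambda>x. H (y + x))" for y
        unfolding jump_integral_def
        by (intro nn_integral_cong_AE eventually_mono[OF AE_noise])
           (use True a in \<open>simp add: jump_case_nat_after jumps_case_nat indicator_def\<close>)
      then show ?thesis using True by simp
    next
      case False
      have "(\<integral>\<^sup>+\<omega>. ?J a y \<omega> \<partial>noise)
        = (\<integral>\<^sup>+\<omega>. 0 \<partial>noise)" for y
        by (intro nn_integral_cong_AE eventually_mono[OF AE_noise])
           (use False a in \<open>simp add: jumps_case_nat\<close>)
      then show ?thesis using False by simp
    qed
  qed
  finally show ?thesis .
qed

text \<open>On the event of \<open>n\<close> jumps, the restarted noise is replaced by an independent copy, by induction on \<open>n\<close>.\<close>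

lemma jump_integral_regeneration:
  assumes H: "case_prod H \<in> borel_measurable (count_space UNIV \<Otimes>\<^sub>M noise)" and s: "0 \<le> s"
  shows "jump_integral n s H = jump_integral n s (\<lambda>x _. \<integral>\<^sup>+\<omega>'. H x \<omega>' \<partial>noise)"
  using H s
proof (induction n arbitrary: s H)
  case (0 s H)
  interpret N: prob_space noise by (rule prob_space_noise)
  note [measurable] = measurable_H[OF 0(1)]
  have "(\<lambda>(x, \<omega>). \<integral>\<^sup>+\<omega>'. H x \<omega>' \<partial>noise) \<in> borel_measurable (count_space UNIV \<Otimes>\<^sub>M noise)"
    unfolding case_prod_unfold by measurable
  then show ?case
    using 0 N.emeasure_space_1 by (simp add: jump_integral_0)
next
  case (Suc n s H)
  interpret N: prob_space noise by (rule prob_space_noise)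
  note mH [measurable] = measurable_H[OF Suc.prems(1)]
  have H': "(\<lambda>(x, \<omega>). \<integral>\<^sup>+\<omega>'. H x \<omega>' \<partial>noise) \<in> borel_measurable (count_space UNIV \<Otimes>\<^sub>M noise)"
    unfolding case_prod_unfold by measurable
  have shifted: "(\<lambda>(x, \<omega>). H (y + x) \<omega>) \<in> borel_measurable (count_space UNIV \<Otimes>\<^sub>M noise)" for y
    unfolding case_prod_unfold by measurable
  have "indicator {..s} a * (\<integral>\<^sup>+y. jump_integral n (s - a) (\<lambda>x. H (y + x)) \<partial>measure_pmf p)
      = indicator {..s} a * (\<integral>\<^sup>+y. jump_integral n (s - a) (\<lambda>x _. \<integral>\<^sup>+\<omega>'. H (y + x) \<omega>' \<partial>noise) \<partial>measure_pmf p)" for a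
    using Suc.IH[OF shifted, of "s - a"] by (auto split: split_indicator)
  then show ?case
    by (simp only: jump_integral_Suc[OF Suc.prems] jump_integral_Suc[OF H' Suc.prems(2)])
qed

text \<open>Summing the preceding lemma over the number of jumps.\<close>

lemma jump_regeneration:
  assumes s: "0 \<le> s"
  shows "distr noise (count_space UNIV \<Otimes>\<^sub>M noise) (\<lambda>\<omega>. (jump_position s \<omega>, jump_restart s \<omega>))
    = distr noise (count_space UNIV) (jump_position s) \<Otimes>\<^sub>M noise"
proof (rule measure_eqI)
  interpret N: prob_space noise by (rule prob_space_noise)
  let ?J = "distr noise (count_space UNIV \<Otimes>\<^sub>M noise) (\<lambda>\<omega>. (jump_position s \<omega>, jump_restart s \<omega>))"
  let ?D = "distr noise (count_space UNIV) (jump_position s)"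
  have pos [measurable]: "jump_position s \<in> noise \<rightarrow>\<^sub>M count_space UNIV" by measurable
  have re [measurable]: "jump_restart s \<in> noise \<rightarrow>\<^sub>M noise" by measurable
  interpret D: prob_space ?D by (rule N.prob_space_distr) simp
  show "sets ?J = sets (?D \<Otimes>\<^sub>M noise)"
    unfolding sets_distr by (intro sets_pair_measure_cong) simp_all
  fix A assume "A \<in> sets ?J"
  then have A [measurable]: "A \<in> sets (count_space UNIV \<Otimes>\<^sub>M noise)" by simp
  define H where "H x \<omega> = (indicator A (x, \<omega>) :: ennreal)" for x \<omega>
  have H: "case_prod H \<in> borel_measurable (count_space UNIV \<Otimes>\<^sub>M noise)"
    unfolding H_def case_prod_unfold by simp
  note [measurable] = measurable_H[OF H]
  have sum: "(\<integral>\<^sup>+\<omega>. G (jump_position s \<omega>) (jump_restart s \<omega>) \<partial>noise) = (\<Sum>n. jump_integral n s G)"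
    if G: "case_prod G \<in> borel_measurable (count_space UNIV \<Otimes>\<^sub>M noise)" for G
  proof -
    note [measurable] = measurable_H[OF G]
    have one: "(\<Sum>n. indicator {n} k) = (1 :: ennreal)" for k :: nat
    proof -
      have "(\<lambda>n. indicator {n} k :: ennreal) = (\<lambda>n. if n = k then 1 else 0)" by (auto simp: fun_eq_iff indicator_def)
      then show ?thesis using sums_unique[OF sums_single[of k "\<lambda>_. 1 :: ennreal"]] by simp
    qed
    have "(\<Sum>n. jump_integral n s G) = (\<integral>\<^sup>+\<omega>. (\<Sum>n. indicator {n} (jumps s (fst \<omega>)) * G (jump_position s \<omega>) (jump_restart s \<omega>)) \<partial>noise)"
      unfolding jump_integral_def by (rule nn_integral_suminf[symmetric]) measurable
    then show ?thesis by (simp add: one)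
  qed
  have H': "(\<lambda>(x, \<omega>). \<integral>\<^sup>+\<omega>'. H x \<omega>' \<partial>noise) \<in> borel_measurable (count_space UNIV \<Otimes>\<^sub>M noise)"
    unfolding case_prod_unfold by measurable
  have "emeasure ?J A
      = (\<integral>\<^sup>+\<omega>. indicator A (jump_position s \<omega>, jump_restart s \<omega>) \<partial>noise)"
    by (subst nn_integral_indicator[symmetric], simp, subst nn_integral_distr) auto
  also have "\<dots> = (\<integral>\<^sup>+\<omega>. H (jump_position s \<omega>) (jump_restart s \<omega>) \<partial>noise)" by (simp add: H_def)
  also have "\<dots> = (\<integral>\<^sup>+\<omega>. (\<integral>\<^sup>+\<omega>'. H (jump_position s \<omega>) \<omega>' \<partial>noise) \<partial>noise)"
    unfolding sum[OF H] sum[OF H'] using jump_integral_regeneration[OF H s] by simp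
  also have "\<dots> = (\<integral>\<^sup>+x. (\<integral>\<^sup>+\<omega>'. H x \<omega>' \<partial>noise) \<partial>?D)"
    by (rule nn_integral_distr[symmetric]) simp_all
  also have "\<dots> = emeasure (?D \<Otimes>\<^sub>M noise) A"
    unfolding H_def
    by (subst N.emeasure_pair_measure) (simp_all cong: sets_pair_measure_cong)
  finally show "emeasure ?J A = emeasure (?D \<Otimes>\<^sub>M noise) A" .
qed

lemma continuous_regenerative:
  "regenerative_walk noise jump_position jump_restart {0..} {\<omega>. nonexplosive (fst \<omega>)}"
proof -
  interpret N: prob_space noise by (rule prob_space_noise)
  show ?thesis
  proof
    show "(\<lambda>z. jump_position (fst z) (snd z)) \<in> borel \<Otimes>\<^sub>M noise \<rightarrow>\<^sub>M count_space UNIV" by measurable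
    show "(\<lambda>z. jump_restart (fst z) (snd z)) \<in> borel \<Otimes>\<^sub>M noise \<rightarrow>\<^sub>M noise" by measurable
    show "AE \<omega> in noise. \<omega> \<in> {\<omega>. nonexplosive (fst \<omega>)}" using AE_noise by simp
    show "jump_restart s \<omega> \<in> {\<omega>. nonexplosive (fst \<omega>)}" if "\<omega> \<in> {\<omega>. nonexplosive (fst \<omega>)}" for s \<omega>
      using nonexplosive_restart[of "fst \<omega>" s "snd \<omega>"] that by simp
  qed (auto simp: jump_position_add jump_regeneration)
qed

subsection \<open>The number of jumps is Poisson distributed\<close>

lemma jumps_Poisson:
  assumes "0 \<le> s"
  shows "jump_integral n s (\<lambda>_ _. 1) = ennreal (exp (- (r * s)) * (r * s) ^ n / fact n)"
  using assms
proof (induction n arbitrary: s)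
  case 0
  interpret N: prob_space noise by (rule prob_space_noise)
  show ?case using 0 N.emeasure_space_1 by (simp add: jump_integral_0)
next
  case (Suc n)
  let ?c = "exp (- (r * s)) * r ^ Suc n"
  have "jump_integral (Suc n) s (\<lambda>_ _. 1) = (\<integral>\<^sup>+a. indicator {..s} a * jump_integral n (s - a) (\<lambda>_ _. 1) \<partial>wait_law)"
    using Suc.prems by (subst jump_integral_Suc) simp_all
  also have "\<dots> = (\<integral>\<^sup>+a. indicator {..s} a * ennreal (exp (- (r * (s - a))) * (r * (s - a)) ^ n / fact n) \<partial>wait_law)"
    using Suc.IH by (intro nn_integral_cong) (auto split: split_indicator)
  also have "\<dots> = (\<integral>\<^sup>+a. ennreal (r * exp (- (r * a))) * indicator {0..} a * (indicator {..s} a * ennreal (exp (- (r * (s - a))) * (r * (s - a)) ^ n / fact n)) \<partial>lborel)"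
    by (rule nn_integral_wait_law) simp
  also have "\<dots> = (\<integral>\<^sup>+a. ennreal (?c * (s - a) ^ n / fact n) * indicator {0..s} a \<partial>lborel)"
  proof (intro nn_integral_cong)
    fix a :: real
    have "r * exp (- (r * a)) * (exp (- (r * (s - a))) * (r * (s - a)) ^ n / fact n) = ?c * (s - a) ^ n / fact n"
    proof -
      have "exp (- (r * a)) * exp (- (r * (s - a))) = exp (- (r * s))" by (simp add: mult_exp_exp algebra_simps)
      then show ?thesis by (simp add: power_mult_distrib mult_ac)
    qed
    then have "ennreal (r * exp (- (r * a))) * ennreal (exp (- (r * (s - a))) * (r * (s - a)) ^ n / fact n)
        = ennreal (?c * (s - a) ^ n / fact n)" if "a \<le> s"
      using r that by (subst ennreal_mult[symmetric]) auto
    then show "ennreal (r * exp (- (r * a))) * indicator {0..} a * (indicator {..s} a * ennreal (exp (- (r * (s - a))) * (r * (s - a)) ^ n / fact n))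
        = ennreal (?c * (s - a) ^ n / fact n) * indicator {0..s} a"
      by (auto split: split_indicator)
  qed
  also have "\<dots> = ennreal (- (?c * (s - s) ^ Suc n / fact (Suc n)) - - (?c * (s - 0) ^ Suc n / fact (Suc n)))"
  proof (rule nn_integral_FTC_Icc)
    fix x :: real
    have "((\<lambda>x. - (?c * (s - x) ^ Suc n / fact (Suc n))) has_real_derivative
        - (?c * (real (Suc n) * (s - x) ^ n * (0 - 1)) / fact (Suc n))) (at x)"
      by (auto intro!: derivative_eq_intros simp del: power_Suc fact_Suc of_nat_Suc)
    also have "- (?c * (real (Suc n) * (s - x) ^ n * (0 - 1)) / fact (Suc n)) = ?c * (s - x) ^ n / fact n"
      by (simp add: divide_simps)
    finally show "((\<lambda>x. - (?c * (s - x) ^ Suc n / fact (Suc n))) has_real_derivative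
        ?c * (s - x) ^ n / fact n) (at x)" .
  qed (use r Suc.prems in auto)
  also have "- (?c * (s - s) ^ Suc n / fact (Suc n)) - - (?c * (s - 0) ^ Suc n / fact (Suc n))
      = exp (- (r * s)) * (r * s) ^ Suc n / fact (Suc n)"
    by (simp add: power_mult_distrib)
  finally show ?case .
qed

text \<open>The generating function of the Poisson law.\<close>

lemma integral_jumps:
  fixes z :: complex
  assumes s: "0 \<le> s" and z: "norm z \<le> 1"
  shows "(\<integral>\<tau>. z ^ jumps s \<tau> \<partial>waits) = exp (- (of_real (r * s) * (1 - z)))"
proof -
  have rs: "0 \<le> r * s" using r s by simp
  define P where "P n = exp (- (r * s)) * (r * s) ^ n / fact n" for n
  have P: "0 \<le> P n" for n using rs by (simp add: P_def)
  have [measurable]: "jumps s \<in> waits \<rightarrow>\<^sub>M count_space UNIV" by measurable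
  have law: "distr waits (count_space UNIV) (jumps s) = density (count_space UNIV) (\<lambda>n. ennreal (P n))"
  proof (rule measure_eqI_countable[of _ UNIV])
    fix n :: nat
    have "emeasure (distr waits (count_space UNIV) (jumps s)) {n} = (\<integral>\<^sup>+\<tau>. indicator {n} (jumps s \<tau>) \<partial>waits)"
      by (subst nn_integral_indicator[symmetric], simp, subst nn_integral_distr) auto
    also have "\<dots> = (\<integral>\<^sup>+\<omega>. indicator {n} (jumps s (fst \<omega>)) \<partial>noise)"
    proof -
      have "distr noise waits fst = waits" unfolding noise_def by (rule X.distr_pair_fst)
      then have "(\<integral>\<^sup>+\<tau>. indicator {n} (jumps s \<tau>) \<partial>waits) = (\<integral>\<^sup>+\<tau>. indicator {n} (jumps s \<tau>) \<partial>distr noise waits fst)" by (simp only:)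
      also have "\<dots> = (\<integral>\<^sup>+\<omega>. indicator {n} (jumps s (fst \<omega>)) \<partial>noise)"
        by (rule nn_integral_distr) (simp_all add: measurable_compose[OF \<open>jumps s \<in> waits \<rightarrow>\<^sub>M count_space UNIV\<close>])
      finally show ?thesis .
    qed
    also have "\<dots> = ennreal (exp (- (r * s)) * (r * s) ^ n / fact n)"
      using jumps_Poisson[OF s, of n] by (simp add: jump_integral_def)
    also have "\<dots> = emeasure (density (count_space UNIV) (\<lambda>n. ennreal (P n))) {n}"
      by (simp add: emeasure_density P_def)
    finally show "emeasure (distr waits (count_space UNIV) (jumps s)) {n} = emeasure (density (count_space UNIV) (\<lambda>n. ennreal (P n))) {n}" .
  qed auto
  have terms: "P n *\<^sub>R z ^ n = exp (- complex_of_real (r * s)) * ((of_real (r * s) * z) ^ n /\<^sub>R fact n)" for n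
    unfolding P_def by (simp add: scaleR_conv_of_real exp_of_real[symmetric] power_mult_distrib field_simps)
  have sums: "(\<lambda>n. P n *\<^sub>R z ^ n) sums (exp (- complex_of_real (r * s)) * exp (of_real (r * s) * z))"
    unfolding terms by (intro sums_mult exp_converges)
  have abs: "summable (\<lambda>n. norm (P n *\<^sub>R z ^ n))"
    unfolding terms norm_mult using summable_norm_exp by (intro summable_mult)
  have "(\<integral>\<tau>. z ^ jumps s \<tau> \<partial>waits) = (\<integral>n. z ^ n \<partial>distr waits (count_space UNIV) (jumps s))"
    by (rule integral_distr[symmetric]) simp_all
  also have "\<dots> = (\<integral>n. P n *\<^sub>R z ^ n \<partial>count_space UNIV)"
    unfolding law by (rule integral_density) (simp_all add: P)
  also have "\<dots> = (\<Sum>n. P n *\<^sub>R z ^ n)"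
    by (rule integral_count_space_nat) (use abs in \<open>simp add: integrable_count_space_nat_iff\<close>)
  also have "\<dots> = exp (- complex_of_real (r * s)) * exp (of_real (r * s) * z)"
    using sums by (rule sums_unique[symmetric])
  also have "\<dots> = exp (- (of_real (r * s) * (1 - z)))"
    by (simp add: mult_exp_exp algebra_simps)
  finally show ?thesis .
qed

text \<open>Given the waiting times, the position is a discrete walk after a fixed number of steps.\<close>

lemma continuous_step_char:
  assumes s: "0 \<le> s"
  shows "regenerative_walk.step_char noise jump_position s \<theta> = exp (- (of_real (r * s) * (1 - char_fun p \<theta>)))"
proof -
  interpret R: regenerative_walk noise jump_position jump_restart "{0..}" "{\<omega>. nonexplosive (fst \<omega>)}"
    by (rule continuous_regenerative)
  interpret D: regenerative_walk "steps p" walk_position walk_restart "range real" UNIV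
    by (rule discrete_regenerative)
  have int: "integrable (waits \<Otimes>\<^sub>M steps p) (\<lambda>\<omega>. character \<theta> (jump_position s \<omega>))"
    using R.integrable_step[of \<theta> s] by (simp add: noise_def)
  have "R.step_char s \<theta> = (\<integral>\<tau>. (\<integral>\<xi>. character \<theta> (jump_position s (\<tau>, \<xi>)) \<partial>steps p) \<partial>waits)"
    unfolding R.step_char_def unfolding noise_def by (rule WX.integral_fst'[symmetric, OF int])
  also have "\<dots> = (\<integral>\<tau>. char_fun p \<theta> ^ jumps s \<tau> \<partial>waits)"
  proof (rule Bochner_Integration.integral_cong[OF refl])
    fix \<tau>
    have "(\<integral>\<xi>. character \<theta> (jump_position s (\<tau>, \<xi>)) \<partial>steps p) = D.step_char (real (jumps s \<tau>)) \<theta>"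
      unfolding D.step_char_def by (simp add: jump_position_def walk_position_def)
    then show "(\<integral>\<xi>. character \<theta> (jump_position s (\<tau>, \<xi>)) \<partial>steps p) = char_fun p \<theta> ^ jumps s \<tau>"
      by (simp only: discrete_step_char)
  qed
  also have "\<dots> = exp (- (of_real (r * s) * (1 - char_fun p \<theta>)))"
    by (rule integral_jumps[OF s norm_char_fun_le])
  finally show ?thesis .
qed

end

lemma one_minus_norm_square_le:
  "(1 - (norm z)\<^sup>2) / 2 \<le> 1 - Re z"
proof -
  have "(Re z)\<^sup>2 \<le> (norm z)\<^sup>2" by (simp add: cmod_def)
  moreover have "0 \<le> (1 - Re z)\<^sup>2" by simp
  ultimately have "1 - (norm z)\<^sup>2 \<le> 2 * (1 - Re z)" by (simp add: power2_eq_square algebra_simps)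
  then show ?thesis by simp
qed

lemma continuous_collision_decay:
  assumes \<kappa>: "\<kappa> > 0" and \<rho>: "\<rho> > 0" and irr: "irreducible_pmf pX" and mean: "zero_mean pX"
  shows "\<exists>C. collision_decay (noise pX \<kappa>) jump_position jump_restart {0..} {\<omega>. nonexplosive (fst \<omega>)}
    (noise pY \<rho>) jump_position jump_restart {\<omega>. nonexplosive (fst \<omega>)}
    (\<lambda>\<theta>. \<kappa> * (1 - Re (char_fun pX \<theta>))) (\<lambda>\<theta>. \<rho> * (1 - Re (char_fun pY \<theta>))) C"
proof -
  obtain C where C: "C > 0" "\<And>u. u > 0 \<Longrightarrow>
      (\<integral>\<^sup>+\<theta>. ennreal (exp (- (u * (1 - (norm (char_fun pX \<theta>))\<^sup>2)))) \<partial>torus) \<le> ennreal (C / u)"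
    using torus_integral_decay[OF irr mean] by blast
  interpret X: regenerative_walk "noise pX \<kappa>" jump_position jump_restart "{0..}" "{\<omega>. nonexplosive (fst \<omega>)}"
    by (rule continuous_regenerative[OF \<kappa>])
  interpret Y: regenerative_walk "noise pY \<rho>" jump_position jump_restart "{0..}" "{\<omega>. nonexplosive (fst \<omega>)}"
    by (rule continuous_regenerative[OF \<rho>])
  have Re_le: "Re (char_fun p \<theta>) \<le> 1" for p \<theta>
    using complex_Re_le_cmod[of "char_fun p \<theta>"] norm_char_fun_le[of p \<theta>] by linarith
  have X_norm: "norm (X.step_char s \<theta>) = exp (- (s * (\<kappa> * (1 - Re (char_fun pX \<theta>)))))" if "s \<in> {0..}" for s \<theta>
    using that by (simp add: continuous_step_char[OF \<kappa>] mult_ac)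
  have Y_norm: "norm (Y.step_char s \<theta>) = exp (- (s * (\<rho> * (1 - Re (char_fun pY \<theta>)))))" if "s \<in> {0..}" for s \<theta>
    using that by (simp add: continuous_step_char[OF \<rho>] mult_ac)
  show ?thesis
  proof (intro exI[of _ "max 1 (2 * C / \<kappa>)"], unfold_locales)
    show "(\<integral>\<^sup>+\<theta>. ennreal (exp (- (u * (\<kappa> * (1 - Re (char_fun pX \<theta>)))))) \<partial>torus) \<le> ennreal (max 1 (2 * C / \<kappa>) / u)"
      if "u > 0" for u
    proof -
      have "(\<integral>\<^sup>+\<theta>. ennreal (exp (- (u * (\<kappa> * (1 - Re (char_fun pX \<theta>)))))) \<partial>torus)
          \<le> (\<integral>\<^sup>+\<theta>. ennreal (exp (- (u * \<kappa> / 2 * (1 - (norm (char_fun pX \<theta>))\<^sup>2)))) \<partial>torus)"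
      proof (intro nn_integral_mono ennreal_leI)
        fix \<theta>
        have "u * \<kappa> * ((1 - (norm (char_fun pX \<theta>))\<^sup>2) / 2) \<le> u * \<kappa> * (1 - Re (char_fun pX \<theta>))"
          using that \<kappa> by (intro mult_left_mono one_minus_norm_square_le) simp
        then show "exp (- (u * (\<kappa> * (1 - Re (char_fun pX \<theta>))))) \<le> exp (- (u * \<kappa> / 2 * (1 - (norm (char_fun pX \<theta>))\<^sup>2)))"
          by (simp add: mult.assoc)
      qed
      also have "\<dots> \<le> ennreal (C / (u * \<kappa> / 2))"
        using that \<kappa> by (intro C) simp
      also have "C / (u * \<kappa> / 2) = 2 * C / \<kappa> / u" by (simp add: mult.commute)
      also have "ennreal (2 * C / \<kappa> / u) \<le> ennreal (max 1 (2 * C / \<kappa>) / u)"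
        using that by (intro ennreal_leI divide_right_mono) auto
      finally show ?thesis .
    qed
    fix \<theta>
    show nonneg: "0 \<le> \<rho> * (1 - Re (char_fun pY \<theta>))" using \<rho> Re_le[of pY \<theta>] by simp
    fix s :: real assume s: "s \<in> {0..}"
    show "norm (X.step_char s \<theta>) \<le> exp (- (s * (\<kappa> * (1 - Re (char_fun pX \<theta>)))))"
      by (simp only: X_norm[OF s])
    show "norm (Y.step_char s \<theta>) \<le> exp (- (s * (\<rho> * (1 - Re (char_fun pY \<theta>)))))"
      by (simp only: Y_norm[OF s])
    have "1 - exp (- (2 * s * (\<rho> * (1 - Re (char_fun pY \<theta>))))) \<le> 2 * s * (\<rho> * (1 - Re (char_fun pY \<theta>)))"
      using exp_ge_add_one_self[of "- (2 * s * (\<rho> * (1 - Re (char_fun pY \<theta>))))"] by simp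
    then show "1 - (norm (Y.step_char s \<theta>))\<^sup>2 \<le> 2 * s * (\<rho> * (1 - Re (char_fun pY \<theta>)))"
      unfolding Y_norm[OF s] by (simp add: exp_double[symmetric] mult.assoc)
  qed auto
qed

abbreviation "continuous_collision \<kappa> \<rho> pX pY C \<equiv>
  collision_time (noise pX \<kappa>) jump_position jump_restart {0..} {\<omega>. nonexplosive (fst \<omega>)}
    (noise pY \<rho>) jump_position jump_restart {\<omega>. nonexplosive (fst \<omega>)}
    (\<lambda>\<theta>. \<kappa> * (1 - Re (char_fun pX \<theta>))) (\<lambda>\<theta>. \<rho> * (1 - Re (char_fun pY \<theta>))) C lborel"

lemma continuous_collision_time:
  assumes "\<kappa> > 0" "\<rho> > 0" "irreducible_pmf pX" "zero_mean pX"
  shows "\<exists>C. continuous_collision \<kappa> \<rho> pX pY C"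
  using continuous_collision_decay[OF assms, of pY] lborel_time.time_measure_axioms
  unfolding collision_time_def collision_time_axioms_def by auto

subsection \<open>The difference of two continuous time walks\<close>

lemma continuous_difference_integral:
  fixes f :: "int ^ 2 \<Rightarrow> 'b::{banach, second_countable_topology}"
  assumes \<kappa>: "\<kappa> > 0" and \<rho>: "\<rho> > 0"
    and f: "integrable (measure_pmf pX) f" and g: "integrable (measure_pmf pY) (\<lambda>x. f (- x))"
  shows "has_bochner_integral (measure_pmf (continuous_difference_pmf \<kappa> \<rho> pX pY)) f
    ((\<kappa> / (\<kappa> + \<rho>)) *\<^sub>R (\<integral>x. f x \<partial>measure_pmf pX) + (\<rho> / (\<kappa> + \<rho>)) *\<^sub>R (\<integral>x. f (- x) \<partial>measure_pmf pY))"
proof -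
  let ?Z = "continuous_difference_pmf \<kappa> \<rho> pX pY" and ?r = "map_pmf uminus pY"
  have r: "integrable (measure_pmf ?r) f" "(\<integral>x. f x \<partial>measure_pmf ?r) = (\<integral>x. f (- x) \<partial>measure_pmf pY)"
    using g by (simp add: map_pmf_rep_eq integrable_distr_eq, simp)
  have pmf_r: "pmf ?r x = pmf pY (- x)" for x
    using pmf_map_inj'[of "uminus :: int ^ 2 \<Rightarrow> int ^ 2" pY "- x"] by simp
  have count: "has_bochner_integral (measure_pmf q) h I \<longleftrightarrow> has_bochner_integral (count_space UNIV) (\<lambda>x. pmf q x *\<^sub>R h x) I"
    for q and h :: "int ^ 2 \<Rightarrow> 'b" and I
    unfolding measure_pmf_eq_density has_bochner_integral_iff by (simp add: integrable_density integral_density)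
  have "has_bochner_integral (count_space UNIV)
      (\<lambda>x. (\<kappa> / (\<kappa> + \<rho>)) *\<^sub>R (pmf pX x *\<^sub>R f x) + (\<rho> / (\<kappa> + \<rho>)) *\<^sub>R (pmf ?r x *\<^sub>R f x))
      ((\<kappa> / (\<kappa> + \<rho>)) *\<^sub>R (\<integral>x. f x \<partial>measure_pmf pX) + (\<rho> / (\<kappa> + \<rho>)) *\<^sub>R (\<integral>x. f (- x) \<partial>measure_pmf pY))"
    unfolding r(2)[symmetric] using f r(1)
    by (intro has_bochner_integral_add has_bochner_integral_scaleR_right count[THEN iffD1] has_bochner_integral_integrable)
  moreover have "(\<kappa> / (\<kappa> + \<rho>)) *\<^sub>R (pmf pX x *\<^sub>R f x) + (\<rho> / (\<kappa> + \<rho>)) *\<^sub>R (pmf ?r x *\<^sub>R f x) = pmf ?Z x *\<^sub>R f x" for x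
    unfolding pmf_continuous_difference_pmf[OF \<kappa> \<rho>] pmf_r by (simp add: add_divide_distrib scaleR_add_left)
  ultimately show ?thesis by (simp add: count)
qed

lemma real_site_minus: "real_site (- x) = - real_site x"
  by (simp add: real_site_def vec_eq_iff)

lemma zero_mean_continuous_difference:
  assumes "\<kappa> > 0" "\<rho> > 0" "zero_mean pX" "zero_mean pY"
  shows "zero_mean (continuous_difference_pmf \<kappa> \<rho> pX pY)"
  using continuous_difference_integral[of \<kappa> \<rho> pX real_site pY] assms
  by (simp add: zero_mean_def has_bochner_integral_iff real_site_minus)

lemma finite_variance_continuous_difference:
  assumes "\<kappa> > 0" "\<rho> > 0" "finite_variance pX" "finite_variance pY"
  shows "finite_variance (continuous_difference_pmf \<kappa> \<rho> pX pY)"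
  using continuous_difference_integral[of \<kappa> \<rho> pX "\<lambda>x. (norm (real_site x))\<^sup>2" pY] assms
  by (simp add: finite_variance_def has_bochner_integral_iff real_site_minus)

lemma char_fun_continuous_difference:
  assumes "\<kappa> > 0" "\<rho> > 0"
  shows "of_real (\<kappa> + \<rho>) * (1 - char_fun (continuous_difference_pmf \<kappa> \<rho> pX pY) \<theta>)
    = of_real \<kappa> * (1 - char_fun pX \<theta>) + of_real \<rho> * (1 - cnj (char_fun pY \<theta>))"
proof -
  have "integrable (measure_pmf pX) (character \<theta>)" "integrable (measure_pmf pY) (\<lambda>x. character \<theta> (- x))"
    by (rule measure_pmf.integrable_const_bound[of _ 1]; simp)+
  from continuous_difference_integral[OF assms this]
  have "char_fun (continuous_difference_pmf \<kappa> \<rho> pX pY) \<theta>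
      = (\<kappa> / (\<kappa> + \<rho>)) *\<^sub>R char_fun pX \<theta> + (\<rho> / (\<kappa> + \<rho>)) *\<^sub>R cnj (char_fun pY \<theta>)"
    by (simp add: has_bochner_integral_iff char_fun_def character_minus)
  then have "(\<kappa> + \<rho>) *\<^sub>R char_fun (continuous_difference_pmf \<kappa> \<rho> pX pY) \<theta>
      = \<kappa> *\<^sub>R char_fun pX \<theta> + \<rho> *\<^sub>R cnj (char_fun pY \<theta>)"
    using assms by (simp add: scaleR_add_right)
  then show ?thesis
    by (simp add: scaleR_conv_of_real algebra_simps)
qed

theorem continuous_quenched_moments:
  fixes pX pY :: "(int ^ 2) pmf"
  assumes \<kappa>: "\<kappa> > 0" and \<rho>: "\<rho> > 0"
    and pX: "irreducible_pmf pX" "zero_mean pX" "finite_variance pX"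
    and pY: "zero_mean pY" "finite_variance pY"
    and irr: "irreducible_pmf (continuous_difference_pmf \<kappa> \<rho> pX pY)"
  defines "A \<equiv> 1 / (2 * pi * (\<kappa> + \<rho>) * sqrt (det (covariance_matrix (continuous_difference_pmf \<kappa> \<rho> pX pY))))"
  shows "AE y in noise pY \<rho>. \<forall>k. ((\<lambda>t. (\<integral>x. measure lborel ({s. jump_position s x = jump_position s y} \<inter> {0..t}) ^ k
      \<partial>noise pX \<kappa>) / ln t ^ k) \<longlongrightarrow> fact k * A ^ k) at_top"
proof -
  define pZ where "pZ = continuous_difference_pmf \<kappa> \<rho> pX pY"
  have Z: "irreducible_pmf pZ" "zero_mean pZ" "finite_variance pZ"
    using irr zero_mean_continuous_difference finite_variance_continuous_difference \<kappa> \<rho> pX pY by (auto simp: pZ_def)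
  obtain C where time: "continuous_collision \<kappa> \<rho> pX pY C"
    using continuous_collision_time[OF \<kappa> \<rho> pX(1,2)] by blast
  interpret collision_time "noise pX \<kappa>" jump_position jump_restart "{0..}" "{\<omega>. nonexplosive (fst \<omega>)}"
    "noise pY \<rho>" jump_position jump_restart "{\<omega>. nonexplosive (fst \<omega>)}"
    "\<lambda>\<theta>. \<kappa> * (1 - Re (char_fun pX \<theta>))" "\<lambda>\<theta>. \<rho> * (1 - Re (char_fun pY \<theta>))" C lborel
    by (rule time)
  have green: "green s = return_kernel pZ ((\<kappa> + \<rho>) * s)" if "0 \<le> s" for s
  proof -
    have "complex_of_real (green s) = (\<integral>\<theta>. exp (- (of_real ((\<kappa> + \<rho>) * s) * (1 - char_fun pZ \<theta>))) \<partial>torus)"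
      unfolding green_Fourier
    proof (rule Bochner_Integration.integral_cong[OF refl])
      fix \<theta>
      have "of_real ((\<kappa> + \<rho>) * s) * (1 - char_fun pZ \<theta>) = of_real s * (of_real (\<kappa> + \<rho>) * (1 - char_fun pZ \<theta>))"
        by (simp only: of_real_mult mult_ac)
      also have "\<dots> = of_real (\<kappa> * s) * (1 - char_fun pX \<theta>) + of_real (\<rho> * s) * (1 - cnj (char_fun pY \<theta>))"
        unfolding pZ_def char_fun_continuous_difference[OF \<kappa> \<rho>] by (simp add: algebra_simps)
      finally show "cnj (Y.step_char s \<theta>) * X.step_char s \<theta> = exp (- (of_real ((\<kappa> + \<rho>) * s) * (1 - char_fun pZ \<theta>)))"
        unfolding continuous_step_char[OF \<kappa> that] continuous_step_char[OF \<rho> that]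
        by (simp add: exp_cnj exp_add[symmetric] add.commute)
    qed
    from arg_cong[OF this, of Re] show ?thesis by (simp add: return_kernel_def)
  qed
  have "(\<integral>s. indicator {0..t} s * green s \<partial>lborel) = (\<integral>s. indicator {0..t} s * return_kernel pZ ((\<kappa> + \<rho>) * s) \<partial>lborel)" for t
    by (rule Bochner_Integration.integral_cong[OF refl]) (auto simp: green split: split_indicator)
  then have G: "((\<lambda>t. (\<integral>s. indicator {0..t} s * green s \<partial>lborel) / ln t) \<longlongrightarrow> A) at_top"
    unfolding A_def pZ_def[symmetric] using \<kappa> \<rho> continuous_returns_log[OF Z, of "\<kappa> + \<rho>"] by simp
  show ?thesis
  proof (rule quenched_moments_tendsto[OF time time order_refl _ _ G G])
    fix B :: "real set" and t :: real and k :: nat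
    assume "B \<in> sets borel" "0 \<le> t"
    note eq = lborel_collision_power[OF this, of k]
    show "measure lborel (B \<inter> {0..t}) ^ Suc k
        \<le> real (Suc k) * collision_integral lborel B t k"
      and "real (Suc k) * collision_integral lborel B t k
        \<le> measure lborel (B \<inter> {0..t}) ^ Suc k"
      by (simp_all only: eq order_refl)
  qed
qed

section \<open>From moments to the law given the second walk\<close>

abbreviation quenched_exponential_limits ::
    "'t filter \<Rightarrow> 'a measure \<Rightarrow> ('u \<Rightarrow> 'a \<Rightarrow> 's) \<Rightarrow> ('u \<Rightarrow> 'a \<Rightarrow> 's) \<Rightarrow>
     ('t \<Rightarrow> ('u \<Rightarrow> 's) \<Rightarrow> ('u \<Rightarrow> 's) \<Rightarrow> real) \<Rightarrow> bool" where
  "quenched_exponential_limits F M P P' U \<equiv> AE \<omega> in M. (\<forall>k::nat. k \<ge> 1 \<longrightarrow> ((\<lambda>t. expectation_given M P P' (\<lambda>x y. U t x y ^ k) \<omega>) \<longlongrightarrow> fact k) F) \<and>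
    weak_conv_along F (\<lambda>t. law_given M P P' (U t) \<omega>) (exponential_law 1)"

text \<open>\<open>S\<close> and \<open>S'\<close> carry the canonical versions of the two walks and \<open>M\<close> the given ones; \<open>X\<close> and \<open>Y\<close> read off the noises from a
  point of \<open>M\<close>. For fixed \<open>t\<close> the local time is bounded, so that its laws have moments of all orders.\<close>

lemma quenched_limits_of_moments:
  fixes L :: "'t \<Rightarrow> 's \<Rightarrow> 'r \<Rightarrow> real" and M :: "'a measure"
  assumes M: "prob_space M"
    and X: "X \<in> M \<rightarrow>\<^sub>M S" "distr M S X = S" and Y: "Y \<in> M \<rightarrow>\<^sub>M S'" "distr M S' Y = S'"
    and moments: "AE y in S'. \<forall>k. ((\<lambda>t. (\<integral>x. L t x y ^ k \<partial>S) / l t ^ k) \<longlongrightarrow> fact k * A ^ k) F"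
    and pos: "\<forall>\<^sub>F t in F. 0 < l t"
    and L_meas: "\<And>t y. y \<in> space S' \<Longrightarrow> (\<lambda>x. L t x y) \<in> borel_measurable S"
    and L_nonneg: "\<And>t x y. 0 \<le> L t x y"
    and L_le: "\<And>t x y. x \<in> space S \<Longrightarrow> y \<in> space S' \<Longrightarrow> L t x y \<le> b t"
    and c: "0 \<le> c" "c * A = 1"
    and U: "\<And>t \<omega> \<omega>'. \<omega> \<in> space M \<Longrightarrow> \<omega>' \<in> space M \<Longrightarrow>
      U t (\<lambda>s. P s \<omega>') (\<lambda>s. P' s \<omega>) = c * L t (X \<omega>') (Y \<omega>) / l t"
  shows "quenched_exponential_limits F M P P' U"
proof -
  interpret prob_space M by (rule M)
  have "AE y in distr M S' Y. \<forall>k. ((\<lambda>t. (\<integral>x. L t x y ^ k \<partial>S) / l t ^ k) \<longlongrightarrow> fact k * A ^ k) F"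
    using moments unfolding Y(2) .
  from AE_distrD[OF Y(1) this] show ?thesis
    using AE_space
  proof eventually_elim
    case (elim \<omega>)
    let ?U = "\<lambda>t \<omega>'. U t (\<lambda>s. P s \<omega>') (\<lambda>s. P' s \<omega>)"
    define y where "y = Y \<omega>"
    have y: "y \<in> space S'" unfolding y_def using Y(1) elim(2) by (rule measurable_space)
    have LX [measurable]: "(\<lambda>\<omega>'. L t (X \<omega>') y) \<in> borel_measurable M" for t
      by (rule measurable_compose[OF X(1) L_meas[OF y]])
    have val: "?U t \<omega>' = c * L t (X \<omega>') y / l t" if "\<omega>' \<in> space M" for t \<omega>'
      unfolding y_def by (rule U[OF elim(2) that])
    have U_meas [measurable]: "?U t \<in> borel_measurable M" for t
      by (subst measurable_cong[OF val]) measurable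
    have expectation: "expectation_given M P P' (\<lambda>x y. U t x y ^ k) \<omega> = c ^ k * ((\<integral>x. L t x y ^ k \<partial>S) / l t ^ k)" for t k
    proof -
      have "expectation_given M P P' (\<lambda>x y. U t x y ^ k) \<omega> = (\<integral>\<omega>'. (c / l t) ^ k * L t (X \<omega>') y ^ k \<partial>M)"
        unfolding expectation_given_def
        by (rule Bochner_Integration.integral_cong) (simp_all add: val power_divide power_mult_distrib)
      also have "\<dots> = (c / l t) ^ k * (\<integral>\<omega>'. L t (X \<omega>') y ^ k \<partial>M)"
        by simp
      also have "(\<integral>\<omega>'. L t (X \<omega>') y ^ k \<partial>M) = (\<integral>x. L t x y ^ k \<partial>distr M S X)"
        by (rule integral_distr[symmetric, OF X(1)]) (intro borel_measurable_power L_meas y)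
      finally show ?thesis by (simp add: X(2) power_divide)
    qed
    have limit: "((\<lambda>t. expectation_given M P P' (\<lambda>x y. U t x y ^ k) \<omega>) \<longlongrightarrow> fact k) F" for k
    proof -
      have "((\<lambda>t. c ^ k * ((\<integral>x. L t x y ^ k \<partial>S) / l t ^ k)) \<longlongrightarrow> c ^ k * (fact k * A ^ k)) F"
        using elim(1) unfolding y_def by (intro tendsto_mult tendsto_const) blast
      moreover have "c ^ k * (fact k * A ^ k) = fact k"
        using c(2) by (metis mult.left_commute mult.right_neutral power_mult_distrib power_one)
      ultimately show ?thesis by (simp only: expectation)
    qed
    have law: "nonneg_with_moments (law_given M P P' (U t) \<omega>)" if "0 < l t" for t
      unfolding nonneg_with_moments_def
    proof (intro conjI allI)
      have bounds: "0 \<le> ?U t \<omega>'" "?U t \<omega>' \<le> c * b t / l t"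
        if "\<omega>' \<in> space M" for \<omega>'
        unfolding val[OF that] using c(1) \<open>0 < l t\<close> L_nonneg[of t "X \<omega>'" y] L_le[OF measurable_space[OF X(1) that] y, of t]
        by (auto intro!: divide_right_mono mult_left_mono)
      show "real_distribution (law_given M P P' (U t) \<omega>)"
        unfolding law_given_def by (rule real_distribution_distr) measurable
      show "AE x in law_given M P P' (U t) \<omega>. 0 \<le> x"
        unfolding law_given_def by (subst AE_distr_iff) (use bounds in \<open>auto intro!: AE_I2\<close>)
      show "integrable (law_given M P P' (U t) \<omega>) (\<lambda>x. x ^ k)" for k
        unfolding law_given_def
      proof (subst integrable_distr_eq)
        show "integrable M (\<lambda>\<omega>'. ?U t \<omega>' ^ k)"
        proof (rule integrable_const_bound)
          show "AE \<omega>' in M. norm (?U t \<omega>' ^ k) \<le> (c * b t / l t) ^ k"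
            using bounds by (auto intro!: AE_I2 power_mono simp: abs_of_nonneg norm_power)
        qed measurable
      qed simp_all
    qed
    have "(\<integral>x. x ^ k \<partial>law_given M P P' (U t) \<omega>) = expectation_given M P P' (\<lambda>x y. U t x y ^ k) \<omega>" for t k
      unfolding law_given_def expectation_given_def by (rule integral_distr) simp_all
    then have "weak_conv_along F (\<lambda>t. law_given M P P' (U t) \<omega>) (exponential_law 1)"
      using limit pos by (intro nonneg_moments_imp_weak_conv_along exponential_law_moments(1))
         (auto simp: exponential_law_moments(2) law elim: eventually_mono)
    with limit show ?case by blast
  qed
qed

section \<open>The increments of the given walks\<close>

lemma iid_increments_law:
  assumes M: "prob_space M" and iid: "iid_increments M p \<xi>"
  shows "(\<lambda>\<omega> i. \<xi> i \<omega>) \<in> M \<rightarrow>\<^sub>M steps p"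
    and "distr M (steps p) (\<lambda>\<omega> i. \<xi> i \<omega>) = steps p"
    and "AE \<omega> in M. \<forall>i. \<xi> i \<omega> \<in> set_pmf p"
proof -
  interpret prob_space M by (rule M)
  have indep: "indep_vars (\<lambda>_. count_space UNIV) \<xi> UNIV" and law: "\<And>i. distr M (count_space UNIV) (\<xi> i) = measure_pmf p"
    using iid by (auto simp: iid_increments_def)
  have meas: "\<xi> i \<in> M \<rightarrow>\<^sub>M count_space UNIV" for i
    using indep by (auto simp: indep_vars_def)
  show "(\<lambda>\<omega> i. \<xi> i \<omega>) \<in> M \<rightarrow>\<^sub>M steps p"
    by (rule measurable_into_steps) (rule meas)
  have sets: "sets (steps p) = sets (\<Pi>\<^sub>M i\<in>UNIV. count_space UNIV)"
    unfolding steps_def by (intro sets_PiM_cong) auto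
  have "distr M (steps p) (\<lambda>\<omega> i. \<xi> i \<omega>) = distr M (\<Pi>\<^sub>M i\<in>UNIV. count_space UNIV) (\<lambda>\<omega>. \<lambda>i\<in>UNIV. \<xi> i \<omega>)"
    using sets by (intro distr_cong) auto
  also have "\<dots> = (\<Pi>\<^sub>M i\<in>UNIV. distr M (count_space UNIV) (\<xi> i))"
    using indep indep_vars_iff_distr_eq_PiM[where I = UNIV and M' = "\<lambda>_. count_space UNIV" and X = \<xi>] meas by simp
  also have "\<dots> = steps p"
    by (simp add: law steps_def)
  finally show "distr M (steps p) (\<lambda>\<omega> i. \<xi> i \<omega>) = steps p" .
  show "AE \<omega> in M. \<forall>i. \<xi> i \<omega> \<in> set_pmf p"
    unfolding AE_all_countable
  proof
    fix i
    have "AE x in distr M (count_space UNIV) (\<xi> i). x \<in> set_pmf p" unfolding law by (rule AE_measure_pmf)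
    then show "AE \<omega> in M. \<xi> i \<omega> \<in> set_pmf p" by (rule AE_distrD[OF meas])
  qed
qed

lemma poisson_waiting_times_law:
  assumes M: "prob_space M" and r: "r > 0" and wait: "poisson_waiting_times M r \<tau>"
  shows "(\<lambda>\<omega> i. \<tau> i \<omega>) \<in> M \<rightarrow>\<^sub>M waits r"
    and "distr M (waits r) (\<lambda>\<omega> i. \<tau> i \<omega>) = waits r"
proof -
  interpret prob_space M by (rule M)
  have indep: "indep_vars (\<lambda>_. borel) \<tau> UNIV" and D: "\<And>i. distributed M lborel (\<tau> i) (exponential_density r)"
    using wait by (auto simp: poisson_waiting_times_def)
  have meas: "\<tau> i \<in> borel_measurable M" for i
    using indep by (auto simp: indep_vars_def)
  show "(\<lambda>\<omega> i. \<tau> i \<omega>) \<in> M \<rightarrow>\<^sub>M waits r"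
    by (rule measurable_into_waits[OF r]) (rule meas)
  have law: "distr M borel (\<tau> i) = wait_law r" for i
  proof -
    have "distr M borel (\<tau> i) = distr M lborel (\<tau> i)" by (intro distr_cong) auto
    then show ?thesis using D[of i] by (simp add: distributed_def wait_law_def[OF r])
  qed
  have sets: "sets (waits r) = sets (\<Pi>\<^sub>M i\<in>UNIV. borel)"
    unfolding waits_def[OF r] by (intro sets_PiM_cong) (simp_all add: sets_wait_law[OF r])
  have "distr M (waits r) (\<lambda>\<omega> i. \<tau> i \<omega>) = distr M (\<Pi>\<^sub>M i\<in>UNIV. borel) (\<lambda>\<omega>. \<lambda>i\<in>UNIV. \<tau> i \<omega>)"
    using sets by (intro distr_cong) auto
  also have "\<dots> = (\<Pi>\<^sub>M i\<in>UNIV. distr M borel (\<tau> i))"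
    using indep indep_vars_iff_distr_eq_PiM[where I = UNIV and M' = "\<lambda>_. borel" and X = \<tau>] meas by simp
  also have "\<dots> = waits r"
    by (simp add: law waits_def[OF r])
  finally show "distr M (waits r) (\<lambda>\<omega> i. \<tau> i \<omega>) = waits r" .
qed

abbreviation paired ::
    "(nat \<Rightarrow> 'a \<Rightarrow> 'b) \<Rightarrow> (nat \<Rightarrow> 'a \<Rightarrow> 'c) \<Rightarrow> 'a \<Rightarrow> (nat \<Rightarrow> 'b) \<times> (nat \<Rightarrow> 'c)" where
  "paired \<tau> \<xi> \<equiv> \<lambda>\<omega>. (\<lambda>i. \<tau> i \<omega>, \<lambda>i. \<xi> i \<omega>)"

text \<open>A joint law on a product is determined by rectangles, and on these the independence of the two generated
  \<open>\<sigma>\<close>-algebras gives the product of the marginal laws.\<close>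

lemma jump_noise_law:
  assumes M: "prob_space M" and r: "r > 0"
    and wait: "poisson_waiting_times M r \<tau>" and iid: "iid_increments M p \<xi>"
    and indep: "prob_space.indep_set M
          (sets (vimage_algebra (space M) (\<lambda>\<omega> i. \<tau> i \<omega>) (\<Pi>\<^sub>M i\<in>UNIV. borel)))
          (sets (vimage_algebra (space M) (\<lambda>\<omega> i. \<xi> i \<omega>) (\<Pi>\<^sub>M i\<in>UNIV. count_space UNIV)))"
  shows "(paired \<tau> \<xi>) \<in> M \<rightarrow>\<^sub>M noise p r"
    and "distr M (noise p r) (paired \<tau> \<xi>) = noise p r"
proof -
  interpret prob_space M by (rule M)
  note \<tau> = poisson_waiting_times_law[OF M r wait] and \<xi> = iid_increments_law[OF M iid]
  show meas: "(paired \<tau> \<xi>) \<in> M \<rightarrow>\<^sub>M noise p r"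
    using \<tau>(1) \<xi>(1) unfolding noise_def[OF r] by (rule measurable_Pair)
  have sets: "sets (\<Pi>\<^sub>M i\<in>UNIV. borel) = sets (waits r)"
    "sets (\<Pi>\<^sub>M i\<in>UNIV. count_space UNIV) = sets (steps p)"
    unfolding waits_def[OF r] steps_def by (intro sets_PiM_cong refl, simp add: sets_wait_law[OF r])+
  interpret W: prob_space "waits r" by (rule prob_space_waits[OF r])
  interpret S: prob_space "steps p" by (rule prob_space_steps)
  have "waits r \<Otimes>\<^sub>M steps p = distr M (noise p r) (paired \<tau> \<xi>)"
  proof (rule pair_measure_eqI[OF W.sigma_finite_measure_axioms S.sigma_finite_measure_axioms])
    fix A B assume A: "A \<in> sets (waits r)" and B: "B \<in> sets (steps p)"
    define E where "E = (\<lambda>\<omega> i. \<tau> i \<omega>) -` A \<inter> space M"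
    define F where "F = (\<lambda>\<omega> i. \<xi> i \<omega>) -` B \<inter> space M"
    have E: "E \<in> sets (vimage_algebra (space M) (\<lambda>\<omega> i. \<tau> i \<omega>) (\<Pi>\<^sub>M i\<in>UNIV. borel))"
      using A unfolding E_def sets[symmetric] by (rule in_vimage_algebra)
    have F: "F \<in> sets (vimage_algebra (space M) (\<lambda>\<omega> i. \<xi> i \<omega>) (\<Pi>\<^sub>M i\<in>UNIV. count_space UNIV))"
      using B unfolding F_def sets[symmetric] by (rule in_vimage_algebra)
    have "emeasure (waits r) A * emeasure (steps p) B = emeasure M E * emeasure M F"
      using emeasure_distr[OF \<tau>(1) A] emeasure_distr[OF \<xi>(1) B] by (simp add: \<tau>(2) \<xi>(2) E_def F_def)
    also have "\<dots> = emeasure M (E \<inter> F)"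
      using indep_setD[OF indep E F] by (simp add: emeasure_eq_measure ennreal_mult)
    also have "E \<inter> F = (paired \<tau> \<xi>) -` (A \<times> B) \<inter> space M"
      by (auto simp: E_def F_def)
    also have "emeasure M \<dots> = emeasure (distr M (noise p r) (paired \<tau> \<xi>)) (A \<times> B)"
      using A B by (intro emeasure_distr[symmetric] meas) (simp add: noise_def[OF r])
    finally show "emeasure (waits r) A * emeasure (steps p) B
        = emeasure (distr M (noise p r) (paired \<tau> \<xi>)) (A \<times> B)" .
  qed (simp add: noise_def[OF r])
  then show "distr M (noise p r) (paired \<tau> \<xi>) = noise p r"
    by (simp add: noise_def[OF r])
qed

text \<open>A site that is no finite sum of points of the support is almost surely never visited.\<close>

lemma irreducible_walk_imp_irreducible_pmf:
  assumes M: "prob_space M" and irr: "irreducible_walk M T X"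
    and sums: "AE \<omega> in M. \<forall>t\<in>T. \<exists>zs. set zs \<subseteq> set_pmf p \<and> sum_list zs = X t \<omega>"
  shows "irreducible_pmf p"
  unfolding irreducible_pmf_def
proof (rule ccontr)
  interpret prob_space M by (rule M)
  assume "\<not> (\<forall>x. \<exists>zs. set zs \<subseteq> set_pmf p \<and> sum_list zs = x)"
  then obtain x where x: "\<And>zs. set zs \<subseteq> set_pmf p \<Longrightarrow> sum_list zs \<noteq> x" by blast
  have pos: "\<P>(\<omega> in M. \<exists>t\<in>T. X t \<omega> = x) > 0" using irr by (simp add: irreducible_walk_def)
  then have "{\<omega> \<in> space M. \<exists>t\<in>T. X t \<omega> = x} \<in> events"
    using measure_notin_sets by fastforce
  moreover have "AE \<omega> in M. \<not> (\<exists>t\<in>T. X t \<omega> = x)"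
    using sums by eventually_elim (use x in blast)
  ultimately have "\<P>(\<omega> in M. \<exists>t\<in>T. X t \<omega> = x) = 0" by (simp only: prob_Collect_eq_0)
  with pos show False by simp
qed

lemma sum_eq_sum_list:
  fixes f :: "nat \<Rightarrow> int ^ 2"
  assumes "\<And>i. f i \<in> D"
  shows "\<exists>zs. set zs \<subseteq> D \<and> sum_list zs = (\<Sum>i<n. f i)"
proof (intro exI conjI)
  show "set (map f [0..<n]) \<subseteq> D" using assms by auto
  show "sum_list (map f [0..<n]) = (\<Sum>i<n. f i)"
    by (simp add: interv_sum_list_conv_sum_set_nat atLeast0LessThan)
qed

section \<open>Local times as measures of the set of collision times\<close>

lemma discrete_local_time_eq_measure:
  assumes "\<And>n. x n = f (real n)" "\<And>n. y n = g (real n)" and E: "{s. f s = g s} \<in> sets borel"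
  shows "discrete_local_time x y t = measure (count_from 0) ({s. f s = g s} \<inter> {0..real t})"
proof -
  have "{s. f s = g s} \<inter> {0..real t} \<in> sets borel" using E by (intro sets.Int) auto
  then have "measure (count_from 0) ({s. f s = g s} \<inter> {0..real t})
      = real (card {n. 0 \<le> n \<and> real n \<in> {s. f s = g s} \<inter> {0..real t}})"
    by (rule measure_count_from)
  also have "{n. 0 \<le> n \<and> real n \<in> {s. f s = g s} \<inter> {0..real t}} = {i \<in> {0..t}. x i = y i}"
    using assms(1,2) by auto
  also have "real (card {i \<in> {0..t}. x i = y i}) = discrete_local_time x y t"
    by (simp add: discrete_local_time_def of_bool_def sum.If_cases Int_def)
  finally show ?thesis by simp
qed

lemma continuous_local_time_eq_measure:
  assumes "\<And>s. 0 \<le> s \<Longrightarrow> x s = f s" "\<And>s. 0 \<le> s \<Longrightarrow> y s = g s" and E: "{s. f s = g s} \<in> sets borel"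
  shows "continuous_local_time x y t = measure lborel ({s. f s = g s} \<inter> {0..t})"
proof -
  have "continuous_local_time x y t = (\<integral>s. indicator ({s. f s = g s} \<inter> {0..t}) s \<partial>lborel)"
    unfolding continuous_local_time_def set_lebesgue_integral_def
    by (intro Bochner_Integration.integral_cong) (use assms in \<open>auto split: split_indicator\<close>)
  also have "\<dots> = measure lborel ({s. f s = g s} \<inter> {0..t})" by simp
  finally show ?thesis .
qed

section \<open>The limit theorem\<close>

lemma discrete_quenched_limits:
  fixes M :: "'a measure" and X Y :: "nat \<Rightarrow> 'a \<Rightarrow> int ^ 2"
  assumes M: "prob_space M"
    and pX: "zero_mean pX" "finite_variance pX" and pY: "zero_mean pY" "finite_variance pY"
    and X: "discrete_random_walk M pX X" and Y: "discrete_random_walk M pY Y"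
    and irrX: "irreducible_walk M UNIV X" and irrZ: "irreducible_walk M UNIV (\<lambda>t \<omega>. X t \<omega> - Y t \<omega>)"
  defines "Q \<equiv> covariance_matrix (discrete_difference_pmf pX pY)"
  defines "U \<equiv> \<lambda>t x y. 2 * pi * sqrt (det Q) * discrete_local_time x y t / ln (real t)"
  shows "quenched_exponential_limits at_top M X Y U"
proof -
  obtain \<xi> where \<xi>: "iid_increments M pX \<xi>" "\<And>n \<omega>. \<omega> \<in> space M \<Longrightarrow> X n \<omega> = (\<Sum>i<n. \<xi> i \<omega>)"
    using X by (auto simp: discrete_random_walk_def)
  obtain \<eta> where \<eta>: "iid_increments M pY \<eta>" "\<And>n \<omega>. \<omega> \<in> space M \<Longrightarrow> Y n \<omega> = (\<Sum>i<n. \<eta> i \<omega>)"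
    using Y by (auto simp: discrete_random_walk_def)
  note \<xi>_law = iid_increments_law[OF M \<xi>(1)] and \<eta>_law = iid_increments_law[OF M \<eta>(1)]
  have irr_pX: "irreducible_pmf pX"
  proof (rule irreducible_walk_imp_irreducible_pmf[OF M irrX])
    show "AE \<omega> in M. \<forall>t\<in>UNIV. \<exists>zs. set zs \<subseteq> set_pmf pX \<and> sum_list zs = X t \<omega>"
      using \<xi>_law(3) AE_space
    proof eventually_elim
      case (elim \<omega>)
      then show ?case using sum_eq_sum_list[of "\<lambda>i. \<xi> i \<omega>"] \<xi>(2) by simp
    qed
  qed
  have irr_pZ: "irreducible_pmf (discrete_difference_pmf pX pY)"
  proof (rule irreducible_walk_imp_irreducible_pmf[OF M irrZ])
    show "AE \<omega> in M. \<forall>t\<in>UNIV. \<exists>zs. set zs \<subseteq> set_pmf (discrete_difference_pmf pX pY) \<and> sum_list zs = X t \<omega> - Y t \<omega>"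
      using \<xi>_law(3) \<eta>_law(3) AE_space
    proof eventually_elim
      case (elim \<omega>)
      have "\<xi> i \<omega> - \<eta> i \<omega> \<in> set_pmf (discrete_difference_pmf pX pY)" for i
        using elim by (force simp: discrete_difference_pmf_def)
      from sum_eq_sum_list[of "\<lambda>i. \<xi> i \<omega> - \<eta> i \<omega>", OF this] show ?case
        using elim by (simp add: \<xi>(2) \<eta>(2) sum_subtractf)
    qed
  qed
  obtain C where time: "\<And>N. discrete_collision pX pY C (count_from N)"
    using discrete_collision_time[OF irr_pX pX(1)] by blast
  define A where "A = 1 / (2 * pi * sqrt (det Q))"
  have "det Q > 0"
    unfolding Q_def using irr_pZ zero_mean_discrete_difference[OF pX(1) pY(1)] finite_variance_discrete_difference[OF pX(2) pY(2)]
    by (intro covariance_positive)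
  then have A: "2 * pi * sqrt (det Q) * A = 1" by (simp add: A_def)
  let ?L = "\<lambda>t x y. measure (count_from 0) ({s. walk_position s x = walk_position s y} \<inter> {0..real t})"
  show ?thesis
  proof (rule quenched_limits_of_moments[OF M \<xi>_law(1,2) \<eta>_law(1,2), where L = ?L and l = "\<lambda>t. ln (real t)"
      and A = A and c = "2 * pi * sqrt (det Q)" and b = "\<lambda>t. measure (count_from 0) {0..real t}"])
    show "AE y in steps pY. \<forall>k. ((\<lambda>t. (\<integral>x. ?L t x y ^ k \<partial>steps pX) / ln (real t) ^ k) \<longlongrightarrow> fact k * A ^ k) at_top"
      using discrete_quenched_moments[OF irr_pX pX pY irr_pZ]
    proof eventually_elim
      case (elim y)
      show ?case
      proof
        fix k
        from elim have "((\<lambda>t. (\<integral>x. measure count_time ({s. walk_position s x = walk_position s y} \<inter> {0..t}) ^ k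
          \<partial>steps pX) / ln t ^ k) \<longlongrightarrow> fact k * A ^ k) at_top"
          unfolding A_def Q_def by blast
        from filterlim_compose[OF this filterlim_real_sequentially]
        show "((\<lambda>t. (\<integral>x. ?L t x y ^ k \<partial>steps pX) / ln (real t) ^ k) \<longlongrightarrow> fact k * A ^ k) at_top"
          by (simp only: count_from_0)
      qed
    qed
    show "\<forall>\<^sub>F t in at_top. 0 < ln (real t)"
      using eventually_gt_at_top[of 1] by eventually_elim simp
    show "?L t x y \<le> measure (count_from 0) {0..real t}" if "x \<in> space (steps pX)" "y \<in> space (steps pY)" for t x y
      by (rule collision_time.measure_collision_le[OF time that])
    show "U t (\<lambda>s. X s \<omega>') (\<lambda>s. Y s \<omega>) = 2 * pi * sqrt (det Q) * ?L t (\<lambda>i. \<xi> i \<omega>') (\<lambda>i. \<eta> i \<omega>) / ln (real t)"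
      if "\<omega> \<in> space M" "\<omega>' \<in> space M" for t \<omega> \<omega>'
    proof -
      have "discrete_local_time (\<lambda>s. X s \<omega>') (\<lambda>s. Y s \<omega>) t = ?L t (\<lambda>i. \<xi> i \<omega>') (\<lambda>i. \<eta> i \<omega>)"
        by (rule discrete_local_time_eq_measure) (simp_all add: \<xi>(2) \<eta>(2) that walk_position_def collision_time.collision_set_measurable[OF time])
      then show ?thesis by (simp add: U_def)
    qed
  qed (use A \<open>det Q > 0\<close> in \<open>simp_all add: collision_time.measurable_collision_measure[OF time]\<close>)
qed

lemma continuous_quenched_limits:
  fixes M :: "'a measure" and X Y :: "real \<Rightarrow> 'a \<Rightarrow> int ^ 2"
  assumes M: "prob_space M" and \<kappa>: "\<kappa> > 0" and \<rho>: "\<rho> > 0"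
    and pX: "zero_mean pX" "finite_variance pX" and pY: "zero_mean pY" "finite_variance pY"
    and X: "continuous_random_walk M \<kappa> pX X" and Y: "continuous_random_walk M \<rho> pY Y"
    and irrX: "irreducible_walk M {0..} X" and irrZ: "irreducible_walk M {0..} (\<lambda>t \<omega>. X t \<omega> - Y t \<omega>)"
  defines "Q \<equiv> covariance_matrix (continuous_difference_pmf \<kappa> \<rho> pX pY)"
  defines "U \<equiv> \<lambda>t x y. 2 * pi * (\<kappa> + \<rho>) * sqrt (det Q) * continuous_local_time x y t / ln t"
  shows "quenched_exponential_limits at_top M X Y U"
proof -
  let ?pZ = "continuous_difference_pmf \<kappa> \<rho> pX pY"
  have walk: "\<exists>\<tau> \<xi>. iid_increments M p \<xi> \<and>
      (paired \<tau> \<xi>) \<in> M \<rightarrow>\<^sub>M noise p r \<and>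
      distr M (noise p r) (paired \<tau> \<xi>) = noise p r \<and>
      (\<forall>t\<ge>0. \<forall>\<omega>\<in>space M. X t \<omega> = jump_position t (paired \<tau> \<xi> \<omega>))"
    if r: "r > 0" and walk: "continuous_random_walk M r p X" for r p X
  proof -
    obtain \<tau> \<xi> where *: "poisson_waiting_times M r \<tau>" "iid_increments M p \<xi>" "prob_space.indep_set M
          (sets (vimage_algebra (space M) (\<lambda>\<omega> i. \<tau> i \<omega>) (\<Pi>\<^sub>M i\<in>UNIV. borel)))
          (sets (vimage_algebra (space M) (\<lambda>\<omega> i. \<xi> i \<omega>) (\<Pi>\<^sub>M i\<in>UNIV. count_space UNIV)))"
      "\<forall>t\<ge>0. \<forall>\<omega>\<in>space M. X t \<omega> = (\<Sum>i<poisson_count \<tau> t \<omega>. \<xi> i \<omega>)"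
      using walk unfolding continuous_random_walk_def by blast
    show ?thesis
    proof (intro exI[of _ \<tau>] exI[of _ \<xi>] conjI jump_noise_law[OF M r *(1-3)] *(2))
      show "\<forall>t\<ge>0. \<forall>\<omega>\<in>space M. X t \<omega> = jump_position t (paired \<tau> \<xi> \<omega>)"
        using *(4) by (simp add: jump_position_def jumps_def arrival_def poisson_count_def)
    qed
  qed
  obtain \<tau> \<xi> where \<xi>: "iid_increments M pX \<xi>"
    and X_noise: "(paired \<tau> \<xi>) \<in> M \<rightarrow>\<^sub>M noise pX \<kappa>"
      "distr M (noise pX \<kappa>) (paired \<tau> \<xi>) = noise pX \<kappa>"
    and X_eq: "\<And>t \<omega>. 0 \<le> t \<Longrightarrow> \<omega> \<in> space M \<Longrightarrow> X t \<omega> = jump_position t (paired \<tau> \<xi> \<omega>)"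
    using walk[OF \<kappa> X] by blast
  obtain \<sigma> \<eta> where \<eta>: "iid_increments M pY \<eta>"
    and Y_noise: "(paired \<sigma> \<eta>) \<in> M \<rightarrow>\<^sub>M noise pY \<rho>"
      "distr M (noise pY \<rho>) (paired \<sigma> \<eta>) = noise pY \<rho>"
    and Y_eq: "\<And>t \<omega>. 0 \<le> t \<Longrightarrow> \<omega> \<in> space M \<Longrightarrow> Y t \<omega> = jump_position t (paired \<sigma> \<eta> \<omega>)"
    using walk[OF \<rho> Y] by blast
  note \<xi>_support = iid_increments_law(3)[OF M \<xi>] and \<eta>_support = iid_increments_law(3)[OF M \<eta>]
  have irr_pX: "irreducible_pmf pX"
  proof (rule irreducible_walk_imp_irreducible_pmf[OF M irrX])
    show "AE \<omega> in M. \<forall>t\<in>{0..}. \<exists>zs. set zs \<subseteq> set_pmf pX \<and> sum_list zs = X t \<omega>"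
      using \<xi>_support AE_space
    proof eventually_elim
      case (elim \<omega>)
      then show ?case using sum_eq_sum_list[of "\<lambda>i. \<xi> i \<omega>"] X_eq by (simp add: jump_position_def)
    qed
  qed
  have irr_pZ: "irreducible_pmf ?pZ"
  proof (rule irreducible_walk_imp_irreducible_pmf[OF M irrZ])
    have supportX: "x \<in> set_pmf ?pZ" if "x \<in> set_pmf pX" for x
    proof -
      have "0 < \<kappa> * pmf pX x + \<rho> * pmf pY (- x)"
        using \<kappa> \<rho> pmf_positive[OF that] by (intro add_pos_nonneg) auto
      then have "0 < pmf ?pZ x" using \<kappa> \<rho> by (simp add: pmf_continuous_difference_pmf)
      then show ?thesis by (simp add: set_pmf_iff)
    qed
    have supportY: "- y \<in> set_pmf ?pZ" if "y \<in> set_pmf pY" for y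
    proof -
      have "0 < \<kappa> * pmf pX (- y) + \<rho> * pmf pY (- (- y))"
        using \<kappa> \<rho> pmf_positive[OF that] by (intro add_nonneg_pos) auto
      then have "0 < pmf ?pZ (- y)" using \<kappa> \<rho> by (simp add: pmf_continuous_difference_pmf)
      then show ?thesis by (simp add: set_pmf_iff)
    qed
    show "AE \<omega> in M. \<forall>t\<in>{0..}. \<exists>zs. set zs \<subseteq> set_pmf ?pZ \<and> sum_list zs = X t \<omega> - Y t \<omega>"
      using \<xi>_support \<eta>_support AE_space
    proof eventually_elim
      case (elim \<omega>)
      show ?case
      proof
        fix t :: real assume t: "t \<in> {0..}"
        obtain xs where xs: "set xs \<subseteq> set_pmf ?pZ" "sum_list xs = X t \<omega>"
          using sum_eq_sum_list[of "\<lambda>i. \<xi> i \<omega>" "set_pmf ?pZ" "jumps t (\<lambda>i. \<tau> i \<omega>)"] X_eq[of t \<omega>] t elim supportX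
          by (auto simp: jump_position_def)
        obtain ys where ys: "set ys \<subseteq> set_pmf ?pZ" "sum_list ys = - Y t \<omega>"
          using sum_eq_sum_list[of "\<lambda>i. - \<eta> i \<omega>" "set_pmf ?pZ" "jumps t (\<lambda>i. \<sigma> i \<omega>)"] Y_eq[of t \<omega>] t elim supportY
          by (auto simp: jump_position_def sum_negf)
        show "\<exists>zs. set zs \<subseteq> set_pmf ?pZ \<and> sum_list zs = X t \<omega> - Y t \<omega>"
          using xs ys by (intro exI[of _ "xs @ ys"]) simp
      qed
    qed
  qed
  obtain C where time: "continuous_collision \<kappa> \<rho> pX pY C"
    using continuous_collision_time[OF \<kappa> \<rho> irr_pX pX(1)] by blast
  define A where "A = 1 / (2 * pi * (\<kappa> + \<rho>) * sqrt (det Q))"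
  have "det Q > 0"
    unfolding Q_def using irr_pZ zero_mean_continuous_difference[OF \<kappa> \<rho> pX(1) pY(1)]
      finite_variance_continuous_difference[OF \<kappa> \<rho> pX(2) pY(2)]
    by (intro covariance_positive)
  then have A: "2 * pi * (\<kappa> + \<rho>) * sqrt (det Q) * A = 1" using \<kappa> \<rho> by (simp add: A_def)
  let ?L = "\<lambda>t x y. measure lborel ({s. jump_position s x = jump_position s y} \<inter> {0..t})"
  show ?thesis
  proof (rule quenched_limits_of_moments[OF M X_noise Y_noise, where L = ?L and l = ln
      and A = A and c = "2 * pi * (\<kappa> + \<rho>) * sqrt (det Q)" and b = "\<lambda>t. measure lborel {0..t}"])
    show "AE y in noise pY \<rho>. \<forall>k. ((\<lambda>t. (\<integral>x. ?L t x y ^ k \<partial>noise pX \<kappa>) / ln t ^ k) \<longlongrightarrow> fact k * A ^ k) at_top"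
      using continuous_quenched_moments[OF \<kappa> \<rho> irr_pX pX pY irr_pZ] unfolding A_def Q_def .
    show "\<forall>\<^sub>F t :: real in at_top. 0 < ln t"
      using eventually_gt_at_top[of 1] by eventually_elim simp
    show "?L t x y \<le> measure lborel {0..t}" if "x \<in> space (noise pX \<kappa>)" "y \<in> space (noise pY \<rho>)" for t x y
      by (rule collision_time.measure_collision_le[OF time that])
    show "U t (\<lambda>s. X s \<omega>') (\<lambda>s. Y s \<omega>)
        = 2 * pi * (\<kappa> + \<rho>) * sqrt (det Q) * ?L t (paired \<tau> \<xi> \<omega>') (paired \<sigma> \<eta> \<omega>) / ln t"
      if "\<omega> \<in> space M" "\<omega>' \<in> space M" for t \<omega> \<omega>'
    proof -
      have "continuous_local_time (\<lambda>s. X s \<omega>') (\<lambda>s. Y s \<omega>) t = ?L t (paired \<tau> \<xi> \<omega>') (paired \<sigma> \<eta> \<omega>)"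
        by (rule continuous_local_time_eq_measure) (simp_all add: X_eq Y_eq that collision_time.collision_set_measurable[OF time] space_noise[OF \<kappa>] space_noise[OF \<rho>])
      then show ?thesis by (simp add: U_def)
    qed
  qed (use A \<open>det Q > 0\<close> \<kappa> \<rho> in \<open>simp_all add: collision_time.measurable_collision_measure[OF time]\<close>)
qed

theorem theorem1p2:
  fixes M :: "'a measure" and pX pY :: "(int ^ 2) pmf"
  assumes "prob_space M"
    and "zero_mean pX" and "finite_variance pX"
    and "zero_mean pY" and "finite_variance pY"
  shows
    "(\<forall>(X :: nat \<Rightarrow> 'a \<Rightarrow> int ^ 2) Y (\<kappa> :: real) \<rho>.
        discrete_random_walk M pX X \<longrightarrow>
        discrete_random_walk M pY Y \<longrightarrow>
        independent_processes M UNIV X Y \<longrightarrow>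
        irreducible_walk M UNIV X \<longrightarrow>
        irreducible_walk M UNIV Y \<longrightarrow>
        irreducible_walk M UNIV (\<lambda>t \<omega>. X t \<omega> - Y t \<omega>) \<longrightarrow>
        \<kappa> + \<rho> = 1 \<longrightarrow>
        (let Q = covariance_matrix (discrete_difference_pmf pX pY);
             U = (\<lambda>t x y. 2 * pi * (\<kappa> + \<rho>) * sqrt (det Q) * discrete_local_time x y t / ln (real t))
         in AE \<omega> in M.
              (\<forall>k::nat. k \<ge> 1 \<longrightarrow>
                 ((\<lambda>t. expectation_given M X Y (\<lambda>x y. U t x y ^ k) \<omega>) \<longlongrightarrow> fact k) at_top) \<and>
              weak_conv_along at_top (\<lambda>t. law_given M X Y (U t) \<omega>) (exponential_law 1)))
     \<and>
     (\<forall>(X :: real \<Rightarrow> 'a \<Rightarrow> int ^ 2) Y (\<kappa> :: real) \<rho>.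
        \<kappa> > 0 \<longrightarrow>
        \<rho> > 0 \<longrightarrow>
        continuous_random_walk M \<kappa> pX X \<longrightarrow>
        continuous_random_walk M \<rho> pY Y \<longrightarrow>
        independent_processes M {0..} X Y \<longrightarrow>
        irreducible_walk M {0..} X \<longrightarrow>
        irreducible_walk M {0..} Y \<longrightarrow>
        irreducible_walk M {0..} (\<lambda>t \<omega>. X t \<omega> - Y t \<omega>) \<longrightarrow>
        (let Q = covariance_matrix (continuous_difference_pmf \<kappa> \<rho> pX pY);
             U = (\<lambda>t x y. 2 * pi * (\<kappa> + \<rho>) * sqrt (det Q) * continuous_local_time x y t / ln t)
         in AE \<omega> in M.
              (\<forall>k::nat. k \<ge> 1 \<longrightarrow>
                 ((\<lambda>t. expectation_given M X Y (\<lambda>x y. U t x y ^ k) \<omega>) \<longlongrightarrow> fact k) at_top) \<and>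
              weak_conv_along at_top (\<lambda>t. law_given M X Y (U t) \<omega>) (exponential_law 1)))"
  unfolding Let_def
proof (intro conjI allI impI, goal_cases)
  case (1 X Y \<kappa> \<rho>)
  show ?case
    unfolding \<open>\<kappa> + \<rho> = 1\<close> mult_1_right
    by (rule discrete_quenched_limits[OF assms 1(1,2,4,6)])
next
  case (2 X Y \<kappa> \<rho>)
  show ?case
    by (rule continuous_quenched_limits[OF assms(1) 2(1,2) assms(2-5) 2(3,4,6,8)])
qed

end
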